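(* Let $X$ be a complete holomorphic vector field on a connected Stein surface $N$ with $H^2(N,\mathbb{Z})=0$. Suppose that $X$ has some closed orbit $L_0$ biholomorphic to $\mathbb{C}^*=\mathbb{C}\setminus\{0\}$ having finite holonomy group. Then $\mathcal{F}(X)$ admits a meromorphic first integral and, in particular, all nonsingular orbits are closed off $\mathrm{sing}(\mathcal{F}(X))$ and have finite holonomy groups.
   Context: A Stein surface is a Stein manifold of complex dimension two; a holomorphic vector field is complete if its flow is defined for all complex times. The singularities of $X$ are isolated; $\mathcal{F}(X)$ is the one-dimensional holomorphic foliation on $N$ whose leaves are the nonsingular orbits of $X$, with $\mathrm{sing}(\mathcal{F}(X))=\mathrm{sing}(X)$. The holonomy group of an orbit is its holonomy group as a leaf of $\mathcal{F}(X)$. A meromorphic first integral is a nonconstant meromorphic function on $N$ that is constant along the leaves. An orbit is closed off $\mathrm{sing}(\mathcal{F}(X))$ if it is closed in $N\setminus\mathrm{sing}(\mathcal{F}(X))$. *)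

theory Defs
  imports "HOL-Analysis.Analysis" "HOL-Homology.Homology"
begin

section \<open>Complex manifolds\<close>

definition complex_linear :: "(complex^'n \<Rightarrow> complex^'m) \<Rightarrow> bool" where
  "complex_linear D \<longleftrightarrow> linear D \<and> (\<forall>c v. D (c *s v) = c *s D v)"

text \<open>Holomorphy in several variables, as complex differentiability at each point; used on open sets only.\<close>

definition holo_on :: "(complex^'n \<Rightarrow> complex^'m) \<Rightarrow> (complex^'n) set \<Rightarrow> bool" where
  "holo_on f S \<longleftrightarrow> (\<forall>x\<in>S. \<exists>D. complex_linear D \<and> (f has_derivative D) (at x))"

text \<open>A chart is a pair of its domain and its coordinate map; the values of the coordinate map
  outside the domain are irrelevant.\<close>

type_synonym ('a, 'n) chart = "'a set \<times> ('a \<Rightarrow> complex^'n)"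

definition topological_chart :: "'a topology \<Rightarrow> ('a, 'n::finite) chart \<Rightarrow> bool" where
  "topological_chart N = (\<lambda>(U, \<phi>). openin N U \<and> open (\<phi> ` U) \<and>
     homeomorphic_map (subtopology N U) (top_of_set (\<phi> ` U)) \<phi>)"

definition compatible_charts :: "('a, 'n::finite) chart \<Rightarrow> ('a, 'n::finite) chart \<Rightarrow> bool" where
  "compatible_charts = (\<lambda>(U, \<phi>) (V, \<psi>).
     holo_on (\<psi> \<circ> inv_into U \<phi>) (\<phi> ` (U \<inter> V)) \<and>
     holo_on (\<phi> \<circ> inv_into V \<psi>) (\<psi> ` (U \<inter> V)))"

text \<open>The complex structure is given by its maximal atlas.\<close>

definition complex_manifold :: "'a topology \<Rightarrow> ('a, 'n::finite) chart set \<Rightarrow> bool" where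
  "complex_manifold N A \<longleftrightarrow>
     Hausdorff_space N \<and> second_countable N \<and>
     (\<Union>c\<in>A. fst c) = topspace N \<and>
     (\<forall>c\<in>A. topological_chart N c) \<and>
     (\<forall>c\<in>A. \<forall>d\<in>A. compatible_charts c d) \<and>
     (\<forall>c. topological_chart N c \<and> (\<forall>d\<in>A. compatible_charts c d) \<longrightarrow> c \<in> A)"

definition holomorphic_map ::
  "'a topology \<Rightarrow> ('a, 'n::finite) chart set \<Rightarrow> 'b topology \<Rightarrow> ('b, 'm::finite) chart set \<Rightarrow> ('a \<Rightarrow> 'b) \<Rightarrow> bool" where
  "holomorphic_map N A M B f \<longleftrightarrow> continuous_map N M f \<and>
     (\<forall>(U, \<phi>)\<in>A. \<forall>(V, \<psi>)\<in>B.
        holo_on (\<psi> \<circ> f \<circ> inv_into U \<phi>) (\<phi> ` (U \<inter> f -` V)))"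

definition biholomorphic ::
  "'a topology \<Rightarrow> ('a, 'n::finite) chart set \<Rightarrow> 'b topology \<Rightarrow> ('b, 'm::finite) chart set \<Rightarrow> bool" where
  "biholomorphic N A M B \<longleftrightarrow>
     (\<exists>f g. holomorphic_map N A M B f \<and> holomorphic_map M B N A g \<and>
        (\<forall>x\<in>topspace N. g (f x) = x) \<and> (\<forall>y\<in>topspace M. f (g y) = y))"

text \<open>The one-chart atlas of an open subset of the complex plane (\<open>vec\<close> identifies
  the plane with one-dimensional coordinate space).\<close>

definition plane_atlas :: "complex set \<Rightarrow> (complex, 1) chart set" where
  "plane_atlas S = {(S, vec)}"

definition restrict_atlas :: "('a, 'n::finite) chart set \<Rightarrow> 'a set \<Rightarrow> ('a, 'n::finite) chart set" where
  "restrict_atlas A W = (\<lambda>(U, \<phi>). (U \<inter> W, \<phi>)) ` A"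

definition holomorphic_fun_on ::
  "'a topology \<Rightarrow> ('a, 'n::finite) chart set \<Rightarrow> 'a set \<Rightarrow> ('a \<Rightarrow> complex) \<Rightarrow> bool" where
  "holomorphic_fun_on N A W f \<longleftrightarrow> openin N W \<and>
     holomorphic_map (subtopology N W) (restrict_atlas A W) euclidean (plane_atlas UNIV) f"

section \<open>Stein manifolds\<close>

definition holomorphic_hull ::
  "'a topology \<Rightarrow> ('a, 'n::finite) chart set \<Rightarrow> 'a set \<Rightarrow> 'a set" where
  "holomorphic_hull N A K = {x \<in> topspace N. \<forall>f. holomorphic_fun_on N A (topspace N) f \<longrightarrow>
      norm (f x) \<le> (SUP y\<in>K. norm (f y))}"

text \<open>Holomorphic convexity, separation of points, and local coordinates by global functions.\<close>

definition stein_manifold :: "'a topology \<Rightarrow> ('a, 'n::finite) chart set \<Rightarrow> bool" where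
  "stein_manifold N A \<longleftrightarrow> complex_manifold N A \<and>
     (\<forall>K. compactin N K \<longrightarrow> compactin N (holomorphic_hull N A K)) \<and>
     (\<forall>x\<in>topspace N. \<forall>y\<in>topspace N. x \<noteq> y \<longrightarrow>
        (\<exists>f. holomorphic_fun_on N A (topspace N) f \<and> f x \<noteq> f y)) \<and>
     (\<forall>p\<in>topspace N. \<exists>F. (\<forall>i. holomorphic_fun_on N A (topspace N) (\<lambda>x. F x $ i)) \<and>
        (\<forall>(U, \<phi>)\<in>A. p \<in> U \<longrightarrow>
           (\<exists>D :: complex^'n \<Rightarrow> complex^'n. bij D \<and> (F \<circ> inv_into U \<phi> has_derivative D) (at (\<phi> p)))))"

section \<open>Integral singular cohomology\<close>

definition singular_cochain :: "nat \<Rightarrow> 'a topology \<Rightarrow> ('a chain \<Rightarrow> int) \<Rightarrow> bool" where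
  "singular_cochain p N a \<longleftrightarrow> a \<in> hom (chain_group p N) integer_group"

definition singular_cocycle :: "nat \<Rightarrow> 'a topology \<Rightarrow> ('a chain \<Rightarrow> int) \<Rightarrow> bool" where
  "singular_cocycle p N a \<longleftrightarrow> singular_cochain p N a \<and>
     (\<forall>c. singular_chain (Suc p) N c \<longrightarrow> a (chain_boundary (Suc p) c) = 0)"

text \<open>Cochains are compared on singular chains only. For \<open>p = 0\<close> the only coboundary is zero,
  since \<open>chain_boundary 0\<close> is zero.\<close>

definition singular_coboundary :: "nat \<Rightarrow> 'a topology \<Rightarrow> ('a chain \<Rightarrow> int) \<Rightarrow> bool" where
  "singular_coboundary p N a \<longleftrightarrow>
     (\<exists>b. singular_cochain (p - 1) N b \<and>
        (\<forall>c. singular_chain p N c \<longrightarrow> a c = b (chain_boundary p c)))"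

definition integral_cohomology_vanishes :: "nat \<Rightarrow> 'a topology \<Rightarrow> bool" where
  "integral_cohomology_vanishes p N \<longleftrightarrow>
     (\<forall>a. singular_cocycle p N a \<longrightarrow> singular_coboundary p N a)"

section \<open>Holomorphic vector fields\<close>

text \<open>\<open>X c p\<close> is the coordinate vector of the field at \<open>p\<close> in the chart \<open>c\<close>.\<close>

type_synonym ('a, 'n) vfield = "('a, 'n) chart \<Rightarrow> 'a \<Rightarrow> complex^'n"

definition holomorphic_vector_field :: "('a, 'n::finite) chart set \<Rightarrow> ('a, 'n::finite) vfield \<Rightarrow> bool" where
  "holomorphic_vector_field A X \<longleftrightarrow>
     (\<forall>(U, \<phi>)\<in>A. holo_on (X (U, \<phi>) \<circ> inv_into U \<phi>) (\<phi> ` U)) \<and>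
     (\<forall>(U, \<phi>)\<in>A. \<forall>(V, \<psi>)\<in>A. \<forall>p\<in>U \<inter> V.
        X (V, \<psi>) p = frechet_derivative (\<psi> \<circ> inv_into U \<phi>) (at (\<phi> p)) (X (U, \<phi>) p))"

text \<open>Integral curves in complex time, defined on the whole plane.\<close>

definition integral_curve ::
  "'a topology \<Rightarrow> ('a, 'n::finite) chart set \<Rightarrow> ('a, 'n::finite) vfield \<Rightarrow> (complex \<Rightarrow> 'a) \<Rightarrow> bool" where
  "integral_curve N A X \<gamma> \<longleftrightarrow> continuous_map euclidean N \<gamma> \<and>
     (\<forall>t. \<forall>(U, \<phi>)\<in>A. \<gamma> t \<in> U \<longrightarrow>
        (\<phi> \<circ> \<gamma> has_derivative (\<lambda>h. h *s X (U, \<phi>) (\<gamma> t))) (at t))"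

definition complete_vector_field ::
  "'a topology \<Rightarrow> ('a, 'n::finite) chart set \<Rightarrow> ('a, 'n::finite) vfield \<Rightarrow> bool" where
  "complete_vector_field N A X \<longleftrightarrow>
     (\<forall>p\<in>topspace N. \<exists>\<gamma>. integral_curve N A X \<gamma> \<and> \<gamma> 0 = p)"

definition sing :: "'a topology \<Rightarrow> ('a, 'n::finite) chart set \<Rightarrow> ('a, 'n::finite) vfield \<Rightarrow> 'a set" where
  "sing N A X = {p \<in> topspace N. \<forall>(U, \<phi>)\<in>A. p \<in> U \<longrightarrow> X (U, \<phi>) p = 0}"

definition isolated_singularities ::
  "'a topology \<Rightarrow> ('a, 'n::finite) chart set \<Rightarrow> ('a, 'n::finite) vfield \<Rightarrow> bool" where
  "isolated_singularities N A X \<longleftrightarrow>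
     (\<forall>p\<in>sing N A X. \<exists>W. openin N W \<and> W \<inter> sing N A X = {p})"

text \<open>This is the orbit of a complete field.\<close>

definition orbit :: "'a topology \<Rightarrow> ('a, 'n::finite) chart set \<Rightarrow> ('a, 'n::finite) vfield \<Rightarrow> 'a \<Rightarrow> 'a set" where
  "orbit N A X p = {q. \<exists>\<gamma> t. integral_curve N A X \<gamma> \<and> \<gamma> 0 = p \<and> \<gamma> t = q}"

section \<open>The foliation of a complete field on a surface\<close>

definition leaves :: "'a topology \<Rightarrow> ('a, 2) chart set \<Rightarrow> ('a, 2) vfield \<Rightarrow> 'a set set" where
  "leaves N A X = orbit N A X ` (topspace N - sing N A X)"

text \<open>Foliated charts have the unit polydisc as image, so that plaques are discs; in such a
  chart the field is a nowhere vanishing multiple of the first coordinate field.\<close>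

definition foliated_chart :: "('a, 2) chart set \<Rightarrow> ('a, 2) vfield \<Rightarrow> ('a, 2) chart \<Rightarrow> bool" where
  "foliated_chart A X = (\<lambda>(U, \<phi>). (U, \<phi>) \<in> A \<and> \<phi> ` U = {v. \<forall>i. norm (v $ i) < 1} \<and>
     (\<forall>p\<in>U. X (U, \<phi>) p $ 1 \<noteq> 0 \<and> X (U, \<phi>) p $ 2 = 0))"

definition plaque :: "('a, 2) chart \<Rightarrow> 'a \<Rightarrow> 'a set" where
  "plaque = (\<lambda>(U, \<phi>) q. {x \<in> U. \<phi> x $ 2 = \<phi> q $ 2})"

text \<open>The intrinsic structure of a leaf as a Riemann surface: the plaques generate its topology,
  and the first foliated coordinate is a chart on each plaque.\<close>

definition leaf_topology :: "('a, 2) chart set \<Rightarrow> ('a, 2) vfield \<Rightarrow> 'a set \<Rightarrow> 'a topology" where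
  "leaf_topology A X L =
     topology_generated_by {plaque c q | c q. foliated_chart A X c \<and> q \<in> L \<inter> fst c}"

definition leaf_atlas :: "('a, 2) chart set \<Rightarrow> ('a, 2) vfield \<Rightarrow> 'a set \<Rightarrow> ('a, 1) chart set" where
  "leaf_atlas A X L =
     {(plaque c q, \<lambda>x. vec (snd c x $ 1)) | c q. foliated_chart A X c \<and> q \<in> L \<inter> fst c}"

definition orbit_biholomorphic_to_punctured_plane ::
  "('a, 2) chart set \<Rightarrow> ('a, 2) vfield \<Rightarrow> 'a set \<Rightarrow> bool" where
  "orbit_biholomorphic_to_punctured_plane A X L \<longleftrightarrow>
     biholomorphic (leaf_topology A X L) (leaf_atlas A X L)
       (top_of_set (- {0})) (plane_atlas (- {0}))"

section \<open>Holonomy\<close>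

text \<open>Local transversals at \<open>p\<close>: embedded holomorphic discs, centred at \<open>p\<close>, that avoid the singular
  set and are nowhere tangent to the field.\<close>

definition transversal ::
  "'a topology \<Rightarrow> ('a, 2) chart set \<Rightarrow> ('a, 2) vfield \<Rightarrow> 'a \<Rightarrow> 'a set \<Rightarrow> bool" where
  "transversal N A X p T \<longleftrightarrow>
     (\<exists>\<sigma>. \<sigma> 0 = p \<and> \<sigma> ` ball (0::complex) 1 = T \<and> T \<subseteq> topspace N - sing N A X \<and>
        homeomorphic_map (top_of_set (ball 0 1)) (subtopology N T) \<sigma> \<and>
        (\<forall>z\<in>ball 0 1. \<forall>(U, \<phi>)\<in>A. \<sigma> z \<in> U \<longrightarrow>
           (\<exists>v. (\<phi> \<circ> \<sigma> has_derivative (\<lambda>h. h *s v)) (at z) \<and>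
                (\<forall>a. v \<noteq> a *s X (U, \<phi>) (\<sigma> z)))))"

text \<open>\<open>g\<close> slides points of the transversal \<open>S\<close> near \<open>p\<close> along the plaques of the chart \<open>c\<close> to the
  transversal \<open>S'\<close> near \<open>q\<close>; this determines the germ of \<open>g\<close>.\<close>

definition plaque_transport ::
  "'a topology \<Rightarrow> ('a, 2) chart \<Rightarrow> 'a set \<Rightarrow> 'a \<Rightarrow> 'a set \<Rightarrow> 'a \<Rightarrow> ('a \<Rightarrow> 'a) \<Rightarrow> bool" where
  "plaque_transport N c S p S' q g \<longleftrightarrow>
     (\<exists>V. openin (subtopology N S) V \<and> p \<in> V \<and> V \<subseteq> fst c \<and>
        continuous_map (subtopology N V) (subtopology N S') g \<and> g p = q \<and>
        (\<forall>x\<in>V. g x \<in> plaque c x))"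

text \<open>\<open>holonomy_along N A X \<alpha> T s S h\<close>: the germ at \<open>\<alpha> 0\<close> of the map \<open>h\<close>, from the transversal \<open>T\<close> at
  \<open>\<alpha> 0\<close> to the transversal \<open>S\<close> at \<open>\<alpha> s\<close>, is the holonomy of the leafwise path \<open>\<alpha>\<close> restricted to
  \<open>{0..s}\<close>, computed through a finite chain of plaques.\<close>

inductive holonomy_along ::
  "'a topology \<Rightarrow> ('a, 2) chart set \<Rightarrow> ('a, 2) vfield \<Rightarrow> (real \<Rightarrow> 'a) \<Rightarrow> 'a set \<Rightarrow>
    real \<Rightarrow> 'a set \<Rightarrow> ('a \<Rightarrow> 'a) \<Rightarrow> bool"
  for N A X \<alpha> T where
  start: "holonomy_along N A X \<alpha> T 0 T (\<lambda>x. x)"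
| extend: "holonomy_along N A X \<alpha> T s S h \<Longrightarrow> s < t \<Longrightarrow> t \<le> 1 \<Longrightarrow> foliated_chart A X c \<Longrightarrow>
    \<alpha> s \<in> fst c \<Longrightarrow> \<alpha> ` {s..t} \<subseteq> plaque c (\<alpha> s) \<Longrightarrow> transversal N A X (\<alpha> t) S' \<Longrightarrow>
    plaque_transport N c S (\<alpha> s) S' (\<alpha> t) g \<Longrightarrow>
    holonomy_along N A X \<alpha> T t S' (g \<circ> h)"

definition germ_at :: "'a topology \<Rightarrow> 'a set \<Rightarrow> 'a \<Rightarrow> ('a \<Rightarrow> 'a) \<Rightarrow> ('a \<Rightarrow> 'a) set" where
  "germ_at N T p h = {h'. \<exists>W. openin N W \<and> p \<in> W \<and> (\<forall>x\<in>W \<inter> T. h' x = h x)}"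

text \<open>The underlying set of the holonomy group of the leaf \<open>L\<close>, as germs at \<open>p\<close> of maps of the
  transversal \<open>T\<close>. Up to isomorphism it does not depend on \<open>p \<in> L\<close> and \<open>T\<close>.\<close>

definition holonomy_group ::
  "'a topology \<Rightarrow> ('a, 2) chart set \<Rightarrow> ('a, 2) vfield \<Rightarrow> 'a set \<Rightarrow> 'a \<Rightarrow> 'a set \<Rightarrow> ('a \<Rightarrow> 'a) set set" where
  "holonomy_group N A X L p T =
     {germ_at N T p h | h. \<exists>\<alpha>. pathin (leaf_topology A X L) \<alpha> \<and> \<alpha> 0 = p \<and> \<alpha> 1 = p \<and>
        holonomy_along N A X \<alpha> T 1 T h}"

section \<open>Meromorphic first integrals\<close>

text \<open>A meromorphic function is represented by a holomorphic function on a dense open set \<open>D\<close> which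
  near every point of the manifold is a quotient \<open>g / h\<close> of holomorphic functions, where \<open>h\<close>
  vanishes identically on no nonempty open set. Points outside \<open>D\<close> may be poles or points of
  indeterminacy.\<close>

definition meromorphic_function ::
  "'a topology \<Rightarrow> ('a, 'n::finite) chart set \<Rightarrow> 'a set \<Rightarrow> ('a \<Rightarrow> complex) \<Rightarrow> bool" where
  "meromorphic_function N A D f \<longleftrightarrow>
     N closure_of D = topspace N \<and> holomorphic_fun_on N A D f \<and>
     (\<forall>p\<in>topspace N. \<exists>W g h. p \<in> W \<and> holomorphic_fun_on N A W g \<and> holomorphic_fun_on N A W h \<and>
        (\<forall>W'. openin N W' \<and> W' \<subseteq> W \<and> W' \<noteq> {} \<longrightarrow> (\<exists>x\<in>W'. h x \<noteq> 0)) \<and>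
        (\<forall>x\<in>W \<inter> D. h x * f x = g x))"

definition meromorphic_first_integral ::
  "'a topology \<Rightarrow> ('a, 2) chart set \<Rightarrow> ('a, 2) vfield \<Rightarrow> 'a set \<Rightarrow> ('a \<Rightarrow> complex) \<Rightarrow> bool" where
  "meromorphic_first_integral N A X D f \<longleftrightarrow>
     meromorphic_function N A D f \<and> \<not> f constant_on D \<and>
     (\<forall>L\<in>leaves N A X. f constant_on (L \<inter> D))"

end

theory Submission
  imports Defs "HOL-Complex_Analysis.Complex_Analysis"
begin

text \<open>
  A period of the flow at a regular point is called persistent if all nearby points have nearby
  periods. Finite holonomy of an orbit \<open>L\<^sub>0\<close> that is not simply connected produces a nonzero
  persistent period: among the iterates of the nontrivial loop of \<open>L\<^sub>0\<close> two have the same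
  holonomy, so the nearby points return after a time close to a multiple of the period of \<open>L\<^sub>0\<close>.
  Since global functions separate points, Liouville's theorem makes the persistent periods at a point
  a discrete subgroup of a real line. The inverse square \<open>\<sigma>\<close> of the smallest one, extended by
  zero, is therefore a well-defined invariant function, which is holomorphic by Rado's theorem.

  If \<open>\<sigma>\<close> is not constant, it is a first integral. If it is constant, then the flow is periodic,
  and the Fourier coefficients of global functions along the orbits are equivariant functions. Were
  any two of the same weight proportional, then all of them would be constant on a transversal,
  suitably moved by the flow, and global functions would not separate its points. So in both
  cases two equivariant functions of equal weight have a nonconstant quotient.

  This quotient is meromorphic at the isolated singularities by Hartogs' theorem. Its restriction to a
  transversal is the power of a local coordinate \<open>y\<close>, up to a Moebius transformation, and is
  invariant under the holonomy, which therefore acts by \<open>y \<mapsto> \<zeta> y\<close> with roots of unity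
  \<open>\<zeta>\<close>; and an orbit meets a transversal in a discrete set.
\<close>

text \<open>The smallest periods themselves jump: next to an orbit with nontrivial finite holonomy,
  the nearby orbits close up only after a proper multiple of its period. Persistence discards such
  exceptional values, and it survives limits. A generator of a discrete subgroup of a real line is
  fixed only up to sign, hence the square. Where persistent periods die out, the nearby ones must
  escape to infinity, hence the inverse. So \<sigma> is continuous and vanishes exactly where there
  is no nonzero persistent period. Nothing is known beforehand about the shape of this zero set, and
  that is what calls for Rado's theorem.

  In the periodic case invariant functions alone are too few: for the radial field on the space of
  two complex variables they are constant, whereas both coordinates have the same weight and a
  nonconstant quotient.

  The field is given by integral curves through single points. Continuity of the flow and its
  holomorphic dependence on the initial point are drawn from Euler polygons before flow boxes and
  holonomy can be used.\<close>

no_notation fps_nth (infixl "$" 75)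

section \<open>One complex variable\<close>

text \<open>Cauchy's inequality on discs of a fixed radius turns uniform closeness of
  \<open>H\<close> at the parameters \<open>u\<close> and \<open>u0\<close> into closeness of the
  derivatives; the derivative at \<open>u0\<close> is continuous in \<open>z\<close> by itself. The
  parameter lives in a metric space, so it can be a real integration variable or the second complex
  coordinate.\<close>

lemma continuous_on_deriv_param:
  fixes H :: "complex \<Rightarrow> 'b::metric_space \<Rightarrow> complex"
  assumes V: "open V" and cont: "continuous_on (V \<times> S) (\<lambda>(z, u). H z u)"
    and hol: "\<And>u. u \<in> S \<Longrightarrow> (\<lambda>z. H z u) holomorphic_on V"
  shows "continuous_on (V \<times> S) (\<lambda>(z, u). deriv (\<lambda>w. H w u) z)"
proof -
  have "continuous (at (z0, u0) within V \<times> S) (\<lambda>(z, u). deriv (\<lambda>w. H w u) z)"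
    if z0: "z0 \<in> V" and u0: "u0 \<in> S" for z0 u0
    unfolding continuous_within_eps_delta
  proof (intro allI impI)
    fix e :: real assume e: "e > 0"
    obtain R where R: "R > 0" "cball z0 R \<subseteq> V"
      using V z0 open_contains_cball by blast
    \<comment> \<open>Within half the radius of \<open>z0\<close>, circles of radius
      \<open>r\<close> stay in the compact disc on which \<open>H\<close> is controlled; the bound
      \<open>e * r / 4\<close> below then costs the derivative only \<open>e / 4\<close>.\<close>
    define r where "r = R / 2"
    have r: "r > 0" using R by (simp add: r_def)
    have "continuous_on (S \<times> cball z0 R) (\<lambda>(u, z). H z u)"
    proof -
      have "continuous_on (S \<times> cball z0 R) ((\<lambda>(z, u). H z u) \<circ> (\<lambda>(u, z). (z, u)))"
        by (intro continuous_on_compose continuous_on_subset[OF cont])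
           (use R in \<open>auto simp: case_prod_unfold intro!: continuous_intros\<close>)
      then show ?thesis by (simp add: o_def case_prod_unfold)
    qed
    then obtain X0 where X0: "u0 \<in> X0" "open X0"
      "\<And>u z. u \<in> X0 \<inter> S \<Longrightarrow> z \<in> cball z0 R \<Longrightarrow> dist (H z u) (H z u0) \<le> e * r / 4"
      using continuous_on_prod_compactE[of S "cball z0 R" "\<lambda>(u, z). H z u" u0 "e * r / 4"] e r u0
      by (metis (no_types, lifting) case_prod_conv compact_cball divide_pos_pos mult_pos_pos zero_less_numeral)
    have "continuous_on V (deriv (\<lambda>w. H w u0))"
      using hol[OF u0] V holomorphic_deriv holomorphic_on_imp_continuous_on by blast
    then obtain d1 where d1: "d1 > 0" "\<And>z. z \<in> V \<Longrightarrow> dist z z0 < d1 \<Longrightarrow>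
        dist (deriv (\<lambda>w. H w u0) z) (deriv (\<lambda>w. H w u0) z0) < e / 2"
      using z0 e unfolding continuous_on_iff by (meson half_gt_zero)
    obtain d2 where d2: "d2 > 0" "ball u0 d2 \<subseteq> X0"
      using X0 open_contains_ball by blast
    have "dist (deriv (\<lambda>w. H w u) z) (deriv (\<lambda>w. H w u0) z0) < e"
      if zu: "z \<in> V" "u \<in> S" and d: "dist z z0 < min (min d1 d2) r" "dist u u0 < min (min d1 d2) r" for z u
    proof -
      have uX: "u \<in> X0 \<inter> S" using d zu d2 by (auto simp: dist_commute)
      have sub: "cball z r \<subseteq> cball z0 R"
        using d by (auto simp: r_def dist_commute) (smt (verit) dist_triangle dist_commute)
      have hd: "(\<lambda>w. H w u - H w u0) holomorphic_on V"
        using hol zu u0 by (intro holomorphic_intros) auto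
      have "norm ((deriv ^^ 1) (\<lambda>w. H w u - H w u0) z) \<le> fact 1 * (e * r / 4) / r ^ 1"
      proof (rule Cauchy_inequality)
        show "(\<lambda>w. H w u - H w u0) holomorphic_on ball z r"
          using hd sub R(2) ball_subset_cball by (meson holomorphic_on_subset order_trans)
        show "continuous_on (cball z r) (\<lambda>w. H w u - H w u0)"
          using hd sub R(2) by (meson continuous_on_subset holomorphic_on_imp_continuous_on order_trans)
        show "norm (H x u - H x u0) \<le> e * r / 4" if "norm (z - x) = r" for x
        proof -
          have "x \<in> cball z0 R" using sub that by (auto simp: dist_norm)
          from X0(3)[OF uX this] show ?thesis by (simp add: dist_norm)
        qed
      qed (use r in auto)
      then have "norm (deriv (\<lambda>w. H w u - H w u0) z) \<le> e / 4" using r by simp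
      moreover have "deriv (\<lambda>w. H w u - H w u0) z = deriv (\<lambda>w. H w u) z - deriv (\<lambda>w. H w u0) z"
        using hol zu u0 V by (intro deriv_diff) (metis holomorphic_on_imp_differentiable_at)+
      moreover have "dist (deriv (\<lambda>w. H w u0) z) (deriv (\<lambda>w. H w u0) z0) < e / 2"
        using d1 d zu by auto
      ultimately have "dist (deriv (\<lambda>w. H w u) z) (deriv (\<lambda>w. H w u0) z) \<le> e / 4"
        and "dist (deriv (\<lambda>w. H w u0) z) (deriv (\<lambda>w. H w u0) z0) < e / 2"
        by (auto simp: dist_norm)
      then show ?thesis using e
        dist_triangle[of "deriv (\<lambda>w. H w u) z" "deriv (\<lambda>w. H w u0) z0" "deriv (\<lambda>w. H w u0) z"]
        by linarith
    qed
    then have "dist (case x' of (z, u) \<Rightarrow> deriv (\<lambda>w. H w u) z) (case (z0, u0) of (z, u) \<Rightarrow> deriv (\<lambda>w. H w u) z) < e"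
      if "x' \<in> V \<times> S" "dist x' (z0, u0) < min (min d1 d2) r" for x'
      using that dist_fst_le[of x' "(z0, u0)"] dist_snd_le[of x' "(z0, u0)"]
      by (cases x') (metis SigmaD1 SigmaD2 case_prod_conv fst_conv le_less_trans snd_conv)
    then show "\<exists>d>0. \<forall>x'\<in>V \<times> S. dist x' (z0, u0) < d \<longrightarrow>
        dist (case x' of (z, u) \<Rightarrow> deriv (\<lambda>w. H w u) z) (case (z0, u0) of (z, u) \<Rightarrow> deriv (\<lambda>w. H w u) z) < e"
      using d1(1) d2(1) r by (intro exI[of _ "min (min d1 d2) r"]) simp
  qed
  then show ?thesis by (auto simp: continuous_on_eq_continuous_within)
qed

lemma has_field_derivative_integral_param:
  fixes H :: "complex \<Rightarrow> real \<Rightarrow> complex"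
  assumes V: "open V" and cont: "continuous_on (V \<times> {0..1}) (\<lambda>(z, u). H z u)"
    and hol: "\<And>u. u \<in> {0..1} \<Longrightarrow> (\<lambda>z. H z u) holomorphic_on V" and z: "z \<in> V"
  shows "((\<lambda>z. integral {0..1} (H z)) has_field_derivative
            integral {0..1} (\<lambda>u. deriv (\<lambda>w. H w u) z)) (at z)"
proof -
  obtain r where r: "r > 0" "ball z r \<subseteq> V" using V z open_contains_ball by blast
  have "((\<lambda>z. integral (cbox 0 1) (H z)) has_field_derivative
            integral (cbox 0 1) (\<lambda>u. deriv (\<lambda>w. H w u) z)) (at z within ball z r)"
  proof (rule leibniz_rule_field_derivative[where fx = "\<lambda>z u. deriv (\<lambda>w. H w u) z"])
    show "((\<lambda>x. H x t) has_field_derivative deriv (\<lambda>w. H w t) x) (at x within ball z r)"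
      if "x \<in> ball z r" "t \<in> cbox 0 1" for x t
      using holomorphic_derivI[OF hol[of t] V, of x] that r
      by (simp add: has_field_derivative_at_within subset_iff)
    show "H x integrable_on cbox 0 1" if "x \<in> ball z r" for x
    proof (rule integrable_continuous)
      have "continuous_on (cbox 0 1) ((\<lambda>(z, u). H z u) \<circ> (\<lambda>u. (x, u)))"
        by (intro continuous_on_compose continuous_on_subset[OF cont] continuous_intros)
           (use that r in auto)
      then show "continuous_on (cbox 0 1) (H x)" by (simp add: o_def)
    qed
    have "continuous_on (V \<times> {0..1}) (\<lambda>(z, u). deriv (\<lambda>w. H w u) z)"
      by (rule continuous_on_deriv_param[OF V cont hol])
    then show "continuous_on (ball z r \<times> cbox 0 1) (\<lambda>(x, t). deriv (\<lambda>w. H w t) x)"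
      using r by (auto intro: continuous_on_subset)
  qed (use r in auto)
  then show ?thesis using r by (simp add: at_within_open[of z "ball z r"])
qed

lemma holomorphic_on_integral_param:
  fixes H :: "complex \<Rightarrow> real \<Rightarrow> complex"
  assumes "open V" "continuous_on (V \<times> {0..1}) (\<lambda>(z, u). H z u)"
    and "\<And>u. u \<in> {0..1} \<Longrightarrow> (\<lambda>z. H z u) holomorphic_on V"
  shows "(\<lambda>z. integral {0..1} (H z)) holomorphic_on V"
  using has_field_derivative_integral_param[OF assms] assms(1)
  by (auto simp: holomorphic_on_open)

subsection \<open>Fourier coefficients of periodic entire functions\<close>

definition fourier_coeff :: "(complex \<Rightarrow> complex) \<Rightarrow> int \<Rightarrow> complex" where
  "fourier_coeff H n = integral {0..1} (\<lambda>u. H (of_real u) * exp (- (2 * pi * \<i> * of_int n * of_real u)))"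

text \<open>The derivative of the left side in \<open>t\<close> is the integral of a derivative over
  a full period, so it vanishes, and the integral does not depend on the complex number
  \<open>t\<close>.\<close>

lemma integral_periodic_shift:
  assumes hol: "H holomorphic_on UNIV" and per: "\<And>s. H (s + 1) = H s"
  shows "integral {0..1} (\<lambda>u. H (of_real u + t)) = integral {0..1} (\<lambda>u. H (of_real u))"
proof -
  define G where "G t = integral {0..1} (\<lambda>u. H (of_real u + t))" for t
  have contH: "continuous_on UNIV H" using hol holomorphic_on_imp_continuous_on by blast
  have "(G has_field_derivative 0) (at t)" for t
  proof -
    have "(G has_field_derivative integral {0..1} (\<lambda>u. deriv (\<lambda>w. H (of_real u + w)) t)) (at t)"
      unfolding G_def
    proof (rule has_field_derivative_integral_param[where V = UNIV])
      show "continuous_on (UNIV \<times> {0..1}) (\<lambda>(z, u::real). H (complex_of_real u + z))"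
        unfolding case_prod_unfold
        by (intro continuous_on_compose2[OF contH] continuous_intros) auto
      show "(\<lambda>z. H (complex_of_real u + z)) holomorphic_on UNIV" for u :: real
        by (rule holomorphic_on_compose_gen[of "\<lambda>z. complex_of_real u + z" UNIV H UNIV, unfolded o_def, OF _ hol])
           (auto intro!: holomorphic_intros)
    qed auto
    moreover have "((\<lambda>u. deriv (\<lambda>w. H (of_real u + w)) t) has_integral (H (of_real 1 + t) - H (of_real 0 + t))) {0..1}"
    proof (rule fundamental_theorem_of_calculus)
      fix u :: real
      have d: "(H has_field_derivative deriv H s) (at s)" for s
        using hol by (simp add: holomorphic_derivI)
      have "((\<lambda>w. H (of_real u + w)) has_field_derivative deriv H (of_real u + t)) (at t)"
        by (rule DERIV_chain'[where g = H and D = 1, OF _ d, simplified]) (auto intro!: derivative_eq_intros)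
      then have "deriv (\<lambda>w. H (of_real u + w)) t = deriv H (of_real u + t)" by (rule DERIV_imp_deriv)
      moreover have "((\<lambda>u. complex_of_real u + t) has_vector_derivative 1) (at u)"
        unfolding has_vector_derivative_def by (auto intro!: derivative_eq_intros simp: scaleR_conv_of_real)
      then have "((\<lambda>u. H (of_real u + t)) has_vector_derivative 1 * deriv H (of_real u + t)) (at u)"
        using field_vector_diff_chain_at[of "\<lambda>u. of_real u + t" 1 u H "deriv H (of_real u + t)", unfolded o_def, OF _ d]
        by simp
      ultimately show "((\<lambda>u. H (of_real u + t)) has_vector_derivative deriv (\<lambda>w. H (of_real u + w)) t) (at u within {0..1})"
        by (simp add: has_vector_derivative_at_within)
    qed auto
    ultimately show ?thesis
      using per[of t] by (simp add: integral_unique add.commute)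
  qed
  then have "G t = G 0"
    by (metis DERIV_zero_connected_constant[of UNIV "{}" G] UNIV_I connected_UNIV continuous_on_eq_continuous_at
        DERIV_isCont finite.emptyI open_UNIV Diff_empty)
  then show ?thesis by (simp add: G_def)
qed

text \<open>\<open>H\<close> times the character of index \<open>n\<close> is again entire of period
  1, so its integral is invariant under complex translation. Imaginary \<open>t\<close> yields the
  decay of the coefficients, general \<open>t\<close> their equivariance along the complex
  flow.\<close>

lemma fourier_coeff_shift:
  assumes hol: "H holomorphic_on UNIV" and per: "\<And>s. H (s + 1) = H s"
  shows "fourier_coeff H n = exp (- (2 * pi * \<i> * of_int n * t)) * fourier_coeff (\<lambda>s. H (s + t)) n"
proof -
  define E where "E s = H s * exp (- (2 * pi * \<i> * of_int n * s))" for s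
  have "E holomorphic_on UNIV" unfolding E_def by (intro holomorphic_intros hol)
  moreover have "E (s + 1) = E s" for s
  proof -
    have "exp (- (2 * pi * \<i> * of_int n * (s + 1))) = exp (- (2 * pi * \<i> * of_int n * s)) * exp (2 * of_int (-n) * pi * \<i>)"
      by (simp add: exp_add[symmetric] algebra_simps)
    also have "exp (2 * of_int (-n) * pi * \<i>) = 1"
      using exp_integer_2pi[of "of_int (-n)"] by (simp add: mult_ac)
    finally show ?thesis by (simp add: E_def per)
  qed
  ultimately have "integral {0..1} (\<lambda>u. E (of_real u + t)) = integral {0..1} (\<lambda>u. E (of_real u))"
    by (rule integral_periodic_shift)
  moreover have "(\<lambda>u. E (of_real u + t)) = (\<lambda>u. exp (- (2 * pi * \<i> * of_int n * t)) *
       (H (of_real u + t) * exp (- (2 * pi * \<i> * of_int n * of_real u))))"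
    by (auto simp: E_def fun_eq_iff algebra_simps exp_add[symmetric])
  ultimately show ?thesis
    by (simp add: fourier_coeff_def E_def)
qed

lemma norm_fourier_coeff_le:
  assumes hol: "H holomorphic_on UNIV" and per: "\<And>s. H (s + 1) = H s"
  obtains C where "C > 0" "\<And>n. norm (fourier_coeff H n) \<le> C * exp (- (2 * pi * \<bar>of_int n\<bar>))"
proof -
  have contH: "continuous_on UNIV H" using hol holomorphic_on_imp_continuous_on by blast
  \<comment> \<open>The box contains the segment from 0 to 1 together with its translates by
    \<open>\<i>\<close> and \<open>- \<i>\<close>.\<close>
  define B where "B = cbox (0 - \<i>) (1 + \<i>)"
  have "compact (H ` B)" unfolding B_def
    by (intro compact_continuous_image continuous_on_subset[OF contH]) auto
  then obtain C where C: "C > 0" "\<And>s. s \<in> B \<Longrightarrow> norm (H s) \<le> C"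
    by (metis bounded_pos compact_imp_bounded imageI)
  show ?thesis
  proof (rule that[OF C(1)])
    fix n :: int
    \<comment> \<open>The direction of the shift depends on the sign of \<open>n\<close>, so that
      the factor has modulus \<open>exp (- (2 * pi * \<bar>of_int n\<bar>))\<close> in all
      cases.\<close>
    define t where "t = - \<i> * of_int (sgn n)"
    have t: "t = 0 \<or> t = \<i> \<or> t = - \<i>"
      by (cases n "0::int" rule: linorder_cases) (auto simp: t_def sgn_if)
    have inB: "of_real u + t \<in> B" if "u \<in> {0..1}" for u :: real
      using t that by (auto simp: B_def in_cbox_complex_iff)
    have "norm (integral {0..1} (\<lambda>u. H (of_real u + t) * exp (- (2 * pi * \<i> * of_int n * of_real u)))) \<le> C * (1 - 0)"
    proof (rule integral_bound)
      show "continuous_on {0..1} (\<lambda>u. H (complex_of_real u + t) * exp (- (complex_of_real (2 * pi) * \<i> * complex_of_int n * complex_of_real u)))"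
        by (intro continuous_intros continuous_on_compose2[OF contH]) auto
      show "norm (H (complex_of_real u + t) * exp (- (complex_of_real (2 * pi) * \<i> * complex_of_int n * complex_of_real u))) \<le> C"
        if "u \<in> {0..1}" for u
        using C(2)[OF inB[OF that]] by (simp add: norm_mult norm_exp_eq_Re)
    qed auto
    then have "norm (fourier_coeff (\<lambda>s. H (s + t)) n) \<le> C"
      by (simp add: fourier_coeff_def)
    moreover have "norm (exp (- (2 * pi * \<i> * of_int n * t))) = exp (- (2 * pi * \<bar>of_int n\<bar>))"
      by (cases n "0::int" rule: linorder_cases) (auto simp: norm_exp_eq_Re t_def sgn_if)
    moreover have "norm (fourier_coeff H n) =
        norm (exp (- (2 * pi * \<i> * of_int n * t))) * norm (fourier_coeff (\<lambda>s. H (s + t)) n)"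
      using fourier_coeff_shift[OF hol per, of n t] by (metis norm_mult)
    ultimately show "norm (fourier_coeff H n) \<le> C * exp (- (2 * pi * \<bar>of_int n\<bar>))"
      by (simp only: mult.commute[of C] mult_left_mono exp_ge_zero)
  qed
qed

lemma fourier_coeff_exp:
  "fourier_coeff (\<lambda>s. exp (2 * pi * \<i> * s)) n = (if n = 1 then 1 else 0)"
  "fourier_coeff (\<lambda>s. c) n = (if n = 0 then c else 0)"
proof -
  have "integral {0..1} (\<lambda>u. exp (2 * pi * \<i> * of_int m * of_real u)) = (if m = 0 then 1 else (0::complex))" for m
  proof (cases "m = 0")
    case False
    let ?a = "2 * pi * \<i> * of_int m"
    have a: "?a \<noteq> 0" using False by simp
    have "((\<lambda>u. exp (?a * of_real u)) has_integral (exp (?a * of_real 1) / ?a - exp (?a * of_real 0) / ?a)) {0..1}"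
    proof (rule fundamental_theorem_of_calculus)
      fix u :: real
      have "((\<lambda>w. exp (?a * w) / ?a) has_field_derivative exp (?a * of_real u)) (at (of_real u))"
        using a by (auto intro!: derivative_eq_intros)
      then show "((\<lambda>u. exp (?a * complex_of_real u) / ?a) has_vector_derivative exp (?a * complex_of_real u)) (at u within {0..1})"
        by (rule has_vector_derivative_real_field[THEN has_vector_derivative_at_within])
    qed auto
    moreover have "exp (?a * of_real 1) = 1"
      using exp_integer_2pi[of "of_int m"] by (simp add: mult_ac)
    ultimately show ?thesis using False by (simp add: integral_unique)
  qed auto
  note this[of "-n"] this[of "1-n"]
  moreover have "(\<lambda>u. exp (2 * pi * \<i> * of_real u) * exp (- (2 * pi * \<i> * of_int n * of_real u)))
      = (\<lambda>u. exp (2 * pi * \<i> * of_int (1 - n) * of_real u))" for u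
    by (auto simp: fun_eq_iff exp_add[symmetric] algebra_simps)
  ultimately show "fourier_coeff (\<lambda>s. exp (2 * pi * \<i> * s)) n = (if n = 1 then 1 else 0)"
    "fourier_coeff (\<lambda>s. c) n = (if n = 0 then c else 0)"
    unfolding fourier_coeff_def by auto
qed

lemma fourier_coeff_diff:
  assumes "continuous_on UNIV H" "continuous_on UNIV K"
  shows "fourier_coeff (\<lambda>s. H s - K s) n = fourier_coeff H n - fourier_coeff K n"
proof -
  have "(\<lambda>u. G (of_real u) * exp (- (2 * pi * \<i> * of_int n * of_real u))) integrable_on {0..1}"
    if "continuous_on UNIV G" for G :: "complex \<Rightarrow> complex"
    by (intro integrable_continuous_real continuous_intros continuous_on_compose2[OF that]) auto
  from this[OF assms(1)] this[OF assms(2)] show ?thesis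
    unfolding fourier_coeff_def left_diff_distrib by (simp add: Henstock_Kurzweil_Integration.integral_diff)
qed

lemma exp_2pi_eq_1_iff: "exp (2 * pi * \<i> * s) = 1 \<longleftrightarrow> s \<in> \<int>"
proof
  assume "exp (2 * pi * \<i> * s) = 1"
  then obtain n where n: "- (Im s * pi * 2) = 0" "Re s * pi * 2 = of_int (2 * n) * pi"
    by (auto simp: exp_eq_1 mult_ac)
  then have "s = of_int n" by (auto simp: complex_eq_iff)
  then show "s \<in> \<int>" by simp
next
  assume "s \<in> \<int>"
  then show "exp (2 * pi * \<i> * s) = 1" by (auto elim!: Ints_cases simp: exp_eq_1 mult_ac)
qed

text \<open>Chernoff's argument: dividing \<open>H - H 0\<close> by \<open>exp (2 \<pi> i s) - 1\<close> makes the Fourier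
  coefficients of the quotient constant on both half lines, hence zero by their decay.\<close>

lemma fourier_coeff_eq_0_imp_zero_at_0:
  assumes hol: "H holomorphic_on UNIV" and per: "\<And>s. H (s + 1) = H s"
    and zero: "\<And>n. fourier_coeff H n = 0"
  shows "H 0 = 0"
proof -
  define e where "e s = exp (2 * pi * \<i> * s) - 1" for s :: complex
  \<comment> \<open>At an integer, \<open>e\<close> has derivative \<open>2 * pi * \<i>\<close> and
    \<open>H\<close> returns to \<open>H 0\<close>, so the first branch is the limit of the second
    and the singularities are removable.\<close>
  define K where "K s = (if s \<in> \<int> then deriv H s / (2 * pi * \<i>) else (H s - H 0) / e s)" for s
  have perZ: "H (s + of_nat n) = H s" for s n
    by (induction n) (simp_all, metis per add.assoc add.commute)
  have perI: "H (s + of_int n) = H s" for s n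
    using perZ[of s "nat n"] perZ[of "s + of_int n" "nat (-n)"] by (cases "n \<ge> 0") auto
  have contH: "continuous_on UNIV H" using hol holomorphic_on_imp_continuous_on by blast
  have e_hol: "e holomorphic_on UNIV" unfolding e_def by (intro holomorphic_intros)
  have e0: "e s = 0 \<longleftrightarrow> s \<in> \<int>" for s using exp_2pi_eq_1_iff[of s] by (simp add: e_def)
  have openZ: "open (UNIV - \<int> :: complex set)" by (simp add: closed_Ints open_Diff)
  have K_hol_off: "K holomorphic_on (UNIV - \<int>)"
  proof -
    have "(\<lambda>s. (H s - H 0) / e s) holomorphic_on (UNIV - \<int>)"
      using e0 by (intro holomorphic_intros holomorphic_on_subset[OF hol] holomorphic_on_subset[OF e_hol]) auto
    then show ?thesis by (rule holomorphic_transform) (auto simp: K_def)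
  qed
  have K_hol_at: "K holomorphic_on ball (of_int m) 1" for m
  proof (rule no_isolated_singularity'[of "{of_int m}"])
    have Zb: "s = of_int m" if "s \<in> ball (of_int m) 1" "s \<in> \<int>" for s :: complex
      using that by (auto elim!: Ints_cases simp: dist_complex_def simp flip: of_int_diff)
    show "K holomorphic_on ball (of_int m) 1 - {of_int m}"
      using Zb by (intro holomorphic_on_subset[OF K_hol_off]) blast
    fix z assume "z \<in> {of_int m :: complex}"
    then have z: "z = of_int m" by simp
    have "((\<lambda>s. (H s - H z) / (s - z)) \<longlongrightarrow> deriv H z) (at z)"
      using hol by (simp add: holomorphic_derivI flip: has_field_derivative_iff)
    moreover have "((\<lambda>s. (e s - e z) / (s - z)) \<longlongrightarrow> 2 * pi * \<i>) (at z)"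
    proof -
      have "(e has_field_derivative (exp (2 * pi * \<i> * z) * (2 * pi * \<i>))) (at z)"
        unfolding e_def by (auto intro!: derivative_eq_intros)
      moreover have "exp (2 * pi * \<i> * z) = 1" using exp_2pi_eq_1_iff z by auto
      ultimately show ?thesis by (simp flip: has_field_derivative_iff)
    qed
    ultimately have "((\<lambda>s. ((H s - H z) / (s - z)) / ((e s - e z) / (s - z))) \<longlongrightarrow> deriv H z / (2 * pi * \<i>)) (at z)"
      by (rule tendsto_divide) simp
    moreover have "\<forall>\<^sub>F s in at z. ((H s - H z) / (s - z)) / ((e s - e z) / (s - z)) = K s"
    proof -
      have "\<forall>\<^sub>F s in at z. s \<in> ball z 1 - {z}"
        using eventually_at_in_open[of "ball z 1" z] by simp
      then show ?thesis
      proof (rule eventually_mono)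
        fix s assume s: "s \<in> ball z 1 - {z}"
        then have "s \<notin> \<int>" using Zb z by blast
        moreover have "e z = 0" using e0 z by simp
        moreover have "H z = H 0" using perI[of 0 m] z by simp
        ultimately show "((H s - H z) / (s - z)) / ((e s - e z) / (s - z)) = K s"
          using s by (auto simp: K_def)
      qed
    qed
    ultimately have "(K \<longlongrightarrow> deriv H z / (2 * pi * \<i>)) (at z)"
      by (rule Lim_transform_eventually)
    then have "(K \<longlongrightarrow> K z) (at z)" using z by (simp add: K_def)
    then show "(K \<longlongrightarrow> K z) (at z within ball (of_int m) 1)"
      by (rule tendsto_within_subset) auto
  qed auto
  have "K holomorphic_on UNIV"
  proof -
    have "K field_differentiable at s" for s
    proof (cases "s \<in> \<int>")
      case True
      then obtain m where "s = of_int m" by (auto elim: Ints_cases)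
      then show ?thesis using K_hol_at[of m] holomorphic_on_imp_differentiable_at by fastforce
    next
      case False
      then show ?thesis using K_hol_off openZ holomorphic_on_imp_differentiable_at[of K] by blast
    qed
    then show ?thesis by (simp add: holomorphic_on_def field_differentiable_at_within)
  qed
  note K_hol = this
  have contK: "continuous_on UNIV K" using K_hol holomorphic_on_imp_continuous_on by blast
  have K_per: "K (s + 1) = K s" for s
  proof -
    have "((\<lambda>w. H (w + 1)) has_field_derivative deriv H (s + 1)) (at s)"
      by (rule DERIV_chain'[where g = H and D = 1, simplified])
         (auto intro!: derivative_eq_intros holomorphic_derivI[OF hol])
    then have "deriv H (s + 1) = deriv H s" using per by (simp add: DERIV_imp_deriv)
    moreover have "e (s + 1) = e s" by (simp add: e_def exp_add ring_distribs)
    moreover have "s + 1 \<in> \<int> \<longleftrightarrow> s \<in> \<int>" using e0 calculation(2) by metis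
    ultimately show ?thesis by (auto simp: K_def per)
  qed
  have HK: "H s - H 0 = K s * exp (2 * pi * \<i> * s) - K s" for s
  proof (cases "s \<in> \<int>")
    case True
    then obtain m where "s = of_int m" by (auto elim: Ints_cases)
    then have "H s = H 0" "exp (2 * pi * \<i> * s) = 1" using perI[of 0 m] exp_2pi_eq_1_iff[of s] by auto
    then show ?thesis by simp
  next
    case False
    then have "K s * e s = H s - H 0" using e0[of s] by (simp add: K_def)
    then show ?thesis by (simp add: e_def ring_distribs)
  qed
  \<comment> \<open>Multiplying \<open>K\<close> by the exponential lowers the index by one. The
    coefficients of \<open>H\<close> vanish, so consecutive coefficients of \<open>K\<close> agree
    except across \<open>n = 0\<close>, where they differ by \<open>H 0\<close>; once both half
    lines are zero, so is \<open>H 0\<close>.\<close>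
  have step: "fourier_coeff K (n - 1) - fourier_coeff K n = (if n = 0 then - H 0 else 0)" for n
  proof -
    have "fourier_coeff (\<lambda>s. H s - H 0) n = fourier_coeff H n - (if n = 0 then H 0 else 0)"
      using fourier_coeff_diff[OF contH continuous_on_const] by (simp add: fourier_coeff_exp)
    moreover have "fourier_coeff (\<lambda>s. K s * exp (2 * pi * \<i> * s) - K s) n =
        fourier_coeff (\<lambda>s. K s * exp (2 * pi * \<i> * s)) n - fourier_coeff K n"
      by (rule fourier_coeff_diff) (auto intro!: continuous_intros contK)
    moreover have "fourier_coeff (\<lambda>s. K s * exp (2 * pi * \<i> * s)) n = fourier_coeff K (n - 1)"
    proof -
      have "K (of_real u) * exp (2 * pi * \<i> * of_real u) * exp (- (2 * pi * \<i> * of_int n * of_real u))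
        = K (of_real u) * exp (- (2 * pi * \<i> * of_int (n - 1) * of_real u))" for u
        by (simp add: mult.assoc exp_add[symmetric] algebra_simps)
      then show ?thesis unfolding fourier_coeff_def by (simp only:)
    qed
    ultimately show ?thesis using zero[of n] by (simp add: HK split: if_splits)
  qed
  obtain C where C: "C > 0" "\<And>n. norm (fourier_coeff K n) \<le> C * exp (- (2 * pi * \<bar>of_int n\<bar>))"
    using norm_fourier_coeff_le[OF K_hol K_per] by blast
  have lim: "(\<lambda>k. C * exp (- (2 * pi * real k))) \<longlonglongrightarrow> 0"
    by real_asymp
  have pos: "fourier_coeff K (int k) = fourier_coeff K 0" for k
  proof (induction k)
    case (Suc k) then show ?case using step[of "int (Suc k)"] by simp
  qed simp
  have neg: "fourier_coeff K (- 1 - int k) = fourier_coeff K (- 1)" for k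
  proof (induction k)
    case (Suc k) then show ?case using step[of "- 1 - int k"] by (simp add: algebra_simps)
  qed simp
  have "norm (fourier_coeff K 0) \<le> C * exp (- (2 * pi * real k))" for k
    using C(2)[of "int k"] pos[of k] by simp
  then have "norm (fourier_coeff K 0) \<le> 0" using LIMSEQ_le_const[OF lim] by blast
  moreover have "norm (fourier_coeff K (-1)) \<le> C * exp (- (2 * pi * real k))" for k
  proof -
    have "C * exp (- (2 * pi * \<bar>real_of_int (- 1 - int k)\<bar>)) \<le> C * exp (- (2 * pi * real k))"
      using C(1) by simp
    then show ?thesis using C(2)[of "- 1 - int k"] neg[of k] by simp
  qed
  then have "norm (fourier_coeff K (-1)) \<le> 0" using LIMSEQ_le_const[OF lim] by blast
  ultimately show ?thesis using step[of 0] by simp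
qed

text \<open>Translation multiplies every Fourier coefficient by a nonzero factor, so all
  coefficients of each translate of the difference vanish as well; evaluating the translates at 0
  covers all points.\<close>

lemma fourier_coeff_inject:
  assumes hol: "H holomorphic_on UNIV" "G holomorphic_on UNIV"
    and per: "\<And>s. H (s + 1) = H s" "\<And>s. G (s + 1) = G s"
    and eq: "\<And>n. fourier_coeff H n = fourier_coeff G n"
  shows "H = G"
proof
  fix t
  define D where "D s = H s - G s" for s
  have D: "D holomorphic_on UNIV" "\<And>s. D (s + 1) = D s"
    using holomorphic_on_diff[OF hol] per by (simp_all add: D_def[abs_def])
  have "fourier_coeff D n = 0" for n
    unfolding D_def using fourier_coeff_diff[of H G n] hol eq[of n] holomorphic_on_imp_continuous_on by auto
  then have "fourier_coeff (\<lambda>s. D (s + t)) n = 0" for n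
    using fourier_coeff_shift[OF D, of n t] by simp
  moreover have "(\<lambda>s. D (s + t)) holomorphic_on UNIV"
    by (rule holomorphic_on_compose_gen[of "\<lambda>s. s + t" UNIV D UNIV, unfolded o_def])
       (auto intro!: holomorphic_intros D)
  ultimately have "D (0 + t) = 0"
    using D(2) by (intro fourier_coeff_eq_0_imp_zero_at_0[of "\<lambda>s. D (s + t)"]) (auto simp: algebra_simps, metis add.commute add.left_commute)
  then show "H t = G t" by (simp add: D_def)
qed

subsection \<open>Rado's theorem\<close>

text \<open>On the unit circle \<open>z * cnj z = 1\<close>, so a product of a polynomial and a conjugate polynomial
  can be reduced degree by degree.\<close>

lemma poly_mult_cnj_poly_on_circle:
  "\<exists>r s. \<forall>z. norm z = 1 \<longrightarrow> poly p z * cnj (poly q z) = poly r z + cnj (poly s z)"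
proof (induction p arbitrary: q)
  case 0
  show ?case by (intro exI[of _ 0]) auto
next
  case (pCons a p)
  obtain b q' where q: "q = pCons b q'" by (cases q) auto
  obtain r s where rs: "\<And>z. norm z = 1 \<Longrightarrow> poly p z * cnj (poly q' z) = poly r z + cnj (poly s z)"
    using pCons.IH by metis
  have "poly (pCons a p) z * cnj (poly q z) =
      poly (r + [:0, cnj b:] * p) z + cnj (poly (s + [:cnj a:] * q) z)" if z: "norm z = 1" for z
  proof -
    have zz: "z * cnj z = 1" using z complex_norm_square[of z] by simp
    have "poly (pCons a p) z * cnj (poly q z) = a * cnj (poly q z) + z * poly p z * cnj b
        + (z * cnj z) * (poly p z * cnj (poly q' z))"
      by (simp add: q algebra_simps)
    then show ?thesis using rs[OF z] by (simp add: zz algebra_simps)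
  qed
  then show ?case by blast
qed

text \<open>Real parts of polynomials form a ring on the circle: twice
  \<open>Re (poly p z) * Re (poly q z)\<close> is the real part of a product plus a mixed product
  with a conjugate, which the previous lemma rewrites. They separate points, so Stone-Weierstrass
  applies.\<close>

lemma circle_real_part_poly_approx:
  fixes g :: "complex \<Rightarrow> real"
  assumes g: "continuous_on (sphere 0 1) g" and e: "e > 0"
  obtains p where "\<And>z. norm z = 1 \<Longrightarrow> \<bar>g z - Re (poly p z)\<bar> < e"
proof -
  define R where "R = {g :: complex \<Rightarrow> real. \<exists>p. \<forall>z. norm z = 1 \<longrightarrow> g z = Re (poly p z)}"
  interpret function_ring_on R "sphere 0 1"
  proof
    show "compact (sphere 0 1 :: complex set)" by simp
    fix f h assume f: "f \<in> R"
    then obtain p where p: "\<And>z. norm z = 1 \<Longrightarrow> f z = Re (poly p z)" by (auto simp: R_def)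
    have "continuous_on (sphere 0 1) (\<lambda>z. Re (poly p z))" by (intro continuous_intros)
    then show "continuous_on (sphere 0 1) f"
      by (rule continuous_on_cong[THEN iffD1, rotated -1]) (auto simp: p)
    assume h: "h \<in> R"
    then obtain q where q: "\<And>z. norm z = 1 \<Longrightarrow> h z = Re (poly q z)" by (auto simp: R_def)
    have "f z + h z = Re (poly (p + q) z)" if "norm z = 1" for z using p q that by simp
    then show "(\<lambda>x. f x + h x) \<in> R" unfolding R_def by blast
    obtain r s where rs: "\<And>z. norm z = 1 \<Longrightarrow> poly p z * cnj (poly q z) = poly r z + cnj (poly s z)"
      using poly_mult_cnj_poly_on_circle by metis
    have "f z * h z = Re (poly ([:1/2:] * (p * q + r + s)) z)" if z: "norm z = 1" for z
    proof -
      have "f z * h z = Re (poly p z * poly q z + poly p z * cnj (poly q z)) / 2"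
        using p[OF z] q[OF z] by simp
      then show ?thesis by (simp add: rs[OF z])
    qed
    then show "(\<lambda>x. f x * h x) \<in> R" unfolding R_def by blast
  next
    show "(\<lambda>_. c) \<in> R" for c unfolding R_def by (auto intro!: exI[of _ "[:of_real c:]"])
  next
    fix x y :: complex assume xy: "x \<in> sphere 0 1" "y \<in> sphere 0 1" "x \<noteq> y"
    have "Re \<in> R" unfolding R_def by (auto intro!: exI[of _ "[:0, 1:]"])
    moreover have "Im \<in> R" unfolding R_def by (auto intro!: exI[of _ "[:0, - \<i>:]"])
    ultimately show "\<exists>f\<in>R. f x \<noteq> f y" using xy(3) complex_eq_iff by blast
  qed
  obtain h where "h \<in> R" "\<And>x. x \<in> sphere 0 1 \<Longrightarrow> \<bar>g x - h x\<bar> < e"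
    using Stone_Weierstrass_basic[OF g e] by blast
  then show ?thesis using that unfolding R_def by fastforce
qed

text \<open>The exponential of \<open>(g w - g z) / e\<close> is bounded by \<open>exp 2\<close> and
  has derivative \<open>deriv g z / e\<close> at \<open>z\<close>; Cauchy's inequality at radius
  \<open>r / 2\<close> gives the bound. Control of the real part alone thus controls the
  derivative.\<close>

lemma norm_deriv_le_real_part_bound:
  assumes hol: "g holomorphic_on ball z r" and r: "r > 0" and e: "e > 0"
    and bd: "\<And>w. w \<in> ball z r \<Longrightarrow> \<bar>Re (g w)\<bar> \<le> e"
  shows "norm (deriv g z) \<le> 2 * exp 2 * e / r"
proof -
  define E where "E w = exp ((g w - g z) / of_real e)" for w
  have E_hol: "E holomorphic_on ball z r"
    unfolding E_def using e by (intro holomorphic_intros hol) auto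
  have Eb: "norm (E w) \<le> exp 2" if "w \<in> ball z r" for w
  proof -
    have "Re (g w) - Re (g z) \<le> 2 * e" using bd[OF that] bd[of z] r by auto
    then show ?thesis using e by (simp add: E_def norm_exp_eq_Re field_simps)
  qed
  have sub: "cball z (r / 2) \<subseteq> ball z r" using r by auto
  have "norm ((deriv ^^ 1) E z) \<le> fact 1 * exp 2 / (r / 2) ^ 1"
    by (rule Cauchy_inequality)
       (use r sub E_hol Eb in \<open>auto intro!: holomorphic_on_imp_continuous_on intro: holomorphic_on_subset simp: dist_norm\<close>)
  moreover have "(E has_field_derivative deriv g z / of_real e) (at z)"
  proof -
    have "(g has_field_derivative deriv g z) (at z)"
      using hol r by (intro holomorphic_derivI) auto
    then show ?thesis unfolding E_def using e by (auto intro!: derivative_eq_intros)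
  qed
  then have "deriv E z = deriv g z / of_real e" by (rule DERIV_imp_deriv)
  ultimately show ?thesis using e r by (simp add: norm_divide field_simps)
qed

lemma open_nonzero_set:
  fixes f :: "'b::topological_space \<Rightarrow> complex"
  assumes "open U" "continuous_on U f"
  shows "open {z \<in> U. f z \<noteq> 0}"
proof -
  have "{z \<in> U. f z \<noteq> 0} = U \<inter> f -` (- {0})" by auto
  then show ?thesis using continuous_open_preimage[OF assms(2,1), of "- {0}"] by auto
qed

text \<open>The maximum principle is applied to \<open>f z * g z ^ n\<close> on the set where
  \<open>f\<close> does not vanish. On its boundary inside the disc this product is zero, so only
  the unit circle counts, and letting \<open>n\<close> grow removes the factor
  \<open>f\<close>.\<close>

lemma Rado_max_modulus:
  assumes f: "continuous_on (cball 0 1) f" "f holomorphic_on {z \<in> ball 0 1. f z \<noteq> 0}"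
    and g: "continuous_on (cball 0 1) g" "g holomorphic_on {z \<in> ball 0 1. f z \<noteq> 0}"
    and B: "\<And>z. norm z = 1 \<Longrightarrow> norm (g z) \<le> B"
    and a: "a \<in> ball 0 1" "f a \<noteq> 0"
  shows "norm (g a) \<le> B"
proof -
  define S where "S = {z \<in> ball 0 1. f z \<noteq> 0}"
  have S_open: "open S"
    unfolding S_def by (intro open_nonzero_set continuous_on_subset[OF f(1)]) auto
  have clS: "closure S \<subseteq> cball 0 1"
    by (rule closure_minimal) (auto simp: S_def)
  obtain F where F: "F > 0" "\<And>z. z \<in> cball 0 1 \<Longrightarrow> norm (f z) \<le> F"
    using compact_continuous_image[OF f(1)] compact_imp_bounded bounded_pos by (metis compact_cball imageI)
  have B0: "B \<ge> 0" using order_trans[OF norm_ge_zero B[of 1]] by simp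
  have main: "norm (f a) * norm (g a) ^ n \<le> F * B ^ n" for n
  proof -
    have "norm (f a * g a ^ n) \<le> F * B ^ n"
    proof (rule maximum_modulus_frontier[where S = S and f = "\<lambda>z. f z * g z ^ n" and B = "F * B ^ n"])
      show "(\<lambda>z. f z * g z ^ n) holomorphic_on interior S"
        using f g interior_subset by (intro holomorphic_intros) (auto simp: S_def intro: holomorphic_on_subset)
      show "continuous_on (closure S) (\<lambda>z. f z * g z ^ n)"
        using f g clS by (intro continuous_intros) (auto intro: continuous_on_subset)
      show "bounded S" by (rule bounded_subset[of "ball 0 1"]) (auto simp: S_def)
      show "a \<in> S" using a by (simp add: S_def)
      fix z assume "z \<in> frontier S"
      then have z: "z \<in> closure S" "z \<notin> S" using S_open by (auto simp: frontier_def interior_open)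
      show "norm (f z * g z ^ n) \<le> F * B ^ n"
      proof (cases "f z = 0")
        case True then show ?thesis using F B0 by simp
      next
        case False
        then have "norm z = 1" using z clS by (force simp: S_def)
        then show ?thesis using B[of z] F(2)[of z] B0 F(1)
          by (simp add: norm_mult norm_power mult_mono power_mono)
      qed
    qed
    then show ?thesis by (simp add: norm_mult norm_power)
  qed
  show ?thesis
  proof (rule ccontr)
    assume "\<not> ?thesis"
    then have gt: "norm (g a) > B" by simp
    have gpos: "norm (g a) > 0" using gt B0 by linarith
    have "norm (f a) \<le> F * (B / norm (g a)) ^ n" for n
      using main[of n] gpos by (simp add: power_divide field_simps)
    moreover have "(\<lambda>n. F * (B / norm (g a)) ^ n) \<longlonglongrightarrow> F * 0"
      using gt gpos B0 by (intro tendsto_intros LIMSEQ_realpow_zero) auto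
    ultimately have "norm (f a) \<le> F * 0" by (intro LIMSEQ_le_const) auto
    then show False using a by simp
  qed
qed

text \<open>Both signs come from the modulus estimate, applied to the exponentials of
  \<open>g\<close> and of \<open>- g\<close>.\<close>

lemma Rado_real_part:
  assumes f: "continuous_on (cball 0 1) f" "f holomorphic_on {z \<in> ball 0 1. f z \<noteq> 0}"
    and g: "continuous_on (cball 0 1) g" "g holomorphic_on {z \<in> ball 0 1. f z \<noteq> 0}"
    and B: "\<And>z. norm z = 1 \<Longrightarrow> \<bar>Re (g z)\<bar> \<le> B"
    and a: "a \<in> ball 0 1" "f a \<noteq> 0"
  shows "\<bar>Re (g a)\<bar> \<le> B"
proof -
  have "norm (exp (g a)) \<le> exp B"
    by (rule Rado_max_modulus[OF f _ _ _ a])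
       (use g B in \<open>auto intro!: continuous_intros holomorphic_intros simp: norm_exp_eq_Re abs_le_iff\<close>)
  moreover have "norm (exp (- g a)) \<le> exp B"
  proof (rule Rado_max_modulus[OF f _ _ _ a])
    show "norm (exp (- g z)) \<le> exp B" if "norm z = 1" for z
      using B[OF that] by (simp add: norm_exp_eq_Re abs_le_iff)
  qed (use g in \<open>auto intro!: continuous_intros holomorphic_intros\<close>)
  ultimately show ?thesis by (simp add: norm_exp_eq_Re abs_le_iff)
qed

text \<open>The real part of \<open>g\<close> is a uniform limit of real parts of polynomials, whose derivatives then
  converge locally uniformly on the whole disc.\<close>

lemma Rado_derivative_extends:
  assumes f: "continuous_on (cball 0 1) f" "f holomorphic_on {z \<in> ball 0 1. f z \<noteq> 0}"
    and g: "continuous_on (cball 0 1) g" "g holomorphic_on {z \<in> ball 0 1. f z \<noteq> 0}"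
  obtains G where "G holomorphic_on ball 0 1" "\<And>z. z \<in> ball 0 1 \<Longrightarrow> f z \<noteq> 0 \<Longrightarrow> deriv g z = G z"
proof -
  define S where "S = {z \<in> ball 0 1. f z \<noteq> 0}"
  have S_open: "open S"
    unfolding S_def by (intro open_nonzero_set continuous_on_subset[OF f(1)]) auto
  define \<epsilon> where "\<epsilon> n = inverse (real (Suc n))" for n
  have eps: "\<epsilon> n > 0" for n by (simp add: \<epsilon>_def)
  have "continuous_on (sphere 0 1) (\<lambda>z. Re (g z))"
    by (intro continuous_intros continuous_on_subset[OF g(1)]) auto
  then have "\<exists>p. \<forall>z. norm z = 1 \<longrightarrow> \<bar>Re (g z) - Re (poly p z)\<bar> < \<epsilon> n" for n
    using circle_real_part_poly_approx[OF _ eps[of n]] by metis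
  then obtain p where p: "\<And>n z. norm z = 1 \<Longrightarrow> \<bar>Re (g z) - Re (poly (p n) z)\<bar> < \<epsilon> n" by metis
  have hp: "poly q holomorphic_on A" for q A
    using poly_holomorphic_on[of "\<lambda>x. x" A q] by (simp add: holomorphic_on_ident)
  \<comment> \<open>With the constant 1 in the place of \<open>f\<close> the exceptional set is
    empty, and the estimate is the ordinary maximum principle.\<close>
  have pp: "\<bar>Re (poly (p n) z - poly (p m) z)\<bar> \<le> \<epsilon> n + \<epsilon> m" if "z \<in> ball 0 1" for n m z
  proof (rule Rado_real_part[where f = "\<lambda>_. 1" and g = "\<lambda>z. poly (p n) z - poly (p m) z" and a = z])
    show "\<bar>Re (poly (p n) z - poly (p m) z)\<bar> \<le> \<epsilon> n + \<epsilon> m" if "norm z = 1" for z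
      using p[OF that, of n] p[OF that, of m] by simp
  qed (use that in \<open>auto intro!: continuous_intros holomorphic_intros hp\<close>)
  have gp: "\<bar>Re (g z - poly (p n) z)\<bar> \<le> \<epsilon> n" if "z \<in> S" for n z
  proof (rule Rado_real_part[OF f, where g = "\<lambda>z. g z - poly (p n) z" and a = z])
    show "\<bar>Re (g z - poly (p n) z)\<bar> \<le> \<epsilon> n" if "norm z = 1" for z
      using p[OF that, of n] by simp
  qed (use that g in \<open>auto intro!: continuous_intros holomorphic_intros hp simp: S_def\<close>)
  have dp: "deriv (poly q) z = poly (pderiv q) z" for q z
    by (rule DERIV_imp_deriv[OF poly_DERIV])
  have est: "norm (poly (pderiv (p n)) z - poly (pderiv (p m)) z) \<le> 2 * exp 2 * (\<epsilon> n + \<epsilon> m) / r"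
    if "ball z r \<subseteq> ball 0 1" "r > 0" for n m z r
  proof -
    have "norm (deriv (poly (p n - p m)) z) \<le> 2 * exp 2 * (\<epsilon> n + \<epsilon> m) / r"
      by (rule norm_deriv_le_real_part_bound) (use that pp eps[of n] eps[of m] in \<open>auto intro: hp\<close>)
    then show ?thesis by (simp add: dp pderiv_diff)
  qed
  have est': "norm (deriv g z - poly (pderiv (p n)) z) \<le> 2 * exp 2 * \<epsilon> n / r"
    if zr: "ball z r \<subseteq> S" "r > 0" for n z r
  proof -
    have "norm (deriv (\<lambda>w. g w - poly (p n) w) z) \<le> 2 * exp 2 * \<epsilon> n / r"
    proof (rule norm_deriv_le_real_part_bound)
      show "(\<lambda>w. g w - poly (p n) w) holomorphic_on ball z r"
        using g(2) zr by (intro holomorphic_intros hp) (auto simp: S_def intro: holomorphic_on_subset)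
    qed (use zr gp eps[of n] in auto)
    moreover have "deriv (\<lambda>w. g w - poly (p n) w) z = deriv g z - deriv (poly (p n)) z"
    proof (rule deriv_diff)
      have "z \<in> S" using zr by auto
      then show "g field_differentiable at z"
        using g(2) S_open holomorphic_on_imp_differentiable_at by (simp add: S_def)
      show "poly (p n) field_differentiable at z"
        using hp[of "p n" UNIV] holomorphic_on_imp_differentiable_at by blast
    qed
    ultimately show ?thesis by (simp add: dp)
  qed
  have eps_lim: "\<epsilon> \<longlonglongrightarrow> 0" unfolding \<epsilon>_def by (rule LIMSEQ_inverse_real_of_nat)
  have uc: "uniformly_Cauchy_on (ball z (r / 2)) (\<lambda>n. poly (pderiv (p n)))"
    if zr: "ball z r \<subseteq> ball 0 1" "r > 0" for z r
    unfolding uniformly_Cauchy_on_def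
  proof (intro allI impI)
    fix e :: real assume e: "e > 0"
    have "(\<lambda>n. 2 * exp 2 * (2 * \<epsilon> n) / (r / 2)) \<longlonglongrightarrow> 2 * exp 2 * (2 * 0) / (r / 2)"
      using zr by (intro tendsto_intros eps_lim) auto
    then obtain M where M: "2 * exp 2 * (2 * \<epsilon> M) / (r / 2) < e"
      using e by (metis (no_types, lifting) LIMSEQ_D dual_order.refl mult_zero_right div_0 norm_conv_dist dist_0_norm
          abs_less_iff real_norm_def diff_zero)
    have eM: "\<epsilon> n \<le> \<epsilon> M" if "n \<ge> M" for n using that by (simp add: \<epsilon>_def field_simps)
    have "dist (poly (pderiv (p m)) x) (poly (pderiv (p n)) x) < e"
      if "x \<in> ball z (r / 2)" "m \<ge> M" "n \<ge> M" for x m n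
    proof -
      have "ball x (r / 2) \<subseteq> ball z r"
      proof
        fix y assume "y \<in> ball x (r / 2)"
        then show "y \<in> ball z r" using that(1) dist_triangle[of z y x] by simp
      qed
      then have "ball x (r / 2) \<subseteq> ball 0 1" using zr by blast
      then have "norm (poly (pderiv (p m)) x - poly (pderiv (p n)) x) \<le> 2 * exp 2 * (\<epsilon> m + \<epsilon> n) / (r / 2)"
        using zr by (intro est) auto
      also have "\<dots> \<le> 2 * exp 2 * (2 * \<epsilon> M) / (r / 2)"
        using eM[OF that(2)] eM[OF that(3)] zr(2) by (intro divide_right_mono mult_left_mono) auto
      finally show ?thesis using M by (simp add: dist_norm)
    qed
    then show "\<exists>M. \<forall>x\<in>ball z (r / 2). \<forall>m\<ge>M. \<forall>n\<ge>M. dist (poly (pderiv (p m)) x) (poly (pderiv (p n)) x) < e"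
      by blast
  qed
  \<comment> \<open>The limit exists on the whole disc, including the zeros of \<open>f\<close>,
    where nothing is known yet about the differentiability of \<open>g\<close>.\<close>
  define G where "G z = lim (\<lambda>n. poly (pderiv (p n)) z)" for z
  have ul: "uniform_limit (ball z (r / 2)) (\<lambda>n. poly (pderiv (p n))) G sequentially"
    if zr: "ball z r \<subseteq> ball 0 1" "r > 0" for z r
    unfolding G_def using uc[OF that] Cauchy_uniformly_convergent uniformly_convergent_uniform_limit_iff by blast
  have G_hol: "G holomorphic_on ball 0 1"
  proof (rule holomorphic_uniform_sequence[OF open_ball])
    show "poly (pderiv (p n)) holomorphic_on ball 0 1" for n by (rule hp)
    fix z :: complex assume "z \<in> ball 0 1"
    then obtain r where r: "r > 0" "ball z r \<subseteq> ball 0 1" using open_contains_ball[of "ball 0 1"] by blast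
    have "uniform_limit (cball z (r / 4)) (\<lambda>n. poly (pderiv (p n))) G sequentially"
      by (rule uniform_limit_on_subset[OF ul[OF r(2,1)]]) (use r in auto)
    moreover have "cball z (r / 4) \<subseteq> ball 0 1" using r by (force simp: subset_iff)
    ultimately show "\<exists>d>0. cball z d \<subseteq> ball 0 1 \<and> uniform_limit (cball z d) (\<lambda>n. poly (pderiv (p n))) G sequentially"
      using r by (intro exI[of _ "r / 4"]) auto
  qed
  show ?thesis
  proof (rule that[OF G_hol])
    fix z assume z: "z \<in> ball 0 1" "f z \<noteq> 0"
    then obtain r where r: "r > 0" "ball z r \<subseteq> S" using S_open open_contains_ball[of S] by (auto simp: S_def)
    then have r': "ball z r \<subseteq> ball 0 1" by (auto simp: S_def)
    have "(\<lambda>n. poly (pderiv (p n)) z) \<longlonglongrightarrow> G z"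
      using tendsto_uniform_limitI[OF ul[OF r' r(1)]] r by simp
    then have "(\<lambda>n. norm (deriv g z - poly (pderiv (p n)) z)) \<longlonglongrightarrow> norm (deriv g z - G z)"
      by (intro tendsto_intros)
    moreover have "(\<lambda>n. 2 * exp 2 * \<epsilon> n / r) \<longlonglongrightarrow> 2 * exp 2 * 0 / r"
      using r by (intro tendsto_intros eps_lim) auto
    ultimately have "norm (deriv g z - G z) \<le> 2 * exp 2 * 0 / r"
      using est'[OF r(2,1)] by (intro LIMSEQ_le) auto
    then show "deriv g z = G z" by simp
  qed
qed

text \<open>Off its zeros \<open>f\<close> equals the derivative of \<open>z * f z\<close> minus
  \<open>z\<close> times the derivative of \<open>f\<close>, and both derivatives extend to the disc
  by the previous lemma. Unless \<open>f\<close> is zero, the resulting holomorphic \<open>F\<close>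
  has countably many zeros, whose complement is connected; there the set where \<open>f\<close> is
  nonzero is open and closed, so \<open>f\<close> and \<open>F\<close> agree everywhere.\<close>

lemma Rado_unit_disc:
  assumes f: "continuous_on (cball 0 1) f" "f holomorphic_on {z \<in> ball 0 1. f z \<noteq> 0}"
  shows "f holomorphic_on ball 0 1"
proof -
  define S where "S = {z \<in> ball 0 1. f z \<noteq> 0}"
  have S_open: "open S"
    unfolding S_def by (intro open_nonzero_set continuous_on_subset[OF f(1)]) auto
  obtain G where G: "G holomorphic_on ball 0 1" "\<And>z. z \<in> S \<Longrightarrow> deriv f z = G z"
    by (rule Rado_derivative_extends[OF f f]) (simp add: S_def)
  have "continuous_on (cball 0 1) (\<lambda>z. z * f z)" "(\<lambda>z. z * f z) holomorphic_on {z \<in> ball 0 1. f z \<noteq> 0}"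
    using f by (auto intro!: continuous_intros holomorphic_intros)
  then obtain K where K: "K holomorphic_on ball 0 1" "\<And>z. z \<in> S \<Longrightarrow> deriv (\<lambda>z. z * f z) z = K z"
    by (rule Rado_derivative_extends[OF f]) (simp add: S_def)
  define F where "F z = K z - z * G z" for z
  have F_hol: "F holomorphic_on ball 0 1"
    unfolding F_def by (intro holomorphic_intros G K)
  have fF: "f z = F z" if "z \<in> S" for z
  proof -
    have "(f has_field_derivative G z) (at z)"
      using f(2) S_open that G(2)[OF that] holomorphic_derivI[of f S z] by (simp add: S_def)
    then have "((\<lambda>z. z * f z) has_field_derivative f z + z * G z) (at z)"
      by (auto intro!: derivative_eq_intros)
    then have "deriv (\<lambda>z. z * f z) z = f z + z * G z" by (rule DERIV_imp_deriv)
    then show ?thesis using K(2)[OF that] by (simp add: F_def)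
  qed
  show ?thesis
  proof (cases "S = {}")
    case True
    then have "f z = 0" if "z \<in> ball 0 1" for z using that by (auto simp: S_def)
    then show ?thesis using holomorphic_cong[of "ball 0 1" "ball 0 1" f "\<lambda>_. 0"] by auto
  next
    case False
    define Z where "Z = {z \<in> ball 0 1. F z = 0}"
    obtain a where a: "a \<in> S" using False by blast
    then have Fa: "F a \<noteq> 0" "a \<in> ball 0 1" using fF[OF a] by (simp_all add: S_def)
    have countZ: "countable Z"
    proof (cases "F constant_on ball 0 1")
      case True
      then have "Z = {}" using Fa unfolding constant_on_def Z_def by force
      then show ?thesis by simp
    next
      case False
      have "ball (0::complex) 1 = \<Union> (range (\<lambda>n. cball 0 (1 - inverse (real (Suc n)))))"
      proof (intro equalityI subsetI)
        fix z :: complex assume "z \<in> ball 0 1"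
        then obtain n where "inverse (real (Suc n)) < 1 - norm z"
          using reals_Archimedean[of "1 - norm z"] by auto
        then show "z \<in> \<Union> (range (\<lambda>n. cball 0 (1 - inverse (real (Suc n)))))"
          by (auto intro!: exI[of _ n])
      next
        fix z :: complex assume "z \<in> \<Union> (range (\<lambda>n. cball 0 (1 - inverse (real (Suc n)))))"
        then obtain n where "norm z \<le> 1 - inverse (real (Suc n))" by auto
        moreover have "inverse (real (Suc n)) > 0" by simp
        ultimately show "z \<in> ball 0 1" unfolding mem_ball dist_0_norm by linarith
      qed
      then have "fsigma (ball (0::complex) 1)" by (metis closed_cball fsigma.intros)
      then show ?thesis unfolding Z_def
        using holomorphic_countable_zeros[OF F_hol] False by simp
    qed
    have conn: "connected (ball 0 1 - Z)"
      using countZ by (intro connected_open_diff_countable) (auto simp: DIM_complex)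
    have fcont: "continuous_on (ball 0 1) f" using f(1) by (rule continuous_on_subset) auto
    have Fcont: "continuous_on (ball 0 1) F" using F_hol holomorphic_on_imp_continuous_on by blast
    have SZ: "S \<subseteq> ball 0 1 - Z" using fF by (auto simp: S_def Z_def)
    have "openin (top_of_set (ball 0 1 - Z)) S"
      using S_open SZ by (simp add: open_subset)
    \<comment> \<open>Outside \<open>Z\<close> a point belongs to \<open>S\<close> exactly when
      \<open>f\<close> equals \<open>F\<close> there: off \<open>S\<close> the value of
      \<open>f\<close> is 0 while that of \<open>F\<close> is not.\<close>
    moreover have "closedin (top_of_set (ball 0 1 - Z)) S"
    proof -
      have "S = {z \<in> ball 0 1 - Z. f z - F z = 0}"
        using fF SZ by (auto simp: S_def Z_def)
      moreover have "continuous_on (ball 0 1 - Z) (\<lambda>z. f z - F z)"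
        by (intro continuous_intros continuous_on_subset[OF fcont] continuous_on_subset[OF Fcont]) auto
      ultimately show ?thesis
        using continuous_closedin_preimage_constant[of "ball 0 1 - Z" "\<lambda>z. f z - F z" 0] by simp
    qed
    ultimately have S_eq: "S = ball 0 1 - Z" using conn False by (auto simp: connected_clopen)
    have "f z = F z" if z: "z \<in> ball 0 1" for z
    proof (cases "f z = 0")
      case False
      then have "z \<in> S" using z unfolding S_def by blast
      then show ?thesis by (rule fF)
    next
      case True
      then have "z \<notin> S" unfolding S_def by blast
      then have "z \<in> Z" using S_eq z by blast
      then show ?thesis using True unfolding Z_def by simp
    qed
    then show ?thesis using F_hol holomorphic_cong by blast
  qed
qed

theorem Rado:
  assumes U: "open U" and f: "continuous_on U f" "f holomorphic_on {z \<in> U. f z \<noteq> 0}"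
  shows "f holomorphic_on U"
proof -
  have "f field_differentiable at z" if z: "z \<in> U" for z
  proof -
    obtain r where r: "r > 0" "cball z r \<subseteq> U" using U z open_contains_cball by blast
    define L where "L w = z + of_real r * w" for w
    have L: "L w \<in> cball z r" if "w \<in> cball 0 1" for w
      using that r by (auto simp: L_def dist_norm norm_mult mult_left_le)
    have Lh: "L holomorphic_on A" for A unfolding L_def by (intro holomorphic_intros)
    have c: "continuous_on (cball 0 1) (f \<circ> L)"
      using L r by (intro continuous_on_compose holomorphic_on_imp_continuous_on[OF Lh]
        continuous_on_subset[OF f(1)]) blast
    have "(f \<circ> L) holomorphic_on {w \<in> ball 0 1. (f \<circ> L) w \<noteq> 0}"
      by (rule holomorphic_on_compose_gen[OF Lh f(2)]) (use L r in auto)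
    then have "(f \<circ> L) holomorphic_on ball 0 1" using Rado_unit_disc c by blast
    moreover have "(\<lambda>w. (w - z) / of_real r) holomorphic_on ball z r" using r by (intro holomorphic_intros) auto
    moreover have "(w - z) / of_real r \<in> ball 0 1" if "w \<in> ball z r" for w
      using that r by (auto simp: dist_norm norm_divide norm_minus_commute)
    ultimately have "((f \<circ> L) \<circ> (\<lambda>w. (w - z) / of_real r)) holomorphic_on ball z r"
      by (intro holomorphic_on_compose_gen[of _ _ "f \<circ> L" "ball 0 1"]) auto
    moreover have "(f \<circ> L) \<circ> (\<lambda>w. (w - z) / of_real r) = f" using r by (auto simp: fun_eq_iff L_def)
    ultimately have "f holomorphic_on ball z r" by (simp only:)
    then show ?thesis using r by (intro holomorphic_on_imp_differentiable_at[of f "ball z r"]) auto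
  qed
  then show ?thesis using U by (simp add: holomorphic_on_open field_differentiable_def)
qed

subsection \<open>Local powers and logarithms\<close>

text \<open>The exponent 0 is allowed and covers \<open>v 0 \<noteq> 0\<close>. The hypothesis
  \<open>nz\<close> has the form in which the identity theorem on slices will supply it.\<close>

lemma local_zero_factor:
  assumes v: "v holomorphic_on ball 0 \<rho>" "0 < \<rho>" and nz: "\<not> 0 islimpt {z \<in> ball 0 \<rho>. v z = 0}"
  obtains n r g where "0 < r" "r \<le> \<rho>" "g holomorphic_on ball (0::complex) r"
    "\<And>w. w \<in> ball 0 r \<Longrightarrow> v w = w ^ n * g w" "\<And>w. w \<in> ball 0 r \<Longrightarrow> g w \<noteq> (0::complex)"
proof (cases "v 0 = 0")
  case False
  have "open (ball 0 \<rho> \<inter> v -` (- {0}))"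
    by (rule continuous_open_preimage[OF holomorphic_on_imp_continuous_on[OF v(1)]]) auto
  moreover have "0 \<in> ball 0 \<rho> \<inter> v -` (- {0})" using v False by simp
  ultimately obtain r where r: "r > 0" "ball 0 r \<subseteq> ball 0 \<rho> \<inter> v -` (- {0})" by (meson open_contains_ball)
  have sub: "ball 0 (min r \<rho>) \<subseteq> ball (0::complex) \<rho>" by auto
  show ?thesis
  proof (rule that[of "min r \<rho>" v 0])
    show "v holomorphic_on ball 0 (min r \<rho>)" by (rule holomorphic_on_subset[OF v(1) sub])
    show "v w \<noteq> 0" if "w \<in> ball 0 (min r \<rho>)" for w
    proof -
      have "w \<in> ball 0 r" using that by simp
      then show ?thesis using r(2) by blast
    qed
  qed (use r v in auto)
next
  case True
  have "\<not> v constant_on ball 0 \<rho>"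
  proof
    assume "v constant_on ball 0 \<rho>"
    moreover have "(0::complex) \<in> ball 0 \<rho>" using v(2) by simp
    ultimately have "{z \<in> ball 0 \<rho>. v z = 0} = ball 0 \<rho>" using True unfolding constant_on_def by fastforce
    then show False using nz v(2) islimpt_ball[of "0::complex" 0 \<rho>] by simp
  qed
  then obtain g r n where g: "0 < r" "ball (0::complex) r \<subseteq> ball 0 \<rho>" "g holomorphic_on ball 0 r"
      "\<And>w. w \<in> ball 0 r \<Longrightarrow> v w = (w - 0) ^ n * g w" "\<And>w. w \<in> ball 0 r \<Longrightarrow> g w \<noteq> 0"
    by (rule holomorphic_factor_zero_nonconstant[OF v(1) open_ball connected_ball centre_in_ball[THEN iffD2, OF v(2)] True])
      (rule that)
  then show ?thesis using that[of r g n] v(2) by (auto simp: ball_subset_ball_iff)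
qed

text \<open>After cancelling powers of the variable, \<open>F\<close> is the quotient of the two
  functions or its inverse, whichever has no pole at 0. The difference \<open>F w - F 0\<close> has
  a zero of finite order \<open>n\<close>, and an \<open>n\<close>-th root \<open>y\<close> of it is
  a local coordinate. Equality of the ratios is written with products, so that no division is
  involved.\<close>

lemma ratio_local_power:
  fixes v1 v2 :: "complex \<Rightarrow> complex"
  assumes v1: "v1 holomorphic_on ball 0 1" and v2: "v2 holomorphic_on ball 0 1"
    and nz: "\<not> 0 islimpt {z \<in> ball 0 1. v2 z = 0}"
    and indep: "\<And>k. \<not> 0 islimpt {z \<in> ball 0 1. v1 z = k * v2 z}"
  obtains r n y where "0 < r" "r \<le> 1" "0 < n" "y holomorphic_on ball 0 r" "inj_on y (ball 0 r)" "y 0 = 0"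
    "\<And>z z'. z \<in> ball 0 r \<Longrightarrow> z' \<in> ball 0 r \<Longrightarrow> z \<noteq> 0 \<Longrightarrow> z' \<noteq> 0 \<Longrightarrow> v1 z' * v2 z = v1 z * v2 z' \<Longrightarrow> y z' ^ n = (y z ^ n :: complex)"
proof -
  obtain a ra u1 where u1: "0 < ra" "ra \<le> 1" "u1 holomorphic_on ball 0 ra"
    "\<And>w. w \<in> ball 0 ra \<Longrightarrow> v1 w = w ^ a * u1 w" "\<And>w. w \<in> ball 0 ra \<Longrightarrow> u1 w \<noteq> 0"
    using local_zero_factor[OF v1, of thesis] indep[of 0] by simp
  obtain b rb u2 where u2: "0 < rb" "rb \<le> 1" "u2 holomorphic_on ball 0 rb"
    "\<And>w. w \<in> ball 0 rb \<Longrightarrow> v2 w = w ^ b * u2 w" "\<And>w. w \<in> ball 0 rb \<Longrightarrow> u2 w \<noteq> 0"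
    using local_zero_factor[OF v2, of thesis] nz by simp
  define \<rho> where "\<rho> = min ra rb"
  have \<rho>: "0 < \<rho>" "\<rho> \<le> 1" using u1 u2 by (auto simp: \<rho>_def)
  have in\<rho>: "w \<in> ball 0 ra" "w \<in> ball 0 rb" "w \<in> ball 0 1" if "w \<in> ball 0 \<rho>" for w :: complex
    using that \<rho> by (auto simp: \<rho>_def)
  define F where "F w = (if b \<le> a then w ^ (a - b) * (u1 w / u2 w) else w ^ (b - a) * (u2 w / u1 w))" for w
  have hu: "u1 holomorphic_on ball 0 \<rho>" "u2 holomorphic_on ball 0 \<rho>"
    by (rule holomorphic_on_subset[OF u1(3)], use in\<rho> in blast)
      (rule holomorphic_on_subset[OF u2(3)], use in\<rho> in blast)
  have F_hol: "F holomorphic_on ball 0 \<rho>"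
    unfolding F_def using hu u1(5)[OF in\<rho>(1)] u2(5)[OF in\<rho>(2)]
    by (cases "b \<le> a") (auto intro!: holomorphic_intros)
  have F: "F w * (if b \<le> a then v2 w else v1 w) = (if b \<le> a then v1 w else v2 w)" if "w \<in> ball 0 \<rho>" for w
    using u1(4,5)[OF in\<rho>(1)[OF that]] u2(4,5)[OF in\<rho>(2)[OF that]] power_add[of w "a - b" b] power_add[of w "b - a" a]
    by (auto simp: F_def field_simps)
  have ne: "v1 w \<noteq> 0" "v2 w \<noteq> 0" if "w \<in> ball 0 \<rho>" "w \<noteq> 0" for w
    using u1(4,5)[OF in\<rho>(1)[OF that(1)]] u2(4,5)[OF in\<rho>(2)[OF that(1)]] that(2) by auto
  \<comment> \<open>If \<open>F\<close> took the value \<open>F 0\<close> at points accumulating at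
    0, the two functions would be proportional there; for the inverted quotient the value 0 would
    instead mean that zeros of \<open>v2\<close> accumulate.\<close>
  have nzF: "\<not> 0 islimpt {z \<in> ball 0 \<rho>. F z - F 0 = 0}"
  proof
    assume lim: "0 islimpt {z \<in> ball 0 \<rho>. F z - F 0 = 0}"
    show False
    proof (cases "b \<le> a")
      case True
      have "{z \<in> ball 0 \<rho>. F z - F 0 = 0} \<subseteq> {z \<in> ball 0 1. v1 z = F 0 * v2 z}"
        using F True in\<rho>(3) by auto metis
      then show False using indep[of "F 0"] islimpt_subset[OF lim] by blast
    next
      case False
      have "{z \<in> ball 0 \<rho>. F z - F 0 = 0} \<subseteq> {z \<in> ball 0 1. v2 z = F 0 * v1 z}"
        using F False in\<rho>(3) by auto metis
      then have lim2: "0 islimpt {z \<in> ball 0 1. v2 z = F 0 * v1 z}" using islimpt_subset[OF lim] by blast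
      moreover have "{z \<in> ball 0 1. v2 z = F 0 * v1 z} \<subseteq> {z \<in> ball 0 1. v1 z = inverse (F 0) * v2 z}" if "F 0 \<noteq> 0"
        using that by (auto simp: field_simps)
      ultimately show False using nz indep[of "inverse (F 0)"] islimpt_subset by (cases "F 0 = 0") auto
    qed
  qed
  obtain n r1 g where g: "0 < r1" "r1 \<le> \<rho>" "g holomorphic_on ball 0 r1"
    "\<And>w. w \<in> ball 0 r1 \<Longrightarrow> F w - F 0 = w ^ n * g w" "\<And>w. w \<in> ball 0 r1 \<Longrightarrow> g w \<noteq> 0"
    by (rule local_zero_factor[OF holomorphic_on_diff[OF F_hol holomorphic_on_const] \<rho>(1) nzF]) (rule that)
  have n: "0 < n" using g(1) g(4,5)[of 0] by (cases n) auto
  obtain G where G: "G holomorphic_on ball 0 r1" "\<And>w. w \<in> ball 0 r1 \<Longrightarrow> exp (G w) = g w"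
    by (rule holomorphic_logarithm_exists[of "ball 0 r1" g 0]) (use g in auto)
  \<comment> \<open>The logarithm \<open>G\<close> of the nonvanishing factor supplies its
    \<open>n\<close>-th root.\<close>
  define y where "y w = w * exp (G w / of_nat n)" for w
  have y_hol: "y holomorphic_on ball 0 r1" unfolding y_def by (intro holomorphic_intros G) (use n in simp)
  have yn: "y w ^ n = F w - F 0" if "w \<in> ball 0 r1" for w
    using g(4)[OF that] G(2)[OF that] n by (simp add: y_def power_mult_distrib exp_of_nat_mult[symmetric])
  have "(y has_field_derivative exp (G 0 / of_nat n)) (at 0)"
  proof -
    have "(G has_field_derivative deriv G 0) (at 0)" using G(1) g(1) by (intro holomorphic_derivI[of _ "ball 0 r1"]) auto
    then show ?thesis unfolding y_def using n by (auto intro!: derivative_eq_intros)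
  qed
  then have "deriv y 0 \<noteq> 0" by (simp add: DERIV_imp_deriv)
  then obtain r where r: "0 < r" "ball (0::complex) r \<subseteq> ball 0 r1" "inj_on y (ball 0 r)"
    by (rule has_complex_derivative_locally_injective[OF y_hol centre_in_ball[THEN iffD2, OF g(1)] open_ball])
  show ?thesis
  proof (rule that[of r n y])
    have "r \<le> r1" using r(1,2) by (simp add: ball_subset_ball_iff)
    then show "r \<le> 1" using g(2) \<rho>(2) by simp
    show "y holomorphic_on ball 0 r" by (rule holomorphic_on_subset[OF y_hol r(2)])
    fix z z' assume z: "z \<in> ball 0 r" "z' \<in> ball 0 r" "z \<noteq> 0" "z' \<noteq> 0" and eq: "v1 z' * v2 z = v1 z * v2 z'"
    have z1: "z \<in> ball 0 r1" "z' \<in> ball 0 r1" using z r(2) by auto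
    then have z\<rho>: "z \<in> ball 0 \<rho>" "z' \<in> ball 0 \<rho>" using g(2) by auto
    have "F w = (if b \<le> a then v1 w / v2 w else v2 w / v1 w)" if "w \<in> ball 0 \<rho>" "w \<noteq> 0" for w
      using F[OF that(1)] ne[OF that] by (auto simp: eq_divide_eq)
    from this[OF z\<rho>(1) z(3)] this[OF z\<rho>(2) z(4)] have "F z = F z'"
      using ne[OF z\<rho>(1) z(3)] ne[OF z\<rho>(2) z(4)] eq by (simp add: frac_eq_eq mult.commute)
    then show "y z' ^ n = y z ^ n" using yn z1 by simp
  qed (use r n in \<open>auto simp: y_def\<close>)
qed

text \<open>Along the unit circle the logarithm minus \<open>\<i> * of_real t\<close> is continuous
  with values in the multiples of \<open>2 * pi * \<i>\<close>, hence constant; this is incompatible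
  with the circle closing up at \<open>t = 2 * pi\<close>.\<close>

lemma no_continuous_logarithm_punctured_plane:
  assumes L: "continuous_on (- {0}) L" and exp: "\<And>z. z \<noteq> 0 \<Longrightarrow> exp (L z) = (z :: complex)"
  shows False
proof -
  define d where "d t = L (exp (\<i> * of_real t)) - \<i> * of_real t" for t :: real
  have "continuous_on UNIV (\<lambda>t. L (exp (\<i> * of_real t)))"
    by (rule continuous_on_compose2[OF L]) (auto intro!: continuous_intros)
  then have dc: "continuous_on UNIV d" unfolding d_def[abs_def] by (intro continuous_intros)
  have dexp: "exp (d t) = 1" for t using exp[of "exp (\<i> * of_real t)"] by (simp add: d_def exp_diff)
  have "d constant_on UNIV"
  proof (rule continuous_discrete_range_constant[OF connected_UNIV dc])
    fix t :: real
    have "2 * pi \<le> norm (d s - d t)" if "d s \<noteq> d t" for s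
    proof -
      have "exp (d s - d t) = 1" using dexp by (simp add: exp_diff)
      then obtain n :: int where n: "Re (d s - d t) = 0" "Im (d s - d t) = of_int (2 * n) * pi" unfolding exp_eq_1 by blast
      then have "n \<noteq> 0" using that by (auto simp: complex_eq_iff)
      then have "1 \<le> \<bar>real_of_int n\<bar>" by linarith
      then have "2 * pi \<le> \<bar>Im (d s - d t)\<bar>" using n(2) by (simp add: abs_mult)
      then show ?thesis using abs_Im_le_cmod order_trans by blast
    qed
    then show "\<exists>e>0. \<forall>s. s \<in> UNIV \<and> d s \<noteq> d t \<longrightarrow> e \<le> norm (d s - d t)" by (intro exI[of _ "2 * pi"]) auto
  qed
  then have "d 0 = d (2 * pi)" unfolding constant_on_def by (metis UNIV_I)
  moreover have "exp (\<i> * of_real (2 * pi)) = 1" by (simp add: mult.commute exp_eq_1)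
  ultimately show False by (simp add: d_def)
qed

text \<open>A continuous injection of the plane is a homeomorphism onto its image by invariance of
  domain. A logarithm of \<open>F\<close>, available since the plane is contractible, composed with
  the inverse of \<open>F\<close> would be a logarithm on the punctured plane.\<close>

lemma no_continuous_bijection_plane_punctured_plane:
  fixes F :: "complex \<Rightarrow> complex"
  assumes F: "continuous_on UNIV F" "inj F" "range F = - {0}"
  shows False
proof -
  obtain G where G: "continuous_on UNIV G" "\<And>x. F x = exp (G x)"
    by (rule continuous_logarithm_on_contractible[OF F(1) contractible_UNIV]) (use F(3) in auto)
  obtain H where H: "homeomorphism UNIV (range F) F H"
    by (rule Further_Topology.invariance_of_domain_homeomorphism[OF open_UNIV F(1) _ F(2)]) simp
  show False
  proof (rule no_continuous_logarithm_punctured_plane)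
    show "continuous_on (- {0}) (\<lambda>z. G (H z))"
      using H F(3) by (intro continuous_on_compose2[OF G(1)]) (auto simp: homeomorphism_def)
    show "exp (G (H z)) = z" if "z \<noteq> 0" for z
      using H F(3) that G(2)[of "H z"] unfolding homeomorphism_def by auto
  qed
qed

section \<open>Several complex variables\<close>

lemma norm_vector_scalar_mult [simp]: "norm (c *s (v :: complex^'n)) = norm c * norm v"
  by (simp add: norm_vec_def norm_mult L2_set_right_distrib)

lemma bounded_bilinear_vector_scalar_mult:
  "bounded_bilinear (\<lambda>c (v :: complex^'n). c *s v)"
proof
  show "\<exists>K. \<forall>a (b :: complex^'n). norm (a *s b) \<le> norm a * norm b * K"
    by (intro exI[of _ 1]) simp
qed (simp_all add: vec_eq_iff ring_distribs)

lemmas bounded_linear_vector_scalar_mult_left =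
  bounded_bilinear.bounded_linear_left[OF bounded_bilinear_vector_scalar_mult]

lemmas bounded_linear_vector_scalar_mult_right =
  bounded_bilinear.bounded_linear_right[OF bounded_bilinear_vector_scalar_mult]

lemmas continuous_on_vector_scalar_mult [continuous_intros] =
  bounded_bilinear.continuous_on[OF bounded_bilinear_vector_scalar_mult]

lemma onorm_vector_scalar_mult_left: "onorm (\<lambda>c. c *s (v :: complex^'n)) \<le> norm v"
  by (rule onorm_le) (simp add: mult.commute)

lemma norm_vec_le_sum: "norm (v :: complex^'n) \<le> (\<Sum>i\<in>UNIV. norm (v $ i))"
  unfolding norm_vec_def by (rule L2_set_le_sum) simp

lemma has_derivative_vec_iff:
  fixes e :: "'a::real_normed_vector \<Rightarrow> complex^'n"
  shows "(e has_derivative D) (at z) \<longleftrightarrow> (\<forall>i. ((\<lambda>w. e w $ i) has_derivative (\<lambda>h. D h $ i)) (at z))"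
proof
  assume "(e has_derivative D) (at z)"
  then show "\<forall>i. ((\<lambda>w. e w $ i) has_derivative (\<lambda>h. D h $ i)) (at z)"
    using bounded_linear.has_derivative[OF bounded_linear_vec_nth] by blast
next
  assume a: "\<forall>i. ((\<lambda>w. e w $ i) has_derivative (\<lambda>h. D h $ i)) (at z)"
  have "((\<lambda>w. \<Sum>i\<in>UNIV. (e w $ i) *s axis i 1) has_derivative (\<lambda>h. \<Sum>i\<in>UNIV. (D h $ i) *s (axis i 1 :: complex^'n))) (at z)"
    by (intro has_derivative_sum bounded_linear.has_derivative[OF bounded_linear_vector_scalar_mult_left])
       (use a in auto)
  then show "(e has_derivative D) (at z)" by (simp add: basis_expansion)
qed

text \<open>The shape is exactly that of the derivatives in the definitions of integral curves and
  transversals.\<close>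

abbreviation cvderiv :: "(complex \<Rightarrow> complex^'n) \<Rightarrow> complex^'n \<Rightarrow> complex \<Rightarrow> bool" where
  "cvderiv e v z \<equiv> (e has_derivative (\<lambda>h. h *s v)) (at z)"

lemma cvderiv_iff: "cvderiv e v z \<longleftrightarrow> (\<forall>i. ((\<lambda>w. e w $ i) has_field_derivative v $ i) (at z))"
proof -
  have "(\<lambda>h. (h *s v) $ i) = (*) (v $ i)" for i by (simp add: fun_eq_iff mult.commute)
  then show ?thesis unfolding has_derivative_vec_iff has_field_derivative_def by simp
qed

lemma cvderiv_holomorphic_iff:
  assumes "open V"
  shows "(\<forall>z\<in>V. \<exists>v. cvderiv e v z) \<longleftrightarrow> (\<forall>i. (\<lambda>z. e z $ i) holomorphic_on V)"
proof
  assume "\<forall>z\<in>V. \<exists>v. cvderiv e v z"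
  then show "\<forall>i. (\<lambda>z. e z $ i) holomorphic_on V"
    using assms by (auto simp: cvderiv_iff holomorphic_on_open)
next
  assume h: "\<forall>i. (\<lambda>z. e z $ i) holomorphic_on V"
  show "\<forall>z\<in>V. \<exists>v. cvderiv e v z"
  proof
    fix z assume "z \<in> V"
    then have "cvderiv e (\<chi> i. deriv (\<lambda>w. e w $ i) z) z"
      using h assms by (auto simp: cvderiv_iff intro: holomorphic_derivI)
    then show "\<exists>v. cvderiv e v z" by blast
  qed
qed

lemma cvderiv_compose:
  assumes "cvderiv e v z" "(F has_derivative D) (at (e z))" "complex_linear D"
  shows "cvderiv (F \<circ> e) (D v) z"
  using diff_chain_at[OF assms(1,2)] assms(3) by (simp add: o_def complex_linear_def)

lemma cvderiv_chain_scalar: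
  assumes "(a has_field_derivative d) (at z)" "cvderiv e v (a z)"
  shows "cvderiv (e \<circ> a) (d *s v) z"
  using diff_chain_at[of a "(*) d" z e "\<lambda>h. h *s v"] assms
  by (simp add: has_field_derivative_def o_def mult.commute vector_smult_assoc)

lemma cvderiv_unique: "cvderiv e v z \<Longrightarrow> cvderiv e w z \<Longrightarrow> v = w"
  unfolding cvderiv_iff vec_eq_iff by (metis DERIV_unique)

lemma holo_on_imp_continuous_on: "holo_on F S \<Longrightarrow> continuous_on S F"
  unfolding holo_on_def
  by (meson continuous_at_imp_continuous_on has_derivative_continuous)

lemma holo_on_subset: "holo_on F S \<Longrightarrow> T \<subseteq> S \<Longrightarrow> holo_on F T"
  unfolding holo_on_def by blast

lemma complex_linear_compose: "complex_linear D \<Longrightarrow> complex_linear E \<Longrightarrow> complex_linear (E \<circ> D)"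
  unfolding complex_linear_def by (auto intro: linear_compose)

lemma holo_on_compose:
  assumes "holo_on F S" "holo_on G T" "F ` S \<subseteq> T"
  shows "holo_on (G \<circ> F) S"
  unfolding holo_on_def
proof
  fix x assume x: "x \<in> S"
  obtain D where D: "complex_linear D" "(F has_derivative D) (at x)" using assms x by (auto simp: holo_on_def)
  obtain E where E: "complex_linear E" "(G has_derivative E) (at (F x))"
    using assms x unfolding holo_on_def by blast
  show "\<exists>D. complex_linear D \<and> (G \<circ> F has_derivative D) (at x)"
    using complex_linear_compose[OF D(1) E(1)] diff_chain_at[OF D(2) E(2)] by blast
qed

lemma holo_on_cong:
  assumes "holo_on F S" "open S" "\<And>x. x \<in> S \<Longrightarrow> F x = G x"
  shows "holo_on G S"
  using assms has_derivative_transform_within_open unfolding holo_on_def by metis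

lemma holo_on_line:
  assumes F: "holo_on F S" and "open V" and V: "\<And>w. w \<in> V \<Longrightarrow> y + w *s d \<in> S"
  shows "(\<lambda>w. F (y + w *s d) $ i) holomorphic_on V"
proof -
  have "\<exists>v. cvderiv (F \<circ> (\<lambda>w. y + w *s d)) v w" if "w \<in> V" for w
  proof -
    have "cvderiv (\<lambda>w. y + w *s d) d w"
      by (auto intro!: derivative_eq_intros bounded_linear_imp_has_derivative
          bounded_linear_vector_scalar_mult_left)
    then show ?thesis using cvderiv_compose F V[OF that] unfolding holo_on_def by metis
  qed
  then show ?thesis using cvderiv_holomorphic_iff[OF \<open>open V\<close>, of "F \<circ> (\<lambda>w. y + w *s d)"] by (auto simp: o_def)
qed

text \<open>Restricting \<open>F\<close> to the complex line through two points and applying Cauchy's estimate there.\<close>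

lemma holo_on_imp_lipschitz:
  fixes F :: "complex^'n \<Rightarrow> complex^'m"
  assumes S: "open S" and F: "holo_on F S" and p: "p \<in> S"
  obtains R M L where "R > 0" "M > 0" "L > 0" "cball p R \<subseteq> S"
    "\<And>x. x \<in> cball p R \<Longrightarrow> norm (F x) \<le> M"
    "\<And>x y. x \<in> cball p R \<Longrightarrow> y \<in> cball p R \<Longrightarrow> norm (F x - F y) \<le> L * norm (x - y)"
proof -
  obtain R0 where R0: "R0 > 0" "cball p R0 \<subseteq> S" using S p open_contains_cball by blast
  define R where "R = R0 / 2"
  have R: "R > 0" "cball p R \<subseteq> cball p R0" using R0 by (auto simp: R_def)
  have "compact (F ` cball p R0)"
    by (intro compact_continuous_image continuous_on_subset[OF holo_on_imp_continuous_on[OF F]] R0) auto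
  then obtain M where M: "M > 0" "\<And>x. x \<in> cball p R0 \<Longrightarrow> norm (F x) \<le> M"
    by (metis bounded_pos compact_imp_bounded imageI)
  define L where "L = real CARD('m) * (M / R)"
  have "norm (F x - F y) \<le> L * norm (x - y)" if xy: "x \<in> cball p R" "y \<in> cball p R" for x y
  proof (cases "x = y")
    case False
    define d where "d = x - y"
    have d: "norm d > 0" using False by (simp add: d_def)
    \<comment> \<open>A parameter disc of radius \<open>\<rho>\<close> around a point of the segment
      moves the line by at most \<open>R\<close>, so it stays in the ball of radius
      \<open>R0 = 2 * R\<close> when the endpoints lie within \<open>R\<close> of
      \<open>p\<close>.\<close>
    define \<rho> where "\<rho> = R / norm d"
    have rho: "\<rho> > 0" using R d by (simp add: \<rho>_def)
    define V where "V = {w. y + w *s d \<in> ball p R0}"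
    have V: "open V"
    proof -
      have "V = (\<lambda>w. y + w *s d) -` ball p R0" by (auto simp: V_def)
      then show ?thesis by (auto intro!: open_vimage continuous_intros)
    qed
    \<comment> \<open>\<open>V\<close> comes from an open ball, so closed discs need a factor
      \<open>r < 1\<close>; it tends to 1 in the end and leaves no trace in the constant.\<close>
    have unitV: "cball (of_real u) (\<rho> * r) \<subseteq> V" if u: "u \<in> {0..1}" and r: "0 < r" "r < 1" for u r
    proof
      fix w assume "w \<in> cball (complex_of_real u) (\<rho> * r)"
      then have w: "norm (w - of_real u) \<le> \<rho> * r" by (simp add: dist_norm norm_minus_commute)
      have "p - (y + of_real u *s d) = (1 - u) *\<^sub>R (p - y) + u *\<^sub>R (p - x)"
        by (simp add: d_def vec_eq_iff) (simp add: scaleR_conv_of_real algebra_simps)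
      then have "norm (p - (y + of_real u *s d)) \<le> (1 - u) * norm (p - y) + u * norm (p - x)"
        using u by (metis (no_types, lifting) abs_of_nonneg atLeastAtMost_iff diff_ge_0_iff_ge norm_scaleR norm_triangle_ineq)
      also have "\<dots> \<le> (1 - u) * R + u * R"
        using xy u by (intro add_mono mult_left_mono) (auto simp: dist_norm)
      finally have 1: "norm (p - (y + of_real u *s d)) \<le> R" by (simp add: algebra_simps)
      have "p - (y + w *s d) = (p - (y + of_real u *s d)) - (w - of_real u) *s d"
        by (simp add: vector_sub_rdistrib)
      also have "norm \<dots> \<le> norm (p - (y + of_real u *s d)) + norm ((w - of_real u) *s d)"
        by (rule norm_triangle_ineq4)
      also have "\<dots> \<le> R + norm (w - of_real u) * norm d"
        using 1 by (simp only: norm_vector_scalar_mult add_right_mono)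
      also have "\<dots> \<le> R + \<rho> * r * norm d" using w by (simp add: mult_right_mono)
      also have "\<dots> = R + R * r" using d by (simp add: \<rho>_def)
      also have "\<dots> < R + R * 1" using r R(1) by (intro add_strict_left_mono mult_strict_left_mono) auto
      also have "\<dots> = R0" by (simp add: R_def)
      finally show "w \<in> V" by (simp add: V_def dist_norm)
    qed
    have comp: "norm (F x $ i - F y $ i) \<le> M / R * norm d" for i
    proof -
      define g where "g w = F (y + w *s d) $ i" for w
      have g_hol: "g holomorphic_on V"
        unfolding g_def by (rule holo_on_line[OF F V]) (use R0 in \<open>auto simp: V_def\<close>)
      have gM: "norm (g w) \<le> M" if "w \<in> V" for w
        using M(2)[of "y + w *s d"] that Finite_Cartesian_Product.norm_nth_le[of "F (y + w *s d)" i]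
        by (simp add: V_def g_def)
      have gd: "norm (deriv g (of_real u)) \<le> M / (\<rho> * r)" if u: "u \<in> {0..1}" and r: "0 < r" "r < 1" for u r
      proof -
        have sub: "cball (of_real u) (\<rho> * r) \<subseteq> V" by (rule unitV[OF u r])
        have "norm ((deriv ^^ 1) g (of_real u)) \<le> fact 1 * M / (\<rho> * r) ^ 1"
        proof (rule Cauchy_inequality)
          show "g holomorphic_on ball (of_real u) (\<rho> * r)"
            using g_hol sub ball_subset_cball by (meson holomorphic_on_subset order_trans)
          show "continuous_on (cball (of_real u) (\<rho> * r)) g"
            using g_hol sub by (meson holomorphic_on_imp_continuous_on holomorphic_on_subset)
          show "norm (g w) \<le> M" if "norm (of_real u - w) = \<rho> * r" for w
            using sub that by (intro gM) (auto simp: dist_norm)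
        qed (use rho r in auto)
        then show ?thesis by simp
      qed
      have lim: "norm (deriv g (of_real u)) \<le> M / \<rho>" if u: "u \<in> {0..1}" for u
      proof (rule LIMSEQ_le_const)
        show "(\<lambda>n. M / (\<rho> * (1 - inverse (real (Suc (Suc n)))))) \<longlonglongrightarrow> M / \<rho>"
        proof -
          have "(\<lambda>n. M / (\<rho> * (1 - inverse (real (Suc (Suc n)))))) \<longlonglongrightarrow> M / (\<rho> * (1 - 0))"
            using rho by (intro tendsto_intros LIMSEQ_Suc[OF LIMSEQ_inverse_real_of_nat]) auto
          then show ?thesis by simp
        qed
        show "\<exists>N. \<forall>n\<ge>N. norm (deriv g (of_real u)) \<le> M / (\<rho> * (1 - inverse (real (Suc (Suc n)))))"
          by (intro exI[of _ 0] allI impI gd[OF u]) (auto simp: field_simps)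
      qed
      have "norm (g 1 - g 0) \<le> (M / \<rho>) * norm (1 - 0 :: complex)"
      proof (rule field_differentiable_bound[of "closed_segment 0 1" g "deriv g"])
        fix z :: complex assume "z \<in> closed_segment 0 1"
        then obtain u where u: "u \<in> {0..1}" "z = of_real u" by (auto simp: closed_segment_def scaleR_conv_of_real)
        have "of_real u \<in> V" using unitV[OF u(1), of "1/2"] rho by auto
        then show "(g has_field_derivative deriv g z) (at z within closed_segment 0 1)"
          using g_hol V u by (auto intro: has_field_derivative_at_within holomorphic_derivI)
        show "norm (deriv g z) \<le> M / \<rho>" using lim[OF u(1)] u by simp
      qed auto
      then show ?thesis using R d by (simp add: g_def d_def \<rho>_def)
    qed
    have "norm (F x - F y) \<le> (\<Sum>i\<in>UNIV. norm ((F x - F y) $ i))" by (rule norm_vec_le_sum)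
    also have "\<dots> \<le> (\<Sum>i\<in>(UNIV::'m set). M / R * norm d)" by (rule sum_mono) (use comp in simp)
    finally show ?thesis by (simp add: L_def d_def)
  qed simp
  moreover have "L > 0" using M R by (simp add: L_def)
  moreover have "cball p R \<subseteq> S" using R R0 by blast
  ultimately show ?thesis using that[of R M L] R M by blast
qed

subsection \<open>Euler polygons and dependence on initial values\<close>

text \<open>The step \<open>h\<close> is complex, so the polygon follows a segment of complex times.
  With a fixed number of steps it is a finite composition of holomorphic maps, which makes the
  dependence on the initial value accessible.\<close>

definition euler :: "(complex^'n \<Rightarrow> complex^'n) \<Rightarrow> complex \<Rightarrow> nat \<Rightarrow> complex^'n \<Rightarrow> complex^'n" where
  "euler F h k x = ((\<lambda>e. e + h *s F e) ^^ k) x"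

lemma euler_simps [simp]:
  "euler F h 0 x = x" "euler F h (Suc k) x = euler F h k x + h *s F (euler F h k x)"
  by (simp_all add: euler_def)

locale lipschitz_field =
  fixes F :: "complex^'n \<Rightarrow> complex^'n" and p :: "complex^'n" and R M L :: real
  assumes R_pos: "R > 0" and M_pos: "M > 0" and L_pos: "L > 0"
    and bound: "\<And>x. x \<in> cball p R \<Longrightarrow> norm (F x) \<le> M"
    and lip: "\<And>x y. x \<in> cball p R \<Longrightarrow> y \<in> cball p R \<Longrightarrow> norm (F x - F y) \<le> L * norm (x - y)"
begin

text \<open>Only times on the segment from 0 to \<open>t\<close> enter, because polygons with step
  \<open>t / of_nat n\<close> sample no others.\<close>

definition solves :: "(complex \<Rightarrow> complex^'n) \<Rightarrow> complex \<Rightarrow> bool" where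
  "solves x t \<longleftrightarrow> (\<forall>s\<in>closed_segment 0 t. x s \<in> cball p R \<and> cvderiv x (F (x s)) s)"

lemma solves_lipschitz:
  assumes "solves x t" "s \<in> closed_segment 0 t" "s' \<in> closed_segment 0 t"
  shows "norm (x s' - x s) \<le> M * norm (s' - s)"
proof (rule differentiable_bound[of "closed_segment 0 t" x "\<lambda>s h. h *s F (x s)"])
  fix w assume "w \<in> closed_segment 0 t"
  then have w: "x w \<in> cball p R" "cvderiv x (F (x w)) w" using assms by (auto simp: solves_def)
  show "(x has_derivative (\<lambda>h. h *s F (x w))) (at w within closed_segment 0 t)"
    using w(2) by (rule has_derivative_at_withinI)
  show "onorm (\<lambda>h. h *s F (x w)) \<le> M"
    using onorm_vector_scalar_mult_left[of "F (x w)"] bound[OF w(1)] by linarith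
qed (use assms in auto)

text \<open>The function \<open>x w - w *s F (x s)\<close> has derivative
  \<open>F (x w) - F (x s)\<close>, which the Lipschitz constant \<open>L\<close> and the speed
  bound \<open>M\<close> control; the mean value inequality gives the quadratic error of one
  step.\<close>

lemma solves_truncation:
  assumes "solves x t" and s: "s \<in> closed_segment 0 t" "s' \<in> closed_segment 0 t"
  shows "norm (x s' - x s - (s' - s) *s F (x s)) \<le> L * M * (norm (s' - s))\<^sup>2"
proof -
  have sub: "closed_segment s s' \<subseteq> closed_segment 0 t"
    using s by (simp add: subset_closed_segment)
  define y where "y w = x w - w *s F (x s)" for w
  have "norm (y s' - y s) \<le> (L * M * norm (s' - s)) * norm (s' - s)"
  proof (rule differentiable_bound[of "closed_segment s s'" y "\<lambda>w h. h *s (F (x w) - F (x s))"])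
    fix w assume w: "w \<in> closed_segment s s'"
    then have w': "w \<in> closed_segment 0 t" using sub by blast
    then have xw: "x w \<in> cball p R" "cvderiv x (F (x w)) w" using assms by (auto simp: solves_def)
    have xs: "x s \<in> cball p R" using assms by (auto simp: solves_def)
    have "cvderiv y (F (x w) - F (x s)) w"
      unfolding y_def vector_sub_rdistrib
      by (rule has_derivative_eq_rhs[OF has_derivative_diff[OF xw(2)
            bounded_linear_imp_has_derivative[OF bounded_linear_vector_scalar_mult_left]]])
         (simp add: fun_eq_iff vec_eq_iff algebra_simps)
    then show "(y has_derivative (\<lambda>h. h *s (F (x w) - F (x s)))) (at w within closed_segment s s')"
      by (rule has_derivative_at_withinI)
    have "onorm (\<lambda>h. h *s (F (x w) - F (x s))) \<le> norm (F (x w) - F (x s))"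
      by (rule onorm_vector_scalar_mult_left)
    also have "\<dots> \<le> L * norm (x w - x s)" using xw xs lip by blast
    also have "\<dots> \<le> L * (M * norm (w - s))"
      using solves_lipschitz[OF assms(1) s(1) w'] L_pos by simp
    also have "\<dots> \<le> L * (M * norm (s' - s))"
      using segment_bound(1)[OF w] L_pos M_pos by simp
    finally show "onorm (\<lambda>h. h *s (F (x w) - F (x s))) \<le> L * M * norm (s' - s)" by simp
  qed auto
  moreover have "y s' - y s = x s' - x s - (s' - s) *s F (x s)"
    by (simp add: y_def vector_sub_rdistrib)
  ultimately show ?thesis by (simp add: power2_eq_square mult.assoc)
qed

lemma euler_stays:
  assumes x: "x \<in> cball p (R / 2)" and "real k * norm h * M \<le> R / 2"
  shows "euler F h k x \<in> cball p R \<and> norm (euler F h k x - x) \<le> real k * norm h * M"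
  using assms(2)
proof (induction k)
  case 0
  then show ?case using x R_pos by auto
next
  case (Suc k)
  have "real k * norm h * M \<le> real (Suc k) * norm h * M"
    using M_pos by (intro mult_right_mono) auto
  then have IH: "euler F h k x \<in> cball p R" "norm (euler F h k x - x) \<le> real k * norm h * M"
    using Suc by auto
  have "norm (h *s F (euler F h k x)) \<le> norm h * M"
    using bound[OF IH(1)] by (simp add: mult_left_mono)
  then have 1: "norm (euler F h (Suc k) x - x) \<le> real (Suc k) * norm h * M"
    using IH(2) norm_triangle_ineq[of "euler F h k x - x" "h *s F (euler F h k x)"]
    by (simp add: algebra_simps)
  moreover have "norm (euler F h (Suc k) x - p) \<le> norm (euler F h (Suc k) x - x) + norm (x - p)"
    using dist_triangle[of "euler F h (Suc k) x" p x] unfolding dist_norm .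
  moreover have "norm (x - p) \<le> R / 2" using x by (simp add: dist_norm norm_minus_commute)
  ultimately have "norm (euler F h (Suc k) x - p) \<le> R" using Suc.prems by linarith
  then show ?case using 1 by (simp only: mem_cball dist_norm norm_minus_commute conj_commute)
qed

text \<open>Each step commits a truncation error of at most \<open>c\<close> and enlarges the
  previous error by at most the factor \<open>q\<close>, whence \<open>real k * c * q ^ k\<close>.
  The powers of \<open>q\<close> stay below \<open>exp (L * norm t)\<close>, and \<open>n\<close>
  errors of order \<open>1 / n ^ 2\<close> add up to order \<open>1 / n\<close>.\<close>

lemma euler_error:
  assumes sol: "solves x t" and x0: "x 0 \<in> cball p (R / 2)" and tM: "norm t * M \<le> R / 2" and n: "n > 0"
  shows "norm (euler F (t / of_nat n) n (x 0) - x t) \<le> L * M * (norm t)\<^sup>2 * exp (L * norm t) / real n"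
proof -
  define h where "h = t / of_nat n"
  have hn: "norm h = norm t / real n" by (simp add: h_def norm_divide)
  define c where "c = L * M * (norm h)\<^sup>2"
  have c: "c \<ge> 0" using L_pos M_pos by (simp add: c_def)
  define q where "q = 1 + L * norm h"
  have q: "q \<ge> 1" using L_pos by (simp add: q_def)
  have "norm (euler F h k (x 0) - x (of_nat k * h)) \<le> real k * c * q ^ k" if "k \<le> n" for k
    using that
  proof (induction k)
    case 0
    then show ?case by simp
  next
    case (Suc k)
    have seg: "of_nat j * h \<in> closed_segment 0 t" if "j \<le> n" for j
      using that n by (auto simp: closed_segment_def h_def scaleR_conv_of_real intro!: exI[of _ "real j / real n"])
    have kM: "real k * norm h * M \<le> R / 2"
    proof -
      have "real k * norm h \<le> norm t" using Suc.prems n by (simp add: hn field_simps mult_right_mono)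
      then show ?thesis using tM M_pos by (meson mult_right_mono less_imp_le order_trans)
    qed
    define e where "e = euler F h k (x 0)"
    define s where "s = of_nat k * h"
    have s': "of_nat (Suc k) * h - s = h" by (simp add: s_def algebra_simps)
    have e: "e \<in> cball p R" using euler_stays[OF x0 kM] by (simp add: e_def)
    have xs: "x s \<in> cball p R" using sol seg[of k] Suc.prems by (auto simp: solves_def s_def)
    have tr: "norm (x (of_nat (Suc k) * h) - x s - h *s F (x s)) \<le> c"
    proof -
      have "norm (x (of_nat (Suc k) * h) - x s - (of_nat (Suc k) * h - s) *s F (x s)) \<le>
          L * M * (norm (of_nat (Suc k) * h - s))\<^sup>2"
        unfolding s_def by (rule solves_truncation[OF sol seg seg]) (use Suc.prems in auto)
      then show ?thesis unfolding s' c_def .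
    qed
    have "euler F h (Suc k) (x 0) - x (of_nat (Suc k) * h) =
        (e - x s) + h *s (F e - F (x s)) - (x (of_nat (Suc k) * h) - x s - h *s F (x s))"
      by (simp add: e_def vector_ssub_ldistrib)
    also have "norm \<dots> \<le> norm (e - x s) + norm (h *s (F e - F (x s))) +
        norm (x (of_nat (Suc k) * h) - x s - h *s F (x s))"
      by (rule order_trans[OF norm_triangle_ineq4 add_right_mono[OF norm_triangle_ineq]])
    also have "\<dots> \<le> norm (e - x s) + norm h * (L * norm (e - x s)) + c"
      unfolding norm_vector_scalar_mult using tr lip[OF e xs]
      by (intro add_mono mult_left_mono order_refl) auto
    also have "\<dots> = q * norm (e - x s) + c" by (simp add: q_def algebra_simps)
    also have "\<dots> \<le> q * (real k * c * q ^ k) + c * q ^ Suc k"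
    proof (intro add_mono mult_left_mono)
      show "norm (e - x s) \<le> real k * c * q ^ k" using Suc by (simp add: e_def s_def)
      have "c * 1 \<le> c * q ^ Suc k" using q c by (intro mult_left_mono one_le_power) auto
      then show "c \<le> c * q ^ Suc k" by simp
    qed (use q in simp)
    also have "\<dots> = real (Suc k) * c * q ^ Suc k" by (simp add: algebra_simps)
    finally show ?case .
  qed
  from this[of n] have "norm (euler F h n (x 0) - x (of_nat n * h)) \<le> real n * c * q ^ n" by simp
  also have "\<dots> \<le> real n * c * exp (L * norm t)"
  proof -
    have "(1 + L * norm t / real n) ^ n \<le> exp (L * norm t)"
      using exp_ge_one_plus_x_over_n_power_n[of n "L * norm t"] n L_pos
      by (smt (verit) mult_nonneg_nonneg norm_ge_zero of_nat_0_le_iff)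
    then show ?thesis using c by (intro mult_left_mono) (auto simp: q_def hn)
  qed
  also have "real n * c * exp (L * norm t) = L * M * (norm t)\<^sup>2 * exp (L * norm t) / real n"
    using n by (simp add: c_def hn power2_eq_square field_simps)
  finally show ?thesis using n by (simp add: h_def)
qed

lemma euler_tendsto:
  assumes "solves x t" "x 0 \<in> cball p (R / 2)" "norm t * M \<le> R / 2"
  shows "(\<lambda>n. euler F (t / of_nat n) n (x 0)) \<longlonglongrightarrow> x t"
proof -
  have "(\<lambda>n. L * M * (norm t)\<^sup>2 * exp (L * norm t) / real n) \<longlonglongrightarrow> 0"
    by (rule lim_const_over_n)
  then have "(\<lambda>n. euler F (t / of_nat n) n (x 0) - x t) \<longlonglongrightarrow> 0"
    by (rule Lim_null_comparison[rotated]) (use euler_error[OF assms] in \<open>auto intro!: eventually_sequentiallyI[of 1]\<close>)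
  then show ?thesis by (simp add: LIM_zero_iff)
qed

text \<open>Two polygons with the same step separate by at most the factor
  \<open>1 + L * norm h\<close> per step; the limit of this bound is Gronwall's estimate.\<close>

lemma solves_initial_lipschitz:
  assumes x: "solves x t" "x 0 \<in> cball p (R / 2)" and y: "solves y t" "y 0 \<in> cball p (R / 2)"
    and tM: "norm t * M \<le> R / 2"
  shows "norm (x t - y t) \<le> exp (L * norm t) * norm (x 0 - y 0)"
proof -
  have bd: "norm (euler F (t / of_nat n) n (x 0) - euler F (t / of_nat n) n (y 0)) \<le> exp (L * norm t) * norm (x 0 - y 0)"
    if n: "n > 0" for n
  proof -
    define h where "h = t / of_nat n"
    have hn: "norm h = norm t / real n" by (simp add: h_def norm_divide)
    have "norm (euler F h k (x 0) - euler F h k (y 0)) \<le> (1 + L * norm h) ^ k * norm (x 0 - y 0)" if "k \<le> n" for k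
      using that
    proof (induction k)
      case (Suc k)
      have kM: "real k * norm h * M \<le> R / 2"
      proof -
        have "real k * norm h \<le> norm t" using Suc.prems n by (simp add: hn field_simps mult_right_mono)
        then show ?thesis using tM M_pos by (meson mult_right_mono less_imp_le order_trans)
      qed
      define a where "a = euler F h k (x 0)"
      define b where "b = euler F h k (y 0)"
      have ab: "a \<in> cball p R" "b \<in> cball p R"
        using euler_stays[OF x(2) kM] euler_stays[OF y(2) kM] by (auto simp: a_def b_def)
      have "norm (euler F h (Suc k) (x 0) - euler F h (Suc k) (y 0)) = norm ((a - b) + h *s (F a - F b))"
        unfolding vector_ssub_ldistrib a_def b_def euler_simps add_diff_add ..
      also have "\<dots> \<le> norm (a - b) + norm h * norm (F a - F b)"
        using norm_triangle_ineq[of "a - b" "h *s (F a - F b)"] unfolding norm_vector_scalar_mult .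
      also have "\<dots> \<le> norm (a - b) + norm h * (L * norm (a - b))"
        using lip[OF ab] by (simp add: mult_left_mono)
      also have "\<dots> = (1 + L * norm h) * norm (a - b)" by (simp add: algebra_simps)
      also have "\<dots> \<le> (1 + L * norm h) * ((1 + L * norm h) ^ k * norm (x 0 - y 0))"
        using Suc L_pos by (intro mult_left_mono) (auto simp: a_def b_def)
      finally show ?case by simp
    qed simp
    from this[of n] have "norm (euler F h n (x 0) - euler F h n (y 0)) \<le> (1 + L * norm h) ^ n * norm (x 0 - y 0)" by simp
    moreover
    have "(1 + L * norm t / real n) ^ n \<le> exp (L * norm t)"
      using exp_ge_one_plus_x_over_n_power_n[of n "L * norm t"] n L_pos
      by (smt (verit) mult_nonneg_nonneg norm_ge_zero of_nat_0_le_iff)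
    then have "(1 + L * norm h) ^ n * norm (x 0 - y 0) \<le> exp (L * norm t) * norm (x 0 - y 0)"
      by (intro mult_right_mono) (simp_all add: hn)
    ultimately show ?thesis unfolding h_def[symmetric] by linarith
  qed
  show ?thesis
  proof (rule LIMSEQ_le_const2)
    show "(\<lambda>n. norm (euler F (t / of_nat n) n (x 0) - euler F (t / of_nat n) n (y 0))) \<longlonglongrightarrow> norm (x t - y t)"
      by (intro tendsto_intros euler_tendsto assms)
  qed (use bd in \<open>auto intro!: exI[of _ 1]\<close>)
qed

text \<open>The polygons depend holomorphically on the parameter, and their error bound involves
  only \<open>L\<close>, \<open>M\<close>, \<open>t\<close> and the number of steps, so they
  converge uniformly in the parameter.\<close>

lemma solves_holomorphic_dependence:
  assumes V: "open V" and S: "cball p R \<subseteq> S" "holo_on F S"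
    and sol: "\<And>z. z \<in> V \<Longrightarrow> solves (x z) t" "\<And>z. z \<in> V \<Longrightarrow> x z 0 \<in> cball p (R / 2)"
    and hol: "\<And>i. (\<lambda>z. x z 0 $ i) holomorphic_on V" and tM: "norm t * M \<le> R / 2"
  shows "(\<lambda>z. x z t $ i) holomorphic_on V"
proof (rule holomorphic_uniform_sequence[OF V])
  define E where "E n z = euler F (t / of_nat (Suc n)) (Suc n) (x z 0)" for n z
  show "(\<lambda>z. E n z $ i) holomorphic_on V" for n
  proof -
    define h where "h = t / of_nat (Suc n)"
    have hn: "norm h = norm t / real (Suc n)" by (simp add: h_def norm_divide del: of_nat_Suc)
    have "\<forall>i. (\<lambda>z. euler F h k (x z 0) $ i) holomorphic_on V" if "k \<le> Suc n" for k
      using that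
    proof (induction k)
      case 0
      then show ?case using hol by simp
    next
      case (Suc k)
      have kM: "real k * norm h * M \<le> R / 2"
      proof -
        have "real k * norm h \<le> real (Suc n) * norm h" using Suc.prems by (intro mult_right_mono) auto
        also have "\<dots> = norm t" by (simp add: hn del: of_nat_Suc)
        finally have "real k * norm h \<le> norm t" .
        then show ?thesis using tM M_pos by (meson mult_right_mono less_imp_le order_trans)
      qed
      have st: "euler F h k (x z 0) \<in> S" if "z \<in> V" for z
        using euler_stays[OF sol(2)[OF that] kM] S by blast
      have "\<exists>v. cvderiv (F \<circ> (\<lambda>z. euler F h k (x z 0))) v z" if "z \<in> V" for z
        using Suc cvderiv_holomorphic_iff[OF V, of "\<lambda>z. euler F h k (x z 0)"] that S(2) st[OF that]
        unfolding holo_on_def by (metis Suc_leD cvderiv_compose)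
      then have "\<forall>i. (\<lambda>z. F (euler F h k (x z 0)) $ i) holomorphic_on V"
        using cvderiv_holomorphic_iff[OF V, of "F \<circ> (\<lambda>z. euler F h k (x z 0))"] by (simp add: o_def)
      then show ?case using Suc by (auto intro!: holomorphic_intros)
    qed
    then show ?thesis unfolding E_def h_def by blast
  qed
  fix z assume z: "z \<in> V"
  obtain d where d: "d > 0" "cball z d \<subseteq> V" using V z open_contains_cball by blast
  define C where "C = L * M * (norm t)\<^sup>2 * exp (L * norm t)"
  have "uniform_limit (cball z d) (\<lambda>n z. E n z $ i) (\<lambda>z. x z t $ i) sequentially"
    unfolding uniform_limit_iff
  proof (intro allI impI)
    fix e :: real assume e: "e > 0"
    have "(\<lambda>n. C / real n) \<longlonglongrightarrow> 0" by (rule lim_const_over_n)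
    then have "(\<lambda>n. C / real (Suc n)) \<longlonglongrightarrow> 0" by (rule LIMSEQ_Suc)
    then have "\<forall>\<^sub>F n in sequentially. C / real (Suc n) < e" using e by (rule order_tendstoD)
    then show "\<forall>\<^sub>F n in sequentially. \<forall>z\<in>cball z d. dist (E n z $ i) (x z t $ i) < e"
    proof (rule eventually_mono, intro ballI)
      fix n w assume n: "C / real (Suc n) < e" and "w \<in> cball z d"
      then have w: "w \<in> V" using d by blast
      have "dist (E n w $ i) (x w t $ i) \<le> norm (E n w - x w t)"
        using Finite_Cartesian_Product.norm_nth_le[of "E n w - x w t" i] by (simp add: dist_norm)
      also have "\<dots> \<le> C / real (Suc n)"
        unfolding E_def C_def using euler_error[OF sol(1)[OF w] sol(2)[OF w] tM, of "Suc n"] by simp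
      finally show "dist (E n w $ i) (x w t $ i) < e" using n by simp
    qed
  qed
  then show "\<exists>d>0. cball z d \<subseteq> V \<and> uniform_limit (cball z d) (\<lambda>n z. E n z $ i) (\<lambda>z. x z t $ i) sequentially"
    using d by blast
qed

end

subsection \<open>Separately holomorphic functions\<close>

abbreviation pt :: "complex \<Rightarrow> complex \<Rightarrow> complex^2" where
  "pt a b \<equiv> vector [a, b]"

lemma pt_eq_iff: "pt a b = v \<longleftrightarrow> a = v $ 1 \<and> b = v $ 2"
  by (auto simp: vec_eq_iff forall_2)

lemma pt_components [simp]: "pt (v $ 1) (v $ 2) = v"
  by (simp add: pt_eq_iff)

lemma norm_le_component_sum: "norm (v :: complex^2) \<le> norm (v $ 1) + norm (v $ 2)"
  using norm_vec_le_sum[of v] by (simp add: UNIV_2)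

lemma continuous_on_pt [continuous_intros]:
  fixes S :: "'a::topological_space set"
  assumes "continuous_on S f" "continuous_on S g"
  shows "continuous_on S (\<lambda>x. pt (f x) (g x))"
proof -
  have "(\<lambda>x. pt (f x) (g x)) = (\<lambda>x. (\<chi> i. if i = 1 then f x else g x) :: complex^2)"
    by (auto simp: fun_eq_iff vec_eq_iff forall_2)
  moreover have "continuous_on S (\<lambda>x. if i = 1 then f x else g x)" for i :: 2
    using assms by (cases "i = 1") auto
  ultimately show ?thesis by (simp only: continuous_on_vec_lambda)
qed

text \<open>The complex linear differential is written out by its two coefficients, which saves a
  one-dimensional vector wrapper around scalar functions.\<close>

definition holo2 :: "(complex^2 \<Rightarrow> complex) \<Rightarrow> (complex^2) set \<Rightarrow> bool" where
  "holo2 f S \<longleftrightarrow> (\<forall>x\<in>S. \<exists>a b. (f has_derivative (\<lambda>h. a * h $ 1 + b * h $ 2)) (at x))"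

lemma complex_linear_functional:
  assumes "complex_linear (D :: complex^2 \<Rightarrow> complex^'m)"
  shows "D h $ i = D (pt 1 0) $ i * h $ 1 + D (pt 0 1) $ i * h $ 2"
proof -
  have "h = h $ 1 *s pt 1 0 + h $ 2 *s pt 0 1" by (simp add: vec_eq_iff forall_2)
  then have "D h = D (h $ 1 *s pt 1 0 + h $ 2 *s pt 0 1)" by (rule arg_cong)
  also have "\<dots> = h $ 1 *s D (pt 1 0) + h $ 2 *s D (pt 0 1)"
    using assms unfolding complex_linear_def by (simp only: linear_add)
  finally show ?thesis by simp
qed

lemma holo_on_iff_components:
  fixes F :: "complex^2 \<Rightarrow> complex^'m"
  shows "holo_on F S \<longleftrightarrow> (\<forall>i. holo2 (\<lambda>x. F x $ i) S)"
proof
  assume F: "holo_on F S"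
  show "\<forall>i. holo2 (\<lambda>x. F x $ i) S"
    unfolding holo2_def
  proof (intro allI ballI)
    fix i x assume "x \<in> S"
    then obtain D where D: "complex_linear D" "(F has_derivative D) (at x)" using F by (auto simp: holo_on_def)
    have "((\<lambda>x. F x $ i) has_derivative (\<lambda>h. D h $ i)) (at x)"
      using D(2) has_derivative_vec_iff by blast
    moreover have "(\<lambda>h. D h $ i) = (\<lambda>h. D (pt 1 0) $ i * h $ 1 + D (pt 0 1) $ i * h $ 2)"
      by (rule ext) (rule complex_linear_functional[OF D(1)])
    ultimately show "\<exists>a b. ((\<lambda>x. F x $ i) has_derivative (\<lambda>h. a * h $ 1 + b * h $ 2)) (at x)"
      by (intro exI) (simp only:)
  qed
next
  assume a: "\<forall>i. holo2 (\<lambda>x. F x $ i) S"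
  show "holo_on F S"
    unfolding holo_on_def
  proof
    fix x assume "x \<in> S"
    then have "\<forall>i. \<exists>a b. ((\<lambda>x. F x $ i) has_derivative (\<lambda>h. a * h $ 1 + b * h $ 2)) (at x)"
      using a by (auto simp: holo2_def)
    then obtain a b where ab: "\<And>i. ((\<lambda>x. F x $ i) has_derivative (\<lambda>h. a i * h $ 1 + b i * h $ 2)) (at x)"
      unfolding choice_iff by blast
    define D where "D h = (\<chi> i. a i * h $ 1 + b i * h $ 2)" for h :: "complex^2"
    have "(F has_derivative D) (at x)" unfolding has_derivative_vec_iff using ab by (simp add: D_def)
    moreover from this have "linear D" using has_derivative_linear by blast
    then have "complex_linear D"
      unfolding complex_linear_def by (simp add: D_def vec_eq_iff algebra_simps)
    ultimately show "\<exists>D. complex_linear D \<and> (F has_derivative D) (at x)" by blast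
  qed
qed

lemma holo2_iff_holo_on_vec: "holo2 f S \<longleftrightarrow> holo_on (vec \<circ> f :: complex^2 \<Rightarrow> complex^1) S"
  unfolding holo_on_iff_components by simp

lemma holo2_subset: "holo2 f S \<Longrightarrow> T \<subseteq> S \<Longrightarrow> holo2 f T"
  unfolding holo2_def by blast

lemma holo2_imp_continuous_on: "holo2 f S \<Longrightarrow> continuous_on S f"
  unfolding holo2_def by (meson continuous_at_imp_continuous_on has_derivative_continuous)

text \<open>Differentiability in two variables follows from the partial derivatives once one of them
  is jointly continuous; Cauchy's inequality with a parameter provides this for the derivative in
  \<open>w\<close>.\<close>

lemma osgood_has_derivative:
  assumes U: "open U" and V: "open V" and cont: "continuous_on (U \<times> V) (\<lambda>(z, w). f z w)"
    and h1: "\<And>w. w \<in> V \<Longrightarrow> (\<lambda>z. f z w) holomorphic_on U"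
    and h2: "\<And>z. z \<in> U \<Longrightarrow> f z holomorphic_on V" and z: "z \<in> U" and w: "w \<in> V"
  shows "((\<lambda>(z, w). f z w) has_derivative
     (\<lambda>(h, k). deriv (\<lambda>z. f z w) z * h + deriv (f z) w * k)) (at (z, w))"
proof -
  obtain r where r: "r > 0" "ball w r \<subseteq> V" using V w open_contains_ball by blast
  have cd: "continuous_on (U \<times> V) (\<lambda>(z, w). deriv (f z) w)"
  proof -
    have "continuous_on (V \<times> U) ((\<lambda>(z, w). f z w) \<circ> (\<lambda>(w, z). (z, w)))"
      by (intro continuous_on_compose continuous_on_subset[OF cont])
         (auto simp: case_prod_unfold intro!: continuous_intros)
    then have "continuous_on (V \<times> U) (\<lambda>(w, z). f z w)" by (simp add: o_def case_prod_unfold)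
    then have 1: "continuous_on (V \<times> U) (\<lambda>(w, z). deriv (\<lambda>w. f z w) w)"
      using h2 by (intro continuous_on_deriv_param[OF V]) auto
    have "continuous_on (U \<times> V) ((\<lambda>(w, z). deriv (\<lambda>w. f z w) w) \<circ> (\<lambda>(z, w). (w, z)))"
      by (intro continuous_on_compose continuous_on_subset[OF 1])
         (auto simp: case_prod_unfold intro!: continuous_intros)
    then show ?thesis by (simp add: o_def case_prod_unfold)
  qed
  have "((\<lambda>(z, w). f z w) has_derivative
     (\<lambda>(h, k). (*) (deriv (\<lambda>z. f z w) z) h + blinfun_apply (blinfun_mult_right (deriv (f z) w)) k))
       (at (z, w) within U \<times> ball w r)"
  proof (rule has_derivative_partialsI)
    show "((\<lambda>z. f z w) has_derivative (*) (deriv (\<lambda>z. f z w) z)) (at z within U)"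
      using h1[OF w] U z by (metis has_derivative_at_withinI has_field_derivative_def holomorphic_derivI)
    show "(f x has_derivative blinfun_apply (blinfun_mult_right (deriv (f x) y))) (at y within ball w r)"
      if "x \<in> U" "y \<in> ball w r" for x y
      using h2[OF that(1)] V that r by (auto intro: has_derivative_at_withinI holomorphic_derivI simp flip: has_field_derivative_def)
    have "continuous_on (U \<times> V) (\<lambda>x. blinfun_mult_right (case x of (z, w) \<Rightarrow> deriv (f z) w))"
      by (rule bounded_linear.continuous_on[OF bounded_linear_blinfun_mult_right cd])
    then have "continuous_on (U \<times> ball w r) (\<lambda>(z, w). blinfun_mult_right (deriv (f z) w))"
      using r by (auto simp: case_prod_unfold intro: continuous_on_subset)
    then show "continuous (at (z, w) within U \<times> ball w r) (\<lambda>(z, w). blinfun_mult_right (deriv (f z) w))"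
      using z r by (auto simp: continuous_on_eq_continuous_within)
  qed (use r in auto)
  moreover have "at (z, w) within U \<times> ball w r = at (z, w)"
    using U z r by (intro at_within_open) (auto intro: open_Times)
  ultimately show ?thesis by simp
qed

lemma holo2_osgood:
  fixes x :: "complex^2"
  assumes U: "open U" and V: "open V" and cont: "continuous_on (U \<times> V) (\<lambda>(z, w). f z w)"
    and h1: "\<And>w. w \<in> V \<Longrightarrow> (\<lambda>z. f z w) holomorphic_on U"
    and h2: "\<And>z. z \<in> U \<Longrightarrow> f z holomorphic_on V" and x: "x $ 1 \<in> U" "x $ 2 \<in> V"
  shows "((\<lambda>v. f (v $ 1) (v $ 2)) has_derivative
     (\<lambda>h. deriv (\<lambda>z. f z (x $ 2)) (x $ 1) * h $ 1 + deriv (f (x $ 1)) (x $ 2) * h $ 2)) (at x)"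
proof -
  have "((\<lambda>v :: complex^2. (v $ 1, v $ 2)) has_derivative (\<lambda>h. (h $ 1, h $ 2))) (at x)"
    by (intro derivative_intros bounded_linear_imp_has_derivative bounded_linear_vec_nth)
  from diff_chain_at[OF this osgood_has_derivative[OF U V cont h1 h2 x]]
  show ?thesis by (simp add: o_def)
qed

text \<open>An isolated point is removable in dimension two: the Cauchy integral over a circle in the
  first coordinate stays away from it.\<close>

lemma hartogs_isolated_point:
  assumes W: "open W" "p \<in> W" and f: "holo2 f (W - {p})"
  obtains g V where "open V" "p \<in> V" "V \<subseteq> W" "holo2 g V" "\<And>x. x \<in> V - {p} \<Longrightarrow> g x = f x"
proof -
  obtain e where e: "e > 0" "ball p e \<subseteq> W" using W open_contains_ball by blast
  \<comment> \<open>The norm is at most the sum of the coordinate norms, so the bidisc of radius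
    \<open>2 * r\<close> fits into the ball of radius \<open>e\<close>.\<close>
  define r where "r = e / 4"
  have r: "r > 0" using e by (simp add: r_def)
  have poly: "pt z w \<in> W" if "norm (z - p $ 1) < 2 * r" "norm (w - p $ 2) < 2 * r" for z w
  proof -
    have "norm (pt z w - p) < e" using norm_le_component_sum[of "pt z w - p"] that by (simp add: r_def)
    then show ?thesis using e by (auto simp: dist_norm norm_minus_commute)
  qed
  define c where "c = circlepath (p $ 1) r"
  define d where "d u = 2 * of_real pi * \<i> * of_real r * exp (2 * of_real pi * \<i> * of_real u)" for u :: real
  have c_eq: "c u = p $ 1 + of_real r * exp (2 * of_real pi * \<i> * of_real u)" for u
    by (simp add: c_def circlepath)
  have c_norm: "norm (c u - p $ 1) = r" for u
    using r by (simp add: c_eq norm_mult norm_exp_eq_Re)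
  have c_cont: "continuous_on S c" for S by (simp add: c_eq[abs_def] continuous_intros)
  have c_vd: "vector_derivative c (at u within {0..1}) = d u" if "u \<in> {0..1}" for u
    unfolding c_def d_def using vector_derivative_circlepath01[of u "p $ 1" r] that by simp
  define G where "G z w = integral {0..1} (\<lambda>u. f (pt (c u) w) / (c u - z) * d u) / (2 * of_real pi * \<i>)" for z w
  define B1 where "B1 = ball (p $ 1) r"
  define B2 where "B2 = ball (p $ 2) r"
  have cne: "c u \<noteq> z" if "z \<in> B1" for u z using c_norm[of u] that by (auto simp: B1_def dist_norm norm_minus_commute)
  \<comment> \<open>The first coordinate stays at distance \<open>r\<close> from
    \<open>p $ 1\<close>, so the circle misses \<open>p\<close> even on the line
    \<open>w = p $ 2\<close>.\<close>
  have cW: "pt (c u) w \<in> W - {p}" if "w \<in> B2" for u w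
    using poly[of "c u" w] c_norm[of u] that r by (auto simp: B2_def dist_norm norm_minus_commute pt_eq_iff)
  have fcont: "continuous_on (W - {p}) f" by (rule holo2_imp_continuous_on[OF f])
  have line1: "(\<lambda>z. f (pt z w)) holomorphic_on V" if "open V" "\<And>z. z \<in> V \<Longrightarrow> pt z w \<in> W - {p}" for V w
  proof -
    have eq: "pt 0 w + z *s pt 1 0 = pt z w" for z by (simp add: vec_eq_iff forall_2)
    have "(\<lambda>z. ((vec \<circ> f :: complex^2 \<Rightarrow> complex^1) (pt 0 w + z *s pt 1 0)) $ 1) holomorphic_on V"
      by (rule holo_on_line[OF f[unfolded holo2_iff_holo_on_vec] that(1)]) (use that(2) in \<open>simp only: eq\<close>)
    then show ?thesis by (simp add: eq)
  qed
  have line2: "(\<lambda>w. f (pt z w)) holomorphic_on V" if "open V" "\<And>w. w \<in> V \<Longrightarrow> pt z w \<in> W - {p}" for V z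
  proof -
    have eq: "pt z 0 + w *s pt 0 1 = pt z w" for w by (simp add: vec_eq_iff forall_2)
    have "(\<lambda>w. ((vec \<circ> f :: complex^2 \<Rightarrow> complex^1) (pt z 0 + w *s pt 0 1)) $ 1) holomorphic_on V"
      by (rule holo_on_line[OF f[unfolded holo2_iff_holo_on_vec] that(1)]) (use that(2) in \<open>simp only: eq\<close>)
    then show ?thesis by (simp add: eq)
  qed
  have Hcont: "continuous_on ((B1 \<times> B2) \<times> {0..1}) (\<lambda>(x, u). f (pt (c u) (snd x)) / (c u - fst x) * d u)"
    unfolding case_prod_unfold
  proof (intro continuous_on_mult continuous_on_divide)
    have cc: "continuous_on ((B1 \<times> B2) \<times> {0..1}) (\<lambda>x. c (snd x))"
      unfolding c_eq by (intro continuous_intros)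
    show "continuous_on ((B1 \<times> B2) \<times> {0..1}) (\<lambda>x. f (pt (c (snd x)) (snd (fst x))))"
    proof (rule continuous_on_compose2[OF fcont])
      show "(\<lambda>x. pt (c (snd x)) (snd (fst x))) ` ((B1 \<times> B2) \<times> {0..1}) \<subseteq> W - {p}"
      proof
        fix y assume "y \<in> (\<lambda>x. pt (c (snd x)) (snd (fst x))) ` ((B1 \<times> B2) \<times> {0..1})"
        then obtain u w where "w \<in> B2" "y = pt (c u) w" by auto
        then show "y \<in> W - {p}" using cW by simp
      qed
    qed (intro continuous_intros cc)
    show "continuous_on ((B1 \<times> B2) \<times> {0..1}) (\<lambda>x. c (snd x) - fst (fst x))"
      by (intro continuous_intros cc)
    show "continuous_on ((B1 \<times> B2) \<times> {0..1}) (\<lambda>x. d (snd x))"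
      unfolding d_def by (intro continuous_intros)
  qed (use cne in auto)
  have Gcont: "continuous_on (B1 \<times> B2) (\<lambda>(z, w). G z w)"
  proof -
    have "continuous_on (B1 \<times> B2) (\<lambda>x. integral (cbox 0 1) (\<lambda>u. f (pt (c u) (snd x)) / (c u - fst x) * d u))"
      by (rule integral_continuous_on_param) (use Hcont in simp)
    then show ?thesis unfolding G_def case_prod_unfold by (intro continuous_intros) auto
  qed
  have slice: "continuous_on (V \<times> {0..1}) (\<lambda>(z, u). f (pt (c u) (w z)) / (c u - y z) * d u)"
    if "continuous_on V w" "continuous_on V y" "w ` V \<subseteq> B2" "y ` V \<subseteq> B1" for V :: "complex set" and w y
  proof -
    have "continuous_on (V \<times> {0..1}) ((\<lambda>(x, u). f (pt (c u) (snd x)) / (c u - fst x) * d u) \<circ> (\<lambda>(z, u). ((y z, w z), u)))"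
    proof (rule continuous_on_compose)
      have "continuous_on (V \<times> {0..1}) (\<lambda>x. y (fst x))" "continuous_on (V \<times> {0..1}) (\<lambda>x. w (fst x))"
        by (rule continuous_on_compose2[OF that(2)] continuous_on_compose2[OF that(1)]; auto intro!: continuous_intros)+
      then show "continuous_on (V \<times> {0..1}) (\<lambda>(z, u :: real). ((y z, w z), u))"
        unfolding case_prod_unfold by (intro continuous_intros)
      show "continuous_on ((\<lambda>(z, u). ((y z, w z), u)) ` (V \<times> {0..1})) (\<lambda>(x, u). f (pt (c u) (snd x)) / (c u - fst x) * d u)"
        by (rule continuous_on_subset[OF Hcont]) (use that(3,4) in auto)
    qed
    then show ?thesis by (simp add: o_def case_prod_unfold)
  qed
  have G1: "(\<lambda>z. G z w) holomorphic_on B1" if w: "w \<in> B2" for w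
  proof -
    have "(\<lambda>z. integral {0..1} (\<lambda>u. f (pt (c u) w) / (c u - z) * d u)) holomorphic_on B1"
    proof (rule holomorphic_on_integral_param)
      show "continuous_on (B1 \<times> {0..1}) (\<lambda>(z, u). f (pt (c u) w) / (c u - z) * d u)"
        by (rule slice) (use w in \<open>auto intro!: continuous_intros\<close>)
      show "(\<lambda>z. f (pt (c u) w) / (c u - z) * d u) holomorphic_on B1" for u
        using cne by (intro holomorphic_intros) auto
    qed (simp add: B1_def)
    then show ?thesis unfolding G_def by (intro holomorphic_intros) auto
  qed
  have G2: "G z holomorphic_on B2" if z: "z \<in> B1" for z
  proof -
    have "(\<lambda>w. integral {0..1} (\<lambda>u. f (pt (c u) w) / (c u - z) * d u)) holomorphic_on B2"
    proof (rule holomorphic_on_integral_param)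
      show "continuous_on (B2 \<times> {0..1}) (\<lambda>(w, u). f (pt (c u) w) / (c u - z) * d u)"
        by (rule slice) (use z in \<open>auto intro!: continuous_intros\<close>)
      show "(\<lambda>w. f (pt (c u) w) / (c u - z) * d u) holomorphic_on B2" for u
        using cne[OF z] cW by (intro holomorphic_intros line2) (auto simp: B2_def)
    qed (simp add: B2_def)
    then show ?thesis unfolding G_def[abs_def] by (intro holomorphic_intros) auto
  qed
  have eq1: "G z w = f (pt z w)" if z: "z \<in> B1" and w: "w \<in> B2" "w \<noteq> p $ 2" for z w
  proof -
    have "(\<lambda>z. f (pt z w)) holomorphic_on ball (p $ 1) (2 * r)"
      by (rule line1) (use poly w r in \<open>auto simp: B2_def dist_norm norm_minus_commute pt_eq_iff\<close>)
    then have "(\<lambda>z. f (pt z w)) holomorphic_on cball (p $ 1) r"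
      by (rule holomorphic_on_subset) (use r in auto)
    then have "((\<lambda>u. f (pt u w) / (u - z)) has_contour_integral (2 * of_real pi * \<i> * f (pt z w))) c"
      unfolding c_def by (rule Cauchy_integral_circlepath_simple)
         (use z in \<open>auto simp: B1_def dist_norm norm_minus_commute\<close>)
    then have "((\<lambda>u. f (pt (c u) w) / (c u - z) * vector_derivative c (at u within {0..1})) has_integral
         (2 * of_real pi * \<i> * f (pt z w))) {0..1}"
      by (simp add: has_contour_integral_def)
    then have "((\<lambda>u. f (pt (c u) w) / (c u - z) * d u) has_integral (2 * of_real pi * \<i> * f (pt z w))) {0..1}"
      by (rule has_integral_eq[rotated]) (simp add: c_vd)
    then show ?thesis by (simp add: G_def integral_unique)
  qed
  have eq: "G (x $ 1) (x $ 2) = f x" if x: "x $ 1 \<in> B1" "x $ 2 \<in> B2" "x \<noteq> p" for x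
  proof (cases "x $ 2 = p $ 2")
    case False
    then show ?thesis using eq1[of "x $ 1" "x $ 2"] x by simp
  next
    case True
    then have ne: "x $ 1 \<noteq> p $ 1" using x(3) by (auto simp: vec_eq_iff forall_2)
    have p2: "p $ 2 \<in> B2" using r by (simp add: B2_def)
    have hol: "(\<lambda>w. f (pt (x $ 1) w)) holomorphic_on B2"
      by (rule line2) (use poly x(1) ne r in \<open>auto simp: B1_def B2_def dist_norm norm_minus_commute pt_eq_iff\<close>)
    have "continuous_on B2 (\<lambda>w. G (x $ 1) w - f (pt (x $ 1) w))"
      using G2[OF x(1)] hol by (intro continuous_intros holomorphic_on_imp_continuous_on)
    then have "((\<lambda>w. G (x $ 1) w - f (pt (x $ 1) w)) \<longlongrightarrow> G (x $ 1) (p $ 2) - f (pt (x $ 1) (p $ 2))) (at (p $ 2))"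
      using p2 unfolding B2_def continuous_on_eq_continuous_at[OF open_ball] isCont_def by blast
    moreover have "\<forall>\<^sub>F w in at (p $ 2). w \<in> B2 - {p $ 2}"
      using eventually_at_in_open[of B2 "p $ 2"] p2 by (simp add: B2_def)
    then have "\<forall>\<^sub>F w in at (p $ 2). G (x $ 1) w - f (pt (x $ 1) w) = 0"
      by (rule eventually_mono) (use eq1 x(1) in auto)
    then have "((\<lambda>w. G (x $ 1) w - f (pt (x $ 1) w)) \<longlongrightarrow> 0) (at (p $ 2))"
      by (rule tendsto_eventually)
    ultimately have "G (x $ 1) (p $ 2) - f (pt (x $ 1) (p $ 2)) = 0"
      by (rule tendsto_unique[rotated]) simp
    then show ?thesis using True by simp (metis True pt_components)
  qed
  define V where "V = {x :: complex^2. x $ 1 \<in> B1 \<and> x $ 2 \<in> B2}"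
  have "open V"
  proof -
    have "V = (\<lambda>x. x $ 1) -` B1 \<inter> (\<lambda>x. x $ 2) -` B2" by (auto simp: V_def)
    then show ?thesis by (auto simp: B1_def B2_def intro!: open_Int open_vimage continuous_intros)
  qed
  moreover have "V \<subseteq> W"
  proof
    fix x assume "x \<in> V"
    then show "x \<in> W" using poly[of "x $ 1" "x $ 2"] r
      by (auto simp: V_def B1_def B2_def dist_norm norm_minus_commute)
  qed
  moreover have "holo2 (\<lambda>x. G (x $ 1) (x $ 2)) V"
    unfolding holo2_def using holo2_osgood[OF _ _ Gcont G1 G2]
    by (auto simp: V_def B1_def B2_def)
  moreover have "p \<in> V" using r by (simp add: V_def B1_def B2_def)
  ultimately show ?thesis using eq by (intro that[of V "\<lambda>x. G (x $ 1) (x $ 2)"]) (auto simp: V_def)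
qed

subsection \<open>Straightening a two-parameter family\<close>

definition polydisc :: "real \<Rightarrow> (complex^2) set" where
  "polydisc r = {v. \<forall>i. norm (v $ i) < r}"

lemma mem_polydisc: "v \<in> polydisc r \<longleftrightarrow> norm (v $ 1) < r \<and> norm (v $ 2) < r"
  by (simp add: polydisc_def forall_2)

lemma open_polydisc [simp]: "open (polydisc r)"
proof -
  have "polydisc r = (\<lambda>x. x $ 1) -` ball 0 r \<inter> (\<lambda>x. x $ 2) -` ball 0 r"
    by (auto simp: mem_polydisc)
  then show ?thesis by (auto intro!: open_Int open_vimage continuous_intros)
qed

lemma complex_linear_inv:
  assumes "complex_linear D" "bij D"
  shows "complex_linear (inv_into UNIV D)"
proof -
  have D: "linear D" "\<And>c v. D (c *s v) = c *s D v" using assms by (auto simp: complex_linear_def)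
  have r: "D (inv_into UNIV D y) = y" for y using assms(2) by (simp add: bij_is_surj surj_f_inv_f)
  have i: "inv_into UNIV D y = x" if "D x = y" for x y using that assms(2) by (metis bij_inv_eq_iff)
  have "linear (inv_into UNIV D)"
  proof (rule linearI)
    show "inv_into UNIV D (x + y) = inv_into UNIV D x + inv_into UNIV D y" for x y by (rule i) (simp add: linear_add[OF D(1)] r)
    show "inv_into UNIV D (c *\<^sub>R x) = c *\<^sub>R inv_into UNIV D x" for c x by (rule i) (simp add: linear_scale[OF D(1)] r)
  qed
  moreover have "inv_into UNIV D (c *s v) = c *s inv_into UNIV D v" for c v by (rule i) (simp add: D r)
  ultimately show ?thesis by (simp add: complex_linear_def)
qed

text \<open>Osgood's lemma makes \<open>f\<close> continuously differentiable with complex linear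
  differential, invertible at 0 by the independence of \<open>a\<close> and \<open>b\<close>. The
  real inverse function theorem applies, and the inverse is holomorphic since inverses of complex
  linear maps are complex linear. All small radii are covered because the radius is shrunk later to
  fit a prescribed open set.\<close>

lemma local_biholomorphism_of_parametrisation:
  fixes P :: "complex \<Rightarrow> complex \<Rightarrow> complex^2"
  assumes \<rho>: "\<rho> > 0"
    and cont: "continuous_on (ball 0 \<rho> \<times> ball 0 \<rho>) (\<lambda>(t, z). P t z)"
    and h1: "\<And>z i. z \<in> ball 0 \<rho> \<Longrightarrow> (\<lambda>t. P t z $ i) holomorphic_on ball 0 \<rho>"
    and h2: "\<And>t i. t \<in> ball 0 \<rho> \<Longrightarrow> (\<lambda>z. P t z $ i) holomorphic_on ball 0 \<rho>"
    and a: "cvderiv (\<lambda>t. P t 0) a 0" and b: "cvderiv (P 0) b 0"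
    and indep: "\<And>s t. s *s a + t *s b = 0 \<Longrightarrow> s = 0 \<and> t = 0"
  obtains r0 where "0 < r0" "\<And>r. 0 < r \<Longrightarrow> r \<le> r0 \<Longrightarrow>
      inj_on (\<lambda>v. P (v $ 1) (v $ 2)) (polydisc r) \<and> open ((\<lambda>v. P (v $ 1) (v $ 2)) ` polydisc r) \<and>
      holo_on (\<lambda>v. P (v $ 1) (v $ 2)) (polydisc r) \<and>
      holo_on (inv_into (polydisc r) (\<lambda>v. P (v $ 1) (v $ 2))) ((\<lambda>v. P (v $ 1) (v $ 2)) ` polydisc r)"
proof -
  define f where "f v = P (v $ 1) (v $ 2)" for v :: "complex^2"
  define B where "B = ball (0::complex) \<rho>"
  have conti: "continuous_on (B \<times> B) (\<lambda>(t, z). P t z $ i)" for i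
    using continuous_on_component[OF cont, of i] by (simp add: B_def case_prod_unfold)
  define d1 where "d1 i v = deriv (\<lambda>t. P t (v $ 2) $ i) (v $ 1)" for i and v :: "complex^2"
  define d2 where "d2 i v = deriv (\<lambda>z. P (v $ 1) z $ i) (v $ 2)" for i and v :: "complex^2"
  have fi: "((\<lambda>v. f v $ i) has_derivative (\<lambda>h. d1 i v * h $ 1 + d2 i v * h $ 2)) (at v)"
    if "v \<in> polydisc \<rho>" for i v
    unfolding f_def d1_def d2_def
    by (rule holo2_osgood[where U = B and V = B and f = "\<lambda>t z. P t z $ i"])
       (use that conti h1 h2 in \<open>auto simp: B_def mem_polydisc\<close>)
  have f_holo: "holo_on f (polydisc \<rho>)"
    unfolding holo_on_iff_components holo2_def using fi by blast
  define D where "D v h = h $ 1 *s (\<chi> i. d1 i v) + h $ 2 *s (\<chi> i. d2 i v)" for v h :: "complex^2"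
  have D_lin: "bounded_linear (D v)" for v
    unfolding D_def
    by (intro bounded_linear_add bounded_linear_compose[OF bounded_linear_vector_scalar_mult_left] bounded_linear_vec_nth)
  have D_clin: "complex_linear (D v)" for v
    unfolding complex_linear_def
    using bounded_linear.linear[OF D_lin[of v]] by (simp add: D_def vec_eq_iff algebra_simps)
  have f_der: "(f has_derivative D v) (at v)" if "v \<in> polydisc \<rho>" for v
    unfolding has_derivative_vec_iff using fi[OF that] by (simp add: D_def mult.commute)
  have pc: "continuous_on (polydisc \<rho>) (d1 i)" "continuous_on (polydisc \<rho>) (d2 i)" for i
  proof -
    have 1: "continuous_on (B \<times> B) (\<lambda>(t, z). deriv (\<lambda>t. P t z $ i) t)"
      using conti h1 by (intro continuous_on_deriv_param) (auto simp: B_def)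
    show "continuous_on (polydisc \<rho>) (d1 i)"
      unfolding d1_def
      by (rule continuous_on_compose2[OF 1, of _ "\<lambda>v. (v $ 1, v $ 2)", simplified])
         (auto simp: B_def mem_polydisc intro!: continuous_intros)
    have "continuous_on (B \<times> B) ((\<lambda>(t, z). P t z $ i) \<circ> (\<lambda>(z, t). (t, z)))"
      by (intro continuous_on_compose continuous_on_subset[OF conti])
         (auto simp: case_prod_unfold intro!: continuous_intros)
    then have "continuous_on (B \<times> B) (\<lambda>(z, t). P t z $ i)" by (simp add: o_def case_prod_unfold)
    then have 2: "continuous_on (B \<times> B) (\<lambda>(z, t). deriv (\<lambda>z. P t z $ i) z)"
      using h2 by (intro continuous_on_deriv_param) (auto simp: B_def)
    show "continuous_on (polydisc \<rho>) (d2 i)"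
      unfolding d2_def
      by (rule continuous_on_compose2[OF 2, of _ "\<lambda>v. (v $ 2, v $ 1)", simplified])
         (auto simp: B_def mem_polydisc intro!: continuous_intros)
  qed
  define f' where "f' v = Blinfun (D v)" for v
  have f'_app: "blinfun_apply (f' v) = D v" for v
    unfolding f'_def by (rule bounded_linear_Blinfun_apply[OF D_lin])
  have contf': "continuous_on (polydisc \<rho>) f'"
    by (rule continuous_on_blinfun_componentwise)
       (auto simp: f'_app D_def intro!: continuous_intros pc)
  have z: "(0 :: complex^2) \<in> polydisc \<rho>" using \<rho> by (simp add: mem_polydisc)
  have a_eq: "a = (\<chi> i. d1 i 0)"
    using a unfolding cvderiv_iff by (auto simp: vec_eq_iff d1_def intro: DERIV_imp_deriv[symmetric])
  have b_eq: "b = (\<chi> i. d2 i 0)"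
    using b unfolding cvderiv_iff by (auto simp: vec_eq_iff d2_def intro: DERIV_imp_deriv[symmetric])
  have "inj (D 0)"
  proof (rule injI)
    fix v w assume "D 0 v = D 0 w"
    then have "D 0 (v - w) = 0" using linear_diff[OF bounded_linear.linear[OF D_lin]] by simp
    then have "(v - w) $ 1 *s a + (v - w) $ 2 *s b = 0" by (simp only: D_def a_eq b_eq)
    from indep[OF this] show "v = w" by (simp add: vec_eq_iff forall_2)
  qed
  then obtain g0 where g0: "linear g0" "g0 \<circ> D 0 = id"
    using linear_injective_left_inverse bounded_linear.linear[OF D_lin] by blast
  have g0b: "bounded_linear g0" using g0(1) by (simp add: linear_conv_bounded_linear)
  have invf: "Blinfun g0 o\<^sub>L f' 0 = id_blinfun"
    using g0(2) by (intro blinfun_eqI) (simp add: bounded_linear_Blinfun_apply[OF g0b] f'_app pointfree_idE)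
  have der: "(f has_derivative blinfun_apply (f' v)) (at v)" if "v \<in> polydisc \<rho>" for v
    using f_der[OF that] by (simp add: f'_app)
  have "\<exists>U' V g g'. open U' \<and> U' \<subseteq> polydisc \<rho> \<and> 0 \<in> U' \<and> open V \<and> homeomorphism U' V f g \<and>
      (\<forall>y\<in>V. (g has_derivative (g' y)) (at y) \<and> g' y = inv_into UNIV (blinfun_apply (f' (g y))) \<and>
        bij (blinfun_apply (f' (g y))))"
    by (rule inverse_function_theorem[OF open_polydisc der contf' z invf]) blast+
  then obtain U' V g g' where U': "open U'" "U' \<subseteq> polydisc \<rho>" "0 \<in> U'" and V: "open V"
    and hom: "homeomorphism U' V f g"
    and g: "\<And>y. y \<in> V \<Longrightarrow> (g has_derivative (g' y)) (at y)"
      "\<And>y. y \<in> V \<Longrightarrow> g' y = inv_into UNIV (blinfun_apply (f' (g y)))" "\<And>y. y \<in> V \<Longrightarrow> bij (blinfun_apply (f' (g y)))"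
    by blast
  obtain e where e: "e > 0" "ball 0 e \<subseteq> U'" using U' open_contains_ball by blast
  show ?thesis
  proof (rule that[of "e / 2"])
    fix r :: real assume r: "0 < r" "r \<le> e / 2"
    have pU: "polydisc r \<subseteq> U'"
    proof
      fix v assume "v \<in> polydisc r"
      then have "norm v < e" using norm_le_component_sum[of v] r by (simp add: mem_polydisc)
      then show "v \<in> U'" using e by (auto simp: dist_norm)
    qed
    have gf: "g (f v) = v" if "v \<in> polydisc r" for v
      using hom pU that by (auto simp: homeomorphism_def)
    have inj: "inj_on f (polydisc r)" by (metis gf inj_onI)
    have op: "open (f ` polydisc r)"
      using homeomorphism_imp_open_map[OF hom, of "polydisc r"] pU V(1) U'(1)
      by (metis open_openin_trans open_polydisc open_subset openin_open_eq)
    have sub: "f ` polydisc r \<subseteq> V" using hom pU by (auto simp: homeomorphism_def)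
    have "holo_on g (f ` polydisc r)"
      unfolding holo_on_def
    proof
      fix y assume "y \<in> f ` polydisc r"
      then have y: "y \<in> V" using sub by blast
      have "complex_linear (g' y)"
        using complex_linear_inv[OF D_clin, of "g y"] g(2,3)[OF y] by (simp add: f'_app)
      then show "\<exists>D. complex_linear D \<and> (g has_derivative D) (at y)" using g(1)[OF y] by blast
    qed
    then have "holo_on (inv_into (polydisc r) f) (f ` polydisc r)"
      by (rule holo_on_cong[OF _ op]) (auto simp: gf inj)
    moreover have "holo_on f (polydisc r)" using holo_on_subset[OF f_holo] pU U' by blast
    ultimately show "inj_on (\<lambda>v. P (v $ 1) (v $ 2)) (polydisc r) \<and> open ((\<lambda>v. P (v $ 1) (v $ 2)) ` polydisc r) \<and>
      holo_on (\<lambda>v. P (v $ 1) (v $ 2)) (polydisc r) \<and>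
      holo_on (inv_into (polydisc r) (\<lambda>v. P (v $ 1) (v $ 2))) ((\<lambda>v. P (v $ 1) (v $ 2)) ` polydisc r)"
      using inj op unfolding f_def[abs_def] by blast
  qed (use e in simp)
qed

section \<open>Complex surfaces\<close>

locale complex_surface =
  fixes N :: "'a topology" and A :: "('a, 2) chart set"
  assumes mfd: "complex_manifold N A"
begin

lemma chart_topological: "(U, \<phi>) \<in> A \<Longrightarrow> topological_chart N (U, \<phi>)"
  using mfd unfolding complex_manifold_def by blast

lemma Hausdorff: "Hausdorff_space N"
  using mfd unfolding complex_manifold_def by blast

lemma chart_exists:
  assumes "x \<in> topspace N"
  obtains U \<phi> where "(U, \<phi>) \<in> A" "x \<in> U"
proof -
  have "x \<in> (\<Union>c\<in>A. fst c)" using mfd assms unfolding complex_manifold_def by blast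
  then obtain c where "c \<in> A" "x \<in> fst c" by blast
  then show ?thesis using that[of "fst c" "snd c"] by simp
qed

lemma chart_open: "(U, \<phi>) \<in> A \<Longrightarrow> openin N U"
  and chart_image_open: "(U, \<phi>) \<in> A \<Longrightarrow> open (\<phi> ` U)"
  and chart_homeo: "(U, \<phi>) \<in> A \<Longrightarrow> homeomorphic_map (subtopology N U) (top_of_set (\<phi> ` U)) \<phi>"
  using chart_topological unfolding topological_chart_def by auto

lemma chart_subset: "(U, \<phi>) \<in> A \<Longrightarrow> U \<subseteq> topspace N"
  using chart_open openin_subset by blast

lemma chart_inj: "(U, \<phi>) \<in> A \<Longrightarrow> inj_on \<phi> U"
  using homeomorphic_imp_injective_map[OF chart_homeo] chart_subset
  by (simp add: Int_absorb1)

lemma chart_inv [simp]: "(U, \<phi>) \<in> A \<Longrightarrow> x \<in> U \<Longrightarrow> inv_into U \<phi> (\<phi> x) = x"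
  using chart_inj inv_into_f_f by metis

lemma chart_continuous: "(U, \<phi>) \<in> A \<Longrightarrow> continuous_map (subtopology N U) euclidean \<phi>"
  using homeomorphic_imp_continuous_map[OF chart_homeo] continuous_map_in_subtopology by blast

lemma chart_preimage_open:
  assumes "(U, \<phi>) \<in> A" "open O'"
  shows "openin N {x \<in> U. \<phi> x \<in> O'}"
proof -
  have "openin (subtopology N U) {x \<in> topspace (subtopology N U). \<phi> x \<in> O'}"
    using chart_continuous[OF assms(1)] assms(2) openin_continuous_map_preimage by fastforce
  then show ?thesis
    using openin_open_subtopology[OF chart_open[OF assms(1)]] chart_subset[OF assms(1)]
    by (simp add: Int_absorb1)
qed

lemma chart_image_of_open:
  assumes "(U, \<phi>) \<in> A" "openin N W"
  shows "open (\<phi> ` (U \<inter> W))"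
proof -
  have "openin (subtopology N U) (U \<inter> W)" using assms by (simp add: openin_subtopology_Int2)
  then have "openin (top_of_set (\<phi> ` U)) (\<phi> ` (U \<inter> W))"
    using homeomorphic_imp_open_map[OF chart_homeo[OF assms(1)]] by (simp add: open_map_def)
  then show ?thesis using chart_image_open[OF assms(1)] openin_open_trans by blast
qed

lemma chart_inv_continuous:
  assumes "(U, \<phi>) \<in> A"
  shows "continuous_map (top_of_set (\<phi> ` U)) N (inv_into U \<phi>)"
proof -
  obtain g where g: "homeomorphic_maps (subtopology N U) (top_of_set (\<phi> ` U)) \<phi> g"
    using chart_homeo[OF assms] homeomorphic_map_maps by blast
  then have "continuous_map (top_of_set (\<phi> ` U)) N g"
    by (simp add: homeomorphic_maps_def continuous_map_in_subtopology)
  moreover have "g y = inv_into U \<phi> y" if "y \<in> \<phi> ` U" for y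
    using g that chart_inv[OF assms] chart_subset[OF assms] by (auto simp: homeomorphic_maps_def)
  ultimately show ?thesis by (auto intro: continuous_map_eq)
qed

lemma transition_holo:
  assumes "(U, \<phi>) \<in> A" "(V, \<psi>) \<in> A"
  shows "holo_on (\<psi> \<circ> inv_into U \<phi>) (\<phi> ` (U \<inter> V))"
  using mfd assms unfolding complex_manifold_def compatible_charts_def by fast

text \<open>The maximality of the atlas turns a biholomorphic change of coordinates on an open part
  of a chart into a chart of \<open>A\<close>. This is how flow boxes become members of the given
  atlas.\<close>

lemma chart_reparametrise:
  assumes U: "(U, \<phi>) \<in> A" and O': "open O'" "O' \<subseteq> \<phi> ` U" and G: "inj_on G O'" "open (G ` O')"
    "holo_on G O'" "holo_on (inv_into O' G) (G ` O')"
  shows "({x \<in> U. \<phi> x \<in> O'}, G \<circ> \<phi>) \<in> A"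
proof -
  define W where "W = {x \<in> U. \<phi> x \<in> O'}"
  have W: "openin N W" unfolding W_def by (rule chart_preimage_open[OF U O'(1)])
  have WU: "W \<subseteq> U" by (auto simp: W_def)
  have phiW: "\<phi> ` W = O'" using O'(2) by (auto simp: W_def)
  have im: "(G \<circ> \<phi>) ` W = G ` O'" using phiW by (metis image_comp)
  have inj: "inj_on (G \<circ> \<phi>) W"
    using chart_inj[OF U] G(1) phiW WU by (metis comp_inj_on inj_on_subset)
  have 1: "homeomorphic_map (subtopology N W) (top_of_set O') \<phi>"
  proof -
    have "homeomorphic_map (subtopology (subtopology N U) W) (subtopology (top_of_set (\<phi> ` U)) O') \<phi>"
      by (rule homeomorphic_map_subtopologies_alt[OF chart_homeo[OF U]]) (use phiW WU in \<open>auto simp: W_def\<close>)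
    then show ?thesis using WU O'(2) by (simp add: subtopology_subtopology Int_absorb1)
  qed
  have 2: "homeomorphic_map (top_of_set O') (top_of_set (G ` O')) G"
  proof -
    have "homeomorphic_maps (top_of_set O') (top_of_set (G ` O')) G (inv_into O' G)"
      unfolding homeomorphic_maps_def
      using G holo_on_imp_continuous_on[OF G(3)] holo_on_imp_continuous_on[OF G(4)]
      by (auto simp: continuous_map_in_subtopology inv_into_into)
    then show ?thesis using homeomorphic_map_maps by blast
  qed
  have top: "topological_chart N (W, G \<circ> \<phi>)"
    unfolding topological_chart_def prod.case im using W homeomorphic_map_compose[OF 1 2] G(2) by blast
  have "compatible_charts (W, G \<circ> \<phi>) (V, \<psi>)" if V: "(V, \<psi>) \<in> A" for V \<psi>
    unfolding compatible_charts_def prod.case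
  proof
    have o1: "open ((G \<circ> \<phi>) ` (W \<inter> V))"
    proof -
      have "open_map (subtopology N W) (top_of_set (G ` O')) (G \<circ> \<phi>)"
        using homeomorphic_map_compose[OF 1 2] homeomorphic_imp_open_map by blast
      moreover have "openin (subtopology N W) (W \<inter> V)"
        using chart_open[OF V] by (simp add: openin_subtopology_Int2)
      ultimately show ?thesis using G(2) openin_open_trans unfolding open_map_def by blast
    qed
    have inv_eq: "inv_into W (G \<circ> \<phi>) y = inv_into U \<phi> (inv_into O' G y)" if yG: "y \<in> G ` O'" for y
    proof -
      obtain x where x: "x \<in> W" "y = G (\<phi> x)" using yG unfolding phiW[symmetric] by blast
      then have "inv_into W (G \<circ> \<phi>) y = x" using inj by (metis comp_apply inv_into_f_f)
      moreover have "inv_into O' G y = \<phi> x" using x G(1) by (simp add: W_def)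
      ultimately show ?thesis using x WU U by (simp add: subset_iff)
    qed
    have "holo_on ((\<psi> \<circ> inv_into U \<phi>) \<circ> inv_into O' G) ((G \<circ> \<phi>) ` (W \<inter> V))"
    proof (rule holo_on_compose)
      show "holo_on (inv_into O' G) ((G \<circ> \<phi>) ` (W \<inter> V))"
        by (rule holo_on_subset[OF G(4)]) (use im in blast)
      show "inv_into O' G ` (G \<circ> \<phi>) ` (W \<inter> V) \<subseteq> \<phi> ` (U \<inter> V)"
        using G(1) WU by (auto simp: W_def)
    qed (rule transition_holo[OF U V])
    then show "holo_on (\<psi> \<circ> inv_into W (G \<circ> \<phi>)) ((G \<circ> \<phi>) ` (W \<inter> V))"
    proof (rule holo_on_cong[OF _ o1])
      fix y assume "y \<in> (G \<circ> \<phi>) ` (W \<inter> V)"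
      then have "y \<in> G ` O'" using im by blast
      then show "((\<psi> \<circ> inv_into U \<phi>) \<circ> inv_into O' G) y = (\<psi> \<circ> inv_into W (G \<circ> \<phi>)) y"
        by (simp only: comp_apply inv_eq)
    qed
    have o2: "open (\<psi> ` (W \<inter> V))" using chart_image_of_open[OF V W] by (simp add: Int_commute)
    have "holo_on (G \<circ> (\<phi> \<circ> inv_into V \<psi>)) (\<psi> ` (W \<inter> V))"
    proof (rule holo_on_compose)
      show "holo_on (\<phi> \<circ> inv_into V \<psi>) (\<psi> ` (W \<inter> V))"
        by (rule holo_on_subset[OF transition_holo[OF V U]]) (use WU in blast)
      show "(\<phi> \<circ> inv_into V \<psi>) ` \<psi> ` (W \<inter> V) \<subseteq> O'" using V by (auto simp: W_def)
    qed (rule G(3))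
    then show "holo_on ((G \<circ> \<phi>) \<circ> inv_into V \<psi>) (\<psi> ` (W \<inter> V))" by (simp add: comp_assoc)
  qed
  then have "\<forall>d\<in>A. compatible_charts (W, G \<circ> \<phi>) d" by auto
  then show ?thesis using mfd top unfolding complex_manifold_def W_def by blast
qed

subsection \<open>Holomorphic curves and functions\<close>

text \<open>Holomorphy of the flow in the initial point is expressed through its action on such
  curves, so one complex variable suffices for it.\<close>

definition hcurve :: "(complex \<Rightarrow> 'a) \<Rightarrow> complex set \<Rightarrow> bool" where
  "hcurve \<kappa> V \<longleftrightarrow> open V \<and> continuous_map (top_of_set V) N \<kappa> \<and>
     (\<forall>(U, \<phi>)\<in>A. \<forall>z\<in>V. \<kappa> z \<in> U \<longrightarrow> (\<exists>v. cvderiv (\<phi> \<circ> \<kappa>) v z))"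

lemma curve_preimage_open:
  assumes "continuous_map (top_of_set V) N \<kappa>" "open V" "openin N W"
  shows "open {z \<in> V. \<kappa> z \<in> W}"
proof -
  have "openin (top_of_set V) {z \<in> topspace (top_of_set V). \<kappa> z \<in> W}"
    using assms openin_continuous_map_preimage by blast
  then show ?thesis using assms(2) openin_open_trans by auto
qed

lemma cvderiv_chart_change:
  assumes U: "(U, \<phi>) \<in> A" and V: "(V, \<psi>) \<in> A"
    and \<kappa>: "continuous_map (top_of_set W) N \<kappa>" "open W" "z \<in> W" "\<kappa> z \<in> U" "\<kappa> z \<in> V"
    and v: "cvderiv (\<phi> \<circ> \<kappa>) v z"
  shows "cvderiv (\<psi> \<circ> \<kappa>) (frechet_derivative (\<psi> \<circ> inv_into U \<phi>) (at (\<phi> (\<kappa> z))) v) z"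
proof -
  obtain D where D: "complex_linear D" "((\<psi> \<circ> inv_into U \<phi>) has_derivative D) (at (\<phi> (\<kappa> z)))"
    using transition_holo[OF U V] \<kappa> by (auto simp: holo_on_def)
  have "cvderiv ((\<psi> \<circ> inv_into U \<phi>) \<circ> (\<phi> \<circ> \<kappa>)) (D v) z"
    by (rule cvderiv_compose[OF v _ D(1)]) (use D(2) in simp)
  moreover have "open {z \<in> W. \<kappa> z \<in> U}" using curve_preimage_open[OF \<kappa>(1,2) chart_open[OF U]] .
  ultimately have "cvderiv (\<psi> \<circ> \<kappa>) (D v) z"
    by (rule has_derivative_transform_within_open) (use \<kappa> U in auto)
  then show ?thesis using frechet_derivative_at[OF D(2)] by simp
qed

lemma hcurveI:
  assumes "open V" "continuous_map (top_of_set V) N \<kappa>"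
    and "\<And>z. z \<in> V \<Longrightarrow> \<exists>U \<phi> v. (U, \<phi>) \<in> A \<and> \<kappa> z \<in> U \<and> cvderiv (\<phi> \<circ> \<kappa>) v z"
  shows "hcurve \<kappa> V"
  unfolding hcurve_def
proof (intro conjI assms ballI, clarify)
  fix U \<phi> z assume U: "(U, \<phi>) \<in> A" and z: "z \<in> V" "\<kappa> z \<in> U"
  obtain U' \<phi>' v where "(U', \<phi>') \<in> A" "\<kappa> z \<in> U'" "cvderiv (\<phi>' \<circ> \<kappa>) v z" using assms(3)[OF z(1)] by blast
  from cvderiv_chart_change[OF this(1) U assms(2,1) z(1) this(2) z(2) this(3)]
  show "\<exists>v. cvderiv (\<phi> \<circ> \<kappa>) v z" by blast
qed

lemma hcurve_subset:
  assumes "hcurve \<kappa> V" "open V'" "V' \<subseteq> V"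
  shows "hcurve \<kappa> V'"
proof -
  have "continuous_map (top_of_set V') N \<kappa>"
    using assms continuous_map_from_subtopology_mono unfolding hcurve_def by blast
  then show ?thesis using assms unfolding hcurve_def by blast
qed

lemma hcurve_cong:
  assumes \<kappa>: "hcurve \<kappa> V" and eq: "\<And>z. z \<in> V \<Longrightarrow> \<kappa> z = \<kappa>' z"
  shows "hcurve \<kappa>' V"
  unfolding hcurve_def
proof (intro conjI ballI, goal_cases)
  case 1
  then show ?case using \<kappa> by (simp add: hcurve_def)
next
  case 2
  then show ?case using \<kappa> eq by (auto simp: hcurve_def intro: continuous_map_eq)
next
  case (3 c)
  obtain U \<phi> where c: "c = (U, \<phi>)" by (cases c)
  have "\<exists>v. cvderiv (\<phi> \<circ> \<kappa>') v z" if z: "z \<in> V" "\<kappa>' z \<in> U" for z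
  proof -
    obtain v where "cvderiv (\<phi> \<circ> \<kappa>) v z" using \<kappa> 3 c z eq[OF z(1)] unfolding hcurve_def by fastforce
    then have "cvderiv (\<phi> \<circ> \<kappa>') v z"
      by (rule has_derivative_transform_within_open[of _ _ _ _ V]) (use \<kappa> z eq in \<open>auto simp: hcurve_def\<close>)
    then show ?thesis by blast
  qed
  then show ?case using c by simp
qed

lemma hcurve_chart_inv:
  assumes U: "(U, \<phi>) \<in> A" and "open V" and e: "\<And>z. z \<in> V \<Longrightarrow> e z \<in> \<phi> ` U" "\<And>z. z \<in> V \<Longrightarrow> \<exists>v. cvderiv e v z"
  shows "hcurve (inv_into U \<phi> \<circ> e) V"
proof (rule hcurveI[OF \<open>open V\<close>])
  have "continuous_on V e" using e(2)
    by (meson continuous_at_imp_continuous_on has_derivative_continuous)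
  then have "continuous_map (top_of_set V) (top_of_set (\<phi> ` U)) e"
    using e(1) by (auto simp: continuous_map_in_subtopology)
  then show "continuous_map (top_of_set V) N (inv_into U \<phi> \<circ> e)"
    using chart_inv_continuous[OF U] continuous_map_compose by blast
  fix z assume z: "z \<in> V"
  obtain v where "cvderiv e v z" using e(2)[OF z] by blast
  then have "cvderiv (\<phi> \<circ> (inv_into U \<phi> \<circ> e)) v z"
    by (rule has_derivative_transform_within_open[OF _ \<open>open V\<close> z]) (simp add: f_inv_into_f[OF e(1)])
  moreover have "(inv_into U \<phi> \<circ> e) z \<in> U" using e(1)[OF z] by (simp add: inv_into_into)
  ultimately show "\<exists>U' \<phi>' v. (U', \<phi>') \<in> A \<and> (inv_into U \<phi> \<circ> e) z \<in> U' \<and> cvderiv (\<phi>' \<circ> (inv_into U \<phi> \<circ> e)) v z"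
    using U by blast
qed

lemma hcurve_coordinate_holomorphic:
  assumes "hcurve \<kappa> V" "(U, \<phi>) \<in> A" "\<kappa> ` V \<subseteq> U"
  shows "(\<lambda>z. \<phi> (\<kappa> z) $ i) holomorphic_on V"
  using assms cvderiv_holomorphic_iff[of V "\<phi> \<circ> \<kappa>"] unfolding hcurve_def by fastforce

text \<open>Differentiability in the charts already gives continuity, and on
  \<open>U \<inter> W\<close> the inverses of the restricted and of the full chart agree. So the
  continuity clause and the restricted atlas disappear.\<close>

lemma holomorphic_fun_on_iff:
  "holomorphic_fun_on N A W f \<longleftrightarrow> openin N W \<and> (\<forall>(U, \<phi>)\<in>A. holo2 (f \<circ> inv_into U \<phi>) (\<phi> ` (U \<inter> W)))"
proof (cases "openin N W")
  case False
  then show ?thesis by (simp add: holomorphic_fun_on_def)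
next
  case W: True
  have eq: "holo_on (vec \<circ> f \<circ> inv_into (U \<inter> W) \<phi> :: complex^2 \<Rightarrow> complex^1) (\<phi> ` (U \<inter> W)) \<longleftrightarrow>
      holo2 (f \<circ> inv_into U \<phi>) (\<phi> ` (U \<inter> W))" if U: "(U, \<phi>) \<in> A" for U \<phi>
  proof -
    have o: "open (\<phi> ` (U \<inter> W))" by (rule chart_image_of_open[OF U W])
    have "inv_into (U \<inter> W) \<phi> y = inv_into U \<phi> y" if "y \<in> \<phi> ` (U \<inter> W)" for y
      using that chart_inv[OF U] chart_inj[OF U] by (auto intro!: inv_into_f_f intro: inj_on_subset)
    then show ?thesis
      unfolding holo2_iff_holo_on_vec
      by (intro iffI; elim holo_on_cong[OF _ o]) (auto simp: o_def)
  qed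
  have "holomorphic_fun_on N A W f \<longleftrightarrow> continuous_map (subtopology N W) euclidean f \<and>
      (\<forall>(U, \<phi>)\<in>A. holo_on (vec \<circ> f \<circ> inv_into (U \<inter> W) \<phi> :: complex^2 \<Rightarrow> complex^1) (\<phi> ` (U \<inter> W)))"
    using W by (auto simp: holomorphic_fun_on_def holomorphic_map_def plane_atlas_def restrict_atlas_def)
  also have "\<dots> \<longleftrightarrow> continuous_map (subtopology N W) euclidean f \<and>
      (\<forall>(U, \<phi>)\<in>A. holo2 (f \<circ> inv_into U \<phi>) (\<phi> ` (U \<inter> W)))"
    using eq by fast
  also have "\<dots> \<longleftrightarrow> (\<forall>(U, \<phi>)\<in>A. holo2 (f \<circ> inv_into U \<phi>) (\<phi> ` (U \<inter> W)))"
  proof -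
    have "continuous_map (subtopology N W) euclidean f"
      if h: "\<forall>(U, \<phi>)\<in>A. holo2 (f \<circ> inv_into U \<phi>) (\<phi> ` (U \<inter> W))"
      unfolding continuous_map_atin
    proof
      fix x assume "x \<in> topspace (subtopology N W)"
      then have x: "x \<in> W" "x \<in> topspace N" by auto
      obtain U \<phi> where U: "(U, \<phi>) \<in> A" "x \<in> U" using chart_exists[OF x(2)] by blast
      have c: "continuous_on (\<phi> ` (U \<inter> W)) (f \<circ> inv_into U \<phi>)"
        using h U holo2_imp_continuous_on by blast
      have "limitin euclidean f (f x) (atin (subtopology N W) x)"
        unfolding limitin_atin
      proof (intro conjI impI allI)
        fix V assume V: "openin euclidean V \<and> f x \<in> V"
        define O' where "O' = \<phi> ` (U \<inter> W) \<inter> (f \<circ> inv_into U \<phi>) -` V"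
        have "open O'" unfolding O'_def
          using continuous_open_preimage[OF c chart_image_of_open[OF U(1) W]] V by auto
        then have "openin N {y \<in> U. \<phi> y \<in> O'}" by (rule chart_preimage_open[OF U(1)])
        then have "openin (subtopology N W) ({y \<in> U. \<phi> y \<in> O'} \<inter> W)" by (rule openin_subtopology_Int)
        moreover have "x \<in> {y \<in> U. \<phi> y \<in> O'} \<inter> W" using x U V by (auto simp: O'_def)
        moreover have "f y \<in> V" if "y \<in> {y \<in> U. \<phi> y \<in> O'} \<inter> W" for y
        proof -
          have "y \<in> U" "\<phi> y \<in> O'" using that by auto
          then show ?thesis using U(1) unfolding O'_def by simp
        qed
        ultimately show "\<exists>Ua. openin (subtopology N W) Ua \<and> x \<in> Ua \<and> f ` (Ua - {x}) \<subseteq> V"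
          by blast
      qed auto
      then show "limitin euclidean f (f x) (atin (subtopology N W) x)" .
    qed
    then show ?thesis by blast
  qed
  finally show ?thesis using W by simp
qed

lemma holomorphic_fun_onI:
  assumes W: "openin N W"
    and f: "\<And>x. x \<in> W \<Longrightarrow> \<exists>U \<phi> a b. (U, \<phi>) \<in> A \<and> x \<in> U \<and>
      ((f \<circ> inv_into U \<phi>) has_derivative (\<lambda>h. a * h $ 1 + b * h $ 2)) (at (\<phi> x))"
  shows "holomorphic_fun_on N A W f"
  unfolding holomorphic_fun_on_iff
proof (intro conjI W ballI, clarify)
  fix V \<psi> assume V: "(V, \<psi>) \<in> A"
  show "holo2 (f \<circ> inv_into V \<psi>) (\<psi> ` (V \<inter> W))"
    unfolding holo2_def
  proof
    fix y assume "y \<in> \<psi> ` (V \<inter> W)"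
    then obtain x where x: "x \<in> V" "x \<in> W" "y = \<psi> x" by blast
    obtain U \<phi> a b where U: "(U, \<phi>) \<in> A" "x \<in> U"
      and d: "((f \<circ> inv_into U \<phi>) has_derivative (\<lambda>h. a * h $ 1 + b * h $ 2)) (at (\<phi> x))"
      using f[OF x(2)] by blast
    obtain D where D: "complex_linear D" "((\<phi> \<circ> inv_into V \<psi>) has_derivative D) (at y)"
      using transition_holo[OF V U(1)] x U by (auto simp: holo_on_def)
    have "((f \<circ> inv_into U \<phi>) \<circ> (\<phi> \<circ> inv_into V \<psi>) has_derivative (\<lambda>h. a * h $ 1 + b * h $ 2) \<circ> D) (at y)"
      by (rule diff_chain_at[OF D(2)]) (use d x V in simp)
    moreover have "open (\<psi> ` (V \<inter> U))" by (rule chart_image_of_open[OF V chart_open[OF U(1)]])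
    ultimately have 1: "((f \<circ> inv_into V \<psi>) has_derivative (\<lambda>h. a * h $ 1 + b * h $ 2) \<circ> D) (at y)"
      by (rule has_derivative_transform_within_open) (use x U V in auto)
    have "(\<lambda>h. a * h $ 1 + b * h $ 2) \<circ> D = (\<lambda>h. (a * D (pt 1 0) $ 1 + b * D (pt 1 0) $ 2) * h $ 1 +
        (a * D (pt 0 1) $ 1 + b * D (pt 0 1) $ 2) * h $ 2)"
    proof
      fix h
      have "a * D h $ 1 + b * D h $ 2 = a * (D (pt 1 0) $ 1 * h $ 1 + D (pt 0 1) $ 1 * h $ 2) +
          b * (D (pt 1 0) $ 2 * h $ 1 + D (pt 0 1) $ 2 * h $ 2)"
        by (simp only: complex_linear_functional[OF D(1), of h])
      then show "((\<lambda>h. a * h $ 1 + b * h $ 2) \<circ> D) h = (a * D (pt 1 0) $ 1 + b * D (pt 1 0) $ 2) * h $ 1 +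
        (a * D (pt 0 1) $ 1 + b * D (pt 0 1) $ 2) * h $ 2" by (simp add: algebra_simps)
    qed
    then show "\<exists>a b. ((f \<circ> inv_into V \<psi>) has_derivative (\<lambda>h. a * h $ 1 + b * h $ 2)) (at y)"
      using 1 by (intro exI) (simp only:)
  qed
qed

lemma holomorphic_fun_along_hcurve:
  assumes f: "holomorphic_fun_on N A W f" and \<kappa>: "hcurve \<kappa> V" "\<kappa> ` V \<subseteq> W"
  shows "(\<lambda>z. f (\<kappa> z)) holomorphic_on V"
proof -
  have "\<exists>d. ((\<lambda>z. f (\<kappa> z)) has_field_derivative d) (at z)" if z: "z \<in> V" for z
  proof -
    have W: "openin N W" using f by (simp add: holomorphic_fun_on_iff)
    have kz: "\<kappa> z \<in> W" using \<kappa> z by blast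
    then obtain U \<phi> where U: "(U, \<phi>) \<in> A" "\<kappa> z \<in> U"
      using chart_exists W openin_subset by blast
    have kc: "continuous_map (top_of_set V) N \<kappa>" "open V" using \<kappa> by (auto simp: hcurve_def)
    obtain v where v: "cvderiv (\<phi> \<circ> \<kappa>) v z" using \<kappa> U z unfolding hcurve_def by blast
    obtain a b where d: "((f \<circ> inv_into U \<phi>) has_derivative (\<lambda>h. a * h $ 1 + b * h $ 2)) (at ((\<phi> \<circ> \<kappa>) z))"
      using f U kz unfolding holomorphic_fun_on_iff holo2_def by fastforce
    have "((f \<circ> inv_into U \<phi>) \<circ> (\<phi> \<circ> \<kappa>) has_derivative (\<lambda>h. a * h $ 1 + b * h $ 2) \<circ> (\<lambda>h. h *s v)) (at z)"
      by (rule diff_chain_at[OF v d])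
    moreover have "open {z \<in> V. \<kappa> z \<in> U}" by (rule curve_preimage_open[OF kc chart_open[OF U(1)]])
    ultimately have "((\<lambda>z. f (\<kappa> z)) has_derivative (\<lambda>h. a * h $ 1 + b * h $ 2) \<circ> (\<lambda>h. h *s v)) (at z)"
      by (rule has_derivative_transform_within_open) (use z U in auto)
    moreover have "(\<lambda>h. a * h $ 1 + b * h $ 2) \<circ> (\<lambda>h. h *s v) = (*) (a * v $ 1 + b * v $ 2)"
      by (auto simp: fun_eq_iff algebra_simps)
    ultimately show ?thesis unfolding has_field_derivative_def by auto
  qed
  moreover have "open V" using \<kappa> by (simp add: hcurve_def)
  ultimately show ?thesis by (simp add: holomorphic_on_open)
qed

end

section \<open>The flow of a complete field\<close>

locale complete_flow = complex_surface N A
  for N :: "'a topology" and A :: "('a, 2) chart set" +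
  fixes X :: "('a, 2) vfield"
  assumes vf: "holomorphic_vector_field A X" and complete: "complete_vector_field N A X"
begin

abbreviation coord_field :: "'a set \<Rightarrow> ('a \<Rightarrow> complex^2) \<Rightarrow> complex^2 \<Rightarrow> complex^2" where
  "coord_field U \<phi> \<equiv> X (U, \<phi>) \<circ> inv_into U \<phi>"

definition flow_chart :: "'a set \<Rightarrow> ('a \<Rightarrow> complex^2) \<Rightarrow> complex^2 \<Rightarrow> real \<Rightarrow> real \<Rightarrow> real \<Rightarrow> bool" where
  "flow_chart U \<phi> q R M L \<longleftrightarrow> (U, \<phi>) \<in> A \<and> lipschitz_field (coord_field U \<phi>) q R M L \<and> cball q R \<subseteq> \<phi> ` U"

lemma coord_field_holo: "(U, \<phi>) \<in> A \<Longrightarrow> holo_on (coord_field U \<phi>) (\<phi> ` U)"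
  using vf unfolding holomorphic_vector_field_def by blast

lemma flow_chart_exists:
  assumes "(U, \<phi>) \<in> A" "p \<in> U"
  obtains R M L where "flow_chart U \<phi> (\<phi> p) R M L"
proof -
  obtain R M L where "R > 0" "M > 0" "L > 0" "cball (\<phi> p) R \<subseteq> \<phi> ` U"
    "\<And>x. x \<in> cball (\<phi> p) R \<Longrightarrow> norm (coord_field U \<phi> x) \<le> M"
    "\<And>x y. x \<in> cball (\<phi> p) R \<Longrightarrow> y \<in> cball (\<phi> p) R \<Longrightarrow>
       norm (coord_field U \<phi> x - coord_field U \<phi> y) \<le> L * norm (x - y)"
    using holo_on_imp_lipschitz[OF chart_image_open[OF assms(1)] coord_field_holo[OF assms(1)], of "\<phi> p"]
      assms(2) by blast
  then show ?thesis using assms by (intro that[of R M L]) (simp add: flow_chart_def lipschitz_field_def)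
qed

lemma integral_curve_continuous: "integral_curve N A X \<gamma> \<Longrightarrow> continuous_map euclidean N \<gamma>"
  unfolding integral_curve_def by blast

lemma integral_curve_deriv:
  "integral_curve N A X \<gamma> \<Longrightarrow> (U, \<phi>) \<in> A \<Longrightarrow> \<gamma> t \<in> U \<Longrightarrow> cvderiv (\<phi> \<circ> \<gamma>) (X (U, \<phi>) (\<gamma> t)) t"
  unfolding integral_curve_def by blast

lemma integral_curve_in: "integral_curve N A X \<gamma> \<Longrightarrow> \<gamma> t \<in> topspace N"
  using integral_curve_continuous unfolding continuous_map_def by auto

lemma integral_curve_translate:
  assumes "integral_curve N A X \<gamma>"
  shows "integral_curve N A X (\<lambda>s. \<gamma> (t + s))"
  unfolding integral_curve_def
proof (intro conjI allI ballI, goal_cases)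
  case 1
  have "continuous_map euclidean N (\<gamma> \<circ> (\<lambda>s. t + s))"
    by (rule continuous_map_compose[OF _ integral_curve_continuous[OF assms]])
       (auto intro!: continuous_intros)
  then show ?case by (simp add: o_def)
next
  case (2 s c)
  obtain U \<phi> where c: "c = (U, \<phi>)" by (cases c)
  have "cvderiv (\<phi> \<circ> (\<lambda>s. \<gamma> (t + s))) (X (U, \<phi>) (\<gamma> (t + s))) s" if "\<gamma> (t + s) \<in> U"
  proof -
    have "((\<lambda>s. t + s) has_field_derivative 1) (at s)" by (auto intro!: derivative_eq_intros)
    from cvderiv_chain_scalar[OF this, of "\<phi> \<circ> \<gamma>"] integral_curve_deriv[OF assms _ that]
    show ?thesis using 2 c by (simp add: o_def)
  qed
  then show ?case using c by simp
qed

lemma preimage_closed_curve: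
  assumes "integral_curve N A X \<gamma>" "openin N W"
  shows "open {t. \<gamma> t \<in> W}"
  using openin_continuous_map_preimage[OF integral_curve_continuous[OF assms(1)] assms(2)] by simp

text \<open>A continuity argument in time: up to the first exit from the open ball the curve solves
  the equation with speed at most \<open>M\<close>, so it moves by less than \<open>R / 2\<close>
  and cannot reach the boundary.\<close>

lemma flow_chart_stays:
  assumes fc: "flow_chart U \<phi> q R M L" and \<gamma>: "integral_curve N A X \<gamma>"
    and start: "\<gamma> 0 \<in> U" "\<phi> (\<gamma> 0) \<in> cball q (R / 2)" and t: "norm t * M < R / 2"
  shows "lipschitz_field.solves (coord_field U \<phi>) q R (\<phi> \<circ> \<gamma>) t \<and> (\<forall>s\<in>closed_segment 0 t. \<gamma> s \<in> U \<and> \<phi> (\<gamma> s) \<in> ball q R)"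
proof -
  have U: "(U, \<phi>) \<in> A" and sub: "cball q R \<subseteq> \<phi> ` U" using fc by (auto simp: flow_chart_def)
  interpret lipschitz_field "coord_field U \<phi>" q R M L using fc by (simp add: flow_chart_def)
  define B where "B = {x \<in> U. \<phi> x \<in> cball q R}"
  define B' where "B' = {x \<in> U. \<phi> x \<in> ball q R}"
  have B'_open: "openin N B'" unfolding B'_def by (rule chart_preimage_open[OF U]) simp
  \<comment> \<open>Compactness of the closed ball and the Hausdorff property make \<open>B\<close>
    closed in the whole of \<open>N\<close>, so the curve cannot leave it through points outside the
    chart.\<close>
  have B_closed: "closedin N B"
  proof -
    have "compactin (top_of_set (\<phi> ` U)) (cball q R)" using sub by (simp add: compactin_subtopology)
    then have "compactin N (inv_into U \<phi> ` cball q R)"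
      by (rule image_compactin[OF _ chart_inv_continuous[OF U]])
    moreover have "inv_into U \<phi> ` cball q R = B"
    proof (intro equalityI subsetI)
      fix x assume "x \<in> inv_into U \<phi> ` cball q R"
      then obtain y where "y \<in> cball q R" "x = inv_into U \<phi> y" by blast
      moreover from this have "y \<in> \<phi> ` U" using sub by blast
      ultimately show "x \<in> B" using inv_into_into f_inv_into_f unfolding B_def
        by (metis (mono_tags, lifting) mem_Collect_eq)
    next
      fix x assume "x \<in> B"
      then show "x \<in> inv_into U \<phi> ` cball q R" using chart_inv[OF U] unfolding B_def
        by (metis (mono_tags, lifting) image_eqI mem_Collect_eq)
    qed
    ultimately show ?thesis using compactin_imp_closedin[OF Hausdorff] by simp
  qed
  define g where "g u = \<gamma> (of_real u * t)" for u :: real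
  have g_cont: "continuous_map euclidean N g"
  proof -
    have "continuous_map euclidean N (\<gamma> \<circ> (\<lambda>u::real. of_real u * t))"
      by (rule continuous_map_compose[OF _ integral_curve_continuous[OF \<gamma>]]) (auto intro!: continuous_intros)
    then show ?thesis by (simp add: g_def[abs_def] o_def)
  qed
  have step: "g u \<in> B'" if u: "u \<in> {0..1}" and below: "\<And>v. v \<in> {0..<u} \<Longrightarrow> g v \<in> B" for u
  proof -
    have g0: "g 0 \<in> B" using start R_pos by (auto simp: g_def B_def)
    have gu: "g u \<in> B"
    proof (cases "u = 0")
      case False
      have "closed {v. g v \<in> B}"
        using closedin_continuous_map_preimage[OF g_cont B_closed] by simp
      moreover have "{0..<u} \<subseteq> {v. g v \<in> B}" using below by blast
      ultimately have "closure {0..<u} \<subseteq> {v. g v \<in> B}" by (simp add: closure_minimal)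
      then show ?thesis using False u by (auto simp: closure_atLeastLessThan)
    qed (use g0 in simp)
    have "s \<in> closed_segment 0 (of_real u * t) \<Longrightarrow> \<gamma> s \<in> B" for s
    proof -
      assume "s \<in> closed_segment 0 (of_real u * t)"
      then obtain a where a: "0 \<le> a" "a \<le> 1" "s = of_real (a * u) * t"
        by (auto simp: closed_segment_def scaleR_conv_of_real)
      have "a * u \<le> u" "a * u \<ge> 0" using a u by (auto simp: mult_left_le_one_le)
      then have "g (a * u) \<in> B" using below[of "a * u"] gu by (cases "a * u < u") auto
      then show ?thesis using a by (simp add: g_def)
    qed
    then have sol: "solves (\<phi> \<circ> \<gamma>) (of_real u * t)"
      unfolding solves_def using integral_curve_deriv[OF \<gamma> U] U by (auto simp: B_def)
    have "norm ((\<phi> \<circ> \<gamma>) (of_real u * t) - (\<phi> \<circ> \<gamma>) 0) \<le> M * norm (of_real u * t - 0)"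
      by (rule solves_lipschitz[OF sol]) auto
    also have "\<dots> = u * (norm t * M)" using u by (simp add: norm_mult)
    also have "\<dots> \<le> 1 * (norm t * M)" using u M_pos by (intro mult_right_mono) auto
    also have "\<dots> < R / 2" using t by simp
    finally have "dist (\<phi> (\<gamma> 0)) (\<phi> (g u)) < R / 2" by (simp add: g_def dist_norm norm_minus_commute)
    moreover have "dist q (\<phi> (\<gamma> 0)) \<le> R / 2" using start by simp
    ultimately have "dist q (\<phi> (g u)) < R" using dist_triangle[of q "\<phi> (g u)" "\<phi> (\<gamma> 0)"] by linarith
    then show ?thesis using gu by (simp add: B'_def B_def)
  qed
  have all: "g u \<in> B'" if u: "u \<in> {0..1}" for u
  proof (rule ccontr)
    assume bad: "g u \<notin> B'"
    define Z where "Z = {v \<in> {0..1}. g v \<notin> B'}"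
    have "open {v. g v \<in> B'}" using openin_continuous_map_preimage[OF g_cont B'_open] by simp
    then have "closed (- {v. g v \<in> B'})" by (simp add: closed_Compl)
    then have "compact ({0..1} \<inter> - {v. g v \<in> B'})" by (simp add: compact_Int_closed)
    moreover have "Z = {0..1} \<inter> - {v. g v \<in> B'}" by (auto simp: Z_def)
    ultimately have "compact Z" by simp
    moreover have "Z \<noteq> {}" using bad u by (auto simp: Z_def)
    ultimately obtain v where v: "v \<in> Z" "\<forall>w\<in>Z. v \<le> w" using compact_attains_inf[of Z] by blast
    have "g v \<in> B'"
    proof (rule step)
      show "v \<in> {0..1}" using v by (simp add: Z_def)
      fix w assume w: "w \<in> {0..<v}"
      then have "w \<in> {0..1}" using v(1) by (simp add: Z_def)
      moreover have "w \<notin> Z" using v(2) w by force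
      ultimately show "g w \<in> B" by (auto simp: Z_def B'_def B_def)
    qed
    then show False using v by (simp add: Z_def)
  qed
  have seg: "\<gamma> s \<in> B'" if s: "s \<in> closed_segment 0 t" for s
  proof -
    obtain u where "0 \<le> u" "u \<le> 1" "s = of_real u * t"
      using s by (auto simp: closed_segment_def scaleR_conv_of_real)
    then show ?thesis using all[of u] by (simp add: g_def)
  qed
  then have "solves (\<phi> \<circ> \<gamma>) t"
    unfolding solves_def using integral_curve_deriv[OF \<gamma> U] U by (auto simp: B'_def intro: less_imp_le)
  then show ?thesis using seg by (auto simp: B'_def)
qed

text \<open>The times of agreement form a closed set because \<open>N\<close> is Hausdorff and an
  open one by Gronwall's estimate with equal initial values; the plane of times is
  connected.\<close>

lemma integral_curve_unique:
  assumes \<gamma>: "integral_curve N A X \<gamma>" and \<delta>: "integral_curve N A X \<delta>" and eq: "\<gamma> 0 = \<delta> 0"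
  shows "\<gamma> t = \<delta> t"
proof -
  define E where "E = {t. \<gamma> t = \<delta> t}"
  have "closed E"
    using closedin_continuous_maps_eq[OF Hausdorff integral_curve_continuous[OF \<gamma>] integral_curve_continuous[OF \<delta>]]
    by (simp add: E_def)
  moreover have "open E"
    unfolding open_contains_ball
  proof
    fix t assume t: "t \<in> E"
    obtain U \<phi> where U: "(U, \<phi>) \<in> A" "\<gamma> t \<in> U" using chart_exists[OF integral_curve_in[OF \<gamma>]] by blast
    obtain R M L where fc: "flow_chart U \<phi> (\<phi> (\<gamma> t)) R M L" using flow_chart_exists[OF U] by blast
    interpret lipschitz_field "coord_field U \<phi>" "\<phi> (\<gamma> t)" R M L using fc by (simp add: flow_chart_def)
    note g = flow_chart_stays[OF fc integral_curve_translate[OF \<gamma>, of t]]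
    note d = flow_chart_stays[OF fc integral_curve_translate[OF \<delta>, of t]]
    have "ball t (R / (2 * M)) \<subseteq> E"
    proof
      fix s assume "s \<in> ball t (R / (2 * M))"
      then have s: "norm (s - t) * M < R / 2"
        using M_pos by (simp add: dist_norm norm_minus_commute field_simps)
      have td: "\<delta> t = \<gamma> t" using t by (simp add: E_def)
      have init: "(\<phi> \<circ> (\<lambda>s. \<gamma> (t + s))) 0 \<in> cball (\<phi> (\<gamma> t)) (R / 2)" "(\<phi> \<circ> (\<lambda>s. \<delta> (t + s))) 0 \<in> cball (\<phi> (\<gamma> t)) (R / 2)"
        using R_pos td by auto
      have 1: "solves (\<phi> \<circ> (\<lambda>s. \<gamma> (t + s))) (s - t)" "\<gamma> s \<in> U"
      proof -
        have st: "solves (\<phi> \<circ> (\<lambda>s. \<gamma> (t + s))) (s - t) \<and>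
            (\<forall>s\<in>closed_segment 0 (s - t). \<gamma> (t + s) \<in> U \<and> \<phi> (\<gamma> (t + s)) \<in> ball (\<phi> (\<gamma> t)) R)"
          by (rule g) (use s U init td in simp_all)
        then have "\<gamma> (t + (s - t)) \<in> U" by blast
        with st show "solves (\<phi> \<circ> (\<lambda>s. \<gamma> (t + s))) (s - t)" "\<gamma> s \<in> U" by simp_all
      qed
      have 2: "solves (\<phi> \<circ> (\<lambda>s. \<delta> (t + s))) (s - t)" "\<delta> s \<in> U"
      proof -
        have st: "solves (\<phi> \<circ> (\<lambda>s. \<delta> (t + s))) (s - t) \<and>
            (\<forall>s\<in>closed_segment 0 (s - t). \<delta> (t + s) \<in> U \<and> \<phi> (\<delta> (t + s)) \<in> ball (\<phi> (\<gamma> t)) R)"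
          by (rule d) (use s U init td in simp_all)
        then have "\<delta> (t + (s - t)) \<in> U" by blast
        with st show "solves (\<phi> \<circ> (\<lambda>s. \<delta> (t + s))) (s - t)" "\<delta> s \<in> U" by simp_all
      qed
      have "norm ((\<phi> \<circ> (\<lambda>s. \<gamma> (t + s))) (s - t) - (\<phi> \<circ> (\<lambda>s. \<delta> (t + s))) (s - t)) \<le>
          exp (L * norm (s - t)) * norm ((\<phi> \<circ> (\<lambda>s. \<gamma> (t + s))) 0 - (\<phi> \<circ> (\<lambda>s. \<delta> (t + s))) 0)"
        using solves_initial_lipschitz[OF 1(1) init(1) 2(1) init(2)] s by simp
      then have "\<phi> (\<gamma> s) = \<phi> (\<delta> s)" using td by simp
      then show "s \<in> E" using chart_inj[OF U(1)] 1 2 by (auto simp: E_def inj_on_def)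
    qed
    then show "\<exists>e>0. ball t e \<subseteq> E" using R_pos M_pos by (intro exI[of _ "R / (2 * M)"]) simp
  qed
  ultimately have "E = UNIV" using eq clopen[of E] by (auto simp: E_def)
  then show ?thesis by (auto simp: E_def)
qed

text \<open>The choice is immaterial by the uniqueness of integral curves.\<close>

definition fl :: "complex \<Rightarrow> 'a \<Rightarrow> 'a" where
  "fl t p = (SOME \<gamma>. integral_curve N A X \<gamma> \<and> \<gamma> 0 = p) t"

lemma fl_curve: "p \<in> topspace N \<Longrightarrow> integral_curve N A X (\<lambda>t. fl t p)"
  and fl_0 [simp]: "p \<in> topspace N \<Longrightarrow> fl 0 p = p"
proof -
  assume "p \<in> topspace N"
  then have "\<exists>\<gamma>. integral_curve N A X \<gamma> \<and> \<gamma> 0 = p" using complete by (auto simp: complete_vector_field_def)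
  from someI_ex[OF this] show "integral_curve N A X (\<lambda>t. fl t p)" "fl 0 p = p"
    by (simp_all add: fl_def)
qed

lemma fl_eq: "integral_curve N A X \<gamma> \<Longrightarrow> fl t (\<gamma> 0) = \<gamma> t"
  using integral_curve_unique[of "\<lambda>t. fl t (\<gamma> 0)" \<gamma> t] fl_curve fl_0 integral_curve_in by metis

lemma fl_in [simp]: "p \<in> topspace N \<Longrightarrow> fl t p \<in> topspace N"
  using fl_curve integral_curve_in by fast

lemma fl_fl: "p \<in> topspace N \<Longrightarrow> fl s (fl t p) = fl (t + s) p"
  using fl_eq[OF integral_curve_translate[OF fl_curve, of p t], of s] by simp

lemma fl_inverse [simp]: "p \<in> topspace N \<Longrightarrow> fl (- t) (fl t p) = p" "p \<in> topspace N \<Longrightarrow> fl t (fl (- t) p) = p"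
  by (simp_all add: fl_fl)

lemma orbit_eq: "p \<in> topspace N \<Longrightarrow> orbit N A X p = range (\<lambda>t. fl t p)"
proof (intro equalityI subsetI)
  assume p: "p \<in> topspace N"
  fix q
  show "q \<in> range (\<lambda>t. fl t p)" if "q \<in> orbit N A X p"
  proof -
    obtain \<gamma> t where "integral_curve N A X \<gamma>" "\<gamma> 0 = p" "\<gamma> t = q" using \<open>q \<in> orbit N A X p\<close> unfolding orbit_def by blast
    then have "q = fl t p" using fl_eq[of \<gamma> t] by simp
    then show ?thesis by blast
  qed
  show "q \<in> orbit N A X p" if "q \<in> range (\<lambda>t. fl t p)"
    using that fl_curve[OF p] fl_0[OF p] unfolding orbit_def by blast
qed

lemma fl_deriv:
  "p \<in> topspace N \<Longrightarrow> (U, \<phi>) \<in> A \<Longrightarrow> fl t p \<in> U \<Longrightarrow> cvderiv (\<lambda>t. \<phi> (fl t p)) (X (U, \<phi>) (fl t p)) t"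
  using integral_curve_deriv[OF fl_curve] by (fastforce simp: o_def)

lemma fl_preimage_open: "p \<in> topspace N \<Longrightarrow> openin N W \<Longrightarrow> open {t. fl t p \<in> W}"
  using preimage_closed_curve[OF fl_curve] .

lemma hcurve_fl_time: "p \<in> topspace N \<Longrightarrow> hcurve (\<lambda>t. fl t p) UNIV"
  using fl_curve[of p] unfolding hcurve_def integral_curve_def by fastforce

lemma flow_chart_fl:
  assumes fc: "flow_chart U \<phi> q R M L" and x: "x \<in> U" "\<phi> x \<in> cball q (R / 2)" and t: "norm t * M < R / 2"
  shows "lipschitz_field.solves (coord_field U \<phi>) q R (\<lambda>s. \<phi> (fl s x)) t" "fl t x \<in> U" "\<phi> (fl t x) \<in> ball q R"
proof -
  have U: "(U, \<phi>) \<in> A" using fc by (simp add: flow_chart_def)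
  have xN: "x \<in> topspace N" using x chart_subset[OF U] by blast
  note * = flow_chart_stays[OF fc fl_curve[OF xN] _ _ t]
  show "lipschitz_field.solves (coord_field U \<phi>) q R (\<lambda>s. \<phi> (fl s x)) t" "fl t x \<in> U" "\<phi> (fl t x) \<in> ball q R"
    using * x xN by (auto simp: o_def)
qed

lemma fl_jointly_continuous_near_0:
  assumes fc: "flow_chart U \<phi> q R M L" and x: "x \<in> U" "\<phi> x \<in> ball q (R / 2)" and t: "norm t * M < R / 2"
    and W: "openin N W" "fl t x \<in> W"
  shows "\<exists>\<delta>>0. \<exists>V. openin N V \<and> x \<in> V \<and> (\<forall>s\<in>ball t \<delta>. \<forall>y\<in>V. fl s y \<in> W)"
proof -
  have U: "(U, \<phi>) \<in> A" using fc by (simp add: flow_chart_def)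
  interpret lipschitz_field "coord_field U \<phi>" q R M L using fc by (simp add: flow_chart_def)
  have xN: "x \<in> topspace N" using x chart_subset[OF U] by blast
  have ftU: "fl t x \<in> U" using flow_chart_fl[OF fc x(1) _ t] x by simp
  have "open (\<phi> ` (U \<inter> W))" by (rule chart_image_of_open[OF U W(1)])
  moreover have "\<phi> (fl t x) \<in> \<phi> ` (U \<inter> W)" using ftU W by blast
  ultimately obtain e where e: "e > 0" "ball (\<phi> (fl t x)) e \<subseteq> \<phi> ` (U \<inter> W)" using open_contains_ball by blast
  have inW: "y \<in> W" if y: "y \<in> U" "\<phi> y \<in> ball (\<phi> (fl t x)) e" for y
  proof -
    obtain w where "w \<in> U \<inter> W" "\<phi> y = \<phi> w" using e y by blast
    then show ?thesis using chart_inj[OF U] y by (auto simp: inj_on_def)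
  qed
  have "openin N {y \<in> U. \<phi> y \<in> ball (\<phi> (fl t x)) (e / 2)}" by (rule chart_preimage_open[OF U]) simp
  then have "open {s. fl s x \<in> {y \<in> U. \<phi> y \<in> ball (\<phi> (fl t x)) (e / 2)}}"
    by (rule fl_preimage_open[OF xN])
  then obtain \<delta>1 where d1: "\<delta>1 > 0" "\<And>s. s \<in> ball t \<delta>1 \<Longrightarrow> \<phi> (fl s x) \<in> ball (\<phi> (fl t x)) (e / 2)"
    using ftU e(1) unfolding open_contains_ball by fastforce
  have "open {s. norm s * M < R / 2}" by (intro open_Collect_less continuous_intros)
  then obtain \<delta>2 where "\<delta>2 > 0" "ball t \<delta>2 \<subseteq> {s. norm s * M < R / 2}"
    using t open_contains_ball_eq[of "{s. norm s * M < R / 2}"] by blast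
  then have d2: "\<delta>2 > 0" "\<And>s. s \<in> ball t \<delta>2 \<Longrightarrow> norm s * M < R / 2" by blast+
  \<comment> \<open>An upper bound for \<open>exp (L * norm s)\<close> over all times with
    \<open>norm s * M < R / 2\<close>.\<close>
  define K where "K = exp (L * R / (2 * M))"
  have K: "K > 0" by (simp add: K_def)
  define V where "V = {y \<in> U. \<phi> y \<in> ball q (R / 2) \<inter> ball (\<phi> x) (e / (2 * K))}"
  have "fl s y \<in> W" if s: "s \<in> ball t (min \<delta>1 \<delta>2)" and y: "y \<in> V" for s y
  proof -
    have sM: "norm s * M < R / 2" using d2 s by simp
    have yU: "y \<in> U" "\<phi> y \<in> cball q (R / 2)" using y by (auto simp: V_def)
    have yN: "y \<in> topspace N" using yU chart_subset[OF U] by blast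
    have xc: "\<phi> x \<in> cball q (R / 2)" using x by auto
    have "norm (\<phi> (fl s x) - \<phi> (fl s y)) \<le> exp (L * norm s) * norm (\<phi> x - \<phi> y)"
      using solves_initial_lipschitz[OF flow_chart_fl(1)[OF fc x(1) xc sM] _ flow_chart_fl(1)[OF fc yU sM]] xc yU sM xN yN
      by simp
    also have "\<dots> \<le> K * norm (\<phi> x - \<phi> y)"
    proof (rule mult_right_mono)
      have "norm s \<le> R / (2 * M)" using sM M_pos by (simp add: field_simps)
      then have "L * norm s \<le> L * (R / (2 * M))" using L_pos by (intro mult_left_mono) auto
      then show "exp (L * norm s) \<le> K" by (simp add: K_def)
    qed simp
    also have "\<dots> < K * (e / (2 * K))"
      using y K by (intro mult_strict_left_mono) (auto simp: V_def dist_norm)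
    also have "\<dots> = e / 2" using K by simp
    finally have "dist (\<phi> (fl s x)) (\<phi> (fl s y)) < e / 2" by (simp add: dist_norm)
    moreover have "dist (\<phi> (fl t x)) (\<phi> (fl s x)) < e / 2" using d1(2)[of s] s by simp
    ultimately have "\<phi> (fl s y) \<in> ball (\<phi> (fl t x)) e"
      using dist_triangle[of "\<phi> (fl t x)" "\<phi> (fl s y)" "\<phi> (fl s x)"] by simp
    then show ?thesis using inW flow_chart_fl(2)[OF fc yU sM] by blast
  qed
  moreover have "openin N V" unfolding V_def by (rule chart_preimage_open[OF U]) (intro open_Int open_ball)
  moreover have "x \<in> V" using x e K by (simp add: V_def)
  ultimately show ?thesis using d1 d2 by (intro exI[of _ "min \<delta>1 \<delta>2"] conjI exI[of _ V]) auto
qed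

text \<open>A flow chart controls only times shorter than \<open>R / (2 * M)\<close>, with constants
  that vary along the orbit. Connectedness of the plane of times carries a property from time 0 to
  any \<open>t\<close> through such short steps.\<close>

lemma fl_time_induct [consumes 1, case_names start step]:
  assumes p: "p \<in> topspace N" and "P 0"
    and step: "\<And>U \<phi> q R M L t t'. flow_chart U \<phi> q R M L \<Longrightarrow> fl t p \<in> U \<Longrightarrow> \<phi> (fl t p) \<in> ball q (R / 2) \<Longrightarrow>
      norm (t' - t) * M < R / 2 \<Longrightarrow> P t \<Longrightarrow> P t'"
  shows "P t"
proof (rule connected_induction_simple[of UNIV 0 t P])
  fix t0 :: complex
  obtain U \<phi> where U: "(U, \<phi>) \<in> A" "fl t0 p \<in> U" using chart_exists p fl_in by metis
  obtain R M L where fc: "flow_chart U \<phi> (\<phi> (fl t0 p)) R M L" using flow_chart_exists[OF U] by blast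
  interpret lipschitz_field "coord_field U \<phi>" "\<phi> (fl t0 p)" R M L using fc by (simp add: flow_chart_def)
  have "openin N {y \<in> U. \<phi> y \<in> ball (\<phi> (fl t0 p)) (R / 2)}" by (rule chart_preimage_open[OF U(1)]) simp
  then have o: "open {s. fl s p \<in> {y \<in> U. \<phi> y \<in> ball (\<phi> (fl t0 p)) (R / 2)}}" by (rule fl_preimage_open[OF p])
  \<comment> \<open>The radius is half the admissible time, so any two times in \<open>T\<close>
    differ by less than \<open>R / (2 * M)\<close>.\<close>
  define T where "T = {s. fl s p \<in> {y \<in> U. \<phi> y \<in> ball (\<phi> (fl t0 p)) (R / 2)}} \<inter> ball t0 (R / (4 * M))"
  have "P s'" if "s \<in> T" "s' \<in> T" "P s" for s s'
  proof (rule step[OF fc])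
    have "norm (s' - s) < R / (4 * M) + R / (4 * M)"
    proof -
      have "dist t0 s < R / (4 * M)" "dist t0 s' < R / (4 * M)" using that by (auto simp: T_def)
      then show ?thesis using dist_triangle3[of s' s t0] by (simp add: dist_norm)
    qed
    also have "\<dots> = R / 2 / M" by (simp add: field_simps)
    finally show "norm (s' - s) * M < R / 2" using M_pos by (simp add: pos_less_divide_eq)
  qed (use that in \<open>auto simp: T_def\<close>)
  moreover have "open T" using o by (auto simp: T_def)
  moreover have "t0 \<in> T" using U R_pos M_pos by (simp add: T_def)
  ultimately show "\<exists>T. openin (top_of_set UNIV) T \<and> t0 \<in> T \<and> (\<forall>x\<in>T. \<forall>y\<in>T. P x \<longrightarrow> P y)"
    unfolding subtopology_UNIV open_openin[symmetric] by blast
qed (simp_all add: \<open>P 0\<close> connected_UNIV)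

text \<open>The induction runs over all target sets \<open>W\<close> at once, since each short step
  replaces \<open>W\<close> by another open set one step earlier on the orbit.\<close>

lemma fl_jointly_continuous:
  assumes p: "p \<in> topspace N" and W: "openin N W" "fl t p \<in> W"
  shows "\<exists>\<delta>>0. \<exists>V. openin N V \<and> p \<in> V \<and> (\<forall>s\<in>ball t \<delta>. \<forall>x\<in>V. fl s x \<in> W)"
proof -
  have "\<forall>W. openin N W \<longrightarrow> fl t p \<in> W \<longrightarrow>
      (\<exists>\<delta>>0. \<exists>V. openin N V \<and> p \<in> V \<and> (\<forall>s\<in>ball t \<delta>. \<forall>x\<in>V. fl s x \<in> W))"
    using p
  proof (induction t rule: fl_time_induct)
    case start
    show ?case
    proof (intro allI impI)
      fix W assume W: "openin N W" "fl 0 p \<in> W"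
      obtain U \<phi> where U: "(U, \<phi>) \<in> A" "p \<in> U" using chart_exists[OF p] by blast
      obtain R M L where fc: "flow_chart U \<phi> (\<phi> p) R M L" using flow_chart_exists[OF U] by blast
      then have "R > 0" by (simp add: flow_chart_def lipschitz_field_def)
      then show "\<exists>\<delta>>0. \<exists>V. openin N V \<and> p \<in> V \<and> (\<forall>s\<in>ball 0 \<delta>. \<forall>x\<in>V. fl s x \<in> W)"
        by (intro fl_jointly_continuous_near_0[OF fc U(2) _ _ W]) auto
    qed
  next
    case (step U \<phi> q R M L t t')
    show ?case
    proof (intro allI impI)
      fix W assume W: "openin N W" "fl t' p \<in> W"
      have "fl (t' - t) (fl t p) \<in> W" using W p by (simp add: fl_fl)
      then obtain \<delta> V where V: "\<delta> > 0" "openin N V" "fl t p \<in> V" "\<And>s y. s \<in> ball (t' - t) \<delta> \<Longrightarrow> y \<in> V \<Longrightarrow> fl s y \<in> W"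
        using fl_jointly_continuous_near_0[OF step(1,2,3,4) W(1)] by blast
      obtain \<delta>' V' where V': "\<delta>' > 0" "openin N V'" "p \<in> V'" "\<And>s y. s \<in> ball t \<delta>' \<Longrightarrow> y \<in> V' \<Longrightarrow> fl s y \<in> V"
        using step.IH[rule_format, OF V(2,3)] by blast
      have "fl s x \<in> W" if "s \<in> ball t' \<delta>" "x \<in> V'" for s x
      proof -
        have "fl t x \<in> V" using V'(4)[of t x] V'(1) that by simp
        moreover have "s - t \<in> ball (t' - t) \<delta>" using that by (simp add: dist_norm)
        ultimately have "fl (s - t) (fl t x) \<in> W" using V(4) by blast
        moreover have "x \<in> topspace N" using that V'(2) openin_subset by blast
        ultimately show ?thesis by (simp add: fl_fl)
      qed
      then show "\<exists>\<delta>>0. \<exists>V. openin N V \<and> p \<in> V \<and> (\<forall>s\<in>ball t' \<delta>. \<forall>x\<in>V. fl s x \<in> W)"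
        using V V' by blast
    qed
  qed
  then show ?thesis using W by blast
qed

lemma fl_continuous_map: "continuous_map N N (fl t)"
  unfolding continuous_map_def
proof (intro conjI allI impI)
  show "fl t \<in> topspace N \<rightarrow> topspace N" by simp
  fix W assume W: "openin N W"
  show "openin N {x \<in> topspace N. fl t x \<in> W}"
    unfolding openin_subopen[of N "{x \<in> topspace N. fl t x \<in> W}"]
  proof
    fix x assume "x \<in> {x \<in> topspace N. fl t x \<in> W}"
    then obtain \<delta> V where "\<delta> > 0" "openin N V" "x \<in> V" "\<forall>s\<in>ball t \<delta>. \<forall>y\<in>V. fl s y \<in> W"
      using fl_jointly_continuous[of x W t] W by blast
    then show "\<exists>T. openin N T \<and> x \<in> T \<and> T \<subseteq> {x \<in> topspace N. fl t x \<in> W}"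
      using openin_subset by (intro exI[of _ V]) fastforce
  qed
qed

lemma flow_chart_hcurve:
  assumes fc: "flow_chart U \<phi> q R M L" and \<kappa>: "hcurve \<kappa> V" "\<And>z. z \<in> V \<Longrightarrow> \<kappa> z \<in> U \<and> \<phi> (\<kappa> z) \<in> cball q (R / 2)"
    and t: "norm t * M < R / 2"
  shows "hcurve (\<lambda>z. fl t (\<kappa> z)) V"
proof -
  have U: "(U, \<phi>) \<in> A" and sub: "cball q R \<subseteq> \<phi> ` U" using fc by (auto simp: flow_chart_def)
  interpret lipschitz_field "coord_field U \<phi>" q R M L using fc by (simp add: flow_chart_def)
  have V: "open V" using \<kappa> by (simp add: hcurve_def)
  have zN: "\<kappa> z \<in> topspace N" if "z \<in> V" for z using \<kappa>(2)[OF that] chart_subset[OF U] by blast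
  have "(\<lambda>z. \<phi> (fl t (\<kappa> z)) $ i) holomorphic_on V" for i
  proof (rule solves_holomorphic_dependence[OF V sub coord_field_holo[OF U]])
    show "solves (\<lambda>s. \<phi> (fl s (\<kappa> z))) t" if "z \<in> V" for z
      using flow_chart_fl(1)[OF fc _ _ t] \<kappa>(2)[OF that] by blast
    show "(\<lambda>z. \<phi> (fl 0 (\<kappa> z)) $ i) holomorphic_on V" for i
    proof -
      have "(\<lambda>z. \<phi> (\<kappa> z) $ i) holomorphic_on V"
        by (rule hcurve_coordinate_holomorphic[OF \<kappa>(1) U]) (use \<kappa>(2) in blast)
      then show ?thesis by (rule holomorphic_transform) (simp add: zN)
    qed
  qed (use \<kappa>(2) zN t in auto)
  then have d: "\<exists>v. cvderiv (\<lambda>z. \<phi> (fl t (\<kappa> z))) v z" if "z \<in> V" for z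
    using cvderiv_holomorphic_iff[OF V, of "\<lambda>z. \<phi> (fl t (\<kappa> z))"] that by blast
  have fU: "fl t (\<kappa> z) \<in> U" if "z \<in> V" for z using flow_chart_fl(2)[OF fc _ _ t] \<kappa>(2)[OF that] by blast
  have "hcurve (inv_into U \<phi> \<circ> (\<lambda>z. \<phi> (fl t (\<kappa> z)))) V"
    by (rule hcurve_chart_inv[OF U V]) (use fU d in auto)
  then show ?thesis by (rule hcurve_cong) (use fU U in simp)
qed

text \<open>Holomorphy is local in the parameter: along the time induction the domain around a fixed
  \<open>z\<close> may shrink at every step, which does not affect the derivative at
  \<open>z\<close>.\<close>

lemma hcurve_fl:
  assumes \<kappa>: "hcurve \<kappa> V"
  shows "hcurve (\<lambda>z. fl t (\<kappa> z)) V"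
proof (rule hcurveI)
  show V: "open V" using \<kappa> by (simp add: hcurve_def)
  have kc: "continuous_map (top_of_set V) N \<kappa>" using \<kappa> by (simp add: hcurve_def)
  show "continuous_map (top_of_set V) N (\<lambda>z. fl t (\<kappa> z))"
    using continuous_map_compose[OF kc fl_continuous_map] by (simp add: o_def)
  fix z assume z: "z \<in> V"
  have p: "\<kappa> z \<in> topspace N" using kc z by (auto simp: continuous_map_def Pi_iff)
  have "\<exists>V'. z \<in> V' \<and> V' \<subseteq> V \<and> hcurve (\<lambda>z. fl t (\<kappa> z)) V'"
    using p
  proof (induction t rule: fl_time_induct)
    case start
    have "hcurve (\<lambda>z. fl 0 (\<kappa> z)) V"
      by (rule hcurve_cong[OF \<kappa>]) (use kc in \<open>auto simp: continuous_map_def Pi_iff\<close>)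
    then show ?case using z by blast
  next
    case (step U \<phi> q R M L t t')
    then obtain V' where V': "z \<in> V'" "V' \<subseteq> V" "hcurve (\<lambda>z. fl t (\<kappa> z)) V'" by blast
    have U: "(U, \<phi>) \<in> A" using step(1) by (simp add: flow_chart_def)
    define V'' where "V'' = {w \<in> V'. fl t (\<kappa> w) \<in> {x \<in> U. \<phi> x \<in> ball q (R / 2)}}"
    have "open V''" unfolding V''_def
      by (rule curve_preimage_open[OF _ _ chart_preimage_open[OF U]]) (use V' in \<open>auto simp: hcurve_def\<close>)
    then have "hcurve (\<lambda>z. fl t (\<kappa> z)) V''"
      by (rule hcurve_subset[OF V'(3)]) (auto simp: V''_def)
    then have "hcurve (\<lambda>z. fl (t' - t) (fl t (\<kappa> z))) V''"
      by (rule flow_chart_hcurve[OF step(1) _ _ step(4)]) (auto simp: V''_def)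
    moreover have "fl (t' - t) (fl t (\<kappa> w)) = fl t' (\<kappa> w)" if "w \<in> V''" for w
    proof -
      have "w \<in> V" using that V' by (auto simp: V''_def)
      then have "\<kappa> w \<in> topspace N" using kc by (auto simp: continuous_map_def Pi_iff)
      then show ?thesis by (simp add: fl_fl)
    qed
    ultimately have "hcurve (\<lambda>z. fl t' (\<kappa> z)) V''" by (rule hcurve_cong)
    moreover have "z \<in> V''" using V' step(2,3) by (simp add: V''_def)
    moreover have "V'' \<subseteq> V" using V' by (auto simp: V''_def)
    ultimately show ?case by blast
  qed
  then obtain V' where V': "z \<in> V'" "V' \<subseteq> V" "hcurve (\<lambda>z. fl t (\<kappa> z)) V'" by blast
  obtain U \<phi> where U: "(U, \<phi>) \<in> A" "fl t (\<kappa> z) \<in> U" using chart_exists[of "fl t (\<kappa> z)"] p by auto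
  then obtain v where "cvderiv (\<phi> \<circ> (\<lambda>z. fl t (\<kappa> z))) v z" using V' unfolding hcurve_def by blast
  then show "\<exists>U \<phi> v. (U, \<phi>) \<in> A \<and> fl t (\<kappa> z) \<in> U \<and> cvderiv (\<phi> \<circ> (\<lambda>z. fl t (\<kappa> z))) v z" using U by blast
qed

lemma fl_curve_jointly_continuous:
  assumes \<kappa>: "continuous_map Y N \<kappa>"
  shows "continuous_map (prod_topology euclidean Y) N (\<lambda>(t, y). fl t (\<kappa> y))"
  unfolding continuous_map_def
proof (intro conjI allI impI)
  show "(\<lambda>(t, y). fl t (\<kappa> y)) \<in> topspace (prod_topology euclidean Y) \<rightarrow> topspace N"
    using \<kappa> by (auto simp: continuous_map_def Pi_iff)
  fix W assume W: "openin N W"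
  let ?S = "{x \<in> topspace (prod_topology euclidean Y). (case x of (t, y) \<Rightarrow> fl t (\<kappa> y)) \<in> W}"
  have "\<exists>T. openin (prod_topology euclidean Y) T \<and> x \<in> T \<and> T \<subseteq> ?S" if x: "x \<in> ?S" for x
  proof -
    obtain t y where ty: "x = (t, y)" "y \<in> topspace Y" "fl t (\<kappa> y) \<in> W" using x by auto
    then have "\<kappa> y \<in> topspace N" using \<kappa> by (auto simp: continuous_map_def Pi_iff)
    then obtain \<delta> V where V: "\<delta> > 0" "openin N V" "\<kappa> y \<in> V" "\<forall>s\<in>ball t \<delta>. \<forall>x\<in>V. fl s x \<in> W"
      using fl_jointly_continuous[OF _ W ty(3)] by blast
    have "openin (prod_topology euclidean Y) (ball t \<delta> \<times> {y \<in> topspace Y. \<kappa> y \<in> V})"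
      using openin_continuous_map_preimage[OF \<kappa> V(2)] by (simp add: openin_prod_Times_iff)
    moreover have "x \<in> ball t \<delta> \<times> {y \<in> topspace Y. \<kappa> y \<in> V}" using V ty by simp
    moreover have "ball t \<delta> \<times> {y \<in> topspace Y. \<kappa> y \<in> V} \<subseteq> ?S" using V by auto
    ultimately show ?thesis by blast
  qed
  then show "openin (prod_topology euclidean Y) ?S" using openin_subopen[of _ ?S] by blast
qed

subsection \<open>Singular and regular points\<close>

definition regular_points :: "'a set" where
  "regular_points = topspace N - sing N A X"

lemma frechet_transition_zero:
  assumes "(U, \<phi>) \<in> A" "(V, \<psi>) \<in> A" "p \<in> U" "p \<in> V"
  shows "frechet_derivative (\<psi> \<circ> inv_into U \<phi>) (at (\<phi> p)) 0 = 0"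
proof -
  obtain D where D: "complex_linear D" "((\<psi> \<circ> inv_into U \<phi>) has_derivative D) (at (\<phi> p))"
    using transition_holo[OF assms(1,2)] assms by (auto simp: holo_on_def)
  then show ?thesis using frechet_derivative_at[OF D(2)] by (auto simp: complex_linear_def linear_0)
qed

lemma field_zero_chart_change:
  assumes "(U, \<phi>) \<in> A" "(V, \<psi>) \<in> A" "p \<in> U" "p \<in> V" "X (U, \<phi>) p = 0"
  shows "X (V, \<psi>) p = 0"
proof -
  have "X (V, \<psi>) p = frechet_derivative (\<psi> \<circ> inv_into U \<phi>) (at (\<phi> p)) (X (U, \<phi>) p)"
    using vf assms unfolding holomorphic_vector_field_def by blast
  then show ?thesis using frechet_transition_zero[OF assms(1-4)] assms(5) by simp
qed

lemma sing_iff: "(U, \<phi>) \<in> A \<Longrightarrow> p \<in> U \<Longrightarrow> p \<in> sing N A X \<longleftrightarrow> X (U, \<phi>) p = 0"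
  using field_zero_chart_change[of U \<phi> _ _ p] chart_subset unfolding sing_def by fast

lemma fl_sing: "p \<in> sing N A X \<Longrightarrow> fl t p = p"
proof -
  assume p: "p \<in> sing N A X"
  then have pN: "p \<in> topspace N" by (simp add: sing_def)
  have "integral_curve N A X (\<lambda>t. p)"
    unfolding integral_curve_def
  proof (intro conjI allI ballI)
    show "continuous_map euclidean N (\<lambda>t. p)" using pN by simp
    fix s c assume c: "c \<in> A"
    obtain U \<phi> where "c = (U, \<phi>)" by (cases c)
    then show "case c of (U, \<phi>) \<Rightarrow> p \<in> U \<longrightarrow> cvderiv (\<phi> \<circ> (\<lambda>t. p)) (X (U, \<phi>) p) s"
      using c p by (auto simp: sing_def o_def)
  qed
  from fl_eq[OF this] show ?thesis .
qed

lemma fl_regular [simp]: "p \<in> regular_points \<Longrightarrow> fl t p \<in> regular_points"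
proof -
  assume p: "p \<in> regular_points"
  then have pN: "p \<in> topspace N" "p \<notin> sing N A X" by (auto simp: regular_points_def)
  have "fl t p \<notin> sing N A X"
  proof
    assume "fl t p \<in> sing N A X"
    then have "fl (- t) (fl t p) = fl t p" by (rule fl_sing)
    then show False using pN \<open>fl t p \<in> sing N A X\<close> by simp
  qed
  then show ?thesis using pN by (simp add: regular_points_def)
qed

lemma regular_in [simp]: "p \<in> regular_points \<Longrightarrow> p \<in> topspace N"
  by (simp add: regular_points_def)

lemma openin_regular: "openin N regular_points"
proof -
  have "\<exists>T. openin N T \<and> p \<in> T \<and> T \<subseteq> regular_points" if p: "p \<in> regular_points" for p
  proof -
    obtain U \<phi> where U: "(U, \<phi>) \<in> A" "p \<in> U" using chart_exists regular_in[OF p] by blast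
    define O' where "O' = \<phi> ` U \<inter> coord_field U \<phi> -` (- {0})"
    have "open O'" unfolding O'_def
      by (rule continuous_open_preimage[OF holo_on_imp_continuous_on[OF coord_field_holo[OF U(1)]] chart_image_open[OF U(1)]]) auto
    then have "openin N {x \<in> U. \<phi> x \<in> O'}" by (rule chart_preimage_open[OF U(1)])
    moreover have "x \<in> regular_points \<longleftrightarrow> \<phi> x \<in> O'" if "x \<in> U" for x
      using that U sing_iff[OF U(1) that] chart_subset[OF U(1)] by (auto simp: O'_def regular_points_def)
    ultimately show ?thesis using U p by (intro exI[of _ "{x \<in> U. \<phi> x \<in> O'}"]) auto
  qed
  then show ?thesis using openin_subopen[of N regular_points] by blast
qed

subsection \<open>Flow boxes\<close>

text \<open>The flow is translation of the first coordinate at speed \<open>c\<close>, as long as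
  that coordinate stays in the unit disc. The factor \<open>c\<close> records the rescaling that
  makes the image the unit polydisc required of foliated charts.\<close>

definition flow_box :: "'a set \<Rightarrow> ('a \<Rightarrow> complex^2) \<Rightarrow> complex \<Rightarrow> bool" where
  "flow_box W \<xi> c \<longleftrightarrow> (W, \<xi>) \<in> A \<and> c \<noteq> 0 \<and> \<xi> ` W = polydisc 1 \<and>
     (\<forall>x\<in>W. \<forall>t. norm (\<xi> x $ 1 + c * t) < 1 \<longrightarrow> fl t x \<in> W \<and> \<xi> (fl t x) = pt (\<xi> x $ 1 + c * t) (\<xi> x $ 2))"

text \<open>A complex line transverse to the field at \<open>q\<close> is swept out by the flow;
  time and line parameter are the new coordinates. The sweep is jointly continuous and holomorphic
  in each parameter, so the parametrisation lemma inverts it, and scaling by \<open>1 / r\<close>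
  produces the unit polydisc.\<close>

lemma flow_box_exists:
  assumes q: "q \<in> regular_points" and W0: "openin N W0" "q \<in> W0"
  obtains W \<xi> c where "flow_box W \<xi> c" "q \<in> W" "\<xi> q = 0" "W \<subseteq> W0"
proof -
  have qN: "q \<in> topspace N" using q by simp
  obtain U \<phi> where U: "(U, \<phi>) \<in> A" "q \<in> U" using chart_exists[OF qN] by blast
  define a where "a = X (U, \<phi>) q"
  have a0: "a \<noteq> 0" using q sing_iff[OF U] by (simp add: a_def regular_points_def)
  \<comment> \<open>A coordinate vector that is not a multiple of the field vector
    \<open>a\<close>.\<close>
  define b where "b = (if a $ 1 \<noteq> 0 then pt 0 1 else pt 1 0)"
  have indep: "s = 0 \<and> t = 0" if st: "s *s a + t *s b = 0" for s t
    using st a0 by (auto simp: b_def vec_eq_iff forall_2 split: if_splits)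
  have normb: "norm b \<le> 1" using norm_le_component_sum[of b] by (simp add: b_def split: if_splits)
  obtain R M L where fc: "flow_chart U \<phi> (\<phi> q) R M L" using flow_chart_exists[OF U] by blast
  interpret lipschitz_field "coord_field U \<phi>" "\<phi> q" R M L using fc by (simp add: flow_chart_def)
  have sub: "cball (\<phi> q) R \<subseteq> \<phi> ` U" using fc by (simp add: flow_chart_def)
  \<comment> \<open>The first bound keeps the starting line in the half ball, the second keeps the
    flow times admissible for the flow chart.\<close>
  define \<rho> where "\<rho> = min (R / 2) (R / (2 * M))"
  have rho: "\<rho> > 0" using R_pos M_pos by (simp add: \<rho>_def)
  define B where "B = ball (0::complex) \<rho>"
  define e where "e z = \<phi> q + z *s b" for z
  define \<sigma> where "\<sigma> z = inv_into U \<phi> (e z)" for z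
  have eb: "e z \<in> ball (\<phi> q) (R / 2)" if "z \<in> B" for z
  proof -
    have "norm z * norm b \<le> norm z" using normb by (simp add: mult_left_le)
    moreover have "norm z < R / 2" using that by (simp add: B_def \<rho>_def)
    ultimately have "norm (z *s b) < R / 2" by simp
    then show ?thesis by (simp add: e_def dist_norm)
  qed
  have eU: "e z \<in> \<phi> ` U" if "z \<in> B" for z using eb[OF that] sub R_pos by fastforce
  have e_der: "cvderiv e b z" for z
    unfolding e_def by (auto intro!: derivative_eq_intros bounded_linear_imp_has_derivative
          bounded_linear_vector_scalar_mult_left)
  have "hcurve (inv_into U \<phi> \<circ> e) B"
    by (rule hcurve_chart_inv[OF U(1)]) (use eU e_der in \<open>auto simp: B_def\<close>)
  then have \<sigma>: "hcurve \<sigma> B" by (simp add: \<sigma>_def[abs_def] o_def)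
  have \<sigma>U: "\<sigma> z \<in> U" "\<phi> (\<sigma> z) = e z" if "z \<in> B" for z
    using eU[OF that] by (auto simp: \<sigma>_def inv_into_into f_inv_into_f)
  have tM: "norm t * M < R / 2" if "t \<in> B" for t
    using that M_pos by (simp add: B_def \<rho>_def field_simps)
  have fU: "fl t (\<sigma> z) \<in> U" if "t \<in> B" "z \<in> B" for t z
    using flow_chart_fl(2)[OF fc \<sigma>U(1) _ tM] that \<sigma>U(2) eb[of z] by simp
  have \<sigma>N: "\<sigma> z \<in> topspace N" if "z \<in> B" for z using \<sigma>U(1)[OF that] chart_subset[OF U(1)] by blast
  define P where "P t z = \<phi> (fl t (\<sigma> z))" for t z
  have zB: "0 \<in> B" using rho by (simp add: B_def)
  have contP: "continuous_on (B \<times> B) (\<lambda>(t, z). P t z)"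
  proof -
    have "continuous_map (top_of_set B) N \<sigma>" using \<sigma> by (simp add: hcurve_def)
    from fl_curve_jointly_continuous[OF this]
    have "continuous_map (subtopology (prod_topology euclidean (top_of_set B)) (B \<times> B)) N (\<lambda>(t, y). fl t (\<sigma> y))"
      by (rule continuous_map_from_subtopology)
    then have c: "continuous_map (top_of_set (B \<times> B)) N (\<lambda>(t, y). fl t (\<sigma> y))"
      by (simp add: prod_topology_subtopology subtopology_subtopology euclidean_product_topology Times_Int_Times)
    have "continuous_map (top_of_set (B \<times> B)) (subtopology N U) (\<lambda>(t, y). fl t (\<sigma> y))"
      using c fU by (auto simp: continuous_map_in_subtopology)
    from continuous_map_compose[OF this chart_continuous[OF U(1)]]
    have "continuous_on (B \<times> B) (\<phi> \<circ> (\<lambda>(t, y). fl t (\<sigma> y)))" by simp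
    then show ?thesis by (simp add: P_def o_def case_prod_unfold)
  qed
  have h1: "(\<lambda>t. P t z $ i) holomorphic_on B" if z: "z \<in> B" for z i
  proof -
    have "\<forall>t\<in>B. \<exists>v. cvderiv (\<lambda>t. P t z) v t"
      unfolding P_def using fl_deriv[OF \<sigma>N[OF z] U(1) fU[OF _ z]] by blast
    then show ?thesis using cvderiv_holomorphic_iff[of B "\<lambda>t. P t z"] by (simp add: B_def)
  qed
  have h2: "(\<lambda>z. P t z $ i) holomorphic_on B" if t: "t \<in> B" for t i
    unfolding P_def
    by (rule hcurve_coordinate_holomorphic[OF hcurve_fl[OF \<sigma>] U(1)]) (use fU[OF t] in blast)
  have \<sigma>0: "\<sigma> 0 = q" using U by (simp add: \<sigma>_def e_def)
  have da: "cvderiv (\<lambda>t. P t 0) a 0"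
    unfolding P_def \<sigma>0 a_def using fl_deriv[OF qN U(1), of 0] U(2) qN by simp
  have db: "cvderiv (P 0) b 0"
  proof (rule has_derivative_transform_within_open[OF e_der[of 0], of B])
    show "e z = P 0 z" if "z \<in> B" for z using \<sigma>U(2)[OF that] \<sigma>N[OF that] by (simp add: P_def)
  qed (use zB in \<open>auto simp: B_def\<close>)
  define G where "G v = P (v $ 1) (v $ 2)" for v :: "complex^2"
  obtain r0 where r0: "0 < r0" "\<And>r. 0 < r \<Longrightarrow> r \<le> r0 \<Longrightarrow>
      inj_on G (polydisc r) \<and> open (G ` polydisc r) \<and> holo_on G (polydisc r) \<and>
      holo_on (inv_into (polydisc r) G) (G ` polydisc r)"
    by (rule local_biholomorphism_of_parametrisation[OF rho contP[unfolded B_def] h1[unfolded B_def]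
          h2[unfolded B_def] da db indep, folded G_def[abs_def]]) (assumption | blast)+
  have "continuous_on (polydisc \<rho>) G"
    unfolding G_def
    by (rule continuous_on_compose2[OF contP, of _ "\<lambda>v. (v $ 1, v $ 2)", simplified])
       (auto simp: B_def mem_polydisc intro!: continuous_intros)
  then have "open (polydisc \<rho> \<inter> G -` (\<phi> ` (U \<inter> W0)))"
    by (rule continuous_open_preimage[OF _ open_polydisc chart_image_of_open[OF U(1) W0(1)]])
  moreover have "0 \<in> polydisc \<rho> \<inter> G -` (\<phi> ` (U \<inter> W0))"
    using rho U W0 qN by (auto simp: mem_polydisc G_def P_def \<sigma>0)
  ultimately obtain \<delta> where \<delta>: "\<delta> > 0" "ball 0 \<delta> \<subseteq> polydisc \<rho> \<inter> G -` (\<phi> ` (U \<inter> W0))"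
    using open_contains_ball by blast
  define r where "r = min r0 (\<delta> / 2)"
  have r: "r > 0" "r \<le> r0" using r0 \<delta> by (auto simp: r_def)
  have rsub: "polydisc r \<subseteq> ball 0 \<delta>"
  proof
    fix v assume "v \<in> polydisc r"
    then show "v \<in> ball 0 \<delta>" using norm_le_component_sum[of v] by (simp add: mem_polydisc r_def)
  qed
  have pB: "v $ 1 \<in> B" "v $ 2 \<in> B" if "v \<in> polydisc r" for v
  proof -
    have "v \<in> polydisc \<rho>" using that rsub \<delta> by blast
    then show "v $ 1 \<in> B" "v $ 2 \<in> B" by (simp_all add: B_def mem_polydisc)
  qed
  note Gr = r0(2)[OF r]
  define O' where "O' = G ` polydisc r"
  define \<eta> where "\<eta> y = of_real (1 / r) *s inv_into (polydisc r) G y" for y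
  have O'_sub: "O' \<subseteq> \<phi> ` (U \<inter> W0)" using rsub \<delta> unfolding O'_def by blast
  have \<eta>G: "\<eta> (G v) = of_real (1 / r) *s v" if "v \<in> polydisc r" for v
    using Gr that by (simp add: \<eta>_def)
  have sc: "of_real r *s (of_real (1 / r) *s v) = v" "of_real (1 / r) *s (of_real r *s v) = v" for v :: "complex^2"
    using r by (simp_all add: vec_eq_iff)
  have pd: "of_real r *s v \<in> polydisc r \<longleftrightarrow> v \<in> polydisc 1" for v
    using r by (simp add: mem_polydisc norm_mult)
  have pd': "of_real (1 / r) *s v \<in> polydisc 1 \<longleftrightarrow> v \<in> polydisc r" for v :: "complex^2"
    using pd[of "of_real (1 / r) *s v"] sc by simp
  have im\<eta>: "\<eta> ` O' = polydisc 1"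
  proof (intro equalityI subsetI)
    fix y assume "y \<in> \<eta> ` O'"
    then obtain v where "v \<in> polydisc r" "y = \<eta> (G v)" by (auto simp: O'_def)
    then show "y \<in> polydisc 1" using \<eta>G pd' by simp
  next
    fix y assume "y \<in> polydisc 1"
    then have v: "of_real r *s y \<in> polydisc r" using pd by simp
    then have "y = \<eta> (G (of_real r *s y))" using \<eta>G sc by simp
    then show "y \<in> \<eta> ` O'" using v unfolding O'_def by blast
  qed
  have inj\<eta>: "inj_on \<eta> O'"
  proof (rule inj_onI)
    fix x y assume "x \<in> O'" "y \<in> O'" "\<eta> x = \<eta> y"
    then obtain v w where "v \<in> polydisc r" "w \<in> polydisc r" "x = G v" "y = G w" "\<eta> (G v) = \<eta> (G w)"
      by (auto simp: O'_def)
    then show "x = y" using \<eta>G sc(1) by metis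
  qed
  have scale_holo: "holo_on (\<lambda>v :: complex^2. k *s v) T" for k T
  proof -
    have "complex_linear (\<lambda>v :: complex^2. k *s v)"
      unfolding complex_linear_def using bounded_linear.linear[OF bounded_linear_vector_scalar_mult_right]
      by (simp add: vector_smult_assoc mult.commute)
    then show ?thesis unfolding holo_on_def
      using bounded_linear_imp_has_derivative[OF bounded_linear_vector_scalar_mult_right] by blast
  qed
  have holo\<eta>: "holo_on \<eta> O'"
    using holo_on_compose[of "inv_into (polydisc r) G" O' "\<lambda>v. of_real (1 / r) *s v" UNIV] Gr scale_holo
    unfolding \<eta>_def[abs_def] O'_def o_def by blast
  have inv\<eta>: "inv_into O' \<eta> y = G (of_real r *s y)" if "y \<in> polydisc 1" for y
  proof (rule inv_into_f_eq[OF inj\<eta>])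
    show "G (of_real r *s y) \<in> O'" using that pd unfolding O'_def by blast
    show "\<eta> (G (of_real r *s y)) = y" using that pd \<eta>G sc by simp
  qed
  have "holo_on (G \<circ> (\<lambda>v. of_real r *s v)) (polydisc 1)"
    by (rule holo_on_compose[OF scale_holo, of G "polydisc r"]) (use Gr pd in auto)
  then have holoinv: "holo_on (inv_into O' \<eta>) (\<eta> ` O')"
    unfolding im\<eta> by (rule holo_on_cong[OF _ open_polydisc]) (simp add: inv\<eta>)
  define W where "W = {x \<in> U. \<phi> x \<in> O'}"
  define \<xi> where "\<xi> = \<eta> \<circ> \<phi>"
  have WA: "(W, \<xi>) \<in> A" unfolding W_def \<xi>_def
    by (rule chart_reparametrise[OF U(1)]) (use Gr O'_sub inj\<eta> im\<eta> holo\<eta> holoinv in \<open>auto simp: O'_def\<close>)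
  have W_rep: "\<exists>v\<in>polydisc r. x = fl (v $ 1) (\<sigma> (v $ 2)) \<and> \<xi> x = of_real (1 / r) *s v" if "x \<in> W" for x
  proof -
    have x: "x \<in> U" "\<phi> x \<in> O'" using that by (auto simp: W_def)
    then obtain v where v: "v \<in> polydisc r" "\<phi> x = G v" by (auto simp: O'_def)
    have "v $ 1 \<in> B" "v $ 2 \<in> B" using v pB by auto
    then have "x = fl (v $ 1) (\<sigma> (v $ 2))"
      using v(2) x(1) fU chart_inj[OF U(1)] unfolding G_def P_def by (meson inj_onD)
    then show ?thesis using v \<eta>G by (auto simp: \<xi>_def)
  qed
  have W_mem: "fl (v $ 1) (\<sigma> (v $ 2)) \<in> W \<and> \<xi> (fl (v $ 1) (\<sigma> (v $ 2))) = of_real (1 / r) *s v" if v: "v \<in> polydisc r" for v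
  proof -
    have "v $ 1 \<in> B" "v $ 2 \<in> B" using v pB by auto
    moreover have "\<phi> (fl (v $ 1) (\<sigma> (v $ 2))) = G v" by (simp add: G_def P_def)
    ultimately show ?thesis using v \<eta>G fU by (auto simp: W_def \<xi>_def O'_def)
  qed
  have "flow_box W \<xi> (of_real (1 / r))"
    unfolding flow_box_def
  proof (intro conjI WA ballI allI impI)
    show "complex_of_real (1 / r) \<noteq> 0" using r by simp
    show "\<xi> ` W = polydisc 1"
    proof -
      have "\<phi> ` W = O'" using O'_sub by (auto simp: W_def)
      then show ?thesis unfolding \<xi>_def using im\<eta> by (metis image_comp)
    qed
    fix x t assume x: "x \<in> W" and t: "norm (\<xi> x $ 1 + of_real (1 / r) * t) < 1"
    obtain v where v: "v \<in> polydisc r" "x = fl (v $ 1) (\<sigma> (v $ 2))" "\<xi> x = of_real (1 / r) *s v"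
      using W_rep[OF x] by blast
    have v2: "v $ 2 \<in> B" using v pB by auto
    \<comment> \<open>Flowing for time \<open>t\<close> adds \<open>t\<close> to the first parameter
      and fixes the second.\<close>
    define w where "w = pt (v $ 1 + t) (v $ 2)"
    have wx: "of_real (1 / r) *s w = pt (\<xi> x $ 1 + of_real (1 / r) * t) (\<xi> x $ 2)"
      using v(3) by (simp add: w_def vec_eq_iff forall_2 add_divide_distrib)
    moreover have "norm (\<xi> x $ 2) < 1" using v(1,3) pd' by (metis mem_polydisc)
    ultimately have "w \<in> polydisc r" using t pd'[of w] by (simp add: mem_polydisc)
    from W_mem[OF this] have "fl (v $ 1 + t) (\<sigma> (v $ 2)) \<in> W"
      "\<xi> (fl (v $ 1 + t) (\<sigma> (v $ 2))) = pt (\<xi> x $ 1 + of_real (1 / r) * t) (\<xi> x $ 2)"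
      using wx by (simp_all add: w_def)
    moreover have "fl t x = fl (v $ 1 + t) (\<sigma> (v $ 2))" using v \<sigma>N[OF v2] by (simp add: fl_fl)
    ultimately show "fl t x \<in> W" "\<xi> (fl t x) = pt (\<xi> x $ 1 + of_real (1 / r) * t) (\<xi> x $ 2)" by simp_all
  qed
  moreover have "q \<in> W \<and> \<xi> q = 0"
    using W_mem[of 0] r \<sigma>0 qN by (simp add: mem_polydisc)
  moreover have "W \<subseteq> W0"
  proof
    fix x assume "x \<in> W"
    then have "x \<in> U" "\<phi> x \<in> \<phi> ` (U \<inter> W0)" using O'_sub by (auto simp: W_def)
    then show "x \<in> W0" using chart_inj[OF U(1)] by (auto simp: inj_on_def)
  qed
  ultimately show ?thesis using that by blast
qed

lemma flow_box_chart: "flow_box W \<xi> c \<Longrightarrow> (W, \<xi>) \<in> A"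
  and flow_box_nonzero: "flow_box W \<xi> c \<Longrightarrow> c \<noteq> 0"
  and flow_box_image: "flow_box W \<xi> c \<Longrightarrow> \<xi> ` W = polydisc 1"
  by (simp_all add: flow_box_def)

lemma flow_box_fl:
  assumes "flow_box W \<xi> c" "x \<in> W" "norm (\<xi> x $ 1 + c * t) < 1"
  shows "fl t x \<in> W" "\<xi> (fl t x) = pt (\<xi> x $ 1 + c * t) (\<xi> x $ 2)"
  using assms unfolding flow_box_def by blast+

lemma flow_box_coord_norm: "flow_box W \<xi> c \<Longrightarrow> x \<in> W \<Longrightarrow> norm (\<xi> x $ i) < 1"
  using flow_box_image[of W \<xi> c] unfolding polydisc_def by blast

lemma flow_box_subset: "flow_box W \<xi> c \<Longrightarrow> W \<subseteq> topspace N"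
  using chart_subset flow_box_chart by blast

lemma flow_box_field:
  assumes b: "flow_box W \<xi> c" and x: "x \<in> W"
  shows "X (W, \<xi>) x = pt c 0"
proof -
  have xN: "x \<in> topspace N" using flow_box_subset[OF b] x by blast
  have "cvderiv (\<lambda>t. \<xi> (fl t x)) (X (W, \<xi>) (fl 0 x)) 0"
    by (rule fl_deriv[OF xN flow_box_chart[OF b]]) (use x xN in simp)
  then have 1: "cvderiv (\<lambda>t. \<xi> (fl t x)) (X (W, \<xi>) x) 0" using xN by simp
  have 2: "cvderiv (\<lambda>t. \<xi> (fl t x)) (pt c 0) 0"
  proof (rule has_derivative_transform_within_open[of "\<lambda>t. pt (\<xi> x $ 1 + c * t) (\<xi> x $ 2)"])
    show "cvderiv (\<lambda>t. pt (\<xi> x $ 1 + c * t) (\<xi> x $ 2)) (pt c 0) 0"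
      unfolding cvderiv_iff by (auto simp: forall_2 intro!: derivative_eq_intros)
    show "open {t. norm (\<xi> x $ 1 + c * t) < 1}" by (intro open_Collect_less continuous_intros)
  qed (use flow_box_fl[OF b x] flow_box_coord_norm[OF b x] in auto)
  show ?thesis by (rule cvderiv_unique[OF 1 2])
qed

lemma flow_box_foliated: "flow_box W \<xi> c \<Longrightarrow> foliated_chart A X (W, \<xi>)"
  unfolding foliated_chart_def using flow_box_chart flow_box_image flow_box_field flow_box_nonzero
  by (auto simp: polydisc_def)

lemma flow_box_regular: "flow_box W \<xi> c \<Longrightarrow> W \<subseteq> regular_points"
proof
  fix x assume b: "flow_box W \<xi> c" and x: "x \<in> W"
  have "X (W, \<xi>) x \<noteq> 0" using flow_box_field[OF b x] flow_box_nonzero[OF b] by (simp add: vec_eq_iff forall_2)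
  then show "x \<in> regular_points"
    using sing_iff[OF flow_box_chart[OF b] x] flow_box_subset[OF b] x by (auto simp: regular_points_def)
qed

definition slice :: "'a set \<Rightarrow> ('a \<Rightarrow> complex^2) \<Rightarrow> complex \<Rightarrow> 'a" where
  "slice W \<xi> z = inv_into W \<xi> (pt 0 z)"

lemma slice_in: "flow_box W \<xi> c \<Longrightarrow> norm z < 1 \<Longrightarrow> slice W \<xi> z \<in> W"
  and slice_coord: "flow_box W \<xi> c \<Longrightarrow> norm z < 1 \<Longrightarrow> \<xi> (slice W \<xi> z) = pt 0 z"
proof -
  assume "flow_box W \<xi> c" "norm z < 1"
  then have "pt 0 z \<in> \<xi> ` W" by (simp add: flow_box_image mem_polydisc)
  then show "slice W \<xi> z \<in> W" "\<xi> (slice W \<xi> z) = pt 0 z"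
    unfolding slice_def by (rule inv_into_into, rule f_inv_into_f)
qed

lemma slice_regular: "flow_box W \<xi> c \<Longrightarrow> norm z < 1 \<Longrightarrow> slice W \<xi> z \<in> regular_points"
  using slice_in flow_box_regular by blast

lemma flow_box_eqI: "flow_box W \<xi> c \<Longrightarrow> x \<in> W \<Longrightarrow> y \<in> W \<Longrightarrow> \<xi> x = \<xi> y \<Longrightarrow> x = y"
  using chart_inj[OF flow_box_chart] by (auto simp: inj_on_def)

lemma slice_unique: "flow_box W \<xi> c \<Longrightarrow> x \<in> W \<Longrightarrow> \<xi> x = pt 0 z \<Longrightarrow> slice W \<xi> z = x"
  unfolding slice_def by (metis flow_box_chart chart_inv)

lemma slice_hcurve:
  assumes b: "flow_box W \<xi> c"
  shows "hcurve (slice W \<xi>) (ball 0 1)"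
proof -
  have "hcurve (inv_into W \<xi> \<circ> (\<lambda>z. pt 0 z)) (ball 0 1)"
  proof (rule hcurve_chart_inv[OF flow_box_chart[OF b]])
    show "pt 0 z \<in> \<xi> ` W" if "z \<in> ball 0 1" for z using that by (simp add: flow_box_image[OF b] mem_polydisc)
    have "cvderiv (\<lambda>z. pt 0 z) (pt 0 1) z" for z
      unfolding cvderiv_iff by (auto simp: forall_2 intro!: derivative_eq_intros)
    then show "\<exists>v. cvderiv (\<lambda>z. pt 0 z) v z" for z by blast
  qed simp
  then show ?thesis by (simp add: slice_def[abs_def] o_def)
qed

lemma flow_box_slice:
  assumes b: "flow_box W \<xi> c" and x: "x \<in> W"
  shows "fl (\<xi> x $ 1 / c) (slice W \<xi> (\<xi> x $ 2)) = x" "fl (- (\<xi> x $ 1 / c)) x = slice W \<xi> (\<xi> x $ 2)"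
proof -
  have xN: "x \<in> topspace N" using flow_box_subset[OF b] x by blast
  have "norm (\<xi> x $ 1 + c * - (\<xi> x $ 1 / c)) < 1" using flow_box_nonzero[OF b] by simp
  from flow_box_fl[OF b x this] have "fl (- (\<xi> x $ 1 / c)) x \<in> W" "\<xi> (fl (- (\<xi> x $ 1 / c)) x) = pt 0 (\<xi> x $ 2)"
    using flow_box_nonzero[OF b] by simp_all
  then show 1: "fl (- (\<xi> x $ 1 / c)) x = slice W \<xi> (\<xi> x $ 2)" by (rule slice_unique[OF b, symmetric])
  show "fl (\<xi> x $ 1 / c) (slice W \<xi> (\<xi> x $ 2)) = x"
    unfolding 1[symmetric] using xN by simp
qed

lemma period_iff_fl: "x \<in> topspace N \<Longrightarrow> fl t (fl s x) = fl s x \<longleftrightarrow> fl t x = x"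
proof -
  assume x: "x \<in> topspace N"
  have "fl t (fl s x) = fl s (fl t x)" using x by (simp add: fl_fl add.commute)
  then show ?thesis using fl_inverse(1)[OF fl_in[OF x], of s t] fl_inverse(1)[OF x, of s] by metis
qed

lemma fl_in_orbit_iff:
  assumes q: "q \<in> topspace N" and x: "x \<in> topspace N"
  shows "fl t x \<in> orbit N A X q \<longleftrightarrow> x \<in> orbit N A X q"
proof
  assume "fl t x \<in> orbit N A X q"
  then obtain s where "fl t x = fl s q" using orbit_eq[OF q] by blast
  then have "x = fl (- t) (fl s q)" using fl_inverse(1)[OF x, of t] by simp
  then show "x \<in> orbit N A X q" using orbit_eq[OF q] fl_fl[OF q] by simp
next
  assume "x \<in> orbit N A X q"
  then show "fl t x \<in> orbit N A X q" using orbit_eq[OF q] fl_fl[OF q] by auto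
qed

lemma flow_box_neighbourhood:
  assumes b: "flow_box W \<xi> c" and z0: "norm z0 < 1" and e: "e > 0"
  shows "openin N {x \<in> W. norm (\<xi> x $ 1) < e \<and> norm (\<xi> x $ 2 - z0) < e}"
    and "slice W \<xi> z0 \<in> {x \<in> W. norm (\<xi> x $ 1) < e \<and> norm (\<xi> x $ 2 - z0) < e}"
proof -
  define O' where "O' = {v :: complex^2. norm (v $ 1) < e} \<inter> {v. norm (v $ 2 - z0) < e}"
  have "open O'" unfolding O'_def by (intro open_Int open_Collect_less continuous_intros)
  from chart_preimage_open[OF flow_box_chart[OF b] this]
  show "openin N {x \<in> W. norm (\<xi> x $ 1) < e \<and> norm (\<xi> x $ 2 - z0) < e}" by (simp add: O'_def)
  show "slice W \<xi> z0 \<in> {x \<in> W. norm (\<xi> x $ 1) < e \<and> norm (\<xi> x $ 2 - z0) < e}"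
    using slice_in[OF b z0] slice_coord[OF b z0] e by simp
qed

subsection \<open>Periods\<close>

text \<open>Short times translate the first coordinate of a flow box, so from the middle of the box
  no return within time \<open>1 / (2 * norm c)\<close> is possible unless the time is 0. The bound
  is uniform for nearby points.\<close>

lemma no_small_periods:
  assumes "q \<in> regular_points"
  obtains \<epsilon> V where "\<epsilon> > 0" "openin N V" "q \<in> V"
    "\<And>x t. x \<in> V \<Longrightarrow> norm t < \<epsilon> \<Longrightarrow> fl t x = x \<Longrightarrow> t = 0"
proof -
  obtain W \<xi> c where b: "flow_box W \<xi> c" and q: "q \<in> W" "\<xi> q = 0" and "W \<subseteq> topspace N"
    by (rule flow_box_exists[OF assms openin_topspace regular_in[OF assms]])
  define V where "V = {x \<in> W. norm (\<xi> x $ 1) < 1/2 \<and> norm (\<xi> x $ 2 - 0) < 1/2}"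
  have "openin N V" unfolding V_def by (rule flow_box_neighbourhood(1)[OF b]) auto
  moreover have "q \<in> V" using q by (simp add: V_def)
  moreover have "t = 0" if "x \<in> V" "norm t < 1 / (2 * norm c)" "fl t x = x" for x t
  proof -
    have "norm (c * t) < 1 / 2" using that(2) flow_box_nonzero[OF b] by (simp add: norm_mult field_simps)
    moreover have "norm (\<xi> x $ 1) < 1 / 2" "x \<in> W" using that by (auto simp: V_def)
    ultimately have "norm (\<xi> x $ 1 + c * t) < 1" using norm_triangle_ineq[of "\<xi> x $ 1" "c * t"] by linarith
    from flow_box_fl(2)[OF b \<open>x \<in> W\<close> this] that(3) have "c * t = 0"
      by (metis add_cancel_right_right vector_2(1))
    then show ?thesis using flow_box_nonzero[OF b] by simp
  qed
  ultimately show ?thesis using flow_box_nonzero[OF b] by (intro that[of "1 / (2 * norm c)" V]) auto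
qed

text \<open>Otherwise \<open>q\<close> and \<open>fl t q\<close> would have disjoint neighbourhoods,
  and joint continuity would keep nearby points from returning at nearby times.\<close>

lemma period_limit:
  assumes q: "q \<in> topspace N"
    and acc: "\<And>\<epsilon> V. \<epsilon> > 0 \<Longrightarrow> openin N V \<Longrightarrow> q \<in> V \<Longrightarrow> \<exists>x\<in>V. \<exists>t'\<in>ball t \<epsilon>. fl t' x = x"
  shows "fl t q = q"
proof (rule ccontr)
  assume "fl t q \<noteq> q"
  then obtain W1 W2 where W: "openin N W1" "openin N W2" "fl t q \<in> W1" "q \<in> W2" "disjnt W1 W2"
    using Hausdorff q fl_in[OF q] unfolding Hausdorff_space_def by metis
  obtain \<delta> V where V: "\<delta> > 0" "openin N V" "q \<in> V" "\<forall>s\<in>ball t \<delta>. \<forall>x\<in>V. fl s x \<in> W1"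
    using fl_jointly_continuous[OF q W(1,3)] by blast
  obtain x t' where "x \<in> V \<inter> W2" "t' \<in> ball t \<delta>" "fl t' x = x"
    using acc[OF V(1), of "V \<inter> W2"] V W by (metis IntI openin_Int)
  then show False using V(4) W(5) by (metis IntD1 IntD2 disjnt_iff)
qed

text \<open>The return map to the slice is holomorphic and has fixed points accumulating at \<open>z0\<close>, so it
  is the identity and the return time is a holomorphic period.\<close>

lemma period_function:
  assumes b: "flow_box W \<xi> c" and z0: "norm z0 < 1"
    and acc: "\<And>\<epsilon> V. \<epsilon> > 0 \<Longrightarrow> openin N V \<Longrightarrow> slice W \<xi> z0 \<in> V \<Longrightarrow>
      \<exists>x\<in>V \<inter> W. \<xi> x $ 2 \<noteq> z0 \<and> (\<exists>t'\<in>ball t \<epsilon>. fl t' x = x)"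
  obtains \<rho> \<tau> where "\<rho> > 0" "ball z0 \<rho> \<subseteq> ball 0 1" "\<tau> holomorphic_on ball z0 \<rho>" "\<tau> z0 = t"
    "\<And>x. x \<in> W \<Longrightarrow> \<xi> x $ 2 \<in> ball z0 \<rho> \<Longrightarrow> fl (\<tau> (\<xi> x $ 2)) x = x"
proof -
  have c: "c \<noteq> 0" by (rule flow_box_nonzero[OF b])
  have W: "(W, \<xi>) \<in> A" by (rule flow_box_chart[OF b])
  define q where "q = slice W \<xi> z0"
  have q: "q \<in> W" "\<xi> q = pt 0 z0" using slice_in[OF b z0] slice_coord[OF b z0] by (auto simp: q_def)
  have qN: "q \<in> topspace N" using q flow_box_subset[OF b] by blast
  have per: "fl t q = q"
  proof (rule period_limit[OF qN])
    fix \<epsilon> :: real and V assume "\<epsilon> > 0" "openin N V" "q \<in> V"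
    from acc[OF this[unfolded q_def]] show "\<exists>x\<in>V. \<exists>t'\<in>ball t \<epsilon>. fl t' x = x" by blast
  qed
  have hc: "hcurve (\<lambda>z. fl t (slice W \<xi> z)) (ball 0 1)" by (rule hcurve_fl[OF slice_hcurve[OF b]])
  define W' where "W' = {x \<in> W. norm (\<xi> x $ 1) < 1/2}"
  have "openin N {x \<in> W. \<xi> x \<in> {v. norm (v $ 1) < 1/2}}"
    by (rule chart_preimage_open[OF W]) (intro open_Collect_less continuous_intros)
  then have W'_open: "openin N W'" by (simp add: W'_def)
  have "open {z \<in> ball 0 1. fl t (slice W \<xi> z) \<in> W'}"
    by (rule curve_preimage_open[OF _ _ W'_open]) (use hc in \<open>auto simp: hcurve_def\<close>)
  moreover have "z0 \<in> {z \<in> ball 0 1. fl t (slice W \<xi> z) \<in> W'}"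
    using z0 per q by (simp add: W'_def flip: q_def)
  ultimately obtain \<rho> where \<rho>: "\<rho> > 0" "ball z0 \<rho> \<subseteq> {z \<in> ball 0 1. fl t (slice W \<xi> z) \<in> W'}"
    using open_contains_ball by blast
  define B where "B = ball z0 \<rho>"
  have B1: "norm z < 1" if "z \<in> B" for z using that \<rho> by (auto simp: B_def)
  define y where "y z = fl t (slice W \<xi> z)" for z
  have yW: "y z \<in> W" "norm (\<xi> (y z) $ 1) < 1/2" if "z \<in> B" for z
  proof -
    have "y z \<in> W'" using that \<rho> unfolding B_def y_def by blast
    then show "y z \<in> W" "norm (\<xi> (y z) $ 1) < 1/2" by (auto simp: W'_def)
  qed
  have "hcurve y B"
    unfolding y_def[abs_def] by (rule hcurve_subset[OF hc]) (use B1 in \<open>auto simp: B_def\<close>)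
  then have hol: "(\<lambda>z. \<xi> (y z) $ i) holomorphic_on B" for i
    by (rule hcurve_coordinate_holomorphic[OF _ W]) (use yW in blast)
  have y0: "y z0 = q" using per by (simp add: y_def q_def)
  have slN: "slice W \<xi> z \<in> topspace N" if "z \<in> B" for z using slice_in[OF b B1[OF that]] flow_box_subset[OF b] by blast
  have fix_dense: "\<exists>z\<in>B. z \<noteq> z0 \<and> dist z z0 < e \<and> \<xi> (y z) $ 2 - z = 0" if e: "e > 0" for e
  proof -
    define e' where "e' = min e \<rho>"
    have e': "e' > 0" using e \<rho> by (simp add: e'_def)
    define V where "V = {x \<in> W. norm (\<xi> x $ 1) < e' \<and> norm (\<xi> x $ 2 - z0) < e'}"
    obtain x t' where x: "x \<in> V" "x \<in> W" "\<xi> x $ 2 \<noteq> z0" "t' \<in> ball t (1 / (2 * norm c))" "fl t' x = x"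
      using acc[of "1 / (2 * norm c)" V] flow_box_neighbourhood[OF b z0 e'] c unfolding V_def by auto
    define z where "z = \<xi> x $ 2"
    have z: "dist z z0 < e'" "z \<noteq> z0" using x by (auto simp: V_def z_def dist_norm)
    have zB: "z \<in> B" using z by (simp add: B_def e'_def dist_commute)
    have xN: "x \<in> topspace N" using x flow_box_subset[OF b] by blast
    \<comment> \<open>Periods are constant along orbits, so the slice point on the plaque of
      \<open>x\<close> has the period \<open>t'\<close> too; after time \<open>t\<close> it is only
      a short time away from its return, hence on its own plaque.\<close>
    have "fl t' (slice W \<xi> z) = slice W \<xi> z"
      unfolding z_def flow_box_slice(2)[OF b x(2), symmetric] using x(5) by (simp add: period_iff_fl[OF xN])
    then have eq: "fl (t' - t) (y z) = slice W \<xi> z" using slN[OF zB] by (simp add: y_def fl_fl)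
    have "norm (t' - t) < 1 / (2 * norm c)" using x(4) by (simp add: dist_norm norm_minus_commute)
    then have "norm (c * (t' - t)) < 1/2" using c unfolding norm_mult by (simp add: field_simps)
    then have "norm (\<xi> (y z) $ 1 + c * (t' - t)) < 1"
      using yW(2)[OF zB] norm_triangle_ineq[of "\<xi> (y z) $ 1" "c * (t' - t)"] by linarith
    from flow_box_fl(2)[OF b yW(1)[OF zB] this] have "\<xi> (slice W \<xi> z) $ 2 = \<xi> (y z) $ 2" by (simp add: eq)
    then have "\<xi> (y z) $ 2 = z" using slice_coord[OF b B1[OF zB]] by simp
    then show ?thesis using zB z by (intro bexI[of _ z]) (auto simp: e'_def)
  qed
  have h_id: "\<xi> (y z) $ 2 = z" if z: "z \<in> B" for z
  proof -
    have "\<xi> (y z) $ 2 - z = 0"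
    proof (rule analytic_continuation[of "\<lambda>z. \<xi> (y z) $ 2 - z" B "{z \<in> B. \<xi> (y z) $ 2 - z = 0}" z0])
      show "(\<lambda>z. \<xi> (y z) $ 2 - z) holomorphic_on B" by (intro holomorphic_intros hol)
      show "z0 islimpt {z \<in> B. \<xi> (y z) $ 2 - z = 0}"
        unfolding islimpt_approachable using fix_dense by blast
    qed (use z \<rho> in \<open>auto simp: B_def\<close>)
    then show ?thesis by simp
  qed
  \<comment> \<open>The time \<open>t\<close>, corrected by the time that the point reached needs to
    get back to the slice.\<close>
  define \<tau> where "\<tau> z = t - \<xi> (y z) $ 1 / c" for z
  have slice_per: "fl (\<tau> z) (slice W \<xi> z) = slice W \<xi> z" if z: "z \<in> B" for z
  proof -
    have "norm (\<xi> (y z) $ 1 + c * (- (\<xi> (y z) $ 1 / c))) < 1" using c by simp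
    from flow_box_fl[OF b yW(1)[OF z] this]
    have "fl (- (\<xi> (y z) $ 1 / c)) (y z) = slice W \<xi> z"
      using c h_id[OF z] by (intro slice_unique[OF b, symmetric]) simp_all
    then show ?thesis using slN[OF z] by (simp add: y_def \<tau>_def fl_fl)
  qed
  show ?thesis
  proof (rule that[of \<rho> \<tau>])
    show "\<tau> holomorphic_on ball z0 \<rho>"
      unfolding \<tau>_def B_def[symmetric] by (intro holomorphic_intros hol) (use c in auto)
    show "\<tau> z0 = t" using y0 q by (simp add: \<tau>_def)
    show "fl (\<tau> (\<xi> x $ 2)) x = x" if x: "x \<in> W" "\<xi> x $ 2 \<in> ball z0 \<rho>" for x
    proof -
      define z where "z = \<xi> x $ 2"
      have zB: "z \<in> B" using x by (simp add: z_def B_def)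
      have "fl (\<tau> z) (fl (\<xi> x $ 1 / c) (slice W \<xi> z)) = fl (\<xi> x $ 1 / c) (slice W \<xi> z)"
        using slice_per[OF zB] by (simp add: period_iff_fl[OF slN[OF zB]])
      then show ?thesis using flow_box_slice(1)[OF b x(1)] by (simp add: z_def)
    qed
  qed (use \<rho> in auto)
qed

text \<open>For a nonzero period, persistence means that the corresponding loop has trivial holonomy.\<close>

definition pers :: "'a \<Rightarrow> complex \<Rightarrow> bool" where
  "pers q t \<longleftrightarrow> (\<forall>\<epsilon>>0. \<exists>V. openin N V \<and> q \<in> V \<and> (\<forall>x\<in>V. \<exists>t'\<in>ball t \<epsilon>. fl t' x = x))"

lemma pers_imp_period: "q \<in> topspace N \<Longrightarrow> pers q t \<Longrightarrow> fl t q = q"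
  by (rule period_limit) (auto simp: pers_def, meson)

lemma pers_fl:
  assumes q: "q \<in> topspace N" and p: "pers q t"
  shows "pers (fl s q) t"
  unfolding pers_def
proof (intro allI impI)
  fix \<epsilon> :: real assume "\<epsilon> > 0"
  then obtain V where V: "openin N V" "q \<in> V" "\<forall>x\<in>V. \<exists>t'\<in>ball t \<epsilon>. fl t' x = x" using p unfolding pers_def by blast
  define V' where "V' = {y \<in> topspace N. fl (- s) y \<in> V}"
  have "openin N V'" unfolding V'_def by (rule openin_continuous_map_preimage[OF fl_continuous_map V(1)])
  moreover have "fl s q \<in> V'" using V q by (simp add: V'_def)
  moreover have "\<exists>t'\<in>ball t \<epsilon>. fl t' x = x" if "x \<in> V'" for x
    using V(3) that period_iff_fl unfolding V'_def by blast
  ultimately show "\<exists>V. openin N V \<and> fl s q \<in> V \<and> (\<forall>x\<in>V. \<exists>t'\<in>ball t \<epsilon>. fl t' x = x)" by blast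
qed

text \<open>Periods near \<open>t\<close> at points off the plaque that accumulate at the base point
  already suffice. They force a holomorphic period function on a whole neighbourhood, and its
  continuity makes each of its values persistent.\<close>

lemma pers_local:
  assumes b: "flow_box W \<xi> c" and z0: "norm z0 < 1"
    and acc: "\<And>\<epsilon> V. \<epsilon> > 0 \<Longrightarrow> openin N V \<Longrightarrow> slice W \<xi> z0 \<in> V \<Longrightarrow>
      \<exists>x\<in>V \<inter> W. \<xi> x $ 2 \<noteq> z0 \<and> (\<exists>t'\<in>ball t \<epsilon>. fl t' x = x)"
  obtains \<rho> \<tau> where "\<rho> > 0" "ball z0 \<rho> \<subseteq> ball 0 1" "\<tau> holomorphic_on ball z0 \<rho>" "\<tau> z0 = t"
    "\<And>x. x \<in> W \<Longrightarrow> \<xi> x $ 2 \<in> ball z0 \<rho> \<Longrightarrow> pers x (\<tau> (\<xi> x $ 2))"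
proof -
  obtain \<rho> \<tau> where \<tau>: "\<rho> > 0" "ball z0 \<rho> \<subseteq> ball 0 1" "\<tau> holomorphic_on ball z0 \<rho>" "\<tau> z0 = t"
    "\<And>x. x \<in> W \<Longrightarrow> \<xi> x $ 2 \<in> ball z0 \<rho> \<Longrightarrow> fl (\<tau> (\<xi> x $ 2)) x = x"
    using period_function[OF b z0 acc] by blast
  have "pers x (\<tau> (\<xi> x $ 2))" if x: "x \<in> W" "\<xi> x $ 2 \<in> ball z0 \<rho>" for x
    unfolding pers_def
  proof (intro allI impI)
    fix \<epsilon> :: real assume \<epsilon>: "\<epsilon> > 0"
    have "open (ball z0 \<rho> \<inter> \<tau> -` ball (\<tau> (\<xi> x $ 2)) \<epsilon>)"
      by (rule continuous_open_preimage[OF holomorphic_on_imp_continuous_on[OF \<tau>(3)]]) auto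
    then have "open ((\<lambda>v :: complex^2. v $ 2) -` (ball z0 \<rho> \<inter> \<tau> -` ball (\<tau> (\<xi> x $ 2)) \<epsilon>))"
      by (rule open_vimage) (intro continuous_intros)
    from chart_preimage_open[OF flow_box_chart[OF b] this]
    have "openin N {y \<in> W. \<xi> y $ 2 \<in> ball z0 \<rho> \<and> \<tau> (\<xi> y $ 2) \<in> ball (\<tau> (\<xi> x $ 2)) \<epsilon>}" by simp
    moreover have "\<exists>t'\<in>ball (\<tau> (\<xi> x $ 2)) \<epsilon>. fl t' y = y"
      if "y \<in> {y \<in> W. \<xi> y $ 2 \<in> ball z0 \<rho> \<and> \<tau> (\<xi> y $ 2) \<in> ball (\<tau> (\<xi> x $ 2)) \<epsilon>}" for y
      using that \<tau>(5)[of y] by blast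
    ultimately show "\<exists>V. openin N V \<and> x \<in> V \<and> (\<forall>y\<in>V. \<exists>t'\<in>ball (\<tau> (\<xi> x $ 2)) \<epsilon>. fl t' y = y)"
      using x \<epsilon> by (intro exI[of _ "{y \<in> W. \<xi> y $ 2 \<in> ball z0 \<rho> \<and> \<tau> (\<xi> y $ 2) \<in> ball (\<tau> (\<xi> x $ 2)) \<epsilon>}"]) simp
  qed
  then show ?thesis using \<tau> that by blast
qed

lemma open_meets_off_slice:
  assumes b: "flow_box W \<xi> c" and V: "openin N V" "x \<in> V" "x \<in> W"
  shows "\<exists>y\<in>V \<inter> W. \<xi> y $ 2 \<noteq> z0"
proof (rule ccontr)
  assume a: "\<not> ?thesis"
  have "open (\<xi> ` (W \<inter> V))" by (rule chart_image_of_open[OF flow_box_chart[OF b] V(1)])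
  then obtain e where e: "e > 0" "ball (\<xi> x) e \<subseteq> \<xi> ` (W \<inter> V)" using V open_contains_ball by blast
  have "\<xi> x + pt 0 (of_real (e / 2)) \<in> ball (\<xi> x) e"
    using e norm_le_component_sum[of "pt 0 (of_real (e / 2))"] by (simp add: dist_norm)
  then have "\<xi> x + pt 0 (of_real (e / 2)) \<in> \<xi> ` (W \<inter> V)" using e by blast
  then obtain y where "\<xi> x + pt 0 (of_real (e / 2)) = \<xi> y" "y \<in> W \<inter> V" by (rule imageE)
  moreover from this(1) have "\<xi> y = \<xi> x + pt 0 (of_real (e / 2))" by (rule sym)
  ultimately have "\<xi> y $ 2 = \<xi> x $ 2 + of_real (e / 2)" "y \<in> V \<inter> W" by auto
  then show False using a V e by auto
qed

text \<open>The points supplied by \<open>p\<close> could all lie on the plaque of the base point;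
  persistence at one of them provides periods on a full neighbourhood, which leaves this
  plaque.\<close>

lemma pers_imp_acc:
  assumes b: "flow_box W \<xi> c" and z0: "norm z0 < 1" and q: "slice W \<xi> z0 \<in> V" "openin N V" and \<epsilon>: "\<epsilon> > 0"
    and p: "\<And>\<epsilon> V. \<epsilon> > 0 \<Longrightarrow> openin N V \<Longrightarrow> slice W \<xi> z0 \<in> V \<Longrightarrow> \<exists>x\<in>V. \<exists>t'\<in>ball t \<epsilon>. pers x t'"
  shows "\<exists>x\<in>V \<inter> W. \<xi> x $ 2 \<noteq> z0 \<and> (\<exists>t'\<in>ball t \<epsilon>. fl t' x = x)"
proof -
  have "openin N (V \<inter> W)" using q chart_open[OF flow_box_chart[OF b]] by blast
  then obtain x t' where x: "x \<in> V \<inter> W" "t' \<in> ball t (\<epsilon> / 2)" "pers x t'"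
    using p[of "\<epsilon> / 2" "V \<inter> W"] \<epsilon> q slice_in[OF b z0] by auto
  then obtain V' where V': "openin N V'" "x \<in> V'" "\<forall>y\<in>V'. \<exists>s\<in>ball t' (\<epsilon> / 2). fl s y = y"
    using \<epsilon> unfolding pers_def by (meson half_gt_zero)
  then obtain y where y: "y \<in> (V' \<inter> (V \<inter> W)) \<inter> W" "\<xi> y $ 2 \<noteq> z0"
    using open_meets_off_slice[OF b, of "V' \<inter> (V \<inter> W)" x] x \<open>openin N (V \<inter> W)\<close> by blast
  then obtain s where s: "s \<in> ball t' (\<epsilon> / 2)" "fl s y = y" using V' by blast
  have "dist t s < \<epsilon>" using s x dist_triangle[of t s t'] by simp
  then show ?thesis using y s by (intro bexI[of _ y] conjI bexI[of _ s]) auto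
qed

text \<open>Persistent periods at points tending to \<open>q\<close> supply periods off the plaque
  of \<open>q\<close>, and these give a holomorphic period function through \<open>t\<close>. For a
  fixed point this makes the set of persistent periods closed; for moving points it governs the
  limits of the smallest one.\<close>

lemma pers_closed:
  assumes q: "q \<in> regular_points"
    and p: "\<And>\<epsilon> V. \<epsilon> > 0 \<Longrightarrow> openin N V \<Longrightarrow> q \<in> V \<Longrightarrow> \<exists>x\<in>V. \<exists>t'\<in>ball t \<epsilon>. pers x t'"
  shows "pers q t"
proof -
  obtain W \<xi> c where b: "flow_box W \<xi> c" and qW: "q \<in> W" "\<xi> q = 0" and "W \<subseteq> topspace N"
    by (rule flow_box_exists[OF q openin_topspace regular_in[OF q]])
  have q0: "slice W \<xi> 0 = q" by (rule slice_unique[OF b]) (use qW in \<open>auto simp: vec_eq_iff forall_2\<close>)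
  have "\<exists>x\<in>V \<inter> W. \<xi> x $ 2 \<noteq> 0 \<and> (\<exists>t'\<in>ball t \<epsilon>. fl t' x = x)"
    if "\<epsilon> > 0" "openin N V" "slice W \<xi> 0 \<in> V" for \<epsilon> V
    by (rule pers_imp_acc[OF b _ that(3,2,1)]) (use p q0 in auto)
  then obtain \<rho> \<tau> where "\<rho> > 0" "\<tau> 0 = t" "\<And>x. x \<in> W \<Longrightarrow> \<xi> x $ 2 \<in> ball 0 \<rho> \<Longrightarrow> pers x (\<tau> (\<xi> x $ 2))"
    using pers_local[OF b, of 0 t] by (metis norm_zero zero_less_one)
  then show ?thesis using qW by force
qed

lemma pers_period_function:
  assumes b: "flow_box W \<xi> c" and z0: "norm z0 < 1" and p: "pers (slice W \<xi> z0) t"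
  obtains \<rho> \<tau> where "\<rho> > 0" "ball z0 \<rho> \<subseteq> ball 0 1" "\<tau> holomorphic_on ball z0 \<rho>" "\<tau> z0 = t"
    "\<And>x. x \<in> W \<Longrightarrow> \<xi> x $ 2 \<in> ball z0 \<rho> \<Longrightarrow> pers x (\<tau> (\<xi> x $ 2))"
proof (rule pers_local[OF b z0, of t])
  show "\<exists>x\<in>V \<inter> W. \<xi> x $ 2 \<noteq> z0 \<and> (\<exists>t'\<in>ball t \<epsilon>. fl t' x = x)"
    if eV: "\<epsilon> > 0" "openin N V" "slice W \<xi> z0 \<in> V" for \<epsilon> V
  proof (rule pers_imp_acc[OF b z0 eV(3,2,1)])
    show "\<exists>x\<in>V. \<exists>t'\<in>ball t \<epsilon>. pers x t'" if "\<epsilon> > 0" "openin N V" "slice W \<xi> z0 \<in> V" for \<epsilon> V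
      using that p by (intro bexI[of _ "slice W \<xi> z0"] bexI[of _ t]) auto
  qed
qed (use that in blast)

lemma closed_pers:
  assumes q: "q \<in> regular_points"
  shows "closed {t. pers q t}"
proof -
  have "pers q t" if t: "t \<in> closure {t. pers q t}" for t
  proof (rule pers_closed[OF q])
    fix \<epsilon> :: real and V assume "\<epsilon> > 0" and V: "q \<in> V"
    then obtain t' where "pers q t'" "dist t' t < \<epsilon>" using t unfolding closure_approachable by blast
    then show "\<exists>x\<in>V. \<exists>t'\<in>ball t \<epsilon>. pers x t'"
      using V by (intro bexI[of _ q] bexI[of _ t']) (auto simp: dist_commute)
  qed
  then show ?thesis by (metis closure_subset_eq mem_Collect_eq subsetI)
qed

text \<open>Compactness with coverings in place of sequences: if every time in the disc had a bad
  neighbourhood, finitely many would cover the disc, and the intersection of the matching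
  neighbourhoods of \<open>q\<close> would contradict \<open>acc\<close>.\<close>

lemma limit_point_in_time:
  assumes acc: "\<And>V. openin N V \<Longrightarrow> q \<in> V \<Longrightarrow> \<exists>x\<in>V. \<exists>t\<in>cball 0 K. P x t"
    and q: "q \<in> topspace N"
  obtains t :: complex where "norm t \<le> K" "\<And>\<epsilon> V. \<epsilon> > 0 \<Longrightarrow> openin N V \<Longrightarrow> q \<in> V \<Longrightarrow> \<exists>x\<in>V. \<exists>t'\<in>ball t \<epsilon>. P x t'"
proof (rule ccontr)
  assume "\<not> thesis"
  then have "\<forall>t\<in>cball 0 K. \<exists>\<epsilon> V. \<epsilon> > 0 \<and> openin N V \<and> q \<in> V \<and> (\<forall>x\<in>V. \<forall>t'\<in>ball t \<epsilon>. \<not> P x t')"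
    using that by (metis mem_cball_0)
  then obtain \<epsilon> V where eV: "\<And>t. t \<in> cball 0 K \<Longrightarrow> \<epsilon> t > 0 \<and> openin N (V t) \<and> q \<in> V t \<and> (\<forall>x\<in>V t. \<forall>t'\<in>ball t (\<epsilon> t). \<not> P x t')"
    by metis
  have "cball 0 K \<subseteq> (\<Union>t\<in>cball 0 K. ball t (\<epsilon> t))" using eV by fastforce
  then obtain D where D: "D \<subseteq> cball 0 K" "finite D" "cball 0 K \<subseteq> (\<Union>t\<in>D. ball t (\<epsilon> t))"
    using compactE_image[OF compact_cball, of "cball 0 K" "\<lambda>t. ball t (\<epsilon> t)" "0::complex" K] by auto
  define V0 where "V0 = topspace N \<inter> (\<Inter>t\<in>D. V t)"
  have "openin N V0"
    unfolding V0_def using D eV by (cases "D = {}") (auto intro!: openin_Int openin_Inter)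
  moreover have "q \<in> V0" using D eV q by (auto simp: V0_def)
  ultimately obtain x t where "x \<in> V0" "t \<in> cball 0 K" "P x t" using acc by blast
  then show False using D eV unfolding V0_def by blast
qed

end

section \<open>Global functions and the discreteness of the periods\<close>

locale separated_flow = complete_flow N A X
  for N :: "'a topology" and A :: "('a, 2) chart set" and X :: "('a, 2) vfield" +
  assumes connected: "connected_space N" and isolated: "isolated_singularities N A X"
    and separation: "\<And>x y. x \<in> topspace N \<Longrightarrow> y \<in> topspace N \<Longrightarrow> x \<noteq> y \<Longrightarrow>
      \<exists>f. holomorphic_fun_on N A (topspace N) f \<and> f x \<noteq> f y"
begin

lemma function_along_flow: "holomorphic_fun_on N A (topspace N) f \<Longrightarrow> x \<in> topspace N \<Longrightarrow> (\<lambda>t. f (fl t x)) holomorphic_on UNIV"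
  by (rule holomorphic_fun_along_hcurve[OF _ hcurve_fl_time]) auto

lemma periods_multiple:
  assumes x: "x \<in> topspace N" and t: "fl t x = x"
  shows "fl (of_int n * t) x = x"
proof -
  have nat: "fl (of_nat n * s) x = x" if "fl s x = x" for n s
  proof (induction n)
    case (Suc n)
    have "fl (of_nat (Suc n) * s) x = fl s (fl (of_nat n * s) x)" using x by (simp add: fl_fl algebra_simps)
    then show ?case using Suc that by simp
  qed (use x in simp)
  have neg: "fl (- t) x = x" using fl_inverse(1)[OF x, of t] t by simp
  show ?thesis using nat[OF t, of "nat n"] nat[OF neg, of "nat (- n)"] by (cases "n \<ge> 0") auto
qed

text \<open>Two periods that are independent over the reals would make every global holomorphic function
  bounded along the orbit, hence constant there by Liouville's theorem.\<close>

lemma periods_real_dependent: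
  assumes q: "q \<in> regular_points" and s: "fl s q = q" "s \<noteq> 0" and t: "fl t q = q"
  shows "Im (t / s) = 0"
proof (rule ccontr)
  assume im: "Im (t / s) \<noteq> 0"
  have qN: "q \<in> topspace N" using q by simp
  have const: "f (fl w q) = f q" if f: "holomorphic_fun_on N A (topspace N) f" for f w
  proof -
    define g where "g w = f (fl w q)" for w
    have g: "g holomorphic_on UNIV" unfolding g_def by (rule function_along_flow[OF f qN])
    \<comment> \<open>The closed parallelogram spanned by the periods \<open>s\<close> and
      \<open>t\<close>; every time differs from one of its points by a period.\<close>
    define K where "K = (\<lambda>(a, b). of_real a * s + of_real b * t) ` ({0..1} \<times> {0..1::real})"
    have "compact K" unfolding K_def
      by (intro compact_continuous_image compact_Times) (auto simp: case_prod_unfold intro!: continuous_intros)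
    then have "compact (g ` K)"
      using g holomorphic_on_imp_continuous_on continuous_on_subset by (blast intro: compact_continuous_image)
    moreover have "range g \<subseteq> g ` K"
    proof
      fix y assume "y \<in> range g"
      then obtain w where y: "y = g w" by blast
      \<comment> \<open>The numbers \<open>a\<close> and \<open>b\<close> are the coordinates of
        \<open>w\<close> in the real basis \<open>s\<close>, \<open>t\<close>.\<close>
      define b where "b = Im (w / s) / Im (t / s)"
      define a where "a = Re (w / s - of_real b * (t / s))"
      define r where "r = t / s"
      have "Im (w / s) = b * Im r" using im by (simp add: b_def r_def)
      then have "w / s = of_real a + of_real b * r"
        by (simp add: complex_eq_iff a_def flip: r_def)
      then have "w / s = of_real a + of_real b * (t / s)" by (simp add: r_def)
      then have w: "w = of_real a * s + of_real b * t" using s(2) by (simp add: field_simps)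
      define w' where "w' = of_real (frac a) * s + of_real (frac b) * t"
      have "w = of_int \<lfloor>a\<rfloor> * s + (of_int \<lfloor>b\<rfloor> * t + w')"
        by (simp add: w w'_def frac_def algebra_simps)
      then have "fl w q = fl w' (fl (of_int \<lfloor>b\<rfloor> * t) (fl (of_int \<lfloor>a\<rfloor> * s) q))"
        using qN by (simp add: fl_fl add.assoc)
      then have "g w = g w'" using periods_multiple[OF qN s(1)] periods_multiple[OF qN t] by (simp add: g_def)
      moreover have "w' \<in> K" unfolding K_def w'_def
        using frac_ge_0 frac_lt_1 less_imp_le by (intro image_eqI[of _ _ "(frac a, frac b)"]) auto
      ultimately show "y \<in> g ` K" using y by blast
    qed
    ultimately have "bounded (range g)" using bounded_subset compact_imp_bounded by blast
    then obtain c where "\<And>w. g w = c" using Liouville_theorem[OF g] unfolding constant_on_def by blast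
    from this[of w] this[of 0] show ?thesis using qN by (simp add: g_def)
  qed
  \<comment> \<open>Separation of points turns the constancy of all functions along the orbit into
    stationarity, which the absence of short periods excludes at a regular point.\<close>
  have stat: "fl w q = q" for w
    using separation[OF fl_in[OF qN] qN] const by metis
  obtain \<epsilon> V where e: "\<epsilon> > 0" "openin N V" "q \<in> V" "\<And>x t. x \<in> V \<Longrightarrow> norm t < \<epsilon> \<Longrightarrow> fl t x = x \<Longrightarrow> t = 0"
    using no_small_periods[OF q] by metis
  from e(1) e(4)[OF e(3) _ stat, of "of_real (\<epsilon> / 2)"] show False by simp
qed

section \<open>The smallest persistent period and its inverse square\<close>

definition nzper :: "'a \<Rightarrow> complex set" where
  "nzper q = {t. pers q t \<and> t \<noteq> 0}"

definition minper :: "'a \<Rightarrow> complex \<Rightarrow> bool" where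
  "minper q t \<longleftrightarrow> t \<in> nzper q \<and> (\<forall>t'\<in>nzper q. norm t \<le> norm t')"

text \<open>Nonzero periods are bounded below at a regular point, so the persistent ones up to a
  given length form a compact set, on which the norm attains its minimum.\<close>

lemma minper_exists:
  assumes q: "q \<in> regular_points" and ne: "nzper q \<noteq> {}"
  shows "\<exists>t. minper q t"
proof -
  obtain t1 where t1: "t1 \<in> nzper q" using ne by blast
  obtain \<epsilon> V where \<epsilon>: "\<epsilon> > 0" "q \<in> V" "\<And>x t. x \<in> V \<Longrightarrow> norm t < \<epsilon> \<Longrightarrow> fl t x = x \<Longrightarrow> t = 0"
    using no_small_periods[OF q] by metis
  have big: "norm t \<ge> \<epsilon>" if "t \<in> nzper q" for t
    using \<epsilon>(3)[OF \<epsilon>(2), of t] pers_imp_period[of q t] q that unfolding nzper_def by force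
  define K where "K = {t. pers q t} \<inter> (cball 0 (norm t1) - ball 0 \<epsilon>)"
  have "compact K" unfolding K_def
    by (rule closed_Int_compact[OF closed_pers[OF q]]) (auto intro: compact_diff)
  moreover have "t1 \<in> K" using t1 big[OF t1] by (auto simp: K_def nzper_def)
  ultimately obtain t where t: "t \<in> K" "\<forall>s\<in>K. norm t \<le> norm s"
    using continuous_attains_inf[of K norm] continuous_on_norm_id by blast
  have "t \<in> nzper q" using t \<epsilon> by (auto simp: K_def nzper_def)
  moreover have "norm t \<le> norm s" if "s \<in> nzper q" for s
  proof (cases "norm s \<le> norm t1")
    case True
    then have "s \<in> K" using that big[OF that] by (auto simp: K_def nzper_def)
    then show ?thesis using t by blast
  next
    case False
    then show ?thesis using t \<open>t1 \<in> K\<close> by (meson linear order_trans)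
  qed
  ultimately show ?thesis unfolding minper_def by blast
qed

text \<open>The ratio of two smallest periods is real and has norm 1.\<close>

lemma minper_unique:
  assumes q: "q \<in> regular_points" and "minper q s" "minper q t"
  shows "t = s \<or> t = - s"
proof -
  have s: "s \<in> nzper q" "t \<in> nzper q" and n: "norm s = norm t"
    using assms unfolding minper_def by (auto intro: antisym)
  then have p: "fl s q = q" "fl t q = q" "s \<noteq> 0" using pers_imp_period q by (auto simp: nzper_def)
  define r where "r = t / s"
  have "Im r = 0" unfolding r_def by (rule periods_real_dependent[OF q p(1,3,2)])
  moreover have "norm r = 1" using n p(3) unfolding r_def norm_divide by (metis divide_self norm_eq_zero)
  ultimately have "\<bar>Re r\<bar> = 1" by (simp add: norm_complex_def)
  then have "r = 1 \<or> r = - 1" using \<open>Im r = 0\<close> by (auto simp: complex_eq_iff abs_if split: if_splits)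
  then show ?thesis using p(3) by (auto simp: r_def field_simps)
qed

text \<open>The minimal persistent period is determined up to sign, so its inverse square is a function.\<close>

definition sig :: "'a \<Rightarrow> complex" where
  "sig q = (if nzper q = {} then 0 else 1 / (SOME t. minper q t)\<^sup>2)"

lemma sig_eq:
  assumes q: "q \<in> regular_points" and t: "minper q t"
  shows "sig q = 1 / t\<^sup>2"
proof -
  have "minper q (SOME t. minper q t)" using t by (rule someI)
  then have "(SOME t. minper q t) = t \<or> (SOME t. minper q t) = - t" using minper_unique[OF q t] by blast
  then show ?thesis using t by (auto simp: sig_def minper_def)
qed

lemma minper_nonzero: "minper q t \<Longrightarrow> t \<noteq> 0"
  by (simp add: minper_def nzper_def)

lemma nzper_fl: "q \<in> topspace N \<Longrightarrow> nzper (fl s q) = nzper q"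
  using pers_fl[of q _ s] pers_fl[of "fl s q" _ "- s"] by (auto simp: nzper_def)

lemma sig_fl: "q \<in> topspace N \<Longrightarrow> sig (fl s q) = sig q"
proof -
  assume "q \<in> topspace N"
  then have "minper (fl s q) = minper q" by (simp add: fun_eq_iff minper_def nzper_fl)
  then show ?thesis using \<open>q \<in> topspace N\<close> by (simp add: sig_def nzper_fl)
qed

text \<open>Bounded nonzero persistent periods at points tending to the base point would have a
  persistent limit, nonzero because short periods are excluded. So the smallest periods nearby tend
  to infinity and \<open>sig\<close> tends to 0.\<close>

lemma sig_continuous_at_zero:
  assumes b: "flow_box W \<xi> c" and z0: "norm z0 < 1" and none: "nzper (slice W \<xi> z0) = {}"
  shows "isCont (\<lambda>z. sig (slice W \<xi> z)) z0"
  unfolding continuous_at_eps_delta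
proof (intro allI impI)
  fix e :: real assume e: "e > 0"
  define q where "q = slice W \<xi> z0"
  have q: "q \<in> regular_points" "q \<in> topspace N" using slice_regular[OF b z0] by (auto simp: q_def)
  \<comment> \<open>For \<open>t \<noteq> 0\<close>, the inequality \<open>norm t > K\<close> is
    equivalent to \<open>norm (1 / t ^ 2) < e\<close>.\<close>
  define K where "K = 1 / sqrt e"
  have "\<exists>V. openin N V \<and> q \<in> V \<and> (\<forall>x\<in>V. \<forall>t\<in>cball 0 K. \<not> (pers x t \<and> t \<noteq> 0))"
  proof (rule ccontr)
    assume "\<not> ?thesis"
    then have "\<exists>x\<in>V. \<exists>t\<in>cball 0 K. pers x t \<and> t \<noteq> 0" if "openin N V" "q \<in> V" for V using that by blast
    then obtain t where t: "\<And>\<epsilon> V. \<epsilon> > 0 \<Longrightarrow> openin N V \<Longrightarrow> q \<in> V \<Longrightarrow> \<exists>x\<in>V. \<exists>t'\<in>ball t \<epsilon>. pers x t' \<and> t' \<noteq> 0"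
      using limit_point_in_time[of q K "\<lambda>x t. pers x t \<and> t \<noteq> 0"] q(2) by metis
    have "pers q t" by (rule pers_closed[OF q(1)]) (use t in blast)
    moreover have "t \<noteq> 0"
    proof
      assume "t = 0"
      obtain \<epsilon> V where eV: "\<epsilon> > 0" "openin N V" "q \<in> V" "\<And>x t. x \<in> V \<Longrightarrow> norm t < \<epsilon> \<Longrightarrow> fl t x = x \<Longrightarrow> t = 0"
        using no_small_periods[OF q(1)] by metis
      then obtain x t' where x: "x \<in> V" "t' \<in> ball t \<epsilon>" "pers x t'" "t' \<noteq> 0" using t by metis
      then have "fl t' x = x" using pers_imp_period eV(2) openin_subset by blast
      then show False using eV(4)[of x t'] x \<open>t = 0\<close> by simp
    qed
    ultimately show False using none by (auto simp: nzper_def q_def)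
  qed
  then obtain V where V: "openin N V" "q \<in> V" "\<And>x t. x \<in> V \<Longrightarrow> norm t \<le> K \<Longrightarrow> pers x t \<Longrightarrow> t = 0" by force
  have small: "norm (sig x) < e" if x: "x \<in> V" "x \<in> regular_points" for x
  proof (cases "nzper x = {}")
    case True
    then show ?thesis using e by (simp add: sig_def)
  next
    case False
    then obtain t where t: "minper x t" using minper_exists[OF x(2)] by blast
    then have "pers x t" "t \<noteq> 0" by (auto simp: minper_def nzper_def)
    then have "norm t > K" using V(3)[OF x(1)] by force
    moreover have "K > 0" using e by (simp add: K_def)
    ultimately have "K\<^sup>2 < (norm t)\<^sup>2" by (intro power_strict_mono) auto
    then have "1 / (norm t)\<^sup>2 < 1 / K\<^sup>2"
      using \<open>K > 0\<close> \<open>t \<noteq> 0\<close> by (intro divide_strict_left_mono) auto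
    then show ?thesis using sig_eq[OF x(2) t] e by (simp add: K_def norm_divide norm_power power_divide)
  qed
  have "open {z \<in> ball 0 1. slice W \<xi> z \<in> V}"
    by (rule curve_preimage_open[OF _ _ V(1)]) (use slice_hcurve[OF b] in \<open>auto simp: hcurve_def\<close>)
  moreover have "z0 \<in> {z \<in> ball 0 1. slice W \<xi> z \<in> V}" using z0 V by (simp add: q_def)
  ultimately obtain d where d: "d > 0" "ball z0 d \<subseteq> {z \<in> ball 0 1. slice W \<xi> z \<in> V}"
    using open_contains_ball by blast
  have "dist (sig (slice W \<xi> z)) (sig (slice W \<xi> z0)) < e" if "dist z z0 < d" for z
  proof -
    have "z \<in> ball z0 d" using that by (simp add: dist_commute)
    then have "slice W \<xi> z \<in> V" "norm z < 1" using d by auto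
    then show ?thesis using small[of "slice W \<xi> z"] slice_regular[OF b] none by (simp add: sig_def[of "slice W \<xi> z0"])
  qed
  then show "\<exists>d>0. \<forall>z. dist z z0 < d \<longrightarrow> dist (sig (slice W \<xi> z)) (sig (slice W \<xi> z0)) < e" using d(1) by blast
qed

text \<open>The smallest persistent period continues to a holomorphic period function
  \<open>\<tau>\<close>; the point is that \<open>\<tau>\<close> remains the smallest one. Shorter
  periods at nearby points would accumulate at some \<open>s\<close> that is again smallest at the
  base point, so \<open>s\<close> is \<open>t\<close> or \<open>- t\<close>. Then the difference or
  the sum of such a period and \<open>\<tau>\<close> is a short period, hence 0, against the strict
  inequality of norms.\<close>

lemma sig_holomorphic_at_nonzero:
  assumes b: "flow_box W \<xi> c" and z0: "norm z0 < 1" and some: "nzper (slice W \<xi> z0) \<noteq> {}"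
  obtains d h where "d > 0" "ball z0 d \<subseteq> ball 0 1" "h holomorphic_on ball z0 d"
    "\<And>z. z \<in> ball z0 d \<Longrightarrow> sig (slice W \<xi> z) = h z \<and> h z \<noteq> 0"
proof -
  define q where "q = slice W \<xi> z0"
  have q: "q \<in> regular_points" "q \<in> topspace N" "q \<in> W" "\<xi> q $ 2 = z0"
    using slice_regular[OF b z0] slice_in[OF b z0] slice_coord[OF b z0] by (auto simp: q_def)
  obtain t where t: "minper q t" using minper_exists[OF q(1)] some by (auto simp: q_def)
  have t0: "t \<noteq> 0" "pers q t" using t by (auto simp: minper_def nzper_def)
  obtain \<rho> \<tau> where \<rho>: "\<rho> > 0" "ball z0 \<rho> \<subseteq> ball 0 1" and \<tau>: "\<tau> holomorphic_on ball z0 \<rho>" "\<tau> z0 = t"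
    "\<And>x. x \<in> W \<Longrightarrow> \<xi> x $ 2 \<in> ball z0 \<rho> \<Longrightarrow> pers x (\<tau> (\<xi> x $ 2))"
    using pers_period_function[OF b z0 t0(2)[unfolded q_def]] by blast
  obtain \<epsilon>0 V0 where V0: "\<epsilon>0 > 0" "openin N V0" "q \<in> V0"
    "\<And>x t. x \<in> V0 \<Longrightarrow> norm t < \<epsilon>0 \<Longrightarrow> fl t x = x \<Longrightarrow> t = 0"
    using no_small_periods[OF q(1)] by metis
  define Ne where "Ne e = {x \<in> W. \<xi> x $ 2 \<in> ball z0 \<rho> \<and> \<tau> (\<xi> x $ 2) \<in> ball t e}" for e
  have Ne: "openin N (Ne e)" "e > 0 \<Longrightarrow> q \<in> Ne e" for e
  proof -
    have "open (ball z0 \<rho> \<inter> \<tau> -` ball t e)"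
      by (rule continuous_open_preimage[OF holomorphic_on_imp_continuous_on[OF \<tau>(1)]]) auto
    then have "open ((\<lambda>v :: complex^2. v $ 2) -` (ball z0 \<rho> \<inter> \<tau> -` ball t e))"
      by (rule open_vimage) (intro continuous_intros)
    from chart_preimage_open[OF flow_box_chart[OF b] this] show "openin N (Ne e)" by (simp add: Ne_def)
    show "e > 0 \<Longrightarrow> q \<in> Ne e" using q \<tau>(2) \<rho> by (simp add: Ne_def)
  qed
  \<comment> \<open>On \<open>Ne (norm t)\<close> the values of \<open>\<tau>\<close> are nonzero
    and of norm at most \<open>K\<close>, so all shorter periods lie in a fixed disc.\<close>
  define K where "K = 2 * norm t"
  define P where "P x t' \<longleftrightarrow> x \<in> Ne (norm t) \<and> pers x t' \<and> t' \<noteq> 0 \<and> norm t' < norm (\<tau> (\<xi> x $ 2))" for x t'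
  have Kb: "norm (\<tau> (\<xi> x $ 2)) \<le> K" "\<tau> (\<xi> x $ 2) \<noteq> 0" if "x \<in> Ne (norm t)" for x
  proof -
    have "norm (t - \<tau> (\<xi> x $ 2)) < norm t" using that by (simp add: Ne_def dist_norm)
    then show "norm (\<tau> (\<xi> x $ 2)) \<le> K" "\<tau> (\<xi> x $ 2) \<noteq> 0"
      using norm_triangle_ineq2[of "\<tau> (\<xi> x $ 2)" t] by (auto simp: K_def norm_minus_commute)
  qed
  have "\<exists>V. openin N V \<and> q \<in> V \<and> V \<subseteq> Ne (norm t) \<and> (\<forall>x\<in>V. minper x (\<tau> (\<xi> x $ 2)))"
  proof (rule ccontr)
    assume contr: "\<not> ?thesis"
    have "\<exists>x\<in>V. \<exists>t\<in>cball 0 K. P x t" if V: "openin N V" "q \<in> V" for V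
    proof -
      have "openin N (V \<inter> Ne (norm t))" "q \<in> V \<inter> Ne (norm t)" using V Ne t0 by auto
      then obtain x where x: "x \<in> V" "x \<in> Ne (norm t)" "\<not> minper x (\<tau> (\<xi> x $ 2))" using contr by blast
      have "\<tau> (\<xi> x $ 2) \<in> nzper x" using x(2) \<tau>(3) Kb(2) by (simp add: nzper_def Ne_def)
      then obtain t' where "t' \<in> nzper x" "norm t' < norm (\<tau> (\<xi> x $ 2))"
        using x(3) unfolding minper_def by (meson not_le)
      then have "P x t'" "t' \<in> cball 0 K" using x Kb(1)[OF x(2)] by (auto simp: P_def nzper_def)
      then show ?thesis using x by blast
    qed
    then obtain s where s: "\<And>\<epsilon> V. \<epsilon> > 0 \<Longrightarrow> openin N V \<Longrightarrow> q \<in> V \<Longrightarrow> \<exists>x\<in>V. \<exists>t'\<in>ball s \<epsilon>. P x t'"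
      using limit_point_in_time[of q K P] q(2) by metis
    have ps: "pers q s" by (rule pers_closed[OF q(1)]) (use s in \<open>unfold P_def, blast\<close>)
    have s0: "s \<noteq> 0"
    proof
      assume "s = 0"
      obtain x t' where x: "x \<in> V0" "t' \<in> ball s \<epsilon>0" "P x t'" using s V0 by metis
      then have "fl t' x = x" using pers_imp_period V0(2) openin_subset unfolding P_def by blast
      then show False using V0(4)[of x t'] x \<open>s = 0\<close> by (simp add: P_def)
    qed
    have "norm s \<le> norm t"
    proof (rule field_le_epsilon)
      fix e :: real assume e: "e > 0"
      obtain x t' where x: "x \<in> Ne (e / 2)" "t' \<in> ball s (e / 2)" "P x t'"
        using s[of "e / 2" "Ne (e / 2)"] Ne e by auto
      have "norm s < norm t' + e / 2" using x(2) norm_triangle_ineq2[of s t'] by (simp add: dist_norm)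
      also have "norm t' < norm (\<tau> (\<xi> x $ 2))" using x(3) by (simp add: P_def)
      also have "norm (\<tau> (\<xi> x $ 2)) < norm t + e / 2"
        using x(1) norm_triangle_ineq2[of "\<tau> (\<xi> x $ 2)" t] by (simp add: Ne_def dist_norm norm_minus_commute)
      finally show "norm s \<le> norm t + e" by simp
    qed
    then have "minper q s" using t ps s0 unfolding minper_def nzper_def by (auto intro: order_trans)
    then have st: "s = t \<or> s = - t" by (rule minper_unique[OF q(1) t])
    have "openin N (V0 \<inter> Ne (\<epsilon>0 / 2))" "q \<in> V0 \<inter> Ne (\<epsilon>0 / 2)" using V0 Ne by auto
    then obtain x t' where x: "x \<in> V0" "x \<in> Ne (\<epsilon>0 / 2)" "t' \<in> ball s (\<epsilon>0 / 2)" "P x t'"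
      using s[of "\<epsilon>0 / 2"] V0(1) by (metis IntE half_gt_zero)
    define u where "u = \<tau> (\<xi> x $ 2)"
    have xN: "x \<in> topspace N" using x V0(2) openin_subset by blast
    have per: "fl t' x = x" "fl u x = x"
      using x(2,4) \<tau>(3)[of x] pers_imp_period[OF xN] by (auto simp: P_def Ne_def u_def)
    have near: "norm (t - u) < \<epsilon>0 / 2" "norm (s - t') < \<epsilon>0 / 2" using x by (auto simp: Ne_def u_def dist_norm)
    have lt: "norm t' < norm u" using x by (simp add: P_def u_def)
    from st show False
    proof
      assume "s = t"
      then have "norm (t' - u) < \<epsilon>0"
        using near norm_triangle_ineq[of "t' - s" "t - u"] by (simp add: norm_minus_commute)
      moreover have "fl (t' - u) x = x"
        using fl_fl[OF xN, of "- u" t'] per fl_inverse(1)[OF xN, of u] by simp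
      ultimately have "t' - u = 0" using V0(4)[OF x(1)] by blast
      then show False using lt by simp
    next
      assume st: "s = - t"
      have "norm (t' + u) = norm ((s - t') + (t - u))"
        by (metis (no_types, opaque_lifting) st add.commute add_diff_eq diff_add_cancel minus_add_distrib
            norm_minus_cancel uminus_add_conv_diff)
      then have "norm (t' + u) < \<epsilon>0" using near norm_triangle_ineq[of "s - t'" "t - u"] by linarith
      moreover have "fl (t' + u) x = x" using fl_fl[OF xN, of u t'] per by simp
      ultimately have "t' + u = 0" using V0(4)[OF x(1)] by blast
      then have "t' = - u" by (simp add: eq_neg_iff_add_eq_0)
      then show False using lt by simp
    qed
  qed
  then obtain V where V: "openin N V" "q \<in> V" "V \<subseteq> Ne (norm t)" "\<And>x. x \<in> V \<Longrightarrow> minper x (\<tau> (\<xi> x $ 2))" by blast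
  have "open {z \<in> ball 0 1. slice W \<xi> z \<in> V}"
    by (rule curve_preimage_open[OF _ _ V(1)]) (use slice_hcurve[OF b] in \<open>auto simp: hcurve_def\<close>)
  moreover have "z0 \<in> {z \<in> ball 0 1. slice W \<xi> z \<in> V}" using z0 V by (simp add: q_def)
  ultimately obtain d where d: "d > 0" "ball z0 d \<subseteq> {z \<in> ball 0 1. slice W \<xi> z \<in> V}"
    using open_contains_ball by blast
  define d' where "d' = min d \<rho>"
  have in_d: "slice W \<xi> z \<in> V" "norm z < 1" "z \<in> ball z0 \<rho>" if "z \<in> ball z0 d'" for z
    using that d by (auto simp: d'_def)
  have mz: "minper (slice W \<xi> z) (\<tau> z)" if "z \<in> ball z0 d'" for z
    using V(4)[OF in_d(1)[OF that]] slice_coord[OF b in_d(2)[OF that]] by simp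
  show ?thesis
  proof (rule that[of d' "\<lambda>z. 1 / (\<tau> z)\<^sup>2"])
    show "d' > 0" using d \<rho> by (simp add: d'_def)
    show "ball z0 d' \<subseteq> ball 0 1" using in_d(2) by auto
    show "(\<lambda>z. 1 / (\<tau> z)\<^sup>2) holomorphic_on ball z0 d'"
      using minper_nonzero[OF mz] in_d(3)
      by (intro holomorphic_intros holomorphic_on_subset[OF \<tau>(1)]) auto
    show "sig (slice W \<xi> z) = 1 / (\<tau> z)\<^sup>2 \<and> 1 / (\<tau> z)\<^sup>2 \<noteq> 0" if "z \<in> ball z0 d'" for z
      using sig_eq[OF slice_regular[OF b in_d(2)[OF that]] mz[OF that]] minper_nonzero[OF mz[OF that]] by simp
  qed
qed

theorem sig_holomorphic:
  assumes b: "flow_box W \<xi> c"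
  shows "(\<lambda>z. sig (slice W \<xi> z)) holomorphic_on ball 0 1"
proof (rule Rado[OF open_ball])
  define u where "u z = sig (slice W \<xi> z)" for z
  have u0: "u z = 0" if "nzper (slice W \<xi> z) = {}" for z using that by (simp add: u_def sig_def)
  have diff: "u field_differentiable at z" if z: "norm z < 1" "nzper (slice W \<xi> z) \<noteq> {}" for z
  proof -
    obtain d h where h: "d > 0" "h holomorphic_on ball z d" "\<And>w. w \<in> ball z d \<Longrightarrow> u w = h w"
      using sig_holomorphic_at_nonzero[OF b z] unfolding u_def by metis
    have "u holomorphic_on ball z d" by (rule holomorphic_transform[OF h(2)]) (simp add: h(3))
    then show ?thesis using h(1) by (intro holomorphic_on_imp_differentiable_at[of u "ball z d"]) auto
  qed
  show "continuous_on (ball 0 1) (\<lambda>z. sig (slice W \<xi> z))"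
  proof (rule continuous_at_imp_continuous_on, intro ballI)
    fix z :: complex assume "z \<in> ball 0 1"
    then have z: "norm z < 1" by simp
    show "isCont (\<lambda>z. sig (slice W \<xi> z)) z"
      using sig_continuous_at_zero[OF b z] diff[OF z] field_differentiable_imp_continuous_at
      unfolding u_def by blast
  qed
  show "(\<lambda>z. sig (slice W \<xi> z)) holomorphic_on {z \<in> ball 0 1. sig (slice W \<xi> z) \<noteq> 0}"
    unfolding holomorphic_on_def u_def[symmetric]
  proof
    fix z assume "z \<in> {z \<in> ball 0 1. u z \<noteq> 0}"
    then have "norm z < 1" "nzper (slice W \<xi> z) \<noteq> {}" using u0[of z] by auto
    then have "u field_differentiable at z" by (rule diff)
    then show "u field_differentiable at z within {z \<in> ball 0 1. u z \<noteq> 0}"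
      by (rule field_differentiable_at_within)
  qed
qed

subsection \<open>The regular part is connected and dense\<close>

text \<open>A ball in complex dimension two remains connected when its centre is removed.\<close>

lemma punctured_neighbourhood:
  assumes p: "p \<in> topspace N" and W: "openin N W" "p \<in> W"
  obtains B where "openin N B" "p \<in> B" "B \<subseteq> W" "connectedin N (B - {p})" "B - {p} \<noteq> {}"
proof -
  obtain U \<phi> where U: "(U, \<phi>) \<in> A" "p \<in> U" using chart_exists[OF p] by blast
  have "open (\<phi> ` (U \<inter> W))" by (rule chart_image_of_open[OF U(1) W(1)])
  then obtain r where r: "r > 0" "ball (\<phi> p) r \<subseteq> \<phi> ` (U \<inter> W)" using U W open_contains_ball by blast
  define B where "B = {x \<in> U. \<phi> x \<in> ball (\<phi> p) r}"
  have B: "openin N B" unfolding B_def by (rule chart_preimage_open[OF U(1)]) simp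
  have inv: "inv_into U \<phi> y \<in> U \<and> \<phi> (inv_into U \<phi> y) = y" if "y \<in> ball (\<phi> p) r" for y
  proof -
    have "y \<in> \<phi> ` U" using that r by blast
    then show ?thesis by (simp add: inv_into_into f_inv_into_f)
  qed
  have img: "inv_into U \<phi> ` (ball (\<phi> p) r - {\<phi> p}) = B - {p}"
  proof (intro equalityI subsetI)
    fix x assume "x \<in> inv_into U \<phi> ` (ball (\<phi> p) r - {\<phi> p})"
    then obtain y where y: "x = inv_into U \<phi> y" "y \<in> ball (\<phi> p) r" "y \<noteq> \<phi> p" by blast
    then show "x \<in> B - {p}" using inv[OF y(2)] by (auto simp: B_def)
  next
    fix x assume x: "x \<in> B - {p}"
    then have "\<phi> x \<noteq> \<phi> p" using chart_inj[OF U(1)] U by (auto simp: B_def inj_on_def)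
    then show "x \<in> inv_into U \<phi> ` (ball (\<phi> p) r - {\<phi> p})"
      using x chart_inv[OF U(1), of x] by (intro image_eqI[of _ _ "\<phi> x"]) (auto simp: B_def)
  qed
  have conn: "connected (ball (\<phi> p) r - {\<phi> p})"
    by (rule connected_open_delete) (auto simp: DIM_cart)
  have "continuous_map (top_of_set (\<phi> ` U)) N (inv_into U \<phi>)" by (rule chart_inv_continuous[OF U(1)])
  moreover have "connectedin (top_of_set (\<phi> ` U)) (ball (\<phi> p) r - {\<phi> p})"
    using conn r by (auto simp: connectedin_subtopology)
  ultimately have "connectedin N (B - {p})"
    unfolding img[symmetric] by (rule connectedin_continuous_map_image)
  moreover have "\<phi> p + pt (of_real (r / 2)) 0 \<in> ball (\<phi> p) r - {\<phi> p}"
    using r norm_le_component_sum[of "pt (of_real (r / 2)) 0"] by (auto simp: dist_norm vec_eq_iff forall_2)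
  then have "B - {p} \<noteq> {}" using img by blast
  moreover have "B \<subseteq> W"
  proof
    fix x assume "x \<in> B"
    then have "x \<in> U" "\<phi> x \<in> \<phi> ` (U \<inter> W)" using r by (auto simp: B_def)
    then show "x \<in> W" using chart_inj[OF U(1)] by (auto simp: inj_on_def)
  qed
  moreover have "p \<in> B" using U r by (simp add: B_def)
  ultimately show ?thesis using that B by blast
qed

lemma sing_punctured_neighbourhood:
  assumes p: "p \<in> sing N A X" and W: "openin N W" "p \<in> W"
  obtains B where "openin N B" "p \<in> B" "B \<subseteq> W" "connectedin N (B - {p})" "B - {p} \<noteq> {}" "B - {p} \<subseteq> regular_points"
proof -
  obtain W' where W': "openin N W'" "W' \<inter> sing N A X = {p}"
    using isolated p unfolding isolated_singularities_def by blast
  have "p \<in> topspace N" using p by (simp add: sing_def)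
  then obtain B where B: "openin N B" "p \<in> B" "B \<subseteq> W \<inter> W'" "connectedin N (B - {p})" "B - {p} \<noteq> {}"
    using punctured_neighbourhood[of p "W \<inter> W'"] W W' by blast
  moreover have "B - {p} \<subseteq> regular_points"
    using B(1,3) W' openin_subset unfolding regular_points_def by blast
  ultimately show ?thesis using that by blast
qed

lemma regular_dense:
  assumes V: "openin N V" "V \<noteq> {}"
  shows "V \<inter> regular_points \<noteq> {}"
proof -
  obtain p where p: "p \<in> V" using V by blast
  show ?thesis
  proof (cases "p \<in> sing N A X")
    case True
    then obtain B where "B \<subseteq> V" "B - {p} \<noteq> {}" "B - {p} \<subseteq> regular_points"
      using sing_punctured_neighbourhood[OF True V(1) p] by metis
    then show ?thesis by blast
  next
    case False
    then show ?thesis using p V openin_subset unfolding regular_points_def by blast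
  qed
qed

text \<open>A separation of the regular part extends to one of \<open>N\<close>:
  \<open>ext E\<close> collects the open sets whose regular part lies in \<open>E\<close>. The two
  extensions are disjoint since regular points are dense, and together they contain every singular
  point because it has connected punctured neighbourhoods.\<close>

lemma regular_connected: "connectedin N regular_points"
proof (rule ccontr)
  assume "\<not> ?thesis"
  then obtain E1 E2 where E: "openin N E1" "openin N E2" "regular_points \<subseteq> E1 \<union> E2"
    "E1 \<inter> E2 \<inter> regular_points = {}" "E1 \<inter> regular_points \<noteq> {}" "E2 \<inter> regular_points \<noteq> {}"
    unfolding connectedin using openin_regular openin_subset by blast
  define ext where "ext E = \<Union> {B. openin N B \<and> B \<inter> regular_points \<subseteq> E}" for E
  have o: "openin N (ext E)" for E unfolding ext_def by (rule openin_Union) blast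
  have disj: "ext E1 \<inter> ext E2 = {}"
  proof (rule ccontr)
    assume "ext E1 \<inter> ext E2 \<noteq> {}"
    then obtain B1 B2 where "openin N B1" "B1 \<inter> regular_points \<subseteq> E1" "openin N B2" "B2 \<inter> regular_points \<subseteq> E2"
      "B1 \<inter> B2 \<noteq> {}" unfolding ext_def by blast
    then show False using regular_dense[of "B1 \<inter> B2"] E(4) by blast
  qed
  have E_ext: "E1 \<subseteq> ext E1" "E2 \<subseteq> ext E2" unfolding ext_def using E by blast+
  have "topspace N \<subseteq> ext E1 \<union> ext E2"
  proof
    fix x assume x: "x \<in> topspace N"
    show "x \<in> ext E1 \<union> ext E2"
    proof (cases "x \<in> sing N A X")
      case False
      then have "x \<in> regular_points" using x by (simp add: regular_points_def)
      then show ?thesis using E(3) E_ext by blast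
    next
      case True
      obtain B where B: "openin N B" "x \<in> B" "connectedin N (B - {x})" "B - {x} \<subseteq> regular_points"
        using sing_punctured_neighbourhood[OF True openin_topspace x] by metis
      have "B - {x} \<subseteq> E1 \<or> B - {x} \<subseteq> E2"
      proof (rule ccontr)
        assume "\<not> ?thesis"
        then have "E1 \<inter> (B - {x}) \<noteq> {}" "E2 \<inter> (B - {x}) \<noteq> {}" using B(4) E(3) by blast+
        moreover have "B - {x} \<subseteq> E1 \<union> E2" "E1 \<inter> E2 \<inter> (B - {x}) = {}" using B(4) E(3,4) by blast+
        ultimately show False using B(3) E(1,2) unfolding connectedin by blast
      qed
      moreover have "B \<inter> regular_points \<subseteq> B - {x}" using True by (auto simp: regular_points_def)
      ultimately show ?thesis using B(1,2) unfolding ext_def by blast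
    qed
  qed
  moreover have "ext E1 \<noteq> {}" "ext E2 \<noteq> {}" using E E_ext by blast+
  ultimately show False using connected disj o unfolding connected_space_def by blast
qed

subsection \<open>Transversally holomorphic functions of a given weight\<close>

text \<open>Holomorphy is demanded only in one variable, on slices of flow boxes, which is what
  Rado's theorem and parameter integrals deliver. Together with the equivariance it implies
  holomorphy on the regular part. Weight 0 means invariance under the flow.\<close>

definition weight_fun :: "complex \<Rightarrow> ('a \<Rightarrow> complex) \<Rightarrow> bool" where
  "weight_fun \<nu> g \<longleftrightarrow> (\<forall>x\<in>regular_points. \<forall>t. g (fl t x) = exp (\<nu> * t) * g x) \<and>
     (\<forall>W \<xi> c. flow_box W \<xi> c \<longrightarrow> (\<lambda>z. g (slice W \<xi> z)) holomorphic_on ball 0 1)"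

lemma weight_fun_fl: "weight_fun \<nu> g \<Longrightarrow> x \<in> regular_points \<Longrightarrow> g (fl t x) = exp (\<nu> * t) * g x"
  and weight_fun_slice: "weight_fun \<nu> g \<Longrightarrow> flow_box W \<xi> c \<Longrightarrow> (\<lambda>z. g (slice W \<xi> z)) holomorphic_on ball 0 1"
  unfolding weight_fun_def by blast+

lemma weight_funI:
  assumes "\<And>x t. x \<in> regular_points \<Longrightarrow> g (fl t x) = exp (\<nu> * t) * g x"
    and "\<And>W \<xi> c. flow_box W \<xi> c \<Longrightarrow> (\<lambda>z. g (slice W \<xi> z)) holomorphic_on ball 0 1"
  shows "weight_fun \<nu> g"
  using assms unfolding weight_fun_def by blast

lemma weight_fun_const: "weight_fun 0 (\<lambda>_. k)"
  by (rule weight_funI) auto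

lemma weight_fun_mult:
  assumes "weight_fun \<nu> g" "weight_fun \<mu> h"
  shows "weight_fun (\<nu> + \<mu>) (\<lambda>x. g x * h x)"
  using assms[THEN weight_fun_fl] assms[THEN weight_fun_slice]
  by (intro weight_funI holomorphic_on_mult) (auto simp: exp_add ring_distribs)

lemma weight_fun_power:
  assumes "weight_fun \<nu> g"
  shows "weight_fun (of_nat n * \<nu>) (\<lambda>x. g x ^ n)"
  using assms[THEN weight_fun_fl] assms[THEN weight_fun_slice]
  by (intro weight_funI holomorphic_on_power) (auto simp: power_mult_distrib exp_of_nat_mult[symmetric] mult.assoc)

lemma weight_fun_diff_mult:
  assumes "weight_fun \<nu> g" "weight_fun \<nu> h"
  shows "weight_fun \<nu> (\<lambda>x. g x - k * h x)"
  using assms[THEN weight_fun_fl] assms[THEN weight_fun_slice]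
  by (intro weight_funI holomorphic_on_diff holomorphic_on_mult holomorphic_on_const) (auto simp: algebra_simps)

lemma weight_fun_box:
  assumes g: "weight_fun \<nu> g" and b: "flow_box W \<xi> c" and x: "x \<in> W"
  shows "g x = exp (\<nu> * (\<xi> x $ 1 / c)) * g (slice W \<xi> (\<xi> x $ 2))"
  using weight_fun_fl[OF g slice_regular[OF b flow_box_coord_norm[OF b x]], of "\<xi> x $ 1 / c" 2]
    flow_box_slice(1)[OF b x] by metis

text \<open>Zeros accumulating in one slice make the function vanish on the slice and, by
  equivariance, on the whole box. The points near which \<open>g\<close> vanishes then form an open
  and closed part of the connected set of regular points.\<close>

lemma weight_fun_identity:
  assumes g: "weight_fun \<nu> g" and b: "flow_box W \<xi> c" and z0: "z0 \<in> ball 0 1"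
    and lim: "z0 islimpt {z \<in> ball 0 1. g (slice W \<xi> z) = 0}" and x: "x \<in> regular_points"
  shows "g x = 0"
proof -
  have box_zero: "g y = 0" if b: "flow_box W \<xi> c" and z0: "z0 \<in> ball 0 1"
    and lim: "z0 islimpt {z \<in> ball 0 1. g (slice W \<xi> z) = 0}" and y: "y \<in> W" for W \<xi> c z0 y
  proof -
    have "g (slice W \<xi> z) = 0" if "z \<in> ball 0 1" for z
      by (rule analytic_continuation[OF weight_fun_slice[OF g b] _ _ _ z0 lim]) (use that in auto)
    then show ?thesis using weight_fun_box[OF g b y] flow_box_coord_norm[OF b y, of 2] by simp
  qed
  define Z where "Z = {y \<in> regular_points. \<exists>V. openin N V \<and> y \<in> V \<and> (\<forall>v\<in>V. g v = 0)}"
  define Z' where "Z' = regular_points - Z"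
  have "openin N Z"
  proof -
    have "\<exists>T. openin N T \<and> y \<in> T \<and> T \<subseteq> Z" if y: "y \<in> Z" for y
    proof -
      obtain V where "openin N V" "y \<in> V" "\<forall>v\<in>V. g v = 0" "y \<in> regular_points" using y by (auto simp: Z_def)
      then show ?thesis using openin_regular by (intro exI[of _ "V \<inter> regular_points"]) (auto simp: Z_def)
    qed
    then show ?thesis using openin_subopen[of N Z] by blast
  qed
  moreover have "openin N Z'"
  proof -
    have "\<exists>T. openin N T \<and> y \<in> T \<and> T \<subseteq> Z'" if y: "y \<in> Z'" for y
    proof -
      have yr: "y \<in> regular_points" using y by (simp add: Z'_def)
      obtain W \<xi> c where b: "flow_box W \<xi> c" and yW: "y \<in> W" "\<xi> y = 0" and "W \<subseteq> topspace N"
        by (rule flow_box_exists[OF yr openin_topspace regular_in[OF yr]])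
      have W: "openin N W" by (rule chart_open[OF flow_box_chart[OF b]])
      \<comment> \<open>A box around \<open>y\<close> that meets \<open>Z\<close> contains an open
        piece of zeros; the flow carries it to the slice, so \<open>g\<close> would vanish on all of
        \<open>W\<close> and \<open>y\<close> would lie in \<open>Z\<close>.\<close>
      have "W \<inter> Z = {}"
      proof (rule ccontr)
        assume "W \<inter> Z \<noteq> {}"
        then obtain v V where v: "v \<in> W" and V: "openin N V" "v \<in> V" "\<forall>v\<in>V. g v = 0" by (auto simp: Z_def)
        define z1 where "z1 = \<xi> v $ 2"
        define s where "s = \<xi> v $ 1 / c"
        have z1: "z1 \<in> ball 0 1" using flow_box_coord_norm[OF b v] by (simp add: z1_def)
        have fv: "fl s (slice W \<xi> z1) = v" using flow_box_slice(1)[OF b v] by (simp add: s_def z1_def)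
        have "open {z \<in> ball 0 1. fl s (slice W \<xi> z) \<in> V}"
          by (rule curve_preimage_open[OF _ _ V(1)]) (use hcurve_fl[OF slice_hcurve[OF b]] in \<open>auto simp: hcurve_def\<close>)
        then have "z1 islimpt {z \<in> ball 0 1. fl s (slice W \<xi> z) \<in> V}"
          using z1 fv V(2) by (intro interior_limit_point) (simp add: interior_open)
        then have "z1 islimpt {z \<in> ball 0 1. g (slice W \<xi> z) = 0}"
        proof (rule islimpt_subset)
          show "{z \<in> ball 0 1. fl s (slice W \<xi> z) \<in> V} \<subseteq> {z \<in> ball 0 1. g (slice W \<xi> z) = 0}"
            using V(3) weight_fun_fl[OF g slice_regular[OF b]] by auto
        qed
        then have "\<forall>w\<in>W. g w = 0" using box_zero[OF b z1] by blast
        then have "y \<in> Z" using W yW yr by (auto simp: Z_def)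
        then show False using y by (simp add: Z'_def)
      qed
      then show ?thesis using W yW flow_box_regular[OF b] by (intro exI[of _ W]) (auto simp: Z'_def)
    qed
    then show ?thesis using openin_subopen[of N Z'] by blast
  qed
  moreover have "Z \<inter> regular_points \<noteq> {}"
  proof -
    have W: "openin N W" "W \<subseteq> regular_points" using chart_open[OF flow_box_chart[OF b]] flow_box_regular[OF b] by auto
    have "slice W \<xi> z0 \<in> W" using slice_in[OF b] z0 by simp
    moreover have "\<forall>w\<in>W. g w = 0" using box_zero[OF b z0 lim] by blast
    ultimately have "slice W \<xi> z0 \<in> Z" using W unfolding Z_def by blast
    then show ?thesis by (auto simp: Z_def)
  qed
  ultimately have "Z' \<inter> regular_points = {}"
    using regular_connected unfolding connectedin Z'_def by blast
  then have "x \<in> Z" using x by (auto simp: Z'_def)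
  then show ?thesis by (auto simp: Z_def)
qed

lemma weight_fun_has_derivative:
  assumes g: "weight_fun \<nu> g" and b: "flow_box W \<xi> c" and x: "x \<in> W"
  shows "\<exists>a b. ((g \<circ> inv_into W \<xi>) has_derivative (\<lambda>h. a * h $ 1 + b * h $ 2)) (at (\<xi> x))"
proof -
  define v where "v z = g (slice W \<xi> z)" for z
  define E where "E y = exp (\<nu> * (y $ 1 / c)) * v (y $ 2)" for y :: "complex^2"
  have c: "c \<noteq> 0" by (rule flow_box_nonzero[OF b])
  have dv: "(v has_field_derivative deriv v (\<xi> x $ 2)) (at (\<xi> x $ 2))"
    using weight_fun_slice[OF g b] flow_box_coord_norm[OF b x] unfolding v_def
    by (intro holomorphic_derivI[of _ "ball 0 1"]) auto
  have "((\<lambda>y :: complex^2. v (y $ 2)) has_derivative (\<lambda>h. deriv v (\<xi> x $ 2) * h $ 2)) (at (\<xi> x))"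
    using diff_chain_at[OF bounded_linear_imp_has_derivative[OF bounded_linear_vec_nth[of 2]] dv[unfolded has_field_derivative_def]]
    by (simp add: o_def)
  moreover have "((\<lambda>y :: complex^2. exp (\<nu> * (y $ 1 / c))) has_derivative (\<lambda>h. exp (\<nu> * (\<xi> x $ 1 / c)) * (\<nu> / c) * h $ 1)) (at (\<xi> x))"
  proof -
    have "((\<lambda>w. exp (\<nu> * (w / c))) has_field_derivative exp (\<nu> * (\<xi> x $ 1 / c)) * (\<nu> / c)) (at (\<xi> x $ 1))"
      using c by (auto intro!: derivative_eq_intros)
    from diff_chain_at[OF bounded_linear_imp_has_derivative[OF bounded_linear_vec_nth[of 1]] this[unfolded has_field_derivative_def]]
    show ?thesis by (simp add: o_def)
  qed
  ultimately have "(E has_derivative (\<lambda>h. exp (\<nu> * (\<xi> x $ 1 / c)) * (deriv v (\<xi> x $ 2) * h $ 2) +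
      exp (\<nu> * (\<xi> x $ 1 / c)) * (\<nu> / c) * h $ 1 * v (\<xi> x $ 2))) (at (\<xi> x))"
    unfolding E_def[abs_def] by (intro has_derivative_mult)
  then have "(E has_derivative (\<lambda>h. (exp (\<nu> * (\<xi> x $ 1 / c)) * (\<nu> / c) * v (\<xi> x $ 2)) * h $ 1 +
      (exp (\<nu> * (\<xi> x $ 1 / c)) * deriv v (\<xi> x $ 2)) * h $ 2)) (at (\<xi> x))"
    by (rule has_derivative_eq_rhs) (simp add: fun_eq_iff algebra_simps)
  then have "((g \<circ> inv_into W \<xi>) has_derivative (\<lambda>h. (exp (\<nu> * (\<xi> x $ 1 / c)) * (\<nu> / c) * v (\<xi> x $ 2)) * h $ 1 +
      (exp (\<nu> * (\<xi> x $ 1 / c)) * deriv v (\<xi> x $ 2)) * h $ 2)) (at (\<xi> x))"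
  proof (rule has_derivative_transform_within_open[OF _ open_polydisc[of 1]])
    show "\<xi> x \<in> polydisc 1" using flow_box_image[OF b] x by blast
    fix y assume "y \<in> polydisc 1"
    then obtain w where "w \<in> W" "y = \<xi> w" using flow_box_image[OF b] by blast
    then show "E y = (g \<circ> inv_into W \<xi>) y"
      using weight_fun_box[OF g b] chart_inv[OF flow_box_chart[OF b]] by (simp add: E_def v_def)
  qed
  then show ?thesis by blast
qed

lemma weight_fun_holomorphic:
  assumes "weight_fun \<nu> g"
  shows "holomorphic_fun_on N A regular_points g"
proof (rule holomorphic_fun_onI[OF openin_regular])
  fix x assume x: "x \<in> regular_points"
  obtain W \<xi> c where b: "flow_box W \<xi> c" and xW: "x \<in> W" "\<xi> x = 0" and "W \<subseteq> topspace N"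
    by (rule flow_box_exists[OF x openin_topspace regular_in[OF x]])
  then show "\<exists>U \<phi> a b. (U, \<phi>) \<in> A \<and> x \<in> U \<and> ((g \<circ> inv_into U \<phi>) has_derivative (\<lambda>h. a * h $ 1 + b * h $ 2)) (at (\<phi> x))"
    using weight_fun_has_derivative[OF assms b] flow_box_chart[OF b] by blast
qed

end

section \<open>The quotient of two independent functions of equal weight\<close>

locale first_integral_pair = separated_flow N A X
  for N :: "'a topology" and A :: "('a, 2) chart set" and X :: "('a, 2) vfield" +
  fixes \<nu> :: complex and g1 g2 :: "'a \<Rightarrow> complex"
  assumes weight1: "weight_fun \<nu> g1" and weight2: "weight_fun \<nu> g2"
    and nonzero2: "\<exists>x\<in>regular_points. g2 x \<noteq> 0"
    and independent: "\<And>k. \<exists>x\<in>regular_points. g1 x \<noteq> k * g2 x"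
begin

lemma slice_zeros_isolated:
  assumes b: "flow_box W \<xi> c" and z0: "z0 \<in> ball 0 1"
  shows "\<not> z0 islimpt {z \<in> ball 0 1. g2 (slice W \<xi> z) = 0}"
    and "\<not> z0 islimpt {z \<in> ball 0 1. g1 (slice W \<xi> z) = k * g2 (slice W \<xi> z)}"
proof
  assume "z0 islimpt {z \<in> ball 0 1. g2 (slice W \<xi> z) = 0}"
  then show False using weight_fun_identity[OF weight2 b z0] nonzero2 by blast
next
  show "\<not> z0 islimpt {z \<in> ball 0 1. g1 (slice W \<xi> z) = k * g2 (slice W \<xi> z)}"
  proof
    assume "z0 islimpt {z \<in> ball 0 1. g1 (slice W \<xi> z) = k * g2 (slice W \<xi> z)}"
    then have "z0 islimpt {z \<in> ball 0 1. g1 (slice W \<xi> z) - k * g2 (slice W \<xi> z) = 0}" by simp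
    then have "g1 x - k * g2 x = 0" if "x \<in> regular_points" for x
      using weight_fun_identity[OF weight_fun_diff_mult[OF weight1 weight2] b z0] that by blast
    then show False using independent[of k] by auto
  qed
qed

text \<open>Along one orbit the values of \<open>g1\<close> and \<open>g2\<close> change only by a
  common factor. So its points on a slice are zeros of \<open>g2\<close>, or of
  \<open>g1 - k * g2\<close> with \<open>k\<close> the value of the quotient at \<open>q\<close>,
  and neither zero set accumulates.\<close>

lemma orbit_sparse_in_slice:
  assumes b: "flow_box W \<xi> c" and z0: "z0 \<in> ball 0 1" and q: "q \<in> regular_points"
  shows "\<not> z0 islimpt {z \<in> ball 0 1. slice W \<xi> z \<in> orbit N A X q}"
proof
  assume lim: "z0 islimpt {z \<in> ball 0 1. slice W \<xi> z \<in> orbit N A X q}"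
  have orb: "\<exists>t. x = fl t q" if "x \<in> orbit N A X q" for x
    using that orbit_eq[OF regular_in[OF q]] by blast
  show False
  proof (cases "g2 q = 0")
    case True
    have "z0 islimpt {z \<in> ball 0 1. g2 (slice W \<xi> z) = 0}"
      by (rule islimpt_subset[OF lim]) (use orb True weight_fun_fl[OF weight2 q] in force)
    then show ?thesis using slice_zeros_isolated(1)[OF b z0] by blast
  next
    case False
    have "z0 islimpt {z \<in> ball 0 1. g1 (slice W \<xi> z) = (g1 q / g2 q) * g2 (slice W \<xi> z)}"
      by (rule islimpt_subset[OF lim])
         (use orb False weight_fun_fl[OF weight1 q] weight_fun_fl[OF weight2 q] in force)
    then show ?thesis using slice_zeros_isolated(2)[OF b z0] by blast
  qed
qed

lemma nonzero_dense:
  assumes V: "openin N V" "V \<noteq> {}"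
  shows "\<exists>x\<in>V \<inter> regular_points. g2 x \<noteq> 0"
proof -
  have "V \<inter> regular_points \<noteq> {}" by (rule regular_dense[OF V])
  then obtain x where x: "x \<in> V" "x \<in> regular_points" by blast
  obtain W \<xi> c where b: "flow_box W \<xi> c" and xW: "x \<in> W" "\<xi> x = 0" and W: "W \<subseteq> V"
    by (rule flow_box_exists[OF x(2) V(1) x(1)])
  show ?thesis
  proof (rule ccontr)
    assume "\<not> ?thesis"
    then have "g2 y = 0" if "y \<in> W" for y using that W flow_box_regular[OF b] by blast
    then have "{z \<in> ball 0 1. g2 (slice W \<xi> z) = 0} = ball 0 1" using slice_in[OF b] by auto
    moreover have "(0::complex) islimpt ball 0 1" by (simp add: islimpt_ball)
    ultimately show False using slice_zeros_isolated(1)[OF b, of 0] by simp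
  qed
qed

definition dom :: "'a set" where
  "dom = {x \<in> regular_points. g2 x \<noteq> 0}"

definition quot :: "'a \<Rightarrow> complex" where
  "quot x = g1 x / g2 x"

lemma openin_dom: "openin N dom"
proof -
  have "continuous_map (subtopology N regular_points) euclidean g2"
    using weight_fun_holomorphic[OF weight2] unfolding holomorphic_fun_on_def holomorphic_map_def by blast
  from openin_continuous_map_preimage[OF this, of "- {0}"] open_Compl[OF closed_singleton, of "0::complex"]
  have "openin (subtopology N regular_points) {x \<in> topspace N \<inter> regular_points. g2 x \<noteq> 0}" by simp
  moreover have "{x \<in> topspace N \<inter> regular_points. g2 x \<noteq> 0} = dom" by (auto simp: dom_def)
  ultimately show ?thesis using openin_trans_full openin_regular by metis
qed

lemma quot_fl: "x \<in> regular_points \<Longrightarrow> quot (fl t x) = quot x"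
  using weight_fun_fl[OF weight1] weight_fun_fl[OF weight2] by (simp add: quot_def)

lemma quot_holomorphic: "holomorphic_fun_on N A dom quot"
proof (rule holomorphic_fun_onI[OF openin_dom])
  fix x assume x: "x \<in> dom"
  then have xr: "x \<in> regular_points" "g2 x \<noteq> 0" by (auto simp: dom_def)
  obtain W \<xi> c where b: "flow_box W \<xi> c" and xW: "x \<in> W" "\<xi> x = 0" and "W \<subseteq> topspace N"
    by (rule flow_box_exists[OF xr(1) openin_topspace regular_in[OF xr(1)]])
  obtain a1 b1 where d1: "((g1 \<circ> inv_into W \<xi>) has_derivative (\<lambda>h. a1 * h $ 1 + b1 * h $ 2)) (at (\<xi> x))"
    using weight_fun_has_derivative[OF weight1 b xW(1)] by blast
  obtain a2 b2 where d2: "((g2 \<circ> inv_into W \<xi>) has_derivative (\<lambda>h. a2 * h $ 1 + b2 * h $ 2)) (at (\<xi> x))"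
    using weight_fun_has_derivative[OF weight2 b xW(1)] by blast
  have ix: "inv_into W \<xi> (\<xi> x) = x" by (rule chart_inv[OF flow_box_chart[OF b] xW(1)])
  define k where "k = inverse (g2 x)"
  have "((\<lambda>y. (g1 \<circ> inv_into W \<xi>) y / (g2 \<circ> inv_into W \<xi>) y) has_derivative
      (\<lambda>h. - g1 x * (k * (a2 * h $ 1 + b2 * h $ 2) * k) + (a1 * h $ 1 + b1 * h $ 2) / g2 x)) (at (\<xi> x))"
    using has_derivative_divide[OF d1 d2] xr(2) by (simp add: ix k_def)
  then have "((quot \<circ> inv_into W \<xi>) has_derivative
      (\<lambda>h. (k * a1 - g1 x * k * k * a2) * h $ 1 + (k * b1 - g1 x * k * k * b2) * h $ 2)) (at (\<xi> x))"
    by (rule has_derivative_eq_rhs[OF has_derivative_transform_within_open[OF _ open_UNIV]])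
       (simp_all add: quot_def fun_eq_iff k_def divide_inverse algebra_simps)
  then show "\<exists>U \<phi> a b. (U, \<phi>) \<in> A \<and> x \<in> U \<and> ((quot \<circ> inv_into U \<phi>) has_derivative (\<lambda>h. a * h $ 1 + b * h $ 2)) (at (\<phi> x))"
    using flow_box_chart[OF b] xW by blast
qed

lemma hartogs_at_sing:
  assumes p: "p \<in> sing N A X" and g: "holomorphic_fun_on N A regular_points g"
    and W: "openin N W" "p \<in> W"
  obtains V G where "openin N V" "p \<in> V" "V \<subseteq> W" "V - {p} \<subseteq> regular_points" "holomorphic_fun_on N A V G"
    "\<And>x. x \<in> V - {p} \<Longrightarrow> G x = g x"
proof -
  obtain B where B: "openin N B" "p \<in> B" "B \<subseteq> W" "B - {p} \<subseteq> regular_points"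
    using sing_punctured_neighbourhood[OF p W] by metis
  have "p \<in> topspace N" using p by (simp add: sing_def)
  then obtain U \<phi> where U: "(U, \<phi>) \<in> A" "p \<in> U" using chart_exists by blast
  have o: "open (\<phi> ` (U \<inter> B))" by (rule chart_image_of_open[OF U(1) B(1)])
  have "holo2 (g \<circ> inv_into U \<phi>) (\<phi> ` (U \<inter> regular_points))"
    using g U unfolding holomorphic_fun_on_iff by blast
  moreover have "\<phi> ` (U \<inter> B) - {\<phi> p} \<subseteq> \<phi> ` (U \<inter> regular_points)" using B(4) by blast
  ultimately have "holo2 (g \<circ> inv_into U \<phi>) (\<phi> ` (U \<inter> B) - {\<phi> p})" by (rule holo2_subset)
  note H = this
  have pin: "\<phi> p \<in> \<phi> ` (U \<inter> B)" using U B by blast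
  obtain F V where V: "open V" "\<phi> p \<in> V" "V \<subseteq> \<phi> ` (U \<inter> B)" "holo2 F V"
    "\<And>y. y \<in> V - {\<phi> p} \<Longrightarrow> F y = (g \<circ> inv_into U \<phi>) y"
    by (rule hartogs_isolated_point[OF o pin H]) blast
  define V' where "V' = {x \<in> U. \<phi> x \<in> V}"
  have V'o: "openin N V'" unfolding V'_def by (rule chart_preimage_open[OF U(1) V(1)])
  have V'B: "V' \<subseteq> B"
  proof
    fix x assume "x \<in> V'"
    then have "x \<in> U" "\<phi> x \<in> \<phi> ` (U \<inter> B)" using V by (auto simp: V'_def)
    then show "x \<in> B" using chart_inj[OF U(1)] by (auto simp: inj_on_def)
  qed
  have "holomorphic_fun_on N A V' (F \<circ> \<phi>)"
  proof (rule holomorphic_fun_onI[OF V'o])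
    fix x assume x: "x \<in> V'"
    then obtain a b where "(F has_derivative (\<lambda>h. a * h $ 1 + b * h $ 2)) (at (\<phi> x))"
      using V(4) unfolding holo2_def V'_def by blast
    then have "((F \<circ> \<phi> \<circ> inv_into U \<phi>) has_derivative (\<lambda>h. a * h $ 1 + b * h $ 2)) (at (\<phi> x))"
      by (rule has_derivative_transform_within_open[OF _ V(1)])
         (use x V(3) in \<open>auto simp: V'_def f_inv_into_f\<close>)
    then show "\<exists>U' \<phi>' a b. (U', \<phi>') \<in> A \<and> x \<in> U' \<and> ((F \<circ> \<phi> \<circ> inv_into U' \<phi>') has_derivative (\<lambda>h. a * h $ 1 + b * h $ 2)) (at (\<phi>' x))"
      using U x by (auto simp: V'_def)
  qed
  moreover have "(F \<circ> \<phi>) x = g x" if x: "x \<in> V' - {p}" for x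
  proof -
    have "\<phi> x \<noteq> \<phi> p" using x chart_inj[OF U(1)] U by (auto simp: V'_def inj_on_def)
    then show ?thesis using V(5)[of "\<phi> x"] x U by (simp add: V'_def)
  qed
  moreover have "p \<in> V'" using U V by (simp add: V'_def)
  ultimately show ?thesis using that[of V' "F \<circ> \<phi>"] V'o V'B B by blast
qed

lemma holomorphic_fun_on_open_subset:
  assumes "holomorphic_fun_on N A W f" "openin N W'" "W' \<subseteq> W"
  shows "holomorphic_fun_on N A W' f"
  unfolding holomorphic_fun_on_iff
proof (intro conjI assms(2) ballI, clarify)
  fix U \<phi> assume "(U, \<phi>) \<in> A"
  then have "holo2 (f \<circ> inv_into U \<phi>) (\<phi> ` (U \<inter> W))" using assms(1) unfolding holomorphic_fun_on_iff by blast
  then show "holo2 (f \<circ> inv_into U \<phi>) (\<phi> ` (U \<inter> W'))" by (rule holo2_subset) (use assms(3) in blast)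
qed

lemma quot_meromorphic: "meromorphic_function N A dom quot"
  unfolding meromorphic_function_def
proof (intro conjI ballI quot_holomorphic)
  show "N closure_of dom = topspace N"
  proof (intro equalityI subsetI)
    fix x assume x: "x \<in> topspace N"
    show "x \<in> N closure_of dom"
      unfolding in_closure_of
    proof (intro conjI allI impI x)
      fix T assume T: "x \<in> T \<and> openin N T"
      then show "\<exists>y. y \<in> dom \<and> y \<in> T" using nonzero_dense[of T] by (auto simp: dom_def)
    qed
  qed (use closure_of_subset_topspace[of N dom] in blast)
  fix p assume p: "p \<in> topspace N"
  show "\<exists>W g h. p \<in> W \<and> holomorphic_fun_on N A W g \<and> holomorphic_fun_on N A W h \<and>
        (\<forall>W'. openin N W' \<and> W' \<subseteq> W \<and> W' \<noteq> {} \<longrightarrow> (\<exists>x\<in>W'. h x \<noteq> 0)) \<and> (\<forall>x\<in>W \<inter> dom. h x * quot x = g x)"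
  proof (cases "p \<in> sing N A X")
    case False
    then have "p \<in> regular_points" using p by (simp add: regular_points_def)
    moreover have "\<exists>x\<in>W'. g2 x \<noteq> 0" if "openin N W'" "W' \<noteq> {}" for W' using nonzero_dense[OF that] by blast
    ultimately show ?thesis
      using weight_fun_holomorphic[OF weight1] weight_fun_holomorphic[OF weight2]
      by (intro exI[of _ regular_points] exI[of _ g1] exI[of _ g2]) (auto simp: quot_def dom_def)
  next
    case True
    obtain V1 G1 where V1: "openin N V1" "p \<in> V1" "V1 - {p} \<subseteq> regular_points" "holomorphic_fun_on N A V1 G1"
      "\<And>x. x \<in> V1 - {p} \<Longrightarrow> G1 x = g1 x"
      using hartogs_at_sing[OF True weight_fun_holomorphic[OF weight1] openin_topspace p] by metis
    obtain V G2 where V: "openin N V" "p \<in> V" "V \<subseteq> V1" "V - {p} \<subseteq> regular_points" "holomorphic_fun_on N A V G2"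
      "\<And>x. x \<in> V - {p} \<Longrightarrow> G2 x = g2 x"
      using hartogs_at_sing[OF True weight_fun_holomorphic[OF weight2] V1(1,2)] by metis
    have "holomorphic_fun_on N A V G1" by (rule holomorphic_fun_on_open_subset[OF V1(4) V(1,3)])
    moreover have "\<exists>x\<in>W'. G2 x \<noteq> 0" if W': "openin N W'" "W' \<subseteq> V" "W' \<noteq> {}" for W'
    proof -
      obtain x where x: "x \<in> W'" "x \<in> regular_points" "g2 x \<noteq> 0" using nonzero_dense[OF W'(1,3)] by blast
      then have "x \<in> V - {p}" using W' True by (auto simp: regular_points_def)
      then show ?thesis using V(6) x by metis
    qed
    moreover have "G2 x * quot x = G1 x" if x: "x \<in> V \<inter> dom" for x
    proof -
      have "x \<in> V - {p}" "x \<in> V1 - {p}" using x True V(3) by (auto simp: dom_def regular_points_def)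
      then show ?thesis using V(6) V1(5) x by (simp add: dom_def quot_def)
    qed
    ultimately show ?thesis using V(2,5) by blast
  qed
qed

lemma quot_first_integral: "meromorphic_first_integral N A X dom quot"
  unfolding meromorphic_first_integral_def
proof (intro conjI ballI quot_meromorphic)
  show "\<not> quot constant_on dom"
  proof
    assume "quot constant_on dom"
    then obtain k where "\<And>x. x \<in> dom \<Longrightarrow> quot x = k" by (auto simp: constant_on_def)
    then have k: "g1 x = k * g2 x" if "x \<in> dom" for x using that by (force simp: dom_def quot_def)
    obtain x where x: "x \<in> dom" using nonzero2 by (auto simp: dom_def)
    then have xr: "x \<in> regular_points" by (simp add: dom_def)
    obtain W \<xi> c where b: "flow_box W \<xi> c" and xW: "x \<in> W" "\<xi> x = 0" and W: "W \<subseteq> dom"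
      by (rule flow_box_exists[OF xr openin_dom x])
    have "{z \<in> ball 0 1. g1 (slice W \<xi> z) = k * g2 (slice W \<xi> z)} = ball 0 1"
      using k subsetD[OF W slice_in[OF b]] by auto
    moreover have "(0::complex) islimpt ball 0 1" by (simp add: islimpt_ball)
    ultimately show False using slice_zeros_isolated(2)[OF b, of 0 k] by simp
  qed
  fix L assume "L \<in> leaves N A X"
  then obtain q where q: "q \<in> regular_points" "L = orbit N A X q" by (auto simp: leaves_def regular_points_def)
  then have "quot x = quot q" if "x \<in> L" for x using that orbit_eq quot_fl by auto
  then show "quot constant_on L \<inter> dom" by (auto simp: constant_on_def)
qed

text \<open>Points of \<open>L\<close> close to a regular point \<open>x\<close> outside
  \<open>L\<close> can be pushed along their plaques into the slice through \<open>x\<close>. They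
  would accumulate at the parameter 0 without attaining it, against the sparseness of orbits in
  slices.\<close>

lemma leaf_closed:
  assumes "L \<in> leaves N A X"
  shows "closedin (subtopology N (topspace N - sing N A X)) L"
proof -
  obtain q where q: "q \<in> regular_points" and L: "L = orbit N A X q" using assms by (auto simp: leaves_def regular_points_def)
  have Leq: "L = range (\<lambda>t. fl t q)" using orbit_eq q L by simp
  have Lfl: "fl t x \<in> L \<longleftrightarrow> x \<in> L" if "x \<in> topspace N" for t x
    unfolding L by (rule fl_in_orbit_iff[OF regular_in[OF q] that])
  have LM: "L \<subseteq> regular_points" using Leq q by auto
  have "\<exists>T. openin N T \<and> x \<in> T \<and> T \<subseteq> regular_points - L" if x: "x \<in> regular_points - L" for x
  proof (rule ccontr)
    assume contr: "\<not> ?thesis"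
    have xr: "x \<in> regular_points" using x by simp
    obtain W \<xi> c where b: "flow_box W \<xi> c" and xW: "x \<in> W" "\<xi> x = 0" and "W \<subseteq> topspace N"
      by (rule flow_box_exists[OF xr openin_topspace regular_in[OF xr]])
    have x0: "slice W \<xi> 0 = x" by (rule slice_unique[OF b xW(1)]) (simp add: xW(2) vec_eq_iff forall_2)
    have "\<exists>z\<in>{z \<in> ball 0 1. slice W \<xi> z \<in> L}. z \<noteq> 0 \<and> dist z 0 < e" if e: "e > 0" for e
    proof -
      define V where "V = {y \<in> W. norm (\<xi> y $ 1) < e \<and> norm (\<xi> y $ 2 - 0) < e}"
      have V: "openin N V" "slice W \<xi> 0 \<in> V" unfolding V_def using flow_box_neighbourhood[OF b _ e, of 0] by auto
      have "V \<subseteq> regular_points" using flow_box_regular[OF b] by (auto simp: V_def)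
      moreover have "\<not> V \<subseteq> regular_points - L" using contr V unfolding x0 by blast
      ultimately obtain y where y: "y \<in> V" "y \<in> L" by blast
      have yW: "y \<in> W" using y by (simp add: V_def)
      then have "slice W \<xi> (\<xi> y $ 2) \<in> L"
        using Lfl y flow_box_slice(2)[OF b yW] flow_box_subset[OF b] by (metis subsetD)
      moreover from this have "\<xi> y $ 2 \<noteq> 0" using x0 x by auto
      ultimately show ?thesis using y flow_box_coord_norm[OF b yW, of 2]
        by (intro bexI[of _ "\<xi> y $ 2"]) (auto simp: V_def)
    qed
    then have "0 islimpt {z \<in> ball 0 1. slice W \<xi> z \<in> L}" unfolding islimpt_approachable by blast
    then show False using orbit_sparse_in_slice[OF b _ q, of 0] by (simp add: L)
  qed
  then have "openin N (regular_points - L)" using openin_subopen[of N "regular_points - L"] by blast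
  moreover have "topspace N \<inter> regular_points = regular_points" by auto
  ultimately show ?thesis
    using LM openin_regular unfolding closedin_def regular_points_def[symmetric]
    by (auto simp: openin_open_subtopology)
qed

end

section \<open>Leaves and holonomy\<close>

context complete_flow
begin

text \<open>A foliated chart need not be a flow box, since the first component of the field may
  vary. The orbit through a point of the plaque covers a neighbourhood of it in the plaque by the
  open mapping theorem, so the parameters \<open>w\<close> that belong to the orbit of
  \<open>q\<close> form an open and closed subset of the disc.\<close>

lemma plaque_subset_orbit:
  assumes fc: "foliated_chart A X ch" and q: "q \<in> fst ch"
  shows "plaque ch q \<subseteq> orbit N A X q"
proof -
  obtain U \<phi> where ch: "ch = (U, \<phi>)" by (cases ch)
  have U: "(U, \<phi>) \<in> A" and im: "\<phi> ` U = polydisc 1"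
    and X: "\<And>p. p \<in> U \<Longrightarrow> X (U, \<phi>) p $ 1 \<noteq> 0 \<and> X (U, \<phi>) p $ 2 = 0"
    using fc unfolding ch foliated_chart_def polydisc_def by auto
  have qU: "q \<in> U" using q ch by simp
  then have qN: "q \<in> topspace N" using chart_subset[OF U] by blast
  define z where "z = \<phi> q $ 2"
  have cn: "norm (\<phi> x $ i) < 1" if "x \<in> U" for x i using im that unfolding polydisc_def by blast
  define d where "d w = inv_into U \<phi> (pt w z)" for w
  have d: "d w \<in> U" "\<phi> (d w) = pt w z" if "w \<in> ball 0 1" for w
  proof -
    have "pt w z \<in> \<phi> ` U" using that cn[OF qU, of 2] by (simp add: im mem_polydisc z_def)
    then show "d w \<in> U" "\<phi> (d w) = pt w z" unfolding d_def by (rule inv_into_into, rule f_inv_into_f)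
  qed
  have dN: "d w \<in> topspace N" if "w \<in> ball 0 1" for w using d(1)[OF that] chart_subset[OF U] by blast
  have local: "\<exists>O'. open O' \<and> w0 \<in> O' \<and> (\<forall>w\<in>O'. w \<in> ball 0 1 \<and> (\<exists>t. d w = fl t (d w0)))"
    if w0: "w0 \<in> ball 0 1" for w0
  proof -
    define x0 where "x0 = d w0"
    have x0: "x0 \<in> U" "\<phi> x0 = pt w0 z" "x0 \<in> topspace N" using d[OF w0] dN[OF w0] by (auto simp: x0_def)
    have "open {t. fl t x0 \<in> U}" by (rule fl_preimage_open[OF x0(3) chart_open[OF U]])
    moreover have "0 \<in> {t. fl t x0 \<in> U}" using x0 by simp
    ultimately obtain \<delta> where \<delta>: "\<delta> > 0" "ball 0 \<delta> \<subseteq> {t. fl t x0 \<in> U}"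
      by (meson open_contains_ball)
    have inU: "fl t x0 \<in> U" if "t \<in> ball 0 \<delta>" for t using that \<delta>(2) by blast
    define e where "e i t = \<phi> (fl t x0) $ i" for i t
    have der: "(e i has_field_derivative X (U, \<phi>) (fl t x0) $ i) (at t)" if "t \<in> ball 0 \<delta>" for i t
      using fl_deriv[OF x0(3) U, of t] inU[OF that] unfolding cvderiv_iff e_def by blast
    have "\<exists>k. \<forall>t\<in>ball 0 \<delta>. e 2 t = k"
    proof (rule has_field_derivative_zero_constant)
      show "(e 2 has_field_derivative 0) (at t within ball 0 \<delta>)" if "t \<in> ball 0 \<delta>" for t
        using der[OF that, of 2] X[OF inU[OF that]] by (simp add: has_field_derivative_at_within)
    qed simp
    then have e2: "e 2 t = z" if "t \<in> ball 0 \<delta>" for t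
      using that \<delta>(1) x0 by (metis centre_in_ball e_def fl_0 vector_2(2))
    have e1h: "e 1 holomorphic_on ball 0 \<delta>" by (simp add: holomorphic_on_open) (use der[of _ 1] in \<open>metis mem_ball_0\<close>)
    \<comment> \<open>The nonzero first component of the field makes the first coordinate
      nonconstant in time, as the open mapping theorem requires.\<close>
    have "\<not> e 1 constant_on ball 0 \<delta>"
    proof
      assume "e 1 constant_on ball 0 \<delta>"
      then obtain k where k: "\<And>t. t \<in> ball 0 \<delta> \<Longrightarrow> k = e 1 t" by (auto simp: constant_on_def)
      have "(e 1 has_field_derivative 0) (at 0)"
        by (rule has_field_derivative_transform_within_open[OF DERIV_const open_ball[of 0 \<delta>] _ k])
          (use \<delta>(1) in auto)
      moreover have "(e 1 has_field_derivative X (U, \<phi>) x0 $ 1) (at 0)" using der[of 0 1] \<delta> x0 by simp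
      ultimately show False using DERIV_unique X[OF x0(1)] by metis
    qed
    then have "open (e 1 ` ball 0 \<delta>)" by (intro open_mapping_thm[OF e1h open_ball connected_ball open_ball order_refl])
    moreover have "w0 \<in> e 1 ` ball 0 \<delta>" using \<delta> x0 by (intro image_eqI[of _ _ 0]) (auto simp: e_def)
    moreover have "w \<in> ball 0 1 \<and> (\<exists>t. d w = fl t (d w0))" if w: "w \<in> e 1 ` ball 0 \<delta>" for w
    proof -
      obtain t where t: "t \<in> ball 0 \<delta>" "w = e 1 t" using w by blast
      have tU: "fl t x0 \<in> U" using t \<delta> by blast
      have "\<phi> (fl t x0) = pt w z" using t e2[OF t(1)] by (simp add: vec_eq_iff forall_2 e_def)
      then have "d w = fl t x0" using chart_inv[OF U tU] by (simp add: d_def)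
      then show ?thesis using t cn[OF tU, of 1] by (auto simp: e_def x0_def)
    qed
    ultimately show ?thesis by blast
  qed
  define S where "S = {w \<in> ball 0 1. d w \<in> orbit N A X q}"
  define T where "T = {w \<in> ball 0 1. d w \<notin> orbit N A X q}"
  have loc2: "\<exists>O'. open O' \<and> w0 \<in> O' \<and> O' \<subseteq> ball 0 1 \<and> (\<forall>w\<in>O'. d w \<in> orbit N A X q \<longleftrightarrow> d w0 \<in> orbit N A X q)"
    if w0: "w0 \<in> ball 0 1" for w0
  proof -
    obtain O' where O': "open O'" "w0 \<in> O'" "\<And>w. w \<in> O' \<Longrightarrow> w \<in> ball 0 1 \<and> (\<exists>t. d w = fl t (d w0))"
      using local[OF w0] by blast
    have "d w \<in> orbit N A X q \<longleftrightarrow> d w0 \<in> orbit N A X q" if "w \<in> O'" for w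
      using O'(3)[OF that] fl_in_orbit_iff[OF qN dN[OF w0]] by auto
    then show ?thesis using O' by blast
  qed
  have "open S"
  proof (subst open_subopen, intro ballI)
    fix w0 assume "w0 \<in> S"
    then have w0: "w0 \<in> ball 0 1" "d w0 \<in> orbit N A X q" by (auto simp: S_def)
    obtain O' where "open O'" "w0 \<in> O'" "O' \<subseteq> ball 0 1" "\<forall>w\<in>O'. d w \<in> orbit N A X q \<longleftrightarrow> d w0 \<in> orbit N A X q"
      using loc2[OF w0(1)] by blast
    then show "\<exists>O'. open O' \<and> w0 \<in> O' \<and> O' \<subseteq> S" using w0(2) unfolding S_def by blast
  qed
  moreover have "open T"
  proof (subst open_subopen, intro ballI)
    fix w0 assume "w0 \<in> T"
    then have w0: "w0 \<in> ball 0 1" "d w0 \<notin> orbit N A X q" by (auto simp: T_def)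
    obtain O' where "open O'" "w0 \<in> O'" "O' \<subseteq> ball 0 1" "\<forall>w\<in>O'. d w \<in> orbit N A X q \<longleftrightarrow> d w0 \<in> orbit N A X q"
      using loc2[OF w0(1)] by blast
    then show "\<exists>O'. open O' \<and> w0 \<in> O' \<and> O' \<subseteq> T" using w0(2) unfolding T_def by blast
  qed
  moreover have "S \<inter> T \<inter> ball 0 1 = {}" "ball 0 1 \<subseteq> S \<union> T" by (auto simp: S_def T_def)
  moreover have "\<phi> q $ 1 \<in> S \<inter> ball 0 1"
  proof -
    have "d (\<phi> q $ 1) = q" using chart_inv[OF U qU] by (simp add: d_def z_def)
    moreover have "q \<in> orbit N A X q" using orbit_eq[OF qN] fl_0[OF qN] by (metis rangeI)
    ultimately show ?thesis using cn[OF qU, of 1] by (simp add: S_def)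
  qed
  ultimately have "T \<inter> ball 0 1 = {}" using connectedD[OF connected_ball[of "0::complex" 1]] by blast
  then have all: "d w \<in> orbit N A X q" if "w \<in> ball 0 1" for w using that by (auto simp: T_def)
  show ?thesis
  proof
    fix x assume "x \<in> plaque ch q"
    then have x: "x \<in> U" "\<phi> x $ 2 = z" by (auto simp: plaque_def ch z_def)
    then have "d (\<phi> x $ 1) = x" using chart_inv[OF U x(1)] unfolding d_def by (metis pt_components)
    then show "x \<in> orbit N A X q" using all[of "\<phi> x $ 1"] cn[OF x(1), of 1] by simp
  qed
qed

lemma orbit_regular: "q \<in> regular_points \<Longrightarrow> orbit N A X q \<subseteq> regular_points"
  using orbit_eq[of q] by auto

lemma orbit_trans: "q \<in> topspace N \<Longrightarrow> x \<in> orbit N A X q \<Longrightarrow> y \<in> orbit N A X x \<Longrightarrow> y \<in> orbit N A X q"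
  using orbit_eq[of q] orbit_eq[of x] fl_fl[of q] by auto

lemma orbit_sym: "q \<in> topspace N \<Longrightarrow> x \<in> orbit N A X q \<Longrightarrow> q \<in> orbit N A X x"
proof -
  assume q: "q \<in> topspace N" and "x \<in> orbit N A X q"
  then obtain t where t: "x = fl t q" using orbit_eq[OF q] by blast
  have "q = fl (- t) x" using fl_inverse(1)[OF q] t by simp
  then show "q \<in> orbit N A X x" using orbit_eq[of x] fl_in[OF q, of t] t by (metis rangeI)
qed

lemma orbit_self: "q \<in> topspace N \<Longrightarrow> q \<in> orbit N A X q"
  using orbit_eq[of q] fl_0[of q] by (metis rangeI)

lemma transversal_subset: "transversal N A X p T \<Longrightarrow> T \<subseteq> regular_points"
  unfolding transversal_def regular_points_def by blast

lemma transversal_base: "transversal N A X p T \<Longrightarrow> p \<in> T"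
  unfolding transversal_def by (metis centre_in_ball image_eqI zero_less_one)

text \<open>Each plaque lies in an orbit, so a chain of plaques produces a continuous germ that
  moves every point within its orbit. These two properties carry the finiteness argument.\<close>

lemma holonomy_along_properties:
  assumes hol: "holonomy_along N A X \<alpha> T s S h" and T: "transversal N A X (\<alpha> 0) T"
  shows "\<exists>V. openin (subtopology N T) V \<and> \<alpha> 0 \<in> V \<and> continuous_map (subtopology N V) (subtopology N S) h \<and>
    h (\<alpha> 0) = \<alpha> s \<and> (\<forall>x\<in>V. h x \<in> orbit N A X x)"
  using hol
proof induction
  case start
  have "\<forall>x\<in>T. x \<in> orbit N A X x" using transversal_subset[OF T] orbit_self by auto
  moreover have "openin (subtopology N T) T"
    using openin_topspace[of "subtopology N T"] transversal_subset[OF T] by (simp add: Int_absorb1 subset_iff)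
  ultimately show ?case using transversal_base[OF T] by (intro exI[of _ T]) auto
next
  case (extend s S h t c S' g)
  then obtain V where V: "openin (subtopology N T) V" "\<alpha> 0 \<in> V" "continuous_map (subtopology N V) (subtopology N S) h"
    "h (\<alpha> 0) = \<alpha> s" "\<forall>x\<in>V. h x \<in> orbit N A X x" by blast
  obtain V2 where V2: "openin (subtopology N S) V2" "\<alpha> s \<in> V2" "V2 \<subseteq> fst c"
    "continuous_map (subtopology N V2) (subtopology N S') g" "g (\<alpha> s) = \<alpha> t" "\<forall>x\<in>V2. g x \<in> plaque c x"
    using extend(8) unfolding plaque_transport_def by blast
  have VT: "V \<subseteq> T" "V \<subseteq> topspace N" using openin_subset[OF V(1)] by auto
  define V' where "V' = {x \<in> V. h x \<in> V2}"
  have "openin (subtopology N V) {x \<in> topspace (subtopology N V). h x \<in> V2}"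
    by (rule openin_continuous_map_preimage[OF V(3) V2(1)])
  moreover have "{x \<in> topspace (subtopology N V). h x \<in> V2} = V'" using VT by (auto simp: V'_def)
  ultimately have "openin (subtopology (subtopology N T) V) V'"
    using VT by (simp add: subtopology_subtopology Int_absorb1)
  then have V'o: "openin (subtopology N T) V'" using openin_trans_full V(1) by blast
  have hV: "continuous_map (subtopology N V') (subtopology N V2) h"
  proof -
    have "continuous_map (subtopology N V') (subtopology N S) h"
      by (rule continuous_map_from_subtopology_mono[OF V(3)]) (auto simp: V'_def)
    then show ?thesis by (auto simp: continuous_map_in_subtopology V'_def)
  qed
  have "(g \<circ> h) x \<in> orbit N A X x" if x: "x \<in> V'" for x
  proof -
    have xN: "x \<in> topspace N" using x VT by (auto simp: V'_def)
    have hx: "h x \<in> orbit N A X x" "h x \<in> V2" using x V by (auto simp: V'_def)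
    then have "g (h x) \<in> orbit N A X (h x)"
      using plaque_subset_orbit[OF extend(4), of "h x"] V2 by blast
    then show ?thesis using orbit_trans[OF xN hx(1)] by simp
  qed
  moreover have "continuous_map (subtopology N V') (subtopology N S') (g \<circ> h)"
    by (rule continuous_map_compose[OF hV V2(4)])
  moreover have "\<alpha> 0 \<in> V'" "(g \<circ> h) (\<alpha> 0) = \<alpha> t" using V V2 by (auto simp: V'_def)
  ultimately show ?case using V'o by (intro exI[of _ V']) blast
qed

text \<open>In a flow box the field is a multiple of the first coordinate vector, so transversality
  means that the second coordinate has nonzero derivative along \<open>\<sigma>\<close>; near
  \<open>p\<close> it is therefore a coordinate on \<open>T\<close>.\<close>

lemma transversal_coordinate:
  assumes T: "transversal N A X p T" and b: "flow_box W \<xi> c" and p: "p \<in> W"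
  obtains \<sigma> e where "\<sigma> 0 = p" "\<sigma> ` ball 0 1 = T" "homeomorphic_map (top_of_set (ball 0 1)) (subtopology N T) \<sigma>"
    "0 < e" "e \<le> 1" "\<And>w. w \<in> ball 0 e \<Longrightarrow> \<sigma> w \<in> W" "(\<lambda>w. \<xi> (\<sigma> w) $ 2) holomorphic_on ball 0 e"
    "inj_on (\<lambda>w. \<xi> (\<sigma> w) $ 2) (ball 0 e)"
proof -
  obtain \<sigma> where \<sigma>: "\<sigma> 0 = p" "\<sigma> ` ball 0 1 = T" "homeomorphic_map (top_of_set (ball 0 1)) (subtopology N T) \<sigma>"
    and der: "\<And>z U \<phi>. z \<in> ball 0 1 \<Longrightarrow> (U, \<phi>) \<in> A \<Longrightarrow> \<sigma> z \<in> U \<Longrightarrow>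
      \<exists>v. cvderiv (\<phi> \<circ> \<sigma>) v z \<and> (\<forall>a. v \<noteq> a *s X (U, \<phi>) (\<sigma> z))"
    using T unfolding transversal_def by (elim exE conjE, goal_cases) (rule that, assumption+, drule (1) bspec, drule (1) bspec, simp)
  have "continuous_map (top_of_set (ball 0 1)) N \<sigma>"
    using homeomorphic_imp_continuous_map[OF \<sigma>(3)] by (simp add: continuous_map_in_subtopology)
  from curve_preimage_open[OF this open_ball chart_open[OF flow_box_chart[OF b]]]
  have "open {z \<in> ball 0 1. \<sigma> z \<in> W}" .
  moreover have "0 \<in> {z \<in> ball 0 1. \<sigma> z \<in> W}" using \<sigma>(1) p by simp
  ultimately obtain e0 where e0: "e0 > 0" "ball 0 e0 \<subseteq> {z \<in> ball 0 1. \<sigma> z \<in> W}"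
    by (meson open_contains_ball)
  have inW: "w \<in> ball 0 1" "\<sigma> w \<in> W" if "w \<in> ball 0 e0" for w using that e0(2) by blast+
  have "\<forall>z\<in>ball 0 e0. \<exists>v. cvderiv (\<xi> \<circ> \<sigma>) v z" using der[OF _ flow_box_chart[OF b]] inW by blast
  then have hol: "(\<lambda>w. \<xi> (\<sigma> w) $ 2) holomorphic_on ball 0 e0"
    using cvderiv_holomorphic_iff[of "ball 0 e0" "\<xi> \<circ> \<sigma>"] by simp
  obtain v where v: "cvderiv (\<xi> \<circ> \<sigma>) v 0" "\<And>a. v \<noteq> a *s X (W, \<xi>) p"
    using der[of 0, OF _ flow_box_chart[OF b]] \<sigma>(1) p by auto
  have "v $ 2 \<noteq> 0"
  proof
    assume "v $ 2 = 0"
    then have "v = (v $ 1 / c) *s X (W, \<xi>) p"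
      using flow_box_field[OF b p] flow_box_nonzero[OF b] by (simp add: vec_eq_iff forall_2)
    then show False using v(2) by blast
  qed
  moreover have "((\<lambda>w. \<xi> (\<sigma> w) $ 2) has_field_derivative v $ 2) (at 0)" using v(1) unfolding cvderiv_iff by simp
  ultimately have "deriv (\<lambda>w. \<xi> (\<sigma> w) $ 2) 0 \<noteq> 0" using DERIV_imp_deriv by metis
  then obtain e where e: "e > 0" "ball 0 e \<subseteq> ball (0::complex) e0" "inj_on (\<lambda>w. \<xi> (\<sigma> w) $ 2) (ball 0 e)"
    by (rule has_complex_derivative_locally_injective[OF hol centre_in_ball[THEN iffD2, OF e0(1)] open_ball])
  have ee: "ball 0 (min e 1) \<subseteq> ball (0::complex) e0" using e(2) by auto
  show ?thesis
  proof (rule that[OF \<sigma>, of "min e 1"])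
    show "(\<lambda>w. \<xi> (\<sigma> w) $ 2) holomorphic_on ball 0 (min e 1)"
      by (rule holomorphic_on_subset[OF hol]) (rule ee)
    show "inj_on (\<lambda>w. \<xi> (\<sigma> w) $ 2) (ball 0 (min e 1))"
      by (rule inj_on_subset[OF e(3)]) auto
    show "\<sigma> w \<in> W" if "w \<in> ball 0 (min e 1)" for w
      using inW(2) ee that by blast
  qed (use e(1) in auto)
qed

lemma fl_in_plaque:
  assumes fc: "foliated_chart A X (U, \<phi>)" and x0: "x0 \<in> U"
  obtains \<delta> where "\<delta> > 0" "\<And>t. t \<in> ball 0 \<delta> \<Longrightarrow> fl t x0 \<in> plaque (U, \<phi>) x0"
proof -
  have U: "(U, \<phi>) \<in> A" and X: "\<And>p. p \<in> U \<Longrightarrow> X (U, \<phi>) p $ 2 = 0"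
    using fc unfolding foliated_chart_def by auto
  have xN: "x0 \<in> topspace N" using x0 chart_subset[OF U] by blast
  have "open {t. fl t x0 \<in> U}" by (rule fl_preimage_open[OF xN chart_open[OF U]])
  moreover have "0 \<in> {t. fl t x0 \<in> U}" using x0 xN by simp
  ultimately obtain \<delta> where \<delta>: "\<delta> > 0" "ball 0 \<delta> \<subseteq> {t. fl t x0 \<in> U}"
    by (meson open_contains_ball)
  have inU: "fl t x0 \<in> U" if "t \<in> ball 0 \<delta>" for t using that \<delta>(2) by blast
  have "\<exists>k. \<forall>t\<in>ball 0 \<delta>. \<phi> (fl t x0) $ 2 = k"
  proof (rule has_field_derivative_zero_constant)
    fix t :: complex assume t: "t \<in> ball 0 \<delta>"
    have "((\<lambda>t. \<phi> (fl t x0) $ 2) has_field_derivative X (U, \<phi>) (fl t x0) $ 2) (at t)"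
      using fl_deriv[OF xN U inU[OF t]] unfolding cvderiv_iff by blast
    then show "((\<lambda>t. \<phi> (fl t x0) $ 2) has_field_derivative 0) (at t within ball 0 \<delta>)"
      using X[OF inU[OF t]] by (simp add: has_field_derivative_at_within)
  qed simp
  then have "\<phi> (fl t x0) $ 2 = \<phi> x0 $ 2" if "t \<in> ball 0 \<delta>" for t
    using that \<delta>(1) xN by (metis centre_in_ball fl_0)
  then show ?thesis using that[of \<delta>] \<delta>(1) inU by (auto simp: plaque_def)
qed

lemma leaf_eq_orbit:
  assumes L: "L \<in> leaves N A X" and p: "p \<in> L"
  shows "p \<in> regular_points" "L = orbit N A X p"
proof -
  obtain q where q: "q \<in> regular_points" "L = orbit N A X q" using L by (auto simp: leaves_def regular_points_def)
  show pr: "p \<in> regular_points" using orbit_regular[OF q(1)] p q(2) by blast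
  have pq: "q \<in> orbit N A X p" using orbit_sym[OF regular_in[OF q(1)]] p q(2) by blast
  show "L = orbit N A X p"
    using orbit_trans[OF regular_in[OF q(1)], of p] orbit_trans[OF regular_in[OF pr] pq] p q(2) by blast
qed

lemma topspace_leaf:
  assumes p: "p \<in> regular_points"
  shows "topspace (leaf_topology A X (orbit N A X p)) = orbit N A X p"
proof -
  have "plaque ch q \<subseteq> orbit N A X p" if "foliated_chart A X ch" "q \<in> orbit N A X p \<inter> fst ch" for ch q
    using plaque_subset_orbit[OF that(1), of q] that(2) orbit_trans[OF regular_in[OF p], of q] by blast
  moreover have "\<exists>ch q. foliated_chart A X ch \<and> q \<in> orbit N A X p \<inter> fst ch \<and> x \<in> plaque ch q" if x: "x \<in> orbit N A X p" for x
  proof -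
    have xr: "x \<in> regular_points" using orbit_regular[OF p] x by blast
    obtain W \<xi> c where b: "flow_box W \<xi> c" "x \<in> W" "\<xi> x = 0" "W \<subseteq> topspace N"
      by (rule flow_box_exists[OF xr openin_topspace regular_in[OF xr]])
    then show ?thesis using flow_box_foliated[OF b(1)] x
      by (intro exI[of _ "(W, \<xi>)"] exI[of _ x]) (simp add: plaque_def)
  qed
  ultimately show ?thesis unfolding leaf_topology_def by (auto simp: Union_eq) (meson subsetD, metis)
qed

text \<open>The leaf topology may be finer than the one induced from \<open>N\<close>, so continuity
  into \<open>N\<close> is not enough; the preimage of each plaque has to be open, and it is because
  short flow times stay in a plaque.\<close>

lemma continuous_map_fl_leaf:
  assumes p: "p \<in> regular_points"
  shows "continuous_map euclidean (leaf_topology A X (orbit N A X p)) (\<lambda>t. fl t p)"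
  unfolding leaf_topology_def continuous_on_generated_topo_iff
proof (intro conjI allI impI)
  fix P assume "P \<in> {plaque ch q |ch q. foliated_chart A X ch \<and> q \<in> orbit N A X p \<inter> fst ch}"
  then obtain U \<phi> q where P: "P = plaque (U, \<phi>) q" and fc: "foliated_chart A X (U, \<phi>)" by auto
  have "open {t. fl t p \<in> P}"
    unfolding open_contains_ball
  proof
    fix t0 assume "t0 \<in> {t. fl t p \<in> P}"
    then have t0: "fl t0 p \<in> U" "\<phi> (fl t0 p) $ 2 = \<phi> q $ 2" by (auto simp: P plaque_def)
    obtain \<delta> where \<delta>: "\<delta> > 0" "\<And>t. t \<in> ball 0 \<delta> \<Longrightarrow> fl t (fl t0 p) \<in> plaque (U, \<phi>) (fl t0 p)"
      by (rule fl_in_plaque[OF fc t0(1)]) (rule that)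
    have "fl t p \<in> P" if "t \<in> ball t0 \<delta>" for t
    proof -
      have "t - t0 \<in> ball 0 \<delta>" using that by (simp add: dist_norm norm_minus_commute)
      then show ?thesis using \<delta>(2)[of "t - t0"] fl_fl[OF regular_in[OF p], of "t - t0" t0] t0 by (simp add: P plaque_def)
    qed
    then show "\<exists>e>0. ball t0 e \<subseteq> {t. fl t p \<in> P}" using \<delta>(1) by blast
  qed
  then show "openin euclidean ((\<lambda>t. fl t p) -` P \<inter> topspace euclidean)" by (simp add: vimage_def)
next
  show "(\<lambda>t. fl t p) ` topspace euclidean \<subseteq> \<Union> {plaque ch q |ch q. foliated_chart A X ch \<and> q \<in> orbit N A X p \<inter> fst ch}"
    using topspace_leaf[OF p] orbit_eq[OF regular_in[OF p]] unfolding leaf_topology_def by simp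
qed

text \<open>Without a period, time would parametrise the orbit injectively, and the biholomorphism
  would turn this into a continuous bijection of the plane onto the punctured plane.\<close>

lemma punctured_plane_orbit_period:
  assumes p: "p \<in> regular_points" and bih: "orbit_biholomorphic_to_punctured_plane A X (orbit N A X p)"
  obtains \<omega> where "\<omega> \<noteq> 0" "fl \<omega> p = p"
proof -
  have pN: "p \<in> topspace N" using regular_in[OF p] .
  obtain f g where f: "continuous_map (leaf_topology A X (orbit N A X p)) (top_of_set (- {0 :: complex})) f"
    and g: "continuous_map (top_of_set (- {0})) (leaf_topology A X (orbit N A X p)) g"
    and gf: "\<And>x. x \<in> orbit N A X p \<Longrightarrow> g (f x) = x" and fg: "\<And>y. y \<noteq> 0 \<Longrightarrow> f (g y) = y"
    using bih unfolding orbit_biholomorphic_to_punctured_plane_def biholomorphic_def holomorphic_map_def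
    by (auto simp: topspace_leaf[OF p])
  have "continuous_map euclidean (top_of_set (- {0})) (f \<circ> (\<lambda>t. fl t p))"
    by (rule continuous_map_compose[OF continuous_map_fl_leaf[OF p] f])
  then have F: "continuous_on UNIV (\<lambda>t. f (fl t p))" "\<And>t. f (fl t p) \<noteq> 0"
    by (auto simp: continuous_map_in_subtopology o_def)
  have "\<not> inj (\<lambda>t. f (fl t p))"
  proof
    assume inj: "inj (\<lambda>t. f (fl t p))"
    have "range (\<lambda>t. f (fl t p)) = - {0}"
    proof (intro equalityI subsetI)
      fix y :: complex assume y: "y \<in> - {0}"
      have "g y \<in> orbit N A X p" using continuous_map_image_subset_topspace[OF g] y by (auto simp: topspace_leaf[OF p])
      then obtain t where "g y = fl t p" using orbit_eq[OF pN] by blast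
      then have "y = f (fl t p)" using fg[of y] y by simp
      then show "y \<in> range (\<lambda>t. f (fl t p))" by (rule range_eqI)
    qed (use F(2) in auto)
    then show False by (rule no_continuous_bijection_plane_punctured_plane[OF F(1) inj])
  qed
  then obtain s t where st: "s \<noteq> t" "f (fl s p) = f (fl t p)" by (auto simp: inj_def)
  then have "fl s p = fl t p" using gf orbit_eq[OF pN] by (metis rangeI)
  then have "fl (s - t) p = p" using fl_fl[OF pN, of "- t" s] fl_inverse(1)[OF pN, of t] by simp
  then show ?thesis using that[of "s - t"] st(1) by simp
qed

subsection \<open>Holonomy of closed orbits\<close>

lemma chart_component_continuous:
  assumes "(U, \<phi>) \<in> A"
  shows "continuous_map (subtopology N U) euclidean (\<lambda>x. \<phi> x $ i)"
proof -
  have "continuous_map euclidean euclidean (\<lambda>v :: complex^2. v $ i)" by (simp add: continuous_on_component)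
  from continuous_map_compose[OF chart_continuous[OF assms] this] show ?thesis by (simp add: o_def)
qed

text \<open>A slice of a flow box serves. In the chart of the box it has velocity
  \<open>pt 0 1\<close> and the field is \<open>pt c 0\<close>; the complex linear differential of
  the transition map carries the nontangency to other charts.\<close>

lemma transversal_exists:
  assumes q: "q \<in> regular_points"
  shows "\<exists>T. transversal N A X q T"
proof -
  obtain W \<xi> c where b: "flow_box W \<xi> c" and qW: "q \<in> W" "\<xi> q = 0" and "W \<subseteq> topspace N"
    by (rule flow_box_exists[OF q openin_topspace regular_in[OF q]])
  define \<sigma> where "\<sigma> = slice W \<xi>"
  have c: "continuous_map (top_of_set (ball 0 1)) N \<sigma>"
    using slice_hcurve[OF b] by (simp add: hcurve_def \<sigma>_def)
  have reg: "\<sigma> z \<in> W" "\<xi> (\<sigma> z) = pt 0 z" if "z \<in> ball 0 1" for z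
    using slice_in[OF b] slice_coord[OF b] that by (simp_all add: \<sigma>_def)
  show ?thesis
    unfolding transversal_def
  proof (intro exI conjI ballI)
    show "\<sigma> 0 = q" unfolding \<sigma>_def by (rule slice_unique[OF b qW(1)]) (simp add: qW(2) vec_eq_iff forall_2)
    show "\<sigma> ` ball 0 1 = \<sigma> ` ball 0 1" ..
    show "\<sigma> ` ball 0 1 \<subseteq> topspace N - sing N A X"
      using reg(1) flow_box_regular[OF b] unfolding regular_points_def by blast
    have "homeomorphic_maps (top_of_set (ball 0 1)) (subtopology N (\<sigma> ` ball 0 1)) \<sigma> (\<lambda>x. \<xi> x $ 2)"
      unfolding homeomorphic_maps_def
    proof (intro conjI ballI)
      show "continuous_map (top_of_set (ball 0 1)) (subtopology N (\<sigma> ` ball 0 1)) \<sigma>"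
        using c by (auto simp: continuous_map_in_subtopology)
      have "continuous_map (subtopology N W) euclidean (\<lambda>x. \<xi> x $ 2)"
        by (rule chart_component_continuous[OF flow_box_chart[OF b]])
      then have "continuous_map (subtopology N (\<sigma> ` ball 0 1)) euclidean (\<lambda>x. \<xi> x $ 2)"
        by (rule continuous_map_from_subtopology_mono) (use reg(1) in blast)
      then show "continuous_map (subtopology N (\<sigma> ` ball 0 1)) (top_of_set (ball 0 1)) (\<lambda>x. \<xi> x $ 2)"
        using reg(2) by (auto simp: continuous_map_in_subtopology)
    qed (use reg(2) in auto)
    then show "homeomorphic_map (top_of_set (ball 0 1)) (subtopology N (\<sigma> ` ball 0 1)) \<sigma>"
      unfolding homeomorphic_map_maps by blast
  next
    fix z :: complex assume z: "z \<in> ball 0 1"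
    fix ch assume "ch \<in> A"
    then obtain U \<phi> where ch: "ch = (U, \<phi>)" and U: "(U, \<phi>) \<in> A" by (cases ch) auto
    have "\<exists>v. cvderiv (\<phi> \<circ> \<sigma>) v z \<and> (\<forall>a. v \<noteq> a *s X (U, \<phi>) (\<sigma> z))" if zU: "\<sigma> z \<in> U"
    proof -
      obtain v where v: "cvderiv (\<phi> \<circ> \<sigma>) v z"
        using slice_hcurve[OF b] U zU z unfolding hcurve_def \<sigma>_def by blast
      define D where "D = frechet_derivative (\<xi> \<circ> inv_into U \<phi>) (at (\<phi> (\<sigma> z)))"
      have 1: "cvderiv (\<xi> \<circ> \<sigma>) (D v) z"
        unfolding D_def by (rule cvderiv_chart_change[OF U flow_box_chart[OF b] c open_ball z zU reg(1)[OF z] v])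
      have "cvderiv (\<lambda>z. pt 0 z) (pt 0 1) z"
        unfolding cvderiv_iff by (auto simp: forall_2 intro!: derivative_eq_intros)
      then have 2: "cvderiv (\<xi> \<circ> \<sigma>) (pt 0 1) z"
        by (rule has_derivative_transform_within_open[OF _ open_ball z]) (use reg(2) in simp)
      have Dv: "D v = pt 0 1" by (rule cvderiv_unique[OF 1 2])
      have DX: "D (X (U, \<phi>) (\<sigma> z)) = pt c 0"
        using vf U flow_box_chart[OF b] zU reg(1)[OF z] flow_box_field[OF b reg(1)[OF z]]
        unfolding holomorphic_vector_field_def D_def by fastforce
      obtain D' where D': "complex_linear D'" "((\<xi> \<circ> inv_into U \<phi>) has_derivative D') (at (\<phi> (\<sigma> z)))"
        using transition_holo[OF U flow_box_chart[OF b]] zU reg(1)[OF z] by (auto simp: holo_on_def)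
      have "D = D'" using frechet_derivative_at[OF D'(2)] by (simp add: D_def)
      then have lin: "D (a *s x) = a *s D x" for a x using D'(1) by (simp add: complex_linear_def)
      have "pt 0 1 \<noteq> a *s pt c 0" for a by (simp add: vec_eq_iff forall_2)
      then have "v \<noteq> a *s X (U, \<phi>) (\<sigma> z)" for a using Dv DX lin[of a "X (U, \<phi>) (\<sigma> z)"] by metis
      then show ?thesis using v by blast
    qed
    then show "case ch of (U, \<phi>) \<Rightarrow> \<sigma> z \<in> U \<longrightarrow>
        (\<exists>v. cvderiv (\<phi> \<circ> \<sigma>) v z \<and> (\<forall>a. v \<noteq> a *s X (U, \<phi>) (\<sigma> z)))" by (simp add: ch)
  qed
qed

lemma flow_box_move:
  assumes b: "flow_box W \<xi> c" and x: "x \<in> W" and y: "y \<in> W" and eq: "\<xi> y $ 2 = \<xi> x $ 2"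
  shows "fl ((\<xi> y $ 1 - \<xi> x $ 1) / c) x = y"
proof (rule flow_box_eqI[OF b])
  have 1: "\<xi> x $ 1 + c * ((\<xi> y $ 1 - \<xi> x $ 1) / c) = \<xi> y $ 1" using flow_box_nonzero[OF b] by simp
  then have 2: "norm (\<xi> x $ 1 + c * ((\<xi> y $ 1 - \<xi> x $ 1) / c)) < 1" using flow_box_coord_norm[OF b y] by simp
  show "fl ((\<xi> y $ 1 - \<xi> x $ 1) / c) x \<in> W" by (rule flow_box_fl(1)[OF b x 2])
  show "\<xi> (fl ((\<xi> y $ 1 - \<xi> x $ 1) / c) x) = \<xi> y" using flow_box_fl(2)[OF b x 2] 1 eq by (simp add: vec_eq_iff forall_2)
qed (rule y)

text \<open>The germ of \<open>h\<close> at \<open>p\<close> is the flow for a variable time that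
  can be chosen to tend to \<open>t\<close> at \<open>p\<close>. This keeps track of the time hidden
  in a chain of plaque transports.\<close>

definition time_near :: "'a \<Rightarrow> 'a set \<Rightarrow> complex \<Rightarrow> ('a \<Rightarrow> 'a) \<Rightarrow> bool" where
  "time_near p T t h \<longleftrightarrow>
     (\<forall>\<epsilon>>0. \<exists>V. openin (subtopology N T) V \<and> p \<in> V \<and> (\<forall>x\<in>V. \<exists>t'\<in>ball t \<epsilon>. h x = fl t' x))"

text \<open>The second coordinate of the box labels the plaques and, near \<open>q\<close>, the
  points of \<open>S'\<close>; \<open>g\<close> sends a point to the point of \<open>S'\<close> with
  the same label. The time needed is the difference of the first coordinates divided by
  \<open>c\<close>, which varies continuously.\<close>

lemma plaque_transport_exists:
  assumes b: "flow_box W \<xi> c" and S: "S \<subseteq> topspace N" and p: "p \<in> S" "p \<in> W"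
    and S': "transversal N A X q S'" and q: "q \<in> W" "\<xi> q $ 2 = \<xi> p $ 2"
  obtains g where "plaque_transport N (W, \<xi>) S p S' q g" "time_near p S ((\<xi> q $ 1 - \<xi> p $ 1) / c) g"
proof -
  obtain \<sigma> e where \<sigma>: "\<sigma> 0 = q" "\<sigma> ` ball 0 1 = S'" "homeomorphic_map (top_of_set (ball 0 1)) (subtopology N S') \<sigma>"
    and e: "0 < e" "e \<le> 1" "\<And>w. w \<in> ball 0 e \<Longrightarrow> \<sigma> w \<in> W" "(\<lambda>w. \<xi> (\<sigma> w) $ 2) holomorphic_on ball 0 e"
      "inj_on (\<lambda>w. \<xi> (\<sigma> w) $ 2) (ball 0 e)"
    by (rule transversal_coordinate[OF S' b q(1)]) (rule that)
  define \<beta> where "\<beta> w = \<xi> (\<sigma> w) $ 2" for w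
  obtain \<beta>' where \<beta>': "\<beta>' holomorphic_on \<beta> ` ball 0 e" "\<And>z. z \<in> ball 0 e \<Longrightarrow> \<beta>' (\<beta> z) = z"
    using holomorphic_has_inverse[OF e(4) open_ball e(5)] unfolding \<beta>_def[abs_def] by metis
  have O: "open (\<beta> ` ball 0 e)"
    unfolding \<beta>_def[abs_def] by (rule open_mapping_thm3[OF e(4) open_ball e(5)])
  define V where "V = {x \<in> W. \<xi> x $ 2 \<in> \<beta> ` ball 0 e} \<inter> S"
  have "openin N {x \<in> W. \<xi> x \<in> {v. v $ 2 \<in> \<beta> ` ball 0 e}}"
    by (rule chart_preimage_open[OF flow_box_chart[OF b]]) (use O in \<open>auto intro: open_vimage_vec_nth simp: vimage_def[symmetric]\<close>)
  then have V: "openin (subtopology N S) V" unfolding V_def openin_subtopology by blast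
  have VN: "V \<subseteq> topspace N" using S by (auto simp: V_def)
  define g where "g x = \<sigma> (\<beta>' (\<xi> x $ 2))" for x
  have \<beta>'in: "\<beta>' (\<xi> x $ 2) \<in> ball 0 e" "\<beta> (\<beta>' (\<xi> x $ 2)) = \<xi> x $ 2" if "x \<in> V" for x
    using that \<beta>'(2) by (auto simp: V_def)
  have gW: "g x \<in> W" "\<xi> (g x) $ 2 = \<xi> x $ 2" if "x \<in> V" for x
    using e(3)[OF \<beta>'in(1)[OF that]] \<beta>'in(2)[OF that] by (auto simp: g_def \<beta>_def)
  have \<xi>V: "continuous_map (subtopology N V) euclidean (\<lambda>x. \<xi> x $ i)" for i
  proof -
    have "continuous_map (subtopology N W) euclidean (\<lambda>x. \<xi> x $ i)"
      by (rule chart_component_continuous[OF flow_box_chart[OF b]])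
    then show ?thesis by (rule continuous_map_from_subtopology_mono) (auto simp: V_def)
  qed
  have gc: "continuous_map (subtopology N V) (subtopology N S') g"
  proof -
    have 1: "continuous_map (subtopology N V) (top_of_set (\<beta> ` ball 0 e)) (\<lambda>x. \<xi> x $ 2)"
      using \<xi>V by (auto simp: continuous_map_in_subtopology V_def)
    have 2: "continuous_map (top_of_set (\<beta> ` ball 0 e)) (top_of_set (ball 0 1)) \<beta>'"
      using holomorphic_on_imp_continuous_on[OF \<beta>'(1)] \<beta>'(2) e(2) by (auto simp: continuous_map_in_subtopology)
    show ?thesis
      using continuous_map_compose[OF continuous_map_compose[OF 1 2] homeomorphic_imp_continuous_map[OF \<sigma>(3)]]
      by (simp add: o_def g_def[abs_def])
  qed
  have "\<xi> p $ 2 = \<beta> 0" using q(2) \<sigma>(1) by (simp add: \<beta>_def)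
  then have pV: "p \<in> V" and gp: "g p = q"
    using p e(1) \<beta>'(2)[of 0] \<sigma>(1) by (auto simp: V_def g_def)
  have "plaque_transport N (W, \<xi>) S p S' q g"
    unfolding plaque_transport_def
    by (intro exI[of _ V] conjI V pV gc gp) (use gW in \<open>auto simp: V_def plaque_def\<close>)
  moreover have "time_near p S ((\<xi> q $ 1 - \<xi> p $ 1) / c) g"
    unfolding time_near_def
  proof (intro allI impI)
    fix \<epsilon> :: real assume \<epsilon>: "\<epsilon> > 0"
    define \<tau> where "\<tau> x = (\<xi> (g x) $ 1 - \<xi> x $ 1) / c" for x
    have "continuous_map (subtopology N V) (subtopology N W) g"
      using gc gW(1) by (auto simp: continuous_map_in_subtopology)
    moreover have "continuous_map (subtopology N W) euclidean (\<lambda>x. \<xi> x $ 1)"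
      by (rule chart_component_continuous[OF flow_box_chart[OF b]])
    ultimately have "continuous_map (subtopology N V) euclidean (\<lambda>x. \<xi> (g x) $ 1)"
      using continuous_map_compose[of _ _ g _ "\<lambda>x. \<xi> x $ 1"] by (simp add: o_def)
    then have "continuous_map (subtopology N V) euclidean (\<lambda>x. \<xi> (g x) $ 1 - \<xi> x $ 1)"
      using \<xi>V by (rule continuous_map_diff)
    moreover have "continuous_map euclidean euclidean (\<lambda>z. z / c)"
      unfolding continuous_map_iff_continuous2 using flow_box_nonzero[OF b] by (intro continuous_intros) simp
    ultimately have "continuous_map (subtopology N V) euclidean \<tau>"
      using continuous_map_compose[of _ _ "\<lambda>x. \<xi> (g x) $ 1 - \<xi> x $ 1" _ "\<lambda>z. z / c"] by (simp add: o_def \<tau>_def[abs_def])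
    from openin_continuous_map_preimage[OF this, of "ball (\<tau> p) \<epsilon>"]
    have "openin (subtopology N V) {x \<in> V. \<tau> x \<in> ball (\<tau> p) \<epsilon>}" using VN by (simp add: Int_absorb1 open_openin[symmetric])
    moreover have "V \<subseteq> S" by (auto simp: V_def)
    ultimately have "openin (subtopology (subtopology N S) V) {x \<in> V. \<tau> x \<in> ball (\<tau> p) \<epsilon>}"
      by (simp add: subtopology_subtopology Int_absorb1)
    then have "openin (subtopology N S) {x \<in> V. \<tau> x \<in> ball (\<tau> p) \<epsilon>}" using openin_trans_full V by blast
    moreover have "g x = fl (\<tau> x) x" if "x \<in> V" for x
      using flow_box_move[OF b _ gW(1)[OF that] gW(2)[OF that]] that by (simp add: \<tau>_def V_def)
    moreover have "\<tau> p = (\<xi> q $ 1 - \<xi> p $ 1) / c" by (simp add: \<tau>_def gp)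
    ultimately show "\<exists>V. openin (subtopology N S) V \<and> p \<in> V \<and>
        (\<forall>x\<in>V. \<exists>t'\<in>ball ((\<xi> q $ 1 - \<xi> p $ 1) / c) \<epsilon>. g x = fl t' x)"
      using pV \<epsilon> by (intro exI[of _ "{x \<in> V. \<tau> x \<in> ball (\<tau> p) \<epsilon>}"]) auto
  qed
  ultimately show ?thesis by (rule that)
qed

lemma time_near_compose:
  assumes V: "openin (subtopology N T) V" "p \<in> V" "continuous_map (subtopology N V) (subtopology N S) h" "h p = q"
    and T: "T \<subseteq> topspace N" and h: "time_near p T t h" and g: "time_near q S t' g"
  shows "time_near p T (t + t') (g \<circ> h)"
  unfolding time_near_def
proof (intro allI impI)
  fix \<epsilon> :: real assume \<epsilon>: "\<epsilon> > 0"
  obtain V1 where V1: "openin (subtopology N T) V1" "p \<in> V1" "\<And>x. x \<in> V1 \<Longrightarrow> \<exists>s\<in>ball t (\<epsilon>/2). h x = fl s x"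
    using h \<epsilon> unfolding time_near_def by (meson half_gt_zero)
  obtain V2 where V2: "openin (subtopology N S) V2" "q \<in> V2" "\<And>x. x \<in> V2 \<Longrightarrow> \<exists>s\<in>ball t' (\<epsilon>/2). g x = fl s x"
    using g \<epsilon> unfolding time_near_def by (meson half_gt_zero)
  have VT: "V \<subseteq> T" "V \<subseteq> topspace N" using openin_subset[OF V(1)] by auto
  have "openin (subtopology N V) {x \<in> topspace (subtopology N V). h x \<in> V2}"
    by (rule openin_continuous_map_preimage[OF V(3) V2(1)])
  moreover have "{x \<in> topspace (subtopology N V). h x \<in> V2} = {x \<in> V. h x \<in> V2}" using VT by auto
  ultimately have "openin (subtopology (subtopology N T) V) {x \<in> V. h x \<in> V2}"
    using VT by (simp add: subtopology_subtopology Int_absorb1)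
  then have o: "openin (subtopology N T) {x \<in> V. h x \<in> V2}" using openin_trans_full V(1) by blast
  have "\<exists>s\<in>ball (t + t') \<epsilon>. (g \<circ> h) x = fl s x" if x: "x \<in> V1 \<inter> {x \<in> V. h x \<in> V2}" for x
  proof -
    have xN: "x \<in> topspace N" using x VT by auto
    obtain s where s: "s \<in> ball t (\<epsilon>/2)" "h x = fl s x" using V1(3) x by blast
    obtain s' where s': "s' \<in> ball t' (\<epsilon>/2)" "g (h x) = fl s' (h x)" using V2(3) x by blast
    have "dist (t + t') (s + s') \<le> dist t s + dist t' s'" by (rule dist_triangle_add)
    then have "s + s' \<in> ball (t + t') \<epsilon>" using s(1) s'(1) by simp
    moreover have "(g \<circ> h) x = fl (s + s') x" using s(2) s'(2) fl_fl[OF xN] by (simp add: add.commute)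
    ultimately show ?thesis by blast
  qed
  then show "\<exists>V. openin (subtopology N T) V \<and> p \<in> V \<and> (\<forall>x\<in>V. \<exists>s\<in>ball (t + t') \<epsilon>. (g \<circ> h) x = fl s x)"
    using openin_Int[OF V1(1) o] V1(2) V2(2) V(2,4) by (intro exI[of _ "V1 \<inter> {x \<in> V. h x \<in> V2}"]) auto
qed

text \<open>The loop is cut into pieces inside flow boxes by bisection of the interval:
  \<open>P s t\<close> says that holonomy with the right flow time extends from \<open>s\<close> to
  \<open>t\<close>, for arbitrary transversals at the ends. The times of the pieces add up to
  \<open>a\<close>.\<close>

lemma flow_holonomy:
  assumes T: "transversal N A X p T" and per: "fl a p = p"
  shows "\<exists>h. holonomy_along N A X (\<lambda>u. fl (of_real u * a) p) T 1 T h \<and> time_near p T a h"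
proof -
  define \<gamma> where "\<gamma> u = fl (of_real u * a) p" for u :: real
  have pr: "p \<in> regular_points" using transversal_subset[OF T] transversal_base[OF T] by blast
  have pN: "p \<in> topspace N" using regular_in[OF pr] .
  have TN: "T \<subseteq> topspace N" using transversal_subset[OF T] regular_in by blast
  have \<gamma>0: "\<gamma> 0 = p" and \<gamma>1: "\<gamma> 1 = p" using per pN by (simp_all add: \<gamma>_def)
  have \<gamma>r: "\<gamma> u \<in> regular_points" for u using pr by (simp add: \<gamma>_def)
  have T\<gamma>: "transversal N A X (\<gamma> 0) T" using T \<gamma>0 by simp
  define Q where "Q s S \<longleftrightarrow> transversal N A X (\<gamma> s) S \<and> (\<exists>h. holonomy_along N A X \<gamma> T s S h \<and> time_near p T (of_real s * a) h)" for s S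
  define P where "P s t \<longleftrightarrow> (s < t \<longrightarrow> 0 \<le> s \<longrightarrow> t \<le> 1 \<longrightarrow> (\<forall>S S'. Q s S \<longrightarrow> transversal N A X (\<gamma> t) S' \<longrightarrow> Q t S'))" for s t
  have "P 0 1"
  proof (rule Bolzano, goal_cases)
    case 1
    show ?case by simp
  next
    case (2 x y z)
    show ?case
      unfolding P_def
    proof (intro impI allI)
      fix S S' assume *: "x < z" "0 \<le> x" "z \<le> 1" "Q x S" "transversal N A X (\<gamma> z) S'"
      show "Q z S'"
      proof (cases "x < y \<and> y < z")
        case True
        \<comment> \<open>Gluing the two pieces requires some transversal at the intermediate
          point.\<close>
        obtain S'' where "transversal N A X (\<gamma> y) S''" using transversal_exists[OF \<gamma>r] by blast
        then show ?thesis using 2(1,2) True * unfolding P_def by (meson less_imp_le order_trans)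
      next
        case False
        then have "x = y \<or> y = z" using 2(3,4) by auto
        then show ?thesis using 2(1,2) * unfolding P_def by blast
      qed
    qed
  next
    case (3 x)
    obtain W \<xi> c where b: "flow_box W \<xi> c" and xW: "\<gamma> x \<in> W" "\<xi> (\<gamma> x) = 0" and "W \<subseteq> topspace N"
      by (rule flow_box_exists[OF \<gamma>r[of x] openin_topspace regular_in[OF \<gamma>r]])
    \<comment> \<open>For \<open>\<bar>u - x\<bar> < d\<close> the first coordinate of
      \<open>\<gamma> u\<close> stays in the unit disc; the summand 1 avoids a division by zero when
      \<open>a = 0\<close>.\<close>
    define d where "d = 1 / (1 + norm (c * a))"
    have d: "d > 0" unfolding d_def by (simp add: add_pos_nonneg)
    have box: "\<gamma> u \<in> W" "\<xi> (\<gamma> u) = pt (c * (of_real (u - x) * a)) 0" if "\<bar>u - x\<bar> < d" for u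
    proof -
      have eq: "\<gamma> u = fl (of_real (u - x) * a) (\<gamma> x)"
        using fl_fl[OF pN, of "of_real (u - x) * a" "of_real x * a"] by (simp add: \<gamma>_def algebra_simps)
      have "norm (c * (of_real (u - x) * a)) = \<bar>u - x\<bar> * norm (c * a)" by (simp add: norm_mult mult_ac del: of_real_diff)
      also have "\<dots> \<le> d * norm (c * a)" using that by (intro mult_right_mono) auto
      also have "\<dots> < 1" unfolding d_def by (simp add: field_simps add_pos_nonneg)
      finally have n: "norm (\<xi> (\<gamma> x) $ 1 + c * (of_real (u - x) * a)) < 1" using xW(2) by simp
      show "\<gamma> u \<in> W" "\<xi> (\<gamma> u) = pt (c * (of_real (u - x) * a)) 0"
        using flow_box_fl[OF b xW(1) n] eq xW(2) by simp_all
    qed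
    have "P s t" if st: "s \<le> x" "x \<le> t" "t - s < d" for s t
      unfolding P_def
    proof (intro impI allI)
      fix S S' assume *: "s < t" "0 \<le> s" "t \<le> 1" "Q s S" and S': "transversal N A X (\<gamma> t) S'"
      obtain h where S: "transversal N A X (\<gamma> s) S" and h: "holonomy_along N A X \<gamma> T s S h" "time_near p T (of_real s * a) h"
        using *(4) unfolding Q_def by blast
      have u: "\<gamma> u \<in> W" "\<xi> (\<gamma> u) = pt (c * (of_real (u - x) * a)) 0" if "u \<in> {s..t}" for u
        using box[of u] that st by (auto simp: abs_less_iff)
      have sW: "\<gamma> s \<in> W" and tW: "\<gamma> t \<in> W" and eq: "\<xi> (\<gamma> t) $ 2 = \<xi> (\<gamma> s) $ 2" using u[of s] u[of t] *(1) by auto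
      have SN: "S \<subseteq> topspace N" using transversal_subset[OF S] regular_in by blast
      obtain g where g: "plaque_transport N (W, \<xi>) S (\<gamma> s) S' (\<gamma> t) g"
        "time_near (\<gamma> s) S ((\<xi> (\<gamma> t) $ 1 - \<xi> (\<gamma> s) $ 1) / c) g"
        by (rule plaque_transport_exists[OF b SN transversal_base[OF S] sW S' tW eq])
      have tm: "(\<xi> (\<gamma> t) $ 1 - \<xi> (\<gamma> s) $ 1) / c = of_real (t - s) * a"
        using u[of s] u[of t] *(1) flow_box_nonzero[OF b] by (simp add: field_simps)
      have "holonomy_along N A X \<gamma> T t S' (g \<circ> h)"
      proof (rule holonomy_along.extend[OF h(1) *(1,3) flow_box_foliated[OF b] _ _ S' g(1)])
        show "\<gamma> s \<in> fst (W, \<xi>)" using sW by simp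
        show "\<gamma> ` {s..t} \<subseteq> plaque (W, \<xi>) (\<gamma> s)" using u *(1) by (auto simp: plaque_def)
      qed
      moreover have "time_near p T (of_real s * a + of_real (t - s) * a) (g \<circ> h)"
      proof -
        obtain V where V: "openin (subtopology N T) V" "\<gamma> 0 \<in> V" "continuous_map (subtopology N V) (subtopology N S) h" "h (\<gamma> 0) = \<gamma> s"
          using holonomy_along_properties[OF h(1) T\<gamma>] by blast
        show ?thesis by (rule time_near_compose[OF V(1) _ V(3) _ TN h(2) g(2)[unfolded tm]]) (use V \<gamma>0 in auto)
      qed
      ultimately show "Q t S'" unfolding Q_def using S' by (auto simp: algebra_simps)
    qed
    then show ?case using d by blast
  qed
  moreover have "Q 0 T"
    unfolding Q_def
  proof (intro conjI T\<gamma> exI)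
    show "holonomy_along N A X \<gamma> T 0 T (\<lambda>x. x)" by (rule holonomy_along.start)
    have "openin (subtopology N T) T" using openin_topspace[of "subtopology N T"] TN by (simp add: Int_absorb1)
    then show "time_near p T (of_real 0 * a) (\<lambda>x. x)"
      unfolding time_near_def using transversal_base[OF T] TN by (intro allI impI exI[of _ T]) (auto intro!: bexI[of _ 0])
  qed
  ultimately have "Q 1 T" using T \<gamma>1 unfolding P_def by auto
  then show ?thesis unfolding Q_def \<gamma>_def[abs_def] by auto
qed

text \<open>By the pigeonhole principle two of the multiples \<open>of_nat i * \<omega>\<close> have
  the same holonomy germ, so nearby points of \<open>T\<close> are carried to the same place by
  times near \<open>of_nat i * \<omega>\<close> and near \<open>of_nat j * \<omega>\<close>. The
  difference of these times is a period near \<open>of_nat k * \<omega>\<close>.\<close>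

lemma finite_holonomy_pers:
  assumes T: "transversal N A X p T" and fin: "finite (holonomy_group N A X (orbit N A X p) p T)" and per: "fl \<omega> p = p"
  obtains k :: nat where "k > 0" "pers p (of_nat k * \<omega>)"
proof -
  have pr: "p \<in> regular_points" using transversal_subset[OF T] transversal_base[OF T] by blast
  have pN: "p \<in> topspace N" using regular_in[OF pr] .
  have perm: "fl (of_nat i * \<omega>) p = p" for i
  proof (induction i)
    case (Suc i)
    then show ?case using fl_fl[OF pN, of \<omega> "of_nat i * \<omega>"] per by (simp add: algebra_simps)
  qed (simp add: pN)
  define H where "H i h \<longleftrightarrow> holonomy_along N A X (\<lambda>u. fl (of_real u * (of_nat i * \<omega>)) p) T 1 T h \<and> time_near p T (of_nat i * \<omega>) h" for i h
  have "\<forall>i. \<exists>h. H i h" using flow_holonomy[OF T perm] by (simp add: H_def)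
  then obtain h where h: "\<And>i. H i (h i)" by metis
  have "germ_at N T p (h i) \<in> holonomy_group N A X (orbit N A X p) p T" for i
  proof -
    have "continuous_map (top_of_set {0..1}) euclidean (\<lambda>u::real. complex_of_real u * (of_nat i * \<omega>))"
      by (auto intro!: continuous_intros)
    from continuous_map_compose[OF this continuous_map_fl_leaf[OF pr]]
    have "pathin (leaf_topology A X (orbit N A X p)) (\<lambda>u. fl (of_real u * (of_nat i * \<omega>)) p)"
      by (simp add: pathin_def o_def)
    then show ?thesis unfolding holonomy_group_def using h[of i] perm[of i] pN unfolding H_def
      by (intro CollectI exI[of _ "h i"] conjI refl exI[of _ "\<lambda>u. fl (of_real u * (of_nat i * \<omega>)) p"]) auto
  qed
  then have "finite (range (\<lambda>i. germ_at N T p (h i)))" by (intro finite_subset[OF _ fin]) blast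
  then have "\<not> inj (\<lambda>i. germ_at N T p (h i))" using finite_imageD infinite_UNIV_nat by blast
  then obtain i j where "i \<noteq> j" "germ_at N T p (h i) = germ_at N T p (h j)" by (auto simp: inj_def)
  then obtain i j where ij: "i < j" "germ_at N T p (h i) = germ_at N T p (h j)" by (metis nat_neq_iff)
  have "h j \<in> germ_at N T p (h j)"
    unfolding germ_at_def using openin_topspace[of N] pN by blast
  then have "h j \<in> germ_at N T p (h i)" using ij(2) by simp
  then obtain W0 where W0: "openin N W0" "p \<in> W0" "\<And>x. x \<in> W0 \<inter> T \<Longrightarrow> h j x = h i x"
    unfolding germ_at_def by blast
  obtain W \<xi> c where b: "flow_box W \<xi> c" and pW: "p \<in> W" "\<xi> p = 0" and "W \<subseteq> topspace N"
    by (rule flow_box_exists[OF pr openin_topspace pN])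
  obtain \<sigma> e where \<sigma>: "\<sigma> 0 = p" "\<sigma> ` ball 0 1 = T" "homeomorphic_map (top_of_set (ball 0 1)) (subtopology N T) \<sigma>"
    and e: "0 < e" "e \<le> 1" "\<And>w. w \<in> ball 0 e \<Longrightarrow> \<sigma> w \<in> W" "(\<lambda>w. \<xi> (\<sigma> w) $ 2) holomorphic_on ball 0 e"
      "inj_on (\<lambda>w. \<xi> (\<sigma> w) $ 2) (ball 0 e)"
    by (rule transversal_coordinate[OF T b pW(1)]) (rule that)
  have s0: "slice W \<xi> 0 = p" by (rule slice_unique[OF b pW(1)]) (simp add: pW(2) vec_eq_iff forall_2)
  define k where "k = j - i"
  obtain \<rho> \<tau> where \<tau>: "\<rho> > 0" "ball (0::complex) \<rho> \<subseteq> ball 0 1" "\<tau> holomorphic_on ball 0 \<rho>" "\<tau> 0 = of_nat k * \<omega>"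
    "\<And>x. x \<in> W \<Longrightarrow> \<xi> x $ 2 \<in> ball 0 \<rho> \<Longrightarrow> pers x (\<tau> (\<xi> x $ 2))"
  proof (rule pers_local[OF b, of 0 "of_nat k * \<omega>"])
    fix \<epsilon> :: real and V assume \<epsilon>: "\<epsilon> > 0" and V: "openin N V" "slice W \<xi> 0 \<in> V"
    obtain V1 where V1: "openin (subtopology N T) V1" "p \<in> V1" "\<And>x. x \<in> V1 \<Longrightarrow> \<exists>t'\<in>ball (of_nat i * \<omega>) (\<epsilon>/2). h i x = fl t' x"
      using h[of i] \<epsilon> unfolding H_def time_near_def by (meson half_gt_zero)
    obtain V2 where V2: "openin (subtopology N T) V2" "p \<in> V2" "\<And>x. x \<in> V2 \<Longrightarrow> \<exists>t'\<in>ball (of_nat j * \<omega>) (\<epsilon>/2). h j x = fl t' x"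
      using h[of j] \<epsilon> unfolding H_def time_near_def by (meson half_gt_zero)
    have "openin (subtopology N T) ((V \<inter> W0) \<inter> T)" using V(1) W0(1) unfolding openin_subtopology by blast
    then have V3: "openin (subtopology N T) (V1 \<inter> V2 \<inter> ((V \<inter> W0) \<inter> T))" using V1(1) V2(1) by blast
    have "openin (top_of_set (ball 0 1)) {w \<in> topspace (top_of_set (ball 0 1)). \<sigma> w \<in> V1 \<inter> V2 \<inter> ((V \<inter> W0) \<inter> T)}"
      by (rule openin_continuous_map_preimage[OF homeomorphic_imp_continuous_map[OF \<sigma>(3)] V3])
    then have "open {w \<in> ball 0 1. \<sigma> w \<in> V1 \<inter> V2 \<inter> ((V \<inter> W0) \<inter> T)}" by (simp add: openin_open_eq)
    moreover have "0 \<in> {w \<in> ball 0 1. \<sigma> w \<in> V1 \<inter> V2 \<inter> ((V \<inter> W0) \<inter> T)}"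
      using \<sigma>(1) V1(2) V2(2) V(2) s0 W0(2) transversal_base[OF T] by simp
    ultimately obtain r where r: "r > 0" "ball 0 r \<subseteq> {w \<in> ball 0 1. \<sigma> w \<in> V1 \<inter> V2 \<inter> ((V \<inter> W0) \<inter> T)}"
      by (meson open_contains_ball)
    \<comment> \<open>A nonzero parameter: injectivity of the second coordinate along
      \<open>T\<close> puts the point \<open>x\<close> off the plaque of \<open>p\<close>.\<close>
    define w where "w = complex_of_real (min r e / 2)"
    have w: "w \<in> ball 0 r" "w \<in> ball 0 e" "w \<noteq> 0" using r(1) e(1) by (auto simp: w_def)
    define x where "x = \<sigma> w"
    have xW: "x \<in> W" using e(3)[OF w(2)] by (simp add: x_def)
    have x: "x \<in> V1" "x \<in> V2" "x \<in> V" "x \<in> W0 \<inter> T" using w(1) r(2) by (auto simp: x_def)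
    have xN: "x \<in> topspace N" using xW flow_box_subset[OF b] by blast
    have "\<xi> x $ 2 \<noteq> 0"
      using inj_onD[OF e(5), of w 0] w e(1) \<sigma>(1) pW(2) by (auto simp: x_def)
    moreover obtain t1 where t1: "t1 \<in> ball (of_nat i * \<omega>) (\<epsilon>/2)" "h i x = fl t1 x" using V1(3)[OF x(1)] by blast
    moreover obtain t2 where t2: "t2 \<in> ball (of_nat j * \<omega>) (\<epsilon>/2)" "h j x = fl t2 x" using V2(3)[OF x(2)] by blast
    have "fl t2 x = fl t1 x" using W0(3)[OF x(4)] t1(2) t2(2) by simp
    then have "fl (t2 - t1) x = x" using fl_fl[OF xN, of "- t1" t2] fl_inverse(1)[OF xN, of t1] by simp
    moreover have "t2 - t1 \<in> ball (of_nat k * \<omega>) \<epsilon>"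
    proof -
      have "of_nat k * \<omega> = of_nat j * \<omega> - of_nat i * \<omega>" using ij(1) by (simp add: k_def of_nat_diff algebra_simps)
      then have "of_nat k * \<omega> - (t2 - t1) = (of_nat j * \<omega> - t2) - (of_nat i * \<omega> - t1)" by simp
      then have "dist (of_nat k * \<omega>) (t2 - t1) = norm ((of_nat j * \<omega> - t2) - (of_nat i * \<omega> - t1))" by (simp only: dist_norm)
      also have "\<dots> \<le> norm (of_nat j * \<omega> - t2) + norm (of_nat i * \<omega> - t1)" by (rule norm_triangle_ineq4)
      finally show ?thesis using t1(1) t2(1) by (simp add: dist_norm)
    qed
    ultimately show "\<exists>x\<in>V \<inter> W. \<xi> x $ 2 \<noteq> 0 \<and> (\<exists>t'\<in>ball (of_nat k * \<omega>) \<epsilon>. fl t' x = x)" using x(3) xW by blast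
  qed (simp, rule that)
  have "pers p (\<tau> (\<xi> p $ 2))" by (rule \<tau>(5)[OF pW(1)]) (simp add: pW(2) \<tau>(1))
  then have "pers p (of_nat k * \<omega>)" by (simp add: pW(2) \<tau>(4))
  moreover have "k > 0" using ij(1) by (simp add: k_def)
  ultimately show ?thesis using that by blast
qed

end

context first_integral_pair
begin

subsection \<open>Finiteness of the holonomy\<close>

text \<open>The coordinate \<open>y\<close> whose \<open>n\<close>-th power is governed by the
  quotient is transferred from a slice to \<open>T\<close> along plaques. Points of \<open>T\<close>
  on the same orbit have equal quotients, so their coordinates differ by an \<open>n\<close>-th root
  of unity; sparseness keeps the other points of \<open>T\<close> near \<open>p\<close> off the
  orbit of \<open>p\<close>.\<close>

lemma holonomy_coordinate:
  assumes T: "transversal N A X p T"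
  obtains \<sigma> e n Y where "\<sigma> ` ball (0::complex) 1 = T" "\<sigma> 0 = p" "homeomorphic_map (top_of_set (ball 0 1)) (subtopology N T) \<sigma>"
    "0 < e" "e \<le> 1" "0 < n" "continuous_on (ball 0 e) Y" "inj_on Y (ball 0 e)" "Y 0 = 0"
    "\<And>w w'. w \<in> ball 0 e \<Longrightarrow> w' \<in> ball 0 e \<Longrightarrow> w \<noteq> 0 \<Longrightarrow> \<sigma> w' \<in> orbit N A X (\<sigma> w) \<Longrightarrow>
       w' \<noteq> 0 \<and> Y w' ^ n = (Y w ^ n :: complex)"
proof -
  have p: "p \<in> regular_points" using transversal_subset[OF T] transversal_base[OF T] by blast
  obtain W \<xi> c where b: "flow_box W \<xi> c" and pW: "p \<in> W" "\<xi> p = 0" and "W \<subseteq> topspace N"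
    by (rule flow_box_exists[OF p openin_topspace regular_in[OF p]])
  define v1 where "v1 z = g1 (slice W \<xi> z)" for z
  define v2 where "v2 z = g2 (slice W \<xi> z)" for z
  have v: "v1 holomorphic_on ball 0 1" "v2 holomorphic_on ball 0 1"
    unfolding v1_def[abs_def] v2_def[abs_def] using weight_fun_slice[OF weight1 b] weight_fun_slice[OF weight2 b] .
  have iso: "\<not> 0 islimpt {z \<in> ball 0 1. v2 z = 0}" "\<not> 0 islimpt {z \<in> ball 0 1. v1 z = k * v2 z}" for k
    using slice_zeros_isolated[OF b, of 0] by (simp_all add: v1_def v2_def)
  obtain r n y where y: "0 < r" "r \<le> 1" "0 < n" "y holomorphic_on ball 0 r" "inj_on y (ball 0 r)" "y 0 = 0"
    and yn: "\<And>z z'. z \<in> ball 0 r \<Longrightarrow> z' \<in> ball 0 r \<Longrightarrow> z \<noteq> 0 \<Longrightarrow> z' \<noteq> 0 \<Longrightarrow> v1 z' * v2 z = v1 z * v2 z' \<Longrightarrow> y z' ^ n = y z ^ n"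
    by (rule ratio_local_power[OF v iso]) (rule that)
  obtain d where d: "d > 0" "\<And>z. z \<in> ball 0 1 \<Longrightarrow> z \<noteq> 0 \<Longrightarrow> norm z < d \<Longrightarrow> slice W \<xi> z \<notin> orbit N A X p"
    using orbit_sparse_in_slice[OF b _ p, of 0] unfolding islimpt_approachable by (auto simp: dist_norm)
  obtain \<sigma> e where \<sigma>: "\<sigma> 0 = p" "\<sigma> ` ball 0 1 = T" "homeomorphic_map (top_of_set (ball 0 1)) (subtopology N T) \<sigma>"
    and e: "0 < e" "e \<le> 1" "\<And>w. w \<in> ball 0 e \<Longrightarrow> \<sigma> w \<in> W" "(\<lambda>w. \<xi> (\<sigma> w) $ 2) holomorphic_on ball 0 e"
      "inj_on (\<lambda>w. \<xi> (\<sigma> w) $ 2) (ball 0 e)"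
    by (rule transversal_coordinate[OF T b pW(1)]) (rule that)
  define bb where "bb w = \<xi> (\<sigma> w) $ 2" for w
  have bb0: "bb 0 = 0" using \<sigma>(1) pW by (simp add: bb_def)
  have bbc: "continuous_on (ball 0 e) bb" using holomorphic_on_imp_continuous_on[OF e(4)] by (simp add: bb_def[abs_def])
  have "open (ball 0 e \<inter> bb -` ball 0 (min r d))" by (rule continuous_open_preimage[OF bbc]) auto
  moreover have "0 \<in> ball 0 e \<inter> bb -` ball 0 (min r d)" using e y d bb0 by simp
  ultimately obtain e' where e': "0 < e'" "ball 0 e' \<subseteq> ball 0 e \<inter> bb -` ball 0 (min r d)" by (meson open_contains_ball)
  have ine: "w \<in> ball 0 e" "bb w \<in> ball 0 r" "norm (bb w) < d" if "w \<in> ball 0 e'" for w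
  proof -
    have "w \<in> ball 0 e \<inter> bb -` ball 0 (min r d)" using that e'(2) by (rule subsetD[rotated])
    then show "w \<in> ball 0 e" "bb w \<in> ball 0 r" "norm (bb w) < d" by auto
  qed
  have binj: "w = w'" if "bb w = bb w'" "w \<in> ball 0 e" "w' \<in> ball 0 e" for w w'
    using e(5) that by (auto simp: inj_on_def bb_def)
  have orb: "slice W \<xi> (bb w) \<in> orbit N A X (\<sigma> w)" "\<sigma> w \<in> regular_points" "\<sigma> w \<in> orbit N A X (slice W \<xi> (bb w))"
    if "w \<in> ball 0 e" for w
  proof -
    have W: "\<sigma> w \<in> W" using e(3)[OF that] .
    then show r: "\<sigma> w \<in> regular_points" using flow_box_regular[OF b] by blast
    show "slice W \<xi> (bb w) \<in> orbit N A X (\<sigma> w)"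
      using flow_box_slice(2)[OF b W] orbit_eq[OF regular_in[OF r]] unfolding bb_def by (metis rangeI)
    then show "\<sigma> w \<in> orbit N A X (slice W \<xi> (bb w))" using orbit_sym[OF regular_in[OF r]] by blast
  qed
  have bn: "norm (bb w) < 1" if "w \<in> ball 0 e" for w
    unfolding bb_def by (rule flow_box_coord_norm[OF b e(3)[OF that]])
  show ?thesis
  proof (rule that[OF \<sigma>(2,1,3), of "min e' e" n "y \<circ> bb"])
    show "continuous_on (ball 0 (min e' e)) (y \<circ> bb)"
      unfolding o_def
    proof (rule continuous_on_compose2[of "ball 0 r" y])
      show "continuous_on (ball 0 r) y" by (rule holomorphic_on_imp_continuous_on[OF y(4)])
      show "continuous_on (ball 0 (min e' e)) bb" by (rule continuous_on_subset[OF bbc]) auto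
      show "bb ` ball 0 (min e' e) \<subseteq> ball 0 r" using ine(2) by auto
    qed
    show "inj_on (y \<circ> bb) (ball 0 (min e' e))"
    proof (rule inj_onI)
      fix w w' assume w: "w \<in> ball 0 (min e' e)" "w' \<in> ball 0 (min e' e)" "(y \<circ> bb) w = (y \<circ> bb) w'"
      then have "bb w = bb w'" using y(5) ine(2)[of w] ine(2)[of w'] by (auto simp: inj_on_def)
      then show "w = w'" using binj w by auto
    qed
    fix w w' assume w: "w \<in> ball 0 (min e' e)" "w' \<in> ball 0 (min e' e)" "w \<noteq> 0" and o: "\<sigma> w' \<in> orbit N A X (\<sigma> w)"
    have we: "w \<in> ball 0 e" "w' \<in> ball 0 e" "w \<in> ball 0 e'" "w' \<in> ball 0 e'" using w by auto
    have rN: "\<sigma> w \<in> topspace N" "\<sigma> w' \<in> topspace N" using orb(2)[OF we(1)] orb(2)[OF we(2)] regular_in by auto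
    have bw: "bb w \<noteq> 0" using binj[of w 0] bb0 w(3) we(1) e(1) by auto
    have w'0: "w' \<noteq> 0"
    proof
      assume "w' = 0"
      then have "p \<in> orbit N A X (\<sigma> w)" using o \<sigma>(1) by simp
      then have "\<sigma> w \<in> orbit N A X p" using orbit_sym rN by blast
      then have "slice W \<xi> (bb w) \<in> orbit N A X p" using orbit_trans regular_in[OF p] orb(1)[OF we(1)] by blast
      then show False using d(2)[of "bb w"] bn[OF we(1)] bw ine(3)[OF we(3)] by auto
    qed
    have bw': "bb w' \<noteq> 0" using binj[of w' 0] bb0 w'0 we(2) e(1) by auto
    have sr: "slice W \<xi> (bb w) \<in> regular_points" by (rule slice_regular[OF b bn[OF we(1)]])
    have "slice W \<xi> (bb w') \<in> orbit N A X (slice W \<xi> (bb w))"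
      using orbit_trans[OF regular_in[OF sr] orbit_trans[OF regular_in[OF sr] orb(3)[OF we(1)] o] orb(1)[OF we(2)]] .
    then obtain t where t: "slice W \<xi> (bb w') = fl t (slice W \<xi> (bb w))" using orbit_eq[OF regular_in[OF sr]] by blast
    have "v1 (bb w') * v2 (bb w) = v1 (bb w) * v2 (bb w')"
      using weight_fun_fl[OF weight1 sr, of t] weight_fun_fl[OF weight2 sr, of t] t by (simp add: v1_def v2_def)
    from yn[OF ine(2)[OF we(3)] ine(2)[OF we(4)] bw bw' this]
    show "w' \<noteq> 0 \<and> (y \<circ> bb) w' ^ n = (y \<circ> bb) w ^ n" using w'0 by simp
  qed (use e e' y bb0 in auto)
qed

text \<open>In the coordinate \<open>Y\<close> a holonomy map has a ratio
  \<open>Y (\<kappa> w) / Y w\<close> that is continuous on a punctured disc and takes values in the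
  finite set of \<open>n\<close>-th roots of unity, so it is a constant \<open>\<zeta>\<close>. The
  germ is determined by \<open>\<zeta>\<close> since \<open>Y\<close> is injective.\<close>

lemma holonomy_finite:
  assumes T: "transversal N A X p T"
  shows "finite (holonomy_group N A X L p T)"
proof -
  obtain \<sigma> e n Y where \<sigma>: "\<sigma> ` ball (0::complex) 1 = T" "\<sigma> 0 = p" "homeomorphic_map (top_of_set (ball 0 1)) (subtopology N T) \<sigma>"
    and e: "0 < e" "e \<le> 1" and n: "0 < n" and Yc: "continuous_on (ball 0 e) Y" and Yi: "inj_on Y (ball 0 e)" and Y0: "Y 0 = 0"
    and Yn: "\<And>w w'. w \<in> ball 0 e \<Longrightarrow> w' \<in> ball 0 e \<Longrightarrow> w \<noteq> 0 \<Longrightarrow> \<sigma> w' \<in> orbit N A X (\<sigma> w) \<Longrightarrow>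
       w' \<noteq> 0 \<and> Y w' ^ n = (Y w ^ n :: complex)"
    by (rule holonomy_coordinate[OF T]) (rule that)
  have TN: "T \<subseteq> topspace N" using transversal_subset[OF T] regular_in by blast
  obtain \<sigma>' where inv: "homeomorphic_maps (top_of_set (ball 0 1)) (subtopology N T) \<sigma> \<sigma>'"
    using \<sigma>(3) homeomorphic_map_maps by blast
  have \<sigma>c: "continuous_map (top_of_set (ball 0 1)) (subtopology N T) \<sigma>"
    and \<sigma>'c: "continuous_map (subtopology N T) (top_of_set (ball 0 1)) \<sigma>'"
    and \<sigma>'\<sigma>: "\<And>w. w \<in> ball 0 1 \<Longrightarrow> \<sigma>' (\<sigma> w) = w" and \<sigma>\<sigma>': "\<And>x. x \<in> T \<Longrightarrow> \<sigma> (\<sigma>' x) = x"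
    using inv TN unfolding homeomorphic_maps_def by auto
  have \<sigma>'in: "\<sigma>' x \<in> ball 0 1" if "x \<in> T" for x
    using continuous_map_image_subset_topspace[OF \<sigma>'c] that TN by fastforce
  have \<sigma>'p: "\<sigma>' p = 0" using \<sigma>'\<sigma>[of 0] \<sigma>(2) by simp
  \<comment> \<open>In the coordinate \<open>Y\<close>, the map \<open>h\<close> is multiplication
    by \<open>\<zeta>\<close> near 0, with image inside the disc where \<open>Y\<close> is
    injective.\<close>
  define P where "P h \<zeta> \<longleftrightarrow> (\<exists>\<rho>>0. \<rho> \<le> e \<and> (\<forall>w\<in>ball 0 \<rho>. h (\<sigma> w) \<in> T \<and> \<sigma>' (h (\<sigma> w)) \<in> ball 0 e \<and> Y (\<sigma>' (h (\<sigma> w))) = \<zeta> * Y w))" for h \<zeta>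
  have root: "\<exists>\<zeta>. \<zeta> ^ n = 1 \<and> P h \<zeta>" if \<alpha>: "\<alpha> 0 = p" "\<alpha> 1 = p" and h: "holonomy_along N A X \<alpha> T 1 T h" for \<alpha> h
  proof -
    obtain V where V: "openin (subtopology N T) V" "p \<in> V" "continuous_map (subtopology N V) (subtopology N T) h"
      "h p = p" "\<forall>x\<in>V. h x \<in> orbit N A X x"
      using holonomy_along_properties[OF h] T \<alpha> by auto
    have VT: "V \<subseteq> T" using openin_subset[OF V(1)] by simp
    define B where "B = {w \<in> ball 0 1. \<sigma> w \<in> V}"
    have "openin (top_of_set (ball 0 1)) {w \<in> topspace (top_of_set (ball 0 1)). \<sigma> w \<in> V}"
      by (rule openin_continuous_map_preimage[OF \<sigma>c V(1)])
    then have Bo: "open B" by (simp add: B_def openin_open_eq)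
    define \<kappa> where "\<kappa> w = \<sigma>' (h (\<sigma> w))" for w
    have "continuous_map (top_of_set B) (subtopology N V) \<sigma>"
      using continuous_map_from_subtopology_mono[OF \<sigma>c, of B]
      by (auto simp: continuous_map_in_subtopology subtopology_subtopology B_def Int_absorb1 subset_iff)
    then have "continuous_map (top_of_set B) (top_of_set (ball 0 1)) (\<sigma>' \<circ> (h \<circ> \<sigma>))"
      by (rule continuous_map_compose[OF continuous_map_compose[OF _ V(3)] \<sigma>'c])
    then have \<kappa>c: "continuous_on B \<kappa>" by (simp add: \<kappa>_def[abs_def] o_def)
    have hT: "h x \<in> T" if "x \<in> V" for x
      using continuous_map_image_subset_topspace[OF V(3)] that VT TN by fastforce
    have "open (B \<inter> \<kappa> -` ball 0 e)" by (rule continuous_open_preimage[OF \<kappa>c Bo open_ball])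
    moreover have "0 \<in> B \<inter> \<kappa> -` ball 0 e" using V \<sigma>(2) \<sigma>'p e by (auto simp: B_def \<kappa>_def)
    ultimately obtain \<rho>0 where \<rho>0: "0 < \<rho>0" "ball 0 \<rho>0 \<subseteq> B \<inter> \<kappa> -` ball 0 e" by (meson open_contains_ball)
    define \<rho> where "\<rho> = min \<rho>0 e"
    have \<rho>: "0 < \<rho>" "\<rho> \<le> e" using \<rho>0 e by (auto simp: \<rho>_def)
    have in\<rho>: "w \<in> B" "\<kappa> w \<in> ball 0 e" "w \<in> ball 0 e" if "w \<in> ball 0 \<rho>" for w
    proof -
      have "w \<in> ball 0 \<rho>0" "w \<in> ball 0 e" using that by (auto simp: \<rho>_def)
      then show "w \<in> B" "\<kappa> w \<in> ball 0 e" "w \<in> ball 0 e" using \<rho>0(2) by auto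
    qed
    have rel: "Y (\<kappa> w) ^ n = Y w ^ n" if "w \<in> ball 0 \<rho> - {0}" for w
    proof -
      have w: "w \<in> ball 0 \<rho>" "w \<noteq> 0" using that by auto
      have wV: "\<sigma> w \<in> V" using in\<rho>(1)[OF w(1)] by (simp add: B_def)
      then have "\<sigma> (\<kappa> w) = h (\<sigma> w)" using \<sigma>\<sigma>' hT by (simp add: \<kappa>_def)
      then have "\<sigma> (\<kappa> w) \<in> orbit N A X (\<sigma> w)" using V(5) wV by simp
      then show ?thesis using Yn[OF in\<rho>(3)[OF w(1)] in\<rho>(2)[OF w(1)] w(2)] by blast
    qed
    have Ynz: "Y w \<noteq> 0" if "w \<in> ball 0 \<rho> - {0}" for w
      using inj_onD[OF Yi, of w 0] Y0 in\<rho>(3)[of w] that e by auto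
    define q where "q w = Y (\<kappa> w) / Y w" for w
    have qn: "q w ^ n = 1" if "w \<in> ball 0 \<rho> - {0}" for w
      using rel[OF that] Ynz[OF that] by (simp add: q_def power_divide)
    have "continuous_on (ball 0 \<rho> - {0}) q"
      unfolding q_def
    proof (intro continuous_on_divide ballI Ynz)
      show "continuous_on (ball 0 \<rho> - {0}) Y" by (rule continuous_on_subset[OF Yc]) (use in\<rho> in auto)
      show "continuous_on (ball 0 \<rho> - {0}) (\<lambda>w. Y (\<kappa> w))"
        by (rule continuous_on_compose2[OF Yc continuous_on_subset[OF \<kappa>c]]) (use in\<rho> in auto)
    qed
    moreover have "connected (ball (0::complex) \<rho> - {0})" by (rule connected_open_delete) auto
    moreover have "finite (q ` (ball 0 \<rho> - {0}))"
      by (rule finite_subset[OF _ finite_nth_roots[OF n, of 1]]) (use qn in auto)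
    ultimately have "q constant_on (ball 0 \<rho> - {0})" by (intro continuous_finite_range_constant)
    then obtain \<zeta> where \<zeta>: "\<And>w. w \<in> ball 0 \<rho> - {0} \<Longrightarrow> q w = \<zeta>" by (auto simp: constant_on_def)
    have m: "of_real (\<rho> / 2) \<in> ball (0::complex) \<rho> - {0}" using \<rho> by simp
    have "\<zeta> ^ n = 1" using \<zeta>[OF m] qn[OF m] by simp
    moreover have "P h \<zeta>"
      unfolding P_def
    proof (intro exI[of _ \<rho>] conjI \<rho> ballI)
      fix w assume w: "w \<in> ball (0::complex) \<rho>"
      show "h (\<sigma> w) \<in> T" using in\<rho>(1)[OF w] hT by (simp add: B_def)
      show "\<sigma>' (h (\<sigma> w)) \<in> ball 0 e" using in\<rho>(2)[OF w] by (simp add: \<kappa>_def)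
      show "Y (\<sigma>' (h (\<sigma> w))) = \<zeta> * Y w"
      proof (cases "w = 0")
        case True
        then show ?thesis using \<sigma>(2) V(4) \<sigma>'p Y0 by simp
      next
        case False
        then show ?thesis using \<zeta>[of w] Ynz[of w] w by (auto simp: q_def \<kappa>_def field_simps)
      qed
    qed
    ultimately show ?thesis by blast
  qed
  have germ: "germ_at N T p h \<subseteq> germ_at N T p h'" if P: "P h \<zeta>" "P h' \<zeta>" for h h' \<zeta>
  proof -
    obtain \<rho> where \<rho>: "\<rho> > 0" "\<rho> \<le> e" "\<And>w. w \<in> ball 0 \<rho> \<Longrightarrow> h (\<sigma> w) \<in> T \<and> \<sigma>' (h (\<sigma> w)) \<in> ball 0 e \<and> Y (\<sigma>' (h (\<sigma> w))) = \<zeta> * Y w"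
      using P(1) unfolding P_def by blast
    obtain \<rho>' where \<rho>': "\<rho>' > 0" "\<rho>' \<le> e" "\<And>w. w \<in> ball 0 \<rho>' \<Longrightarrow> h' (\<sigma> w) \<in> T \<and> \<sigma>' (h' (\<sigma> w)) \<in> ball 0 e \<and> Y (\<sigma>' (h' (\<sigma> w))) = \<zeta> * Y w"
      using P(2) unfolding P_def by blast
    define r where "r = min \<rho> \<rho>'"
    have eq: "h (\<sigma> w) = h' (\<sigma> w)" if "w \<in> ball 0 r" for w
    proof -
      have w: "w \<in> ball 0 \<rho>" "w \<in> ball 0 \<rho>'" using that by (auto simp: r_def)
      have "\<sigma>' (h (\<sigma> w)) = \<sigma>' (h' (\<sigma> w))" using \<rho>(3)[OF w(1)] \<rho>'(3)[OF w(2)] inj_onD[OF Yi] by metis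
      then show ?thesis using \<rho>(3)[OF w(1)] \<rho>'(3)[OF w(2)] \<sigma>\<sigma>' by metis
    qed
    have "openin (subtopology N T) {x \<in> topspace (subtopology N T). \<sigma>' x \<in> ball 0 1 \<inter> ball 0 r}"
      by (rule openin_continuous_map_preimage[OF \<sigma>'c]) (auto simp: openin_open)
    then obtain W where W: "openin N W" "{x \<in> topspace (subtopology N T). \<sigma>' x \<in> ball 0 1 \<inter> ball 0 r} = W \<inter> T"
      unfolding openin_subtopology by metis
    have pT: "p \<in> T" using transversal_base[OF T] .
    have pW: "p \<in> W" using W(2) pT TN \<sigma>'p \<rho>(1) \<rho>'(1) by (auto simp: r_def)
    have WT: "h x = h' x" if "x \<in> W \<inter> T" for x
    proof -
      have "\<sigma>' x \<in> ball 0 r" using that W(2) by blast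
      from eq[OF this] show ?thesis using \<sigma>\<sigma>'[of x] that by simp
    qed
    show ?thesis
    proof
      fix k assume "k \<in> germ_at N T p h"
      then obtain W' where W': "openin N W'" "p \<in> W'" "\<forall>x\<in>W' \<inter> T. k x = h x" unfolding germ_at_def by blast
      have "openin N (W \<inter> W')" using W(1) W'(1) by blast
      moreover have "k x = h' x" if "x \<in> (W \<inter> W') \<inter> T" for x using W'(3) WT[of x] that by simp
      ultimately show "k \<in> germ_at N T p h'"
        unfolding germ_at_def using pW W'(2) by (intro CollectI exI[of _ "W \<inter> W'"]) simp
    qed
  qed
  define G where "G \<zeta> = {germ_at N T p h |h. P h \<zeta>}" for \<zeta>
  have "finite (G \<zeta>)" for \<zeta>
  proof (cases "G \<zeta> = {}")
    case False
    then obtain h where h: "P h \<zeta>" by (auto simp: G_def)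
    have "G \<zeta> \<subseteq> {germ_at N T p h}" using germ[OF h] germ[OF _ h] by (auto simp: G_def)
    then show ?thesis by (rule finite_subset) simp
  qed simp
  then have "finite (\<Union>\<zeta>\<in>{\<zeta>. \<zeta> ^ n = 1}. G \<zeta>)" by (intro finite_UN_I finite_nth_roots n)
  moreover have "holonomy_group N A X L p T \<subseteq> (\<Union>\<zeta>\<in>{\<zeta>. \<zeta> ^ n = 1}. G \<zeta>)"
  proof
    fix x assume "x \<in> holonomy_group N A X L p T"
    then obtain h \<alpha> where h: "x = germ_at N T p h" "\<alpha> 0 = p" "\<alpha> 1 = p" "holonomy_along N A X \<alpha> T 1 T h"
      unfolding holonomy_group_def by blast
    obtain \<zeta> where "\<zeta> ^ n = 1" "P h \<zeta>" using root[OF h(2-4)] by blast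
    then show "x \<in> (\<Union>\<zeta>\<in>{\<zeta>. \<zeta> ^ n = 1}. G \<zeta>)" using h(1) by (auto simp: G_def)
  qed
  ultimately show ?thesis by (rule finite_subset[rotated])
qed

end

section \<open>Existence of a first integral\<close>

context separated_flow
begin

text \<open>If \<open>T\<close> is a period of the whole flow, scaled time acts through the
  multiplicative group, and this is the component of \<open>f\<close> of index
  \<open>n\<close>.\<close>

definition fcoeff :: "complex \<Rightarrow> ('a \<Rightarrow> complex) \<Rightarrow> int \<Rightarrow> 'a \<Rightarrow> complex" where
  "fcoeff T f n q = fourier_coeff (\<lambda>s. f (fl (s * T) q)) n"

lemma function_along_scaled_flow:
  assumes "holomorphic_fun_on N A (topspace N) f" "x \<in> topspace N"
  shows "(\<lambda>s. f (fl (s * T) x)) holomorphic_on UNIV"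
proof -
  have "(\<lambda>s. s * T) holomorphic_on UNIV" by (intro holomorphic_intros)
  from holomorphic_on_compose[OF this holomorphic_on_subset[OF function_along_flow[OF assms] subset_UNIV]]
  show ?thesis by (simp add: o_def)
qed

lemma fcoeff_fl:
  assumes f: "holomorphic_fun_on N A (topspace N) f" and T: "T \<noteq> 0" and q: "q \<in> topspace N" "fl T q = q"
  shows "fcoeff T f n (fl t q) = exp (2 * pi * \<i> * of_int n / T * t) * fcoeff T f n q"
proof -
  define H where "H s = f (fl (s * T) q)" for s
  have H: "H holomorphic_on UNIV" unfolding H_def[abs_def] by (rule function_along_scaled_flow[OF f q(1)])
  have "H (s + 1) = H s" for s using fl_fl[OF q(1), of "s * T" T] q(2) by (simp add: H_def algebra_simps)
  from fourier_coeff_shift[OF H this, of n "t / T"]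
  have "fourier_coeff H n = exp (- (2 * pi * \<i> * of_int n * (t / T))) * fourier_coeff (\<lambda>s. H (s + t / T)) n" .
  moreover have "H (s + t / T) = f (fl (s * T) (fl t q))" for s
    using fl_fl[OF q(1), of "s * T" t] T by (simp add: H_def algebra_simps)
  ultimately have "fcoeff T f n q = exp (- (2 * pi * \<i> * of_int n * (t / T))) * fcoeff T f n (fl t q)"
    by (simp add: fcoeff_def H_def[abs_def])
  then show ?thesis by (simp add: exp_minus field_simps)
qed

text \<open>Complex translation in the Fourier integral gives the weight, and holomorphic dependence
  of an integral on a parameter gives holomorphy on slices.\<close>

lemma weight_fun_fcoeff:
  assumes f: "holomorphic_fun_on N A (topspace N) f" and T: "T \<noteq> 0" "\<And>x. x \<in> regular_points \<Longrightarrow> fl T x = x"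
  shows "weight_fun (2 * pi * \<i> * of_int n / T) (fcoeff T f n)"
proof (rule weight_funI)
  show "fcoeff T f n (fl t x) = exp (2 * pi * \<i> * of_int n / T * t) * fcoeff T f n x" if "x \<in> regular_points" for x t
    by (rule fcoeff_fl[OF f T(1) regular_in[OF that] T(2)[OF that]])
  fix W \<xi> c assume b: "flow_box W \<xi> c"
  have sc: "continuous_map (top_of_set (ball 0 1)) N (slice W \<xi>)" using slice_hcurve[OF b] by (simp add: hcurve_def)
  have fc: "continuous_map N euclidean f" using f unfolding holomorphic_fun_on_def holomorphic_map_def by simp
  have "continuous_map (prod_topology euclidean (top_of_set (ball 0 1))) euclidean (f \<circ> (\<lambda>(t, y). fl t (slice W \<xi> y)))"
    by (rule continuous_map_compose[OF fl_curve_jointly_continuous[OF sc] fc])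
  moreover have "prod_topology euclidean (top_of_set (ball 0 1)) = top_of_set (UNIV \<times> ball (0::complex) 1 :: (complex \<times> complex) set)"
    using prod_topology_subtopology(2)[of euclidean euclidean "ball (0::complex) 1"] by simp
  ultimately have c: "continuous_on (UNIV \<times> ball 0 1) (\<lambda>(t, y). f (fl t (slice W \<xi> y)))"
    by (simp add: o_def case_prod_unfold)
  have c1: "continuous_on (ball 0 1 \<times> {0..1}) (\<lambda>x. f (fl (of_real (snd x) * T) (slice W \<xi> (fst x))))"
    using continuous_on_compose2[OF c, of "ball 0 1 \<times> {0..1::real}" "\<lambda>x. (of_real (snd x) * T, fst x)"]
    by (force simp: case_prod_unfold intro!: continuous_intros)
  show "(\<lambda>z. fcoeff T f n (slice W \<xi> z)) holomorphic_on ball 0 1"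
    unfolding fcoeff_def fourier_coeff_def
  proof (rule holomorphic_on_integral_param[OF open_ball])
    show "continuous_on (ball 0 1 \<times> {0..1}) (\<lambda>(z, u). f (fl (of_real u * T) (slice W \<xi> z)) * exp (- (2 * pi * \<i> * of_int n * of_real u)))"
      unfolding case_prod_unfold by (intro continuous_on_mult c1 continuous_intros)
    show "(\<lambda>z. f (fl (of_real u * T) (slice W \<xi> z)) * exp (- (2 * pi * \<i> * of_int n * of_real u))) holomorphic_on ball 0 1" for u :: real
    proof (intro holomorphic_on_mult holomorphic_on_const)
      have h: "hcurve (\<lambda>z. fl (of_real u * T) (slice W \<xi> z)) (ball 0 1)" by (rule hcurve_fl[OF slice_hcurve[OF b]])
      show "(\<lambda>z. f (fl (of_real u * T) (slice W \<xi> z))) holomorphic_on ball 0 1"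
        by (rule holomorphic_fun_along_hcurve[OF f h]) (use slice_regular[OF b] regular_in fl_in in \<open>auto simp: image_subset_iff\<close>)
    qed
  qed
qed

text \<open>Equal coefficients mean equal values of every \<open>f\<close> along the two orbits at
  equal times, in particular at time 0.\<close>

lemma fcoeff_separate:
  assumes T: "T \<noteq> 0" "fl T x = x" "fl T y = y" and x: "x \<in> topspace N" and y: "y \<in> topspace N"
    and eq: "\<And>f n. holomorphic_fun_on N A (topspace N) f \<Longrightarrow> fcoeff T f n x = fcoeff T f n y"
  shows "x = y"
proof (rule ccontr)
  assume "x \<noteq> y"
  then obtain f where f: "holomorphic_fun_on N A (topspace N) f" "f x \<noteq> f y" using separation[OF x y] by blast
  have "(\<lambda>s. f (fl (s * T) x)) = (\<lambda>s. f (fl (s * T) y))"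
  proof (rule fourier_coeff_inject)
    show "f (fl ((s + 1) * T) x) = f (fl (s * T) x)" "f (fl ((s + 1) * T) y) = f (fl (s * T) y)" for s
      using fl_fl[OF x, of "s * T" T] fl_fl[OF y, of "s * T" T] T(2,3) by (simp_all add: algebra_simps)
  qed (use function_along_scaled_flow[OF f(1)] x y eq[OF f(1)] in \<open>auto simp: fcoeff_def\<close>)
  from fun_cong[OF this, of 0] show False using f(2) x y by simp
qed

text \<open>If all coefficients of nonzero index vanished at \<open>p\<close>, every global function
  would be constant along the orbit of \<open>p\<close>, although functions separate
  \<open>p\<close> from \<open>fl t p\<close>.\<close>

lemma fcoeff_nonzero:
  assumes T0: "T \<noteq> 0" and T: "fl T p = p" and p: "p \<in> regular_points"
  obtains f n where "holomorphic_fun_on N A (topspace N) f" "n \<noteq> 0" "fcoeff T f n p \<noteq> 0"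
proof -
  have pN: "p \<in> topspace N" using regular_in[OF p] .
  obtain W \<xi> c where b: "flow_box W \<xi> c" and pW: "p \<in> W" "\<xi> p = 0" and "W \<subseteq> topspace N"
    by (rule flow_box_exists[OF p openin_topspace pN])
  \<comment> \<open>This time moves \<open>p\<close> within the box, to the first coordinate
    \<open>1 / 2\<close>.\<close>
  define t where "t = 1 / (2 * c)"
  have "norm (\<xi> p $ 1 + c * t) < 1" using pW(2) flow_box_nonzero[OF b] by (simp add: t_def norm_divide norm_mult)
  from flow_box_fl(2)[OF b pW(1) this] have "\<xi> (fl t p) \<noteq> \<xi> p"
    using pW(2) flow_box_nonzero[OF b] by (auto simp: t_def vec_eq_iff forall_2)
  then have "fl t p \<noteq> p" by auto
  then obtain f where f: "holomorphic_fun_on N A (topspace N) f" "f (fl t p) \<noteq> f p"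
    using separation[OF fl_in[OF pN] pN] by blast
  define H where "H s = f (fl (s * T) p)" for s
  have H: "H holomorphic_on UNIV" unfolding H_def[abs_def] by (rule function_along_scaled_flow[OF f(1) pN])
  have "\<exists>n. n \<noteq> 0 \<and> fcoeff T f n p \<noteq> 0"
  proof (rule ccontr)
    assume no: "\<not> ?thesis"
    have "H = (\<lambda>s. fourier_coeff H 0)"
    proof (rule fourier_coeff_inject[OF H holomorphic_on_const])
      show "H (s + 1) = H s" for s using fl_fl[OF pN, of "s * T" T] T by (simp add: H_def algebra_simps)
      show "fourier_coeff H n = fourier_coeff (\<lambda>s. fourier_coeff H 0) n" for n
        using no by (auto simp: fourier_coeff_exp(2) fcoeff_def H_def[abs_def])
    qed simp
    then have "H (t / T) = H 0" by metis
    then show False using f(2) T0 pN by (simp add: H_def)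
  qed
  then show ?thesis using that f(1) by blast
qed

text \<open>If functions of equal weight were always proportional, the \<open>m\<close>-th power of
  any coefficient would be comparable with a power of one function \<open>a\<close> of weight
  \<open>\<mu> \<noteq> 0\<close> with \<open>a p \<noteq> 0\<close>. On a disc transverse to the
  orbits where \<open>a\<close> is constant, each coefficient takes finitely many values, hence one;
  coefficients separate points, so the disc would be a single point.\<close>

lemma periodic_flow_pair:
  assumes T: "T \<noteq> 0" "\<And>x. x \<in> regular_points \<Longrightarrow> fl T x = x" and p: "p \<in> regular_points"
  shows "\<exists>\<nu> g1 g2. first_integral_pair N A X \<nu> g1 g2"
proof (rule ccontr)
  assume no: "\<not> ?thesis"
  have dep: "\<exists>k. \<forall>x\<in>regular_points. g1 x = k * g2 x"
    if "weight_fun \<nu> g1" "weight_fun \<nu> g2" "y \<in> regular_points" "g2 y \<noteq> 0" for \<nu> g1 g2 y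
    using no that unfolding first_integral_pair_def first_integral_pair_axioms_def
    using separated_flow_axioms by blast
  obtain f0 n0 where f0: "holomorphic_fun_on N A (topspace N) f0" "n0 \<noteq> 0" "fcoeff T f0 n0 p \<noteq> 0"
    by (rule fcoeff_nonzero[OF T(1) T(2)[OF p] p])
  define a where "a = fcoeff T f0 n0"
  define \<mu> where "\<mu> = 2 * pi * \<i> * of_int n0 / T"
  have \<mu>: "\<mu> \<noteq> 0" using T(1) f0(2) by (simp add: \<mu>_def)
  have a: "weight_fun \<mu> a" unfolding a_def \<mu>_def by (rule weight_fun_fcoeff[OF f0(1) T])
  have ap: "a p \<noteq> 0" using f0(3) by (simp add: a_def)
  \<comment> \<open>With this exponent the power of a coefficient of any index has a weight that is
    an integral multiple of \<open>\<mu>\<close>.\<close>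
  define m where "m = nat \<bar>n0\<bar>"
  have m: "m > 0" using f0(2) by (simp add: m_def)
  have power_eq: "fcoeff T f n x ^ m = fcoeff T f n p ^ m"
    if f: "holomorphic_fun_on N A (topspace N) f" and x: "x \<in> regular_points" "a x = a p" for f n x
  proof -
    \<comment> \<open>The exponents \<open>i\<close> and \<open>j\<close> give \<open>fcoeff T f n ^ m * a ^ i\<close> the weight of \<open>a ^ j\<close>.\<close>
    define d where "d = n * sgn n0"
    define i where "i = nat (- d)"
    define j where "j = nat d"
    have mi: "int m = n0 * sgn n0" by (metis abs_ge_zero abs_sgn m_def nat_0_le)
    have ij: "int j = d + int i" by (simp add: i_def j_def)
    have "int m * n = n0 * d" using mi by (simp add: d_def)
    from arg_cong[OF this, of "of_int :: int \<Rightarrow> complex"]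
    have md: "of_nat m * of_int n = (of_int n0 * of_int d :: complex)" by simp
    have jc: "(of_nat j :: complex) = of_int d + of_nat i"
      using arg_cong[OF ij, of "of_int :: int \<Rightarrow> complex"] by simp
    have "of_nat m * (2 * pi * \<i> * of_int n / T) = (of_nat m * of_int n) * (2 * pi * \<i> / T)" by simp
    also have "\<dots> = of_int d * \<mu>" unfolding md by (simp add: \<mu>_def)
    finally have w: "of_nat m * (2 * pi * \<i> * of_int n / T) + of_nat i * \<mu> = of_nat j * \<mu>"
      unfolding jc by (simp add: distrib_right)
    have "weight_fun (of_nat j * \<mu>) (\<lambda>x. fcoeff T f n x ^ m * a x ^ i)"
      using weight_fun_mult[OF weight_fun_power[OF weight_fun_fcoeff[OF f T], of m n] weight_fun_power[OF a, of i]] w by simp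
    from dep[OF this weight_fun_power[OF a, of j] p] ap
    obtain k where k: "\<And>x. x \<in> regular_points \<Longrightarrow> fcoeff T f n x ^ m * a x ^ i = k * a x ^ j" by auto
    have "fcoeff T f n x ^ m * a p ^ i = fcoeff T f n p ^ m * a p ^ i" using k[OF x(1)] k[OF p] x(2) by simp
    then show ?thesis using ap by simp
  qed
  obtain W \<xi> c where b: "flow_box W \<xi> c" and pW: "p \<in> W" "\<xi> p = 0" and "W \<subseteq> topspace N"
    by (rule flow_box_exists[OF p openin_topspace regular_in[OF p]])
  have s0: "slice W \<xi> 0 = p" by (rule slice_unique[OF b pW(1)]) (simp add: pW(2) vec_eq_iff forall_2)
  define v where "v z = a (slice W \<xi> z) / a p" for z
  have v0: "v 0 = 1" using ap by (simp add: v_def s0)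
  have vh: "v holomorphic_on ball 0 1"
    unfolding v_def[abs_def] using weight_fun_slice[OF a b] ap by (intro holomorphic_on_divide holomorphic_on_const) auto
  \<comment> \<open>The flow multiplies \<open>a\<close> by \<open>exp (\<mu> * t)\<close>, so this
    time brings the value at the slice point back to \<open>a p\<close>. The principal logarithm is
    continuous as long as \<open>v\<close> stays in the right half plane.\<close>
  define t where "t z = - Ln (v z) / \<mu>" for z
  have "open (ball 0 1 \<inter> v -` ball 1 1)"
    by (rule continuous_open_preimage[OF holomorphic_on_imp_continuous_on[OF vh]]) auto
  moreover have "0 \<in> ball 0 1 \<inter> v -` ball 1 1" using v0 by simp
  ultimately obtain r where r: "r > 0" "ball 0 r \<subseteq> ball 0 1 \<inter> v -` ball 1 1" by (meson open_contains_ball)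
  have inr: "z \<in> ball 0 1" "0 < Re (v z)" if "z \<in> ball 0 r" for z
  proof -
    have "z \<in> ball 0 1 \<inter> v -` ball 1 1" using that r(2) by (rule subsetD[rotated])
    then have "z \<in> ball 0 1" "norm (1 - v z) < 1" by (auto simp: dist_norm)
    moreover have "Re (1 - v z) \<le> norm (1 - v z)" by (rule complex_Re_le_cmod)
    ultimately show "z \<in> ball 0 1" "0 < Re (v z)" by auto
  qed
  have v_ne: "v z \<noteq> 0" "v z \<notin> \<real>\<^sub>\<le>\<^sub>0" if "z \<in> ball 0 r" for z
    using inr(2)[OF that] by (auto simp: complex_nonpos_Reals_iff)
  have tc: "continuous_on (ball 0 r) t"
  proof -
    have "continuous_on (ball 0 r) v"
      by (rule continuous_on_subset[OF holomorphic_on_imp_continuous_on[OF vh]]) (use inr in auto)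
    then show ?thesis unfolding t_def using v_ne(2) \<mu> by (intro continuous_intros continuous_on_Ln) auto
  qed
  define x where "x z = fl (t z) (slice W \<xi> z)" for z
  have sr: "slice W \<xi> z \<in> regular_points" if "z \<in> ball 0 r" for z
    by (rule slice_regular[OF b]) (use inr(1)[OF that] in simp)
  have xr: "x z \<in> regular_points" if "z \<in> ball 0 r" for z using sr[OF that] by (simp add: x_def)
  have ax: "a (x z) = a p" if "z \<in> ball 0 r" for z
  proof -
    have "a (x z) = exp (\<mu> * t z) * a (slice W \<xi> z)" unfolding x_def by (rule weight_fun_fl[OF a sr[OF that]])
    also have "exp (\<mu> * t z) = inverse (v z)" using \<mu> v_ne(1)[OF that] by (simp add: t_def exp_minus)
    finally show ?thesis using v_ne(1)[OF that] ap by (simp add: v_def)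
  qed
  have zero_r: "(0::complex) \<in> ball 0 r" using r(1) by simp
  have t0: "t 0 = 0" by (simp add: t_def v0)
  have x0: "x 0 = p" using regular_in[OF p] by (simp add: x_def t0 s0)
  have const: "fcoeff T f n (x z) = fcoeff T f n p"
    if f: "holomorphic_fun_on N A (topspace N) f" and z: "z \<in> ball 0 r" for f n z
  proof -
    define w where "w z = fcoeff T f n (x z)" for z
    have weq: "w z = exp (2 * pi * \<i> * of_int n / T * t z) * fcoeff T f n (slice W \<xi> z)" if "z \<in> ball 0 r" for z
      unfolding w_def x_def by (rule weight_fun_fl[OF weight_fun_fcoeff[OF f T] sr[OF that]])
    have "continuous_on (ball 0 r) (\<lambda>z. exp (2 * pi * \<i> * of_int n / T * t z) * fcoeff T f n (slice W \<xi> z))"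
    proof (intro continuous_on_mult continuous_on_exp continuous_on_const tc)
      show "continuous_on (ball 0 r) (\<lambda>z. fcoeff T f n (slice W \<xi> z))"
        by (rule continuous_on_subset[OF holomorphic_on_imp_continuous_on[OF weight_fun_slice[OF weight_fun_fcoeff[OF f T] b]]])
          (use inr in auto)
    qed
    then have "continuous_on (ball 0 r) w" by (rule continuous_on_eq) (simp add: weq)
    moreover have "finite (w ` ball 0 r)"
      by (rule finite_subset[OF _ finite_nth_roots[OF m, of "fcoeff T f n p ^ m"]])
        (use power_eq[OF f xr ax] in \<open>auto simp: w_def\<close>)
    ultimately have "w constant_on ball 0 r" by (intro continuous_finite_range_constant connected_ball)
    then have "w z = w 0" using z zero_r unfolding constant_on_def by metis
    then show ?thesis by (simp add: w_def x0)
  qed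
  have xp: "x z = p" if "z \<in> ball 0 r" for z
    by (rule fcoeff_separate[OF T(1) T(2)[OF xr[OF that]] T(2)[OF p] regular_in[OF xr[OF that]] regular_in[OF p] const[OF _ that]])
  \<comment> \<open>All slice points near \<open>p\<close> are now \<open>p\<close> moved by a small
    time, which inside the box keeps the second coordinate 0; but the slice point of parameter
    \<open>z\<close> has second coordinate \<open>z\<close>.\<close>
  have "isCont t 0" using tc zero_r continuous_on_eq_continuous_at[OF open_ball] by blast
  then obtain \<delta> where \<delta>: "\<delta> > 0" "\<And>z. norm z < \<delta> \<Longrightarrow> norm (t z) < 1 / norm c"
    using t0 flow_box_nonzero[OF b] unfolding continuous_at_eps_delta
    by (metis dist_0_norm dist_commute divide_pos_pos zero_less_norm_iff zero_less_one)
  define z where "z = complex_of_real (min r \<delta> / 2)"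
  have z: "z \<in> ball 0 r" "norm z < \<delta>" "z \<noteq> 0" using r(1) \<delta>(1) by (auto simp: z_def)
  have "slice W \<xi> z = fl (- t z) p"
    using fl_inverse(1)[OF regular_in[OF sr[OF z(1)]], of "t z"] xp[OF z(1)] by (simp add: x_def)
  moreover have "norm (\<xi> p $ 1 + c * (- t z)) < 1"
    using \<delta>(2)[OF z(2)] flow_box_nonzero[OF b] pW(2) by (simp add: norm_mult field_simps)
  from flow_box_fl(2)[OF b pW(1) this] have "\<xi> (fl (- t z) p) $ 2 = 0" using pW(2) by simp
  moreover have "\<xi> (slice W \<xi> z) $ 2 = z" using slice_coord[OF b] inr(1)[OF z(1)] by simp
  ultimately show False using z(3) by simp
qed

text \<open>The cases are whether \<open>sig\<close> is constant on the regular part. If it is, all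
  smallest persistent periods have the same square, so \<open>T\<close> or \<open>- T\<close> is a
  period at each point, and then \<open>T\<close> is.\<close>

lemma first_integral_pair_exists:
  assumes p: "p \<in> regular_points" and pers: "pers p t" "t \<noteq> 0"
  shows "\<exists>\<nu> g1 g2. first_integral_pair N A X \<nu> g1 g2"
proof -
  have "nzper p \<noteq> {}" using pers by (auto simp: nzper_def)
  then obtain T where T: "minper p T" using minper_exists[OF p] by blast
  have T0: "T \<noteq> 0" using minper_nonzero[OF T] .
  have sp: "sig p = 1 / T\<^sup>2" by (rule sig_eq[OF p T])
  have w: "weight_fun 0 sig" by (rule weight_funI) (use sig_fl regular_in sig_holomorphic in auto)
  show ?thesis
  proof (cases "\<forall>x\<in>regular_points. sig x = sig p")
    case False
    \<comment> \<open>A nonconstant invariant function is paired with the constant 1, both of weight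
      0.\<close>
    then have "first_integral_pair N A X 0 sig (\<lambda>_. 1)"
      using w weight_fun_const p by unfold_locales (auto, metis)
    then show ?thesis by blast
  next
    case True
    have "fl T x = x" if x: "x \<in> regular_points" for x
    proof -
      have xN: "x \<in> topspace N" using regular_in[OF x] .
      have sx: "sig x = 1 / T\<^sup>2" using True sp x by simp
      then have "nzper x \<noteq> {}" using T0 by (auto simp: sig_def)
      then obtain s where s: "minper x s" using minper_exists[OF x] by blast
      have "s\<^sup>2 = T\<^sup>2" using sig_eq[OF x s] sx T0 minper_nonzero[OF s] by (simp add: field_simps)
      then have "T = s \<or> T = - s" by (metis power2_eq_iff)
      moreover have "fl s x = x" using pers_imp_period[OF xN] s by (auto simp: minper_def nzper_def)
      ultimately show ?thesis using fl_inverse(1)[OF xN, of s] by auto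
    qed
    then show ?thesis using periodic_flow_pair[OF T0 _ p] by blast
  qed
qed

end

theorem theorem3:
  fixes N :: "'a topology" and A :: "('a, 2) chart set" and X :: "('a, 2) vfield"
    and L0 T0 :: "'a set" and p0 :: 'a
  assumes "stein_manifold N A" and "connected_space N"
    and "integral_cohomology_vanishes 2 N"
    and "holomorphic_vector_field A X" and "complete_vector_field N A X"
    and "isolated_singularities N A X"
    and "L0 \<in> leaves N A X" and "closedin N L0"
    and "orbit_biholomorphic_to_punctured_plane A X L0"
    and "p0 \<in> L0" and "transversal N A X p0 T0"
    and "finite (holonomy_group N A X L0 p0 T0)"
  shows "(\<exists>D f. meromorphic_first_integral N A X D f) \<and>
    (\<forall>L\<in>leaves N A X.
       closedin (subtopology N (topspace N - sing N A X)) L \<and>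
       (\<forall>p\<in>L. \<forall>T. transversal N A X p T \<longrightarrow> finite (holonomy_group N A X L p T)))"
proof -
  interpret separated_flow N A X
    using assms(1,2,4-6) unfolding stein_manifold_def by unfold_locales blast+
  have p: "p0 \<in> regular_points" and L0: "L0 = orbit N A X p0"
    using leaf_eq_orbit[OF assms(7,10)] by blast+
  obtain \<omega> where \<omega>: "\<omega> \<noteq> 0" "fl \<omega> p0 = p0"
    by (rule punctured_plane_orbit_period[OF p assms(9)[unfolded L0]])
  obtain k :: nat where k: "k > 0" "pers p0 (of_nat k * \<omega>)"
    by (rule finite_holonomy_pers[OF assms(11) assms(12)[unfolded L0] \<omega>(2)])
  have "of_nat k * \<omega> \<noteq> 0" using k(1) \<omega>(1) by simp
  then obtain \<nu> g1 g2 where "first_integral_pair N A X \<nu> g1 g2"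
    using first_integral_pair_exists[OF p k(2)] by blast
  then interpret first_integral_pair N A X \<nu> g1 g2 .
  show ?thesis using quot_first_integral leaf_closed holonomy_finite by blast
qed

end
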